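(* Let $T>0$ and $0<\gamma<1/2$. If $u_0\in\mathcal C^{1+\gamma}(0,\pi)$, then the mild solution $u$ of $$\frac{\partial u(t,x)}{\partial t}=\frac{\partial^2u(t,x)}{\partial x^2}+u(t,x)\cdot\frac{\partial}{\partial x}W(x),\quad t>0,\ 0<x<\pi,\qquad u(t,0)=u(t,\pi)=0,\quad u(0,x)=u_0(x),$$ belongs to $$\mathcal C^{(1+\gamma)/2,\,1+\gamma}_{t,x}\left((0,T)\times(0,\pi)\right).$$
   Context: $W=\{W(x)\}_{x\in[0,\pi]}$ is a standard Brownian motion on a probability space $(\Omega,\mathcal F,\mathbb P)$; all assertions are pathwise, i.e. for almost every fixed sample path of $W$ (recall that the sample paths belong to $\mathcal C^{\gamma}(0,\pi)$ for every $0<\gamma<1/2$). Dirichlet heat kernel on $(0,\pi)$: $P^D(t,x,y)=\sum_{k=1}^\infty e^{-k^2t}m_k(x)m_k(y)$, $m_k(x)=\sqrt{2/\pi}\,\sin(kx)$, $k\ge1$. Subscripts $x,y$ denote partial derivatives. $\mathbf P_0(0,x)=u_0(x)$, and $\mathbf P_0(t,x)=\int_0^\pi P^D(t,x,y)u_0(y)\,dy$ for $t>0$. Mild solution: $u$ is a mild solution of the equation $$\frac{\partial u(t,x)}{\partial t}=\frac{\partial^2u(t,x)}{\partial x^2}+u(t,x)\cdot\frac{\partial}{\partial x}W(x),\quad t>0,\ 0<x<\pi,\qquad u(t,0)=u(t,\pi)=0,\quad u(0,x)=u_0(x),$$ if (i) for every $0<t<T$ and $0<x<\pi$, $u$ is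 continuous in $t$, continuously differentiable in $x$, and satisfies $$u(t,x)=\mathbf P_0(t,x)-\int_0^t\int_0^\pi P^D_y(t-s,x,y)u(s,y)W(y)\,dy\,ds-\int_0^t\int_0^\pi P^D(t-s,x,y)u_y(s,y)W(y)\,dy\,ds;$$ (ii) for every $0\le t\le T$, $u(t,0)=u(t,\pi)=0$; (iii) for every $0\le x\le\pi$, $\lim_{t\to0^+}u(t,x)=u_0(x)$. Hölder spaces: for $0<\gamma<1$ and a domain $G$, $[u]_\gamma=\sup_{z\ne y\in G}|u(z)-u(y)|/|z-y|^\gamma$. $\mathcal C^{k+\gamma}(G)$ is the set of $k$ times continuously differentiable functions on $G$ with finite norm $\sum_{|\alpha|\le k}\sup_G|\partial^\alpha u|+\sum_{|\alpha|=k}[\partial^\alpha u]_\gamma$. For $k_1,k_2\in\mathbb N_0$ and $0<\gamma_1,\gamma_2<1$, $\mathcal C^{k_1+\gamma_1,k_2+\gamma_2}_{t,x}((0,T)\times G)$ is the space with finite norm $$\sum_{n\le k_1,\,|\alpha|\le k_2}\ \sup_{t\in(0,T),\,x\in G}|\partial_t^n\partial_x^\alpha u(t,x)|+[\partial_t^{k_1}u]_{\gamma_1}+\sum_{|\alpha|=k_2}[\partial_x^\alpha u]_{\gamma_2},$$ where $[\,\cdot\,]_{\gamma_1}$ is the Hölder seminorm in the variable $t$ (supremum over $x\in G$) and $[\,\cdot\,]_{\gamma_2}$ is the Hölder seminorm in the variable $x$ (supremum over $t\in(0,T)$). In particular, for $0<\gamma<1/2$, in $\mathcal C^{(1+\gamma)/2,1+\gamma}_{t,x}$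 one has $k_1=0$, $\gamma_1=(1+\gamma)/2$, $k_2=1$, $\gamma_2=\gamma$. *)

theory Defs
  imports "HOL-Probability.Probability"
begin

locale standard_brownian_motion = prob_space M for M :: "'a measure" +
  fixes L :: real and W :: "real \<Rightarrow> 'a \<Rightarrow> real"
  assumes measurable_W: "\<And>x. x \<in> {0..L} \<Longrightarrow> W x \<in> borel_measurable M"
    and starts_at_0: "AE \<omega> in M. W 0 \<omega> = 0"
    and gaussian_increments: "\<And>x y. 0 \<le> x \<Longrightarrow> x < y \<Longrightarrow> y \<le> L \<Longrightarrow>
      distributed M lborel (\<lambda>\<omega>. W y \<omega> - W x \<omega>) (normal_density 0 (sqrt (y - x)))"
    and independent_increments: "\<And>(n::nat) p. (\<forall>i\<le>n. p i \<in> {0..L}) \<Longrightarrow> (\<forall>i<n. p i < p (Suc i)) \<Longrightarrow>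
      indep_vars (\<lambda>_. borel) (\<lambda>i \<omega>. W (p (Suc i)) \<omega> - W (p i) \<omega>) {..<n}"
    and continuous_paths: "AE \<omega> in M. continuous_on {0..L} (\<lambda>x. W x \<omega>)"

text \<open>Hoelder spaces over open subsets of the real line. Functions are total, but only their values
  on the domain enter: on an open set \<open>deriv\<close> is determined by the restriction. Norms take values
  in \<open>ennreal\<close>.\<close>

definition Ck_on :: "nat \<Rightarrow> real set \<Rightarrow> (real \<Rightarrow> real) \<Rightarrow> bool" where
  "Ck_on k G f \<longleftrightarrow>
     (\<forall>j<k. \<forall>x\<in>G. (deriv ^^ j) f field_differentiable at x) \<and>
     (\<forall>j\<le>k. continuous_on G ((deriv ^^ j) f))"

definition holder_seminorm :: "real \<Rightarrow> real set \<Rightarrow> (real \<Rightarrow> real) \<Rightarrow> ennreal" where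
  "holder_seminorm \<gamma> G f =
     (SUP (y, z)\<in>{(y, z). y \<in> G \<and> z \<in> G \<and> y \<noteq> z}. ennreal (\<bar>f z - f y\<bar> / \<bar>z - y\<bar> powr \<gamma>))"

definition holder_norm :: "nat \<Rightarrow> real \<Rightarrow> real set \<Rightarrow> (real \<Rightarrow> real) \<Rightarrow> ennreal" where
  "holder_norm k \<gamma> G f =
     (\<Sum>j\<le>k. SUP x\<in>G. ennreal \<bar>(deriv ^^ j) f x\<bar>) + holder_seminorm \<gamma> G ((deriv ^^ k) f)"

definition holder_space :: "nat \<Rightarrow> real \<Rightarrow> real set \<Rightarrow> (real \<Rightarrow> real) set" where
  "holder_space k \<gamma> G = {f. Ck_on k G f \<and> holder_norm k \<gamma> G f < \<infinity>}"

text \<open>The mixed partial derivative of order \<open>n\<close> in \<open>t\<close> and order \<open>j\<close> in \<open>x\<close>.\<close>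

definition partial_tx :: "nat \<Rightarrow> nat \<Rightarrow> (real \<Rightarrow> real \<Rightarrow> real) \<Rightarrow> real \<Rightarrow> real \<Rightarrow> real" where
  "partial_tx n j u t x = (deriv ^^ n) (\<lambda>s. (deriv ^^ j) (u s) x) t"

definition Ck_tx_on :: "nat \<Rightarrow> nat \<Rightarrow> real \<Rightarrow> real set \<Rightarrow> (real \<Rightarrow> real \<Rightarrow> real) \<Rightarrow> bool" where
  "Ck_tx_on k\<^sub>1 k\<^sub>2 T G u \<longleftrightarrow>
     (\<forall>j<k\<^sub>2. \<forall>t\<in>{0<..<T}. \<forall>x\<in>G. partial_tx 0 j u t field_differentiable at x) \<and>
     (\<forall>n<k\<^sub>1. \<forall>j\<le>k\<^sub>2. \<forall>t\<in>{0<..<T}. \<forall>x\<in>G. (\<lambda>s. partial_tx n j u s x) field_differentiable at t) \<and>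
     (\<forall>n\<le>k\<^sub>1. \<forall>j\<le>k\<^sub>2. continuous_on ({0<..<T} \<times> G) (\<lambda>(t, x). partial_tx n j u t x))"

definition holder_norm_tx ::
    "nat \<Rightarrow> real \<Rightarrow> nat \<Rightarrow> real \<Rightarrow> real \<Rightarrow> real set \<Rightarrow> (real \<Rightarrow> real \<Rightarrow> real) \<Rightarrow> ennreal" where
  "holder_norm_tx k\<^sub>1 \<gamma>\<^sub>1 k\<^sub>2 \<gamma>\<^sub>2 T G u =
     (\<Sum>n\<le>k\<^sub>1. \<Sum>j\<le>k\<^sub>2. SUP t\<in>{0<..<T}. SUP x\<in>G. ennreal \<bar>partial_tx n j u t x\<bar>) +
     (SUP x\<in>G. holder_seminorm \<gamma>\<^sub>1 {0<..<T} (\<lambda>t. partial_tx k\<^sub>1 0 u t x)) +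
     (SUP t\<in>{0<..<T}. holder_seminorm \<gamma>\<^sub>2 G (\<lambda>x. partial_tx 0 k\<^sub>2 u t x))"

definition holder_space_tx ::
    "nat \<Rightarrow> real \<Rightarrow> nat \<Rightarrow> real \<Rightarrow> real \<Rightarrow> real set \<Rightarrow> (real \<Rightarrow> real \<Rightarrow> real) set" where
  "holder_space_tx k\<^sub>1 \<gamma>\<^sub>1 k\<^sub>2 \<gamma>\<^sub>2 T G =
     {u. Ck_tx_on k\<^sub>1 k\<^sub>2 T G u \<and> holder_norm_tx k\<^sub>1 \<gamma>\<^sub>1 k\<^sub>2 \<gamma>\<^sub>2 T G u < \<infinity>}"

definition dirichlet_mode :: "nat \<Rightarrow> real \<Rightarrow> real" where
  "dirichlet_mode k x = sqrt (2 / pi) * sin (real k * x)"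

text \<open>The eigenfunctions are numbered from 1, hence the shift in the index.\<close>

definition dirichlet_heat_kernel :: "real \<Rightarrow> real \<Rightarrow> real \<Rightarrow> real" where
  "dirichlet_heat_kernel t x y =
     (\<Sum>k. exp (- (real (Suc k))\<^sup>2 * t) * dirichlet_mode (Suc k) x * dirichlet_mode (Suc k) y)"

definition dirichlet_heat_kernel_y :: "real \<Rightarrow> real \<Rightarrow> real \<Rightarrow> real" where
  "dirichlet_heat_kernel_y t x y = deriv (\<lambda>z. dirichlet_heat_kernel t x z) y"

definition dirichlet_heat_flow :: "(real \<Rightarrow> real) \<Rightarrow> real \<Rightarrow> real \<Rightarrow> real" where
  "dirichlet_heat_flow u\<^sub>0 t x =
     (if t = 0 then u\<^sub>0 x
      else LINT y:{0<..<pi}|lborel. dirichlet_heat_kernel t x y * u\<^sub>0 y)"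

text \<open>Mild solution for one fixed path \<open>w\<close>. The Bochner integral of a non-integrable function
  is 0, so the (absolute) convergence of the two double integrals, implicit in the integral
  equation, has to be required separately. The last condition uses \<open>u\<^sub>0\<close> at the endpoints; for initial
  data in a Hoelder space over \<open>{0<..<pi}\<close> these values are meant as the continuous extension, so
  such data are to be taken continuous on \<open>{0..pi}\<close>.\<close>

definition mild_solution ::
    "(real \<Rightarrow> real) \<Rightarrow> real \<Rightarrow> (real \<Rightarrow> real) \<Rightarrow> (real \<Rightarrow> real \<Rightarrow> real) \<Rightarrow> bool" where
  "mild_solution w T u\<^sub>0 u \<longleftrightarrow>
     (\<forall>x\<in>{0<..<pi}. continuous_on {0<..<T} (\<lambda>t. u t x)) \<and>
     (\<forall>t\<in>{0<..<T}. Ck_on 1 {0<..<pi} (u t)) \<and>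
     (\<forall>t\<in>{0<..<T}. \<forall>x\<in>{0<..<pi}.
        set_integrable lborel ({0<..<t} \<times> {0<..<pi})
          (\<lambda>(s, y). dirichlet_heat_kernel_y (t - s) x y * u s y * w y) \<and>
        set_integrable lborel ({0<..<t} \<times> {0<..<pi})
          (\<lambda>(s, y). dirichlet_heat_kernel (t - s) x y * deriv (u s) y * w y) \<and>
        u t x = dirichlet_heat_flow u\<^sub>0 t x
          - (LINT s:{0<..<t}|lborel. LINT y:{0<..<pi}|lborel.
               dirichlet_heat_kernel_y (t - s) x y * u s y * w y)
          - (LINT s:{0<..<t}|lborel. LINT y:{0<..<pi}|lborel.
               dirichlet_heat_kernel (t - s) x y * deriv (u s) y * w y)) \<and>
     (\<forall>t\<in>{0..T}. u t 0 = 0 \<and> u t pi = 0) \<and>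
     (\<forall>x\<in>{0..pi}. ((\<lambda>t. u t x) \<longlongrightarrow> u\<^sub>0 x) (at_right 0))"

end

theory Submission
  imports Defs
begin

text \<open>The product \<open>u * W'\<close> is removed by a gauge transformation. For one path \<open>w\<close> let \<open>V\<close> be the
  antiderivative of \<open>w\<close> and \<open>v = exp V * u\<close>. Formally \<open>v\<close> solves the heat equation with right-hand side
  \<open>F = - exp V * (2 * w * u\<^sub>y + w\<^sup>2 * u) = - 2 * w * v\<^sub>y + w\<^sup>2 * v\<close>, in which no derivative of \<open>w\<close>
  occurs. If \<open>F\<close> is bounded, then \<open>v\<close> is the heat flow of \<open>v\<^sub>0 = exp V * u\<^sub>0\<close> plus a Duhamel
  integral of a bounded function. The heat flow inherits the regularity \<open>1 + \<gamma>\<close> of its initial datum. For the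
  Duhamel integral crude bounds of the kernel suffice: expansion into sines, Cauchy-Schwarz and Parseval give
  the \<open>L\<^sup>1\<close> norms \<open>\<tau> powr (- 1 / 4)\<close> for the kernel and \<open>\<tau> powr (- 3 / 4)\<close> for its space derivative; Hoelder
  differences of that derivative in space cost a further \<open>\<tau> powr (- \<gamma> / 2)\<close>, still integrable
  in time because \<open>\<gamma> < 1 / 2\<close>. Finally \<open>u = exp (- V) * v\<close> and
  \<open>u\<^sub>x = exp (- V) * (v\<^sub>x - w * v)\<close>, and \<open>w\<close> itself is Hoelder continuous of order \<open>\<gamma>\<close>.

  Two points need care. First, a mild solution comes with no bound near the boundary or near time \<open>0\<close>; it is only
  known that the two integrands are integrable for every fixed \<open>(t, x)\<close>. By compactness, finitely many \<open>x\<close>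
  detect every point of a rectangle, so \<open>u * w\<close> and \<open>sin y * u\<^sub>y * w\<close> are integrable
  (\<open>uw_integrable\<close>, \<open>sin_dw_integrable\<close>). Testing with sine modes gives a weak formulation for almost every time;
  it is extended to test functions \<open>exp V\<^sub>n * mode\<close> with twice differentiable \<open>V\<^sub>n\<close> and then to
  \<open>exp V * mode\<close> (\<open>gauge_weak\<close>). Sine coefficients determine an integrable function, so
  the Duhamel formula for \<open>v\<close>, and after differentiation the one for \<open>v\<^sub>x\<close>, hold almost everywhere
  (\<open>gauge_duhamel\<close>, \<open>gauge_duhamel_x\<close>).

  Second, \<open>F\<close> is at first only integrable with the weight \<open>sin y\<close>. Inserting the Duhamel formulas into \<open>F\<close> shows that
  \<open>\<bar>F\<bar>\<close> is at most a constant plus a Volterra operator with an integrable singular kernel applied to \<open>\<bar>F\<bar>\<close>; comparison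
  with an exponential in the weighted norm gives \<open>F \<in> L\<^sup>\<infinity>\<close> (\<open>kernel_comparison\<close>, \<open>FF_bounded\<close>).
  The representation then holds everywhere, since both sides are continuous in each variable
  (\<open>duhamel_everywhere\<close>), and the Hoelder bounds follow (\<open>regularity\<close>).\<close>

text \<open>\<open>NN\<close> and \<open>LB\<close> are integrals against Lebesgue measure, nonnegative and Bochner; \<open>LI\<close> is the Bochner integral
  over the interval \<open>(0, \<pi>)\<close>. The abbreviations \<open>smode\<close> and \<open>cmode\<close> number the modes from \<open>0\<close>.\<close>

abbreviation nn_lborel (binder "NN " 10) where "nn_lborel f \<equiv> nn_integral lborel f"
abbreviation int_lborel (binder "LB " 10) where "int_lborel f \<equiv> (integral\<^sup>L lborel f :: real)"
abbreviation int_I (binder "LI " 10) where "int_I f \<equiv> (set_lebesgue_integral lborel {0<..<pi} f :: real)"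
abbreviation integrable_I :: "(real \<Rightarrow> real) \<Rightarrow> bool" where "integrable_I \<equiv> set_integrable lborel {0<..<pi}"
abbreviation Ipi :: "real set" where "Ipi \<equiv> {0<..<pi}"
abbreviation borel_fun where "borel_fun \<equiv> borel_measurable borel"
abbreviation lborel2 where "lborel2 \<equiv> lborel \<Otimes>\<^sub>M lborel"
abbreviation ind_I where "ind_I \<equiv> indicator {0<..<pi}"
abbreviation decay :: "nat \<Rightarrow> real \<Rightarrow> real" where "decay k \<tau> \<equiv> exp (- (real (Suc k))\<^sup>2 * \<tau>)"
abbreviation smode where "smode k \<equiv> dirichlet_mode (Suc k)"

section \<open>Hoelder continuity of Brownian paths\<close>

text \<open>A point is approximated by its dyadic truncations \<open>p j x\<close>. Passing from one level to the next costs at most one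
  increment of that level, and at the level comparable to \<open>\<bar>x - y\<bar>\<close> the truncations of two points
  are equal or adjacent.\<close>

lemma dyadic_chaining:
 fixes f :: "real \<Rightarrow> real"
 assumes L: "L > 0" and g: "\<gamma> > 0" and C: "C \<ge> 0"
  and cont: "continuous_on {0..L} f"
  and inc: "\<And>j i. i < 2 ^ j \<Longrightarrow>
   \<bar>f (L * real (Suc i) / 2 ^ j) - f (L * real i / 2 ^ j)\<bar> \<le> C * (2 powr - \<gamma>) ^ j"
 shows "\<exists>H. \<forall>x\<in>{0..L}. \<forall>y\<in>{0..L}. \<bar>f x - f y\<bar> \<le> H * \<bar>x - y\<bar> powr \<gamma>"
proof -
 define r where "r = 2 powr - \<gamma>"
 have r: "0 < r" "r < 1"
  using g powr_less_mono[of "-\<gamma>" 0 2] unfolding r_def by auto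
 define d where "d j x = nat \<lfloor>2 ^ j * x / L\<rfloor>" for j :: nat and x
 define p where "p j x = L * real (d j x) / 2 ^ j" for j x
 have d_eq: "real (d j x) = of_int \<lfloor>2 ^ j * x / L\<rfloor>" if "x \<in> {0..L}" for j x
  using that L unfolding d_def by simp
 have d_le: "real (d j x) \<le> 2 ^ j * x / L" "2 ^ j * x / L < real (d j x) + 1"
  if "x \<in> {0..L}" for j x
  unfolding d_eq[OF that] by linarith+
 have d_top: "d j x \<le> 2 ^ j" if "x \<in> {0..L}" for j x
 proof -
  have "2 ^ j * x / L \<le> 2 ^ j" using that L by (simp add: field_simps)
  then have "real (d j x) \<le> 2 ^ j" using d_le(1)[OF that, of j] by linarith
  then have "real (d j x) \<le> real (2 ^ j)" by simp
  then show ?thesis by (simp only: of_nat_le_iff)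
 qed
 have step: "\<bar>f (p (Suc j) x) - f (p j x)\<bar> \<le> C * r ^ Suc j" if x: "x \<in> {0..L}" for j x
 proof -
  have a: "2 * real (d j x) \<le> 2 ^ Suc j * x / L" "2 ^ Suc j * x / L < 2 * real (d j x) + 2"
   using d_le[OF x, of j] by (simp_all add: mult.assoc)
  have "real (d (Suc j) x) < real (2 * d j x + 2)" "real (2 * d j x) < real (d (Suc j) x + 1)"
   using a d_le[OF x, of "Suc j"] by auto
  then have "d (Suc j) x < 2 * d j x + 2" "2 * d j x < d (Suc j) x + 1" by linarith+
  then consider "d (Suc j) x = 2 * d j x" | "d (Suc j) x = Suc (2 * d j x)" by linarith
  then show ?thesis
  proof cases
   case 1
   then have "p (Suc j) x = p j x" unfolding p_def by simp
   then show ?thesis using C r by simp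
  next
   case 2
   have "2 * d j x < 2 ^ Suc j" using d_top[OF x, of "Suc j"] 2 by linarith
   from inc[OF this] have "\<bar>f (L * real (Suc (2 * d j x)) / 2 ^ Suc j) - f (L * real (2 * d j x) / 2 ^ Suc j)\<bar>
    \<le> C * r ^ Suc j" unfolding r_def .
   moreover have "p (Suc j) x = L * real (Suc (2 * d j x)) / 2 ^ Suc j" unfolding p_def 2 ..
   moreover have "p j x = L * real (2 * d j x) / 2 ^ Suc j" unfolding p_def by simp
   ultimately show ?thesis by simp
  qed
 qed
 have steps: "\<bar>f (p (j + n) x) - f (p j x)\<bar> \<le> C * r ^ j * (1 - r ^ n) / (1 - r)"
  if x: "x \<in> {0..L}" for j n x
 proof (induction n)
  case 0 then show ?case by simp
 next
  case (Suc n)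
  have "\<bar>f (p (j + Suc n) x) - f (p j x)\<bar> \<le> C * r ^ Suc (j + n) + C * r ^ j * (1 - r ^ n) / (1 - r)"
   using step[OF x, of "j + n"] Suc by simp
  also have "C * r ^ Suc (j + n) \<le> C * r ^ (j + n)"
   using C r by (intro mult_left_mono power_decreasing) auto
  also have "C * r ^ (j + n) + C * r ^ j * (1 - r ^ n) / (1 - r) = C * r ^ j * (1 - r ^ Suc n) / (1 - r)"
   using r by (simp add: field_simps power_add)
  finally show ?case by simp
 qed
 have pd: "\<bar>p j x - x\<bar> \<le> L * (1/2) ^ j" and pm: "p j x \<in> {0..L}" if x: "x \<in> {0..L}" for j x
 proof -
  have "p j x \<le> x" using d_le(1)[OF x, of j] L unfolding p_def by (simp add: field_simps)
  moreover have "x \<le> p j x + L * (1/2) ^ j"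
   using d_le(2)[OF x, of j] L unfolding p_def by (simp add: field_simps)
  ultimately show "\<bar>p j x - x\<bar> \<le> L * (1/2) ^ j" by linarith
  show "p j x \<in> {0..L}" using \<open>p j x \<le> x\<close> x L unfolding p_def by auto
 qed
 have plim: "(\<lambda>j. p j x) \<longlonglongrightarrow> x" if x: "x \<in> {0..L}" for x
 proof -
  have "(\<lambda>j. L * (1/2) ^ j :: real) \<longlonglongrightarrow> L * 0"
   by (intro tendsto_mult tendsto_const LIMSEQ_power_zero) auto
  then have lim0: "(\<lambda>j. L * (1/2) ^ j) \<longlonglongrightarrow> 0" by simp
  have "(\<lambda>j. p j x - x) \<longlonglongrightarrow> 0"
   by (rule Lim_null_comparison[OF always_eventually lim0], unfold real_norm_def, rule allI, rule pd[OF x])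
  then show ?thesis by (rule LIM_zero_cancel)
 qed
 have flim: "\<bar>f x - f (p j x)\<bar> \<le> C * r ^ j / (1 - r)" if x: "x \<in> {0..L}" for j x
 proof -
  have "(\<lambda>n. f (p n x)) \<longlonglongrightarrow> f x"
   using x pm[OF x] by (intro continuous_on_tendsto_compose[OF cont plim[OF x]] always_eventually allI)
  then have "(\<lambda>n. f (p (n + j) x)) \<longlonglongrightarrow> f x" by (rule LIMSEQ_ignore_initial_segment)
  then have "(\<lambda>n. \<bar>f (p (n + j) x) - f (p j x)\<bar>) \<longlonglongrightarrow> \<bar>f x - f (p j x)\<bar>" by (intro tendsto_intros)
  then show ?thesis
  proof (rule LIMSEQ_le_const2, intro exI allI impI)
   fix n :: nat
   have "C * r ^ j * (1 - r ^ n) / (1 - r) \<le> C * r ^ j * 1 / (1 - r)"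
    using C r by (intro divide_right_mono mult_left_mono) auto
   then show "\<bar>f (p (n + j) x) - f (p j x)\<bar> \<le> C * r ^ j / (1 - r)"
    using steps[OF x, of j n] by (simp add: add.commute)
  qed
 qed
 define H where "H = C * (1 + 2 / (1 - r)) * (2 / L) powr \<gamma>"
 have main: "\<bar>f x - f y\<bar> \<le> H * \<bar>x - y\<bar> powr \<gamma>" if x: "x \<in> {0..L}" and y: "y \<in> {0..L}" and xy: "x < y" for x y
 proof -
  have "\<exists>n. L * (1/2) ^ n < y - x"
  proof -
   obtain n where "(1/2) ^ n < (y - x) / L"
    using real_arch_pow_inv[of "(y - x) / L" "1/2"] xy L by auto
   then show ?thesis using L by (auto simp: field_simps)
  qed
  define n where "n = (LEAST n. L * (1/2) ^ n < y - x)"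
  have n1: "L * (1/2) ^ n < y - x" unfolding n_def by (rule LeastI_ex) fact
  have "n \<noteq> 0"
  proof
   assume "n = 0" then show False using n1 x y by auto
  qed
  then obtain j where j: "n = Suc j" by (cases n) auto
  have n2: "y - x \<le> L * (1/2) ^ j"
   using not_less_Least[of j "\<lambda>n. L * (1/2) ^ n < y - x"] j unfolding n_def[symmetric] by auto
  have le1: "2 ^ j * y / L \<le> 2 ^ j * x / L + 1"
   using n2 L by (simp add: field_simps)
  have le2: "2 ^ j * x / L \<le> 2 ^ j * y / L"
   using xy L by (simp add: divide_right_mono)
  have "real (d j x) < real (d j y + 1)" "real (d j y) < real (d j x + 2)"
   using le1 le2 d_le[OF x, of j] d_le[OF y, of j] by auto
  then have "d j x < d j y + 1" "d j y < d j x + 2" by linarith+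
  then consider "d j y = d j x" | "d j y = Suc (d j x)" by linarith
  then have mid: "\<bar>f (p j x) - f (p j y)\<bar> \<le> C * r ^ j"
  proof cases
   case 1
   then show ?thesis using C r unfolding p_def by simp
  next
   case 2
   have "d j x < 2 ^ j" using d_top[OF y, of j] 2 by linarith
   from inc[OF this] show ?thesis unfolding p_def 2 r_def by simp
  qed
  have "\<bar>f x - f y\<bar> \<le> C * r ^ j + 2 * (C * r ^ j / (1 - r))"
   using mid flim[OF x, of j] flim[OF y, of j] by linarith
  also have "\<dots> = C * r ^ j * (1 + 2 / (1 - r))" by (simp add: distrib_left)
  also have "r ^ j = (2 / L) powr \<gamma> * (L * (1/2) ^ n) powr \<gamma>"
  proof -
   have "(2 / L) powr \<gamma> * (L * (1/2) ^ n) powr \<gamma> = ((2 / L) * (L * (1/2) ^ n)) powr \<gamma>"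
    using L by (subst powr_mult) auto
   also have "(2 / L) * (L * (1/2) ^ n) = 2 powr (- real j)"
    using L j by (simp add: powr_minus_divide powr_realpow power_divide)
   also have "(2 powr (- real j)) powr \<gamma> = r ^ j"
    unfolding r_def using powr_realpow[of "2 powr - \<gamma>" j] by (simp add: powr_powr mult.commute)
   finally show ?thesis ..
  qed
  also have "C * ((2 / L) powr \<gamma> * (L * (1/2) ^ n) powr \<gamma>) * (1 + 2 / (1 - r))
    = H * (L * (1/2) ^ n) powr \<gamma>"
   unfolding H_def by simp
  also have "\<dots> \<le> H * (y - x) powr \<gamma>"
   using n1 g C r L unfolding H_def
   by (intro mult_left_mono powr_mono2) (auto intro!: mult_nonneg_nonneg)
  finally show ?thesis using xy by simp
 qed
 show ?thesis
 proof (intro exI ballI)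
  fix x y assume xy: "x \<in> {0..L}" "y \<in> {0..L}"
  consider "x < y" | "y < x" | "x = y" by linarith
  then show "\<bar>f x - f y\<bar> \<le> H * \<bar>x - y\<bar> powr \<gamma>"
  proof cases
   case 1 with main xy show ?thesis by blast
  next
   case 2 with main[OF xy(2,1)] show ?thesis by (simp add: abs_minus_commute)
  qed simp
 qed
qed

lemma (in standard_brownian_motion) increment_moment:
 assumes "0 \<le> x" "x < y" "y \<le> L"
 shows "(\<integral>\<^sup>+\<omega>. ennreal ((W y \<omega> - W x \<omega>) ^ (2 * n)) \<partial>M)
  = ennreal (fact (2 * n) / (2 ^ n * fact n) * (y - x) ^ n)"
proof -
 note D = gaussian_increments[OF assms]
 let ?s = "sqrt (y - x)"
 have s: "?s > 0" using assms by simp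
 have "(\<integral>\<^sup>+\<omega>. ennreal ((W y \<omega> - W x \<omega>) ^ (2 * n)) \<partial>M)
  = (NN z. ennreal (normal_density 0 ?s z) * ennreal (z ^ (2 * n)))"
  by (rule distributed_nn_integral[OF D, symmetric]) auto
 also have "\<dots> = (NN z. ennreal (normal_density 0 ?s z * (z - 0) ^ (2 * n)))"
  by (simp add: ennreal_mult')
 also have "\<dots> = ennreal (fact (2 * n) / ((2 / ?s\<^sup>2) ^ n * fact n))"
  using normal_moment_even[OF s, of 0 n]
  by (intro nn_integral_eq_integral[THEN trans]) (auto simp: has_bochner_integral_iff)
 also have "fact (2 * n) / ((2 / ?s\<^sup>2) ^ n * fact n) = fact (2 * n) / (2 ^ n * fact n) * (y - x) ^ n"
  using assms by (simp add: power_divide)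
 finally show ?thesis .
qed

text \<open>Kolmogorov's criterion: high moments of the increments are summable over all dyadic levels, which bounds all increments
  of one path at once.\<close>

lemma (in standard_brownian_motion) AE_holder_fixed:
 assumes L: "L > 0" and g: "0 < \<gamma>" "\<gamma> < 1/2"
 shows "AE \<omega> in M. \<exists>H. \<forall>x\<in>{0..L}. \<forall>y\<in>{0..L}. \<bar>W x \<omega> - W y \<omega>\<bar> \<le> H * \<bar>x - y\<bar> powr \<gamma>"
proof -
 (* Level j has 2 ^ j intervals, each with a scaled moment of order 2 powr (j * n * (2 * \<gamma> - 1)). *)
 obtain n :: nat where n: "1 / (1 - 2 * \<gamma>) < real n" using reals_Archimedean2 by blast
 then have npos: "n > 0" using g by (cases n) auto
 define q where "q j i = L * real i / 2 ^ j" for j i :: nat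
 define Z where "Z j i \<omega> = 2 powr (\<gamma> * real j) * \<bar>W (q j (Suc i)) \<omega> - W (q j i) \<omega>\<bar>" for j i \<omega>
 have q: "0 \<le> q j i" "q j i < q j (Suc i)" "q j (Suc i) \<le> L" if "i < 2 ^ j" for i j
 proof -
  have "real (Suc i) \<le> 2 ^ j" using that by (metis Suc_leI of_nat_le_iff of_nat_numeral of_nat_power)
  then show "q j (Suc i) \<le> L" unfolding q_def using L by (simp add: divide_le_eq mult_left_mono)
  show "0 \<le> q j i" "q j i < q j (Suc i)"
   unfolding q_def using L by (auto simp: divide_strict_right_mono)
 qed
 have qdiff: "q j (Suc i) - q j i = L / 2 ^ j" for j i
  unfolding q_def by (simp add: field_simps)
 have Zm: "Z j i \<in> borel_measurable M" if "i < 2 ^ j" for i j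
 proof -
  have [measurable]: "W (q j (Suc i)) \<in> borel_measurable M" "W (q j i) \<in> borel_measurable M"
   using q[OF that] by (auto intro!: measurable_W)
  show ?thesis unfolding Z_def by measurable
 qed
 have Zm': "(\<lambda>\<omega>. ennreal (Z j i \<omega> ^ (2 * n))) \<in> borel_measurable M" if "i < 2 ^ j" for i j
  using Zm[OF that] by measurable
 define c where "c = fact (2 * n) / (2 ^ n * fact n) * L ^ n"
 define \<rho> where "\<rho> = 2 powr (1 + 2 * real n * \<gamma> - real n)"
 have c0: "c \<ge> 0" using L unfolding c_def by simp
 have \<rho>: "0 < \<rho>" "\<rho> < 1"
 proof -
  have "1 < real n * (1 - 2 * \<gamma>)" using n g by (simp add: field_simps)
  then have "1 + 2 * real n * \<gamma> - real n < 0" by (simp add: algebra_simps)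
  then show "\<rho> < 1" unfolding \<rho>_def using powr_less_mono[of _ 0 2] by fastforce
 qed (simp add: \<rho>_def)
 have EZ: "(\<integral>\<^sup>+\<omega>. ennreal (Z j i \<omega> ^ (2 * n)) \<partial>M) = ennreal (c * (\<rho> / 2) ^ j)" if "i < 2 ^ j" for i j
 proof -
  have "(\<integral>\<^sup>+\<omega>. ennreal (Z j i \<omega> ^ (2 * n)) \<partial>M)
   = (\<integral>\<^sup>+\<omega>. ennreal ((2 powr (\<gamma> * real j)) ^ (2 * n)) * ennreal ((W (q j (Suc i)) \<omega> - W (q j i) \<omega>) ^ (2 * n)) \<partial>M)"
   unfolding Z_def by (simp add: power_mult_distrib ennreal_mult' power_even_abs)
  also have "\<dots> = ennreal ((2 powr (\<gamma> * real j)) ^ (2 * n)) * ennreal (fact (2 * n) / (2 ^ n * fact n) * (L / 2 ^ j) ^ n)"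
  proof -
   have [measurable]: "W (q j (Suc i)) \<in> borel_measurable M" "W (q j i) \<in> borel_measurable M"
    using q[OF that] by (auto intro!: measurable_W)
   show ?thesis
    by (subst nn_integral_cmult) (auto simp: increment_moment[OF q[OF that]] qdiff)
  qed
  also have "\<dots> = ennreal ((2 powr (\<gamma> * real j)) ^ (2 * n) * (fact (2 * n) / (2 ^ n * fact n) * (L / 2 ^ j) ^ n))"
   using L by (subst ennreal_mult) auto
  also have "(2 powr (\<gamma> * real j)) ^ (2 * n) * (fact (2 * n) / (2 ^ n * fact n) * (L / 2 ^ j) ^ n)
   = c * ((2 powr (\<gamma> * real j)) ^ (2 * n) * (1 / 2 ^ j) ^ n)"
   unfolding c_def by (simp add: power_divide)
  also have "(2 powr (\<gamma> * real j)) ^ (2 * n) * (1 / 2 ^ j) ^ n = (\<rho> / 2) ^ j"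
  proof -
   have "(2 powr (\<gamma> * real j)) ^ (2 * n) = 2 powr (2 * real n * \<gamma> * real j)"
    by (simp add: powr_powr mult_ac flip: powr_realpow)
   moreover have "(1 / 2 ^ j) ^ n = (2::real) powr (- real n * real j)"
    by (simp add: powr_minus_divide mult_ac power_divide powr_realpow flip: power_mult of_nat_mult)
   moreover have "\<rho> / 2 = 2 powr (2 * real n * \<gamma> - real n)"
    unfolding \<rho>_def by (simp add: powr_diff powr_add)
   then have "(\<rho> / 2) ^ j = 2 powr ((2 * real n * \<gamma> - real n) * real j)"
    by (simp add: powr_powr flip: powr_realpow)
   ultimately show ?thesis by (simp add: algebra_simps flip: powr_add)
  qed
  finally show ?thesis .
 qed
 define S where "S \<omega> = (\<Sum>j. \<Sum>i<2^j. ennreal (Z j i \<omega> ^ (2 * n)))" for \<omega>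
 have Sm: "S \<in> borel_measurable M"
  unfolding S_def using Zm' by (intro borel_measurable_suminf_order borel_measurable_sum) auto
 have "(\<integral>\<^sup>+\<omega>. S \<omega> \<partial>M) = (\<Sum>j. \<Sum>i<2^j. (\<integral>\<^sup>+\<omega>. ennreal (Z j i \<omega> ^ (2 * n)) \<partial>M))"
  unfolding S_def using Zm'
  by (subst nn_integral_suminf) (auto intro!: suminf_cong nn_integral_sum borel_measurable_sum simp del: sum_ennreal)
 also have "\<dots> = (\<Sum>j. ennreal (c * \<rho> ^ j))"
 proof (intro suminf_cong)
  fix j
  have "(\<Sum>i<2^j. (\<integral>\<^sup>+\<omega>. ennreal (Z j i \<omega> ^ (2 * n)) \<partial>M)) = (\<Sum>i<(2::nat)^j. ennreal (c * (\<rho> / 2) ^ j))"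
   using EZ by (intro sum.cong) auto
  also have "\<dots> = ennreal (\<Sum>i<(2::nat)^j. c * (\<rho> / 2) ^ j)"
   using c0 \<rho> by (intro sum_ennreal) auto
  also have "(\<Sum>i<(2::nat)^j. c * (\<rho> / 2) ^ j) = c * \<rho> ^ j" by (simp add: power_divide)
  finally show "(\<Sum>i<2^j. (\<integral>\<^sup>+\<omega>. ennreal (Z j i \<omega> ^ (2 * n)) \<partial>M)) = ennreal (c * \<rho> ^ j)" .
 qed
 also have "\<dots> = ennreal (\<Sum>j. c * \<rho> ^ j)"
  using c0 \<rho> by (intro suminf_ennreal2 summable_mult summable_geometric) auto
 finally have "(\<integral>\<^sup>+\<omega>. S \<omega> \<partial>M) \<noteq> \<infinity>" by simp
 then have "AE \<omega> in M. S \<omega> \<noteq> \<infinity>" by (intro nn_integral_PInf_AE Sm)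
 then show ?thesis
  using continuous_paths
 proof eventually_elim
  case (elim \<omega>)
  define s where "s = max 1 (enn2real (S \<omega>))"
  have s: "s \<ge> 1" "s \<ge> 0" unfolding s_def by auto
  have Zle: "Z j i \<omega> \<le> s" if "i < 2 ^ j" for i j
  proof -
   have "ennreal (Z j i \<omega> ^ (2 * n)) \<le> (\<Sum>i<2^j. ennreal (Z j i \<omega> ^ (2 * n)))"
    using that by (intro member_le_sum) auto
   also have "\<dots> \<le> S \<omega>" unfolding S_def
    using sum_le_suminf[OF summableI, of "{j}" "\<lambda>j. \<Sum>i<2^j. ennreal (Z j i \<omega> ^ (2 * n))"] by simp
   also have "\<dots> \<le> ennreal s" using elim(1) unfolding s_def
    by (metis enn2real_nonneg ennreal_enn2real ennreal_leI infinity_ennreal_def less_top max.cobounded2)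
   finally have le: "Z j i \<omega> ^ (2 * n) \<le> s" using s by simp
   show ?thesis
   proof (cases "Z j i \<omega> \<le> 1")
    case False
    then have "Z j i \<omega> ^ 1 \<le> Z j i \<omega> ^ (2 * n)" using npos by (intro power_increasing) auto
    then show ?thesis using le by simp
   qed (use s in simp)
  qed
  show ?case
  proof (rule dyadic_chaining[OF L g(1) s(2) elim(2)])
   fix j i :: nat assume ij: "i < 2 ^ j"
   have "\<bar>W (q j (Suc i)) \<omega> - W (q j i) \<omega>\<bar> = Z j i \<omega> * 2 powr (- \<gamma> * real j)"
    unfolding Z_def by (simp add: powr_minus)
   also have "\<dots> \<le> s * 2 powr (- \<gamma> * real j)" using Zle[OF ij] by (intro mult_right_mono) auto
   also have "2 powr (- \<gamma> * real j) = (2 powr - \<gamma>) ^ j"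
    by (simp add: powr_powr flip: powr_realpow)
   finally show "\<bar>W (L * real (Suc i) / 2 ^ j) \<omega> - W (L * real i / 2 ^ j) \<omega>\<bar> \<le> s * (2 powr - \<gamma>) ^ j"
    unfolding q_def .
  qed
 qed
qed

text \<open>Countably many exponents with limit \<open>1 / 2\<close> dominate all others, so one null set serves every \<open>\<gamma>\<close>.\<close>

theorem (in standard_brownian_motion) AE_holder_paths:
 assumes L: "L > 0"
 shows "AE \<omega> in M. \<forall>\<gamma>. 0 < \<gamma> \<longrightarrow> \<gamma> < 1/2 \<longrightarrow>
  (\<exists>H. \<forall>x\<in>{0..L}. \<forall>y\<in>{0..L}. \<bar>W x \<omega> - W y \<omega>\<bar> \<le> H * \<bar>x - y\<bar> powr \<gamma>)"
proof -
 have "AE \<omega> in M. \<forall>n::nat. \<exists>H. \<forall>x\<in>{0..L}. \<forall>y\<in>{0..L}.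
   \<bar>W x \<omega> - W y \<omega>\<bar> \<le> H * \<bar>x - y\<bar> powr (1/2 - 1 / (real n + 3))"
  unfolding AE_all_countable using L by (intro allI AE_holder_fixed) (auto simp: field_simps)
 then show ?thesis
 proof eventually_elim
  case (elim \<omega>)
  show ?case
  proof (intro allI impI)
   fix \<gamma> :: real assume g: "0 < \<gamma>" "\<gamma> < 1/2"
   obtain n :: nat where n: "1 / (1/2 - \<gamma>) < real n" using reals_Archimedean2 by blast
   define \<delta> where "\<delta> = 1/2 - 1 / (real n + 3)"
   have d: "\<gamma> \<le> \<delta>" using n g unfolding \<delta>_def by (simp add: field_simps)
   obtain H where H: "\<And>x y. x \<in> {0..L} \<Longrightarrow> y \<in> {0..L} \<Longrightarrow> \<bar>W x \<omega> - W y \<omega>\<bar> \<le> H * \<bar>x - y\<bar> powr \<delta>"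
    using elim[rule_format, of n] unfolding \<delta>_def by blast
   have "\<bar>W x \<omega> - W y \<omega>\<bar> \<le> (\<bar>H\<bar> * L powr (\<delta> - \<gamma>)) * \<bar>x - y\<bar> powr \<gamma>"
    if xy: "x \<in> {0..L}" "y \<in> {0..L}" for x y
   proof -
    have "\<bar>W x \<omega> - W y \<omega>\<bar> \<le> \<bar>H\<bar> * \<bar>x - y\<bar> powr \<delta>"
     using H[OF xy] by (rule order_trans) (intro mult_right_mono, auto)
    also have "\<bar>x - y\<bar> powr \<delta> = \<bar>x - y\<bar> powr (\<delta> - \<gamma>) * \<bar>x - y\<bar> powr \<gamma>"
     by (simp flip: powr_add)
    also have "\<bar>x - y\<bar> powr (\<delta> - \<gamma>) \<le> L powr (\<delta> - \<gamma>)"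
     using xy d by (intro powr_mono2) auto
    finally show ?thesis by (simp add: mult_left_mono mult_right_mono mult.assoc)
   qed
   then show "\<exists>H. \<forall>x\<in>{0..L}. \<forall>y\<in>{0..L}. \<bar>W x \<omega> - W y \<omega>\<bar> \<le> H * \<bar>x - y\<bar> powr \<gamma>" by blast
  qed
 qed
qed

section \<open>Modes and norms of sine series\<close>

lemma set_integral_finite_sum:
 fixes f :: "'i \<Rightarrow> 'b \<Rightarrow> real"
 assumes "\<And>i. i \<in> I \<Longrightarrow> set_integrable M A (f i)"
 shows "set_integrable M A (\<lambda>x. \<Sum>i\<in>I. f i x)"
  "(LINT x:A|M. \<Sum>i\<in>I. f i x) = (\<Sum>i\<in>I. LINT x:A|M. f i x)"
 using assms unfolding set_integrable_def set_lebesgue_integral_def by (simp_all add: sum_distrib_left)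

lemma set_integral_FTC:
 fixes f F :: "real \<Rightarrow> real"
 assumes "a \<le> b" and "\<And>x. x \<in> {a..b} \<Longrightarrow> (F has_real_derivative f x) (at x)"
  and "continuous_on {a..b} f"
 shows "set_integrable lborel {a<..<b} f" "(LINT x:{a<..<b}|lborel. f x) = F b - F a"
proof -
 show "set_integrable lborel {a<..<b} f"
  by (rule set_integrable_subset[OF borel_integrable_atLeastAtMost'[OF assms(3)]]) auto
 have "(LBINT x=a..b. f x) = F b - F a"
  by (rule interval_integral_FTC_finite)
   (use assms in \<open>auto simp: min_absorb1 max_absorb2 has_real_derivative_iff_has_vector_derivative
     intro: has_vector_derivative_at_within\<close>)
 then show "(LINT x:{a<..<b}|lborel. f x) = F b - F a"
  using assms(1) by (simp add: interval_lebesgue_integral_def)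
qed

text \<open>The cosine modes are, up to the factor \<open>k\<close>, the derivatives of the sine modes.\<close>

definition neumann_mode :: "nat \<Rightarrow> real \<Rightarrow> real" where
 "neumann_mode k x = sqrt (2 / pi) * cos (real k * x)"

abbreviation cmode where "cmode k \<equiv> neumann_mode (Suc k)"

lemma sqrt_2_pi: "0 < sqrt (2 / pi)" "sqrt (2 / pi) \<le> 1" "sqrt (2 / pi) * sqrt (2 / pi) = 2 / pi"
 using pi_gt3 by auto

lemma abs_mode_le: "\<bar>dirichlet_mode k x\<bar> \<le> 1" "\<bar>neumann_mode k x\<bar> \<le> 1"
proof -
 have "sqrt (2 / pi) * \<bar>sin (real k * x)\<bar> \<le> 1 * 1" "sqrt (2 / pi) * \<bar>cos (real k * x)\<bar> \<le> 1 * 1"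
  using sqrt_2_pi by (intro mult_mono; simp)+
 then show "\<bar>dirichlet_mode k x\<bar> \<le> 1" "\<bar>neumann_mode k x\<bar> \<le> 1"
  unfolding dirichlet_mode_def neumann_mode_def using sqrt_2_pi(1) by (simp_all add: abs_mult)
qed

lemma DERIV_modes:
 "(dirichlet_mode k has_real_derivative real k * neumann_mode k x) (at x)"
 "(neumann_mode k has_real_derivative - real k * dirichlet_mode k x) (at x)"
 unfolding dirichlet_mode_def[abs_def] neumann_mode_def[abs_def]
 by (auto intro!: derivative_eq_intros)

lemma continuous_on_modes [continuous_intros]:
 fixes f :: "'b::t2_space \<Rightarrow> real"
 shows
 "continuous_on A f \<Longrightarrow> continuous_on A (\<lambda>x. dirichlet_mode k (f x))"
 "continuous_on A f \<Longrightarrow> continuous_on A (\<lambda>x. neumann_mode k (f x))"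
 unfolding dirichlet_mode_def neumann_mode_def
 by (rule continuous_on_mult[OF continuous_on_const], rule continuous_on_sin continuous_on_cos,
   rule continuous_on_mult[OF continuous_on_const], assumption)+

lemma measurable_modes [measurable]:
 "dirichlet_mode k \<in> borel_fun" "neumann_mode k \<in> borel_fun"
 unfolding dirichlet_mode_def[abs_def] neumann_mode_def[abs_def] by measurable

lemma mode_boundary: "dirichlet_mode k 0 = 0" "dirichlet_mode k pi = 0"
 unfolding dirichlet_mode_def by simp_all

lemma abs_sin_mult_le:
 assumes "y \<in> {0..pi}"
 shows "\<bar>sin (real n * y)\<bar> \<le> real n * sin y"
proof (induction n)
 case (Suc n)
 have s: "0 \<le> sin y" using assms by (auto intro: sin_ge_zero)
 have "\<bar>sin (real (Suc n) * y)\<bar> = \<bar>sin (real n * y) * cos y + cos (real n * y) * sin y\<bar>"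
  by (simp add: algebra_simps sin_add)
 also have "\<dots> \<le> \<bar>sin (real n * y)\<bar> * \<bar>cos y\<bar> + \<bar>cos (real n * y)\<bar> * \<bar>sin y\<bar>"
  by (metis abs_mult abs_triangle_ineq)
 also have "\<dots> \<le> \<bar>sin (real n * y)\<bar> * 1 + 1 * \<bar>sin y\<bar>"
  by (intro add_mono mult_left_mono mult_right_mono) auto
 finally show ?case using Suc s by (simp add: algebra_simps)
qed simp

lemma abs_dirichlet_mode_le_sin:
 assumes "y \<in> {0..pi}"
 shows "\<bar>dirichlet_mode k y\<bar> \<le> real k * sin y"
proof -
 have "sqrt (2 / pi) * \<bar>sin (real k * y)\<bar> \<le> 1 * (real k * sin y)"
  using sqrt_2_pi abs_sin_mult_le[OF assms, of k] by (intro mult_mono) auto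
 then show ?thesis unfolding dirichlet_mode_def using sqrt_2_pi(1) by (simp add: abs_mult)
qed

lemma integral_cos_multiple:
 fixes n :: int
 shows "integrable_I (\<lambda>y. cos (of_int n * y))"
  "(LI y. cos (of_int n * y)) = (if n = 0 then pi else 0)"
proof -
 show "integrable_I (\<lambda>y. cos (of_int n * y))"
  by (rule set_integrable_subset[OF borel_integrable_atLeastAtMost'[of 0 pi]]) (auto intro!: continuous_intros)
 show "(LI y. cos (of_int n * y)) = (if n = 0 then pi else 0)"
 proof (cases "n = 0")
  case True
  then show ?thesis by (simp add: set_lebesgue_integral_def)
 next
  case False
  have "(LI y. cos (of_int n * y)) = sin (of_int n * pi) / of_int n - sin (of_int n * 0) / of_int n"
   using False by (intro set_integral_FTC) (auto intro!: derivative_eq_intros continuous_intros)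
  then show ?thesis using False by (simp add: sin_npi_int mult.commute)
 qed
qed

lemma dirichlet_mode_orthonormal:
 "integrable_I (\<lambda>y. smode j y * smode k y)"
 "(LI y. smode j y * smode k y) = (if j = k then 1 else 0)"
proof -
 have e: "smode j y * smode k y =
  (1 / pi) * cos (of_int (int j - int k) * y) - (1 / pi) * cos (of_int (int j + int k + 2) * y)" for y
 proof -
  have "smode j y * smode k y
   = (sqrt (2 / pi) * sqrt (2 / pi)) * (sin (real (Suc j) * y) * sin (real (Suc k) * y))"
   unfolding dirichlet_mode_def by (simp only: mult_ac)
  also have "\<dots> = (1 / pi) * cos (real (Suc j) * y - real (Suc k) * y) - (1 / pi) * cos (real (Suc j) * y + real (Suc k) * y)"
   unfolding sqrt_2_pi(3) sin_times_sin by (simp add: field_simps)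
  finally show ?thesis by (simp add: algebra_simps)
 qed
 have i: "integrable_I (\<lambda>y. (1 / pi) * cos (of_int n * y))" for n :: int
  using integral_cos_multiple(1)[of n] by simp
 show "integrable_I (\<lambda>y. smode j y * smode k y)"
  unfolding e by (intro set_integral_diff i)
 have "(LI y. smode j y * smode k y) =
  (1 / pi) * (LI y. cos (of_int (int j - int k) * y))
   - (1 / pi) * (LI y. cos (of_int (int j + int k + 2) * y))"
  unfolding e by (subst set_integral_diff(2)[OF i i]) (simp only: set_integral_mult_right)
 then show "(LI y. smode j y * smode k y) = (if j = k then 1 else 0)"
  unfolding integral_cos_multiple(2) by auto
qed

lemma sum_exp_squares_le:
 assumes "\<tau> > 0"
 shows "(\<Sum>k<n. decay k \<tau>) \<le> 2 * \<tau> powr (- 1 / 2)"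
proof -
 define s where "s = sqrt \<tau>"
 have s: "s > 0" "s\<^sup>2 = \<tau>" using assms unfolding s_def by auto
 have term_le: "decay k \<tau> \<le> (arctan (real (Suc k) * s) - arctan (real k * s)) / s" for k
 proof -
  have "real k * s < real (Suc k) * s" using s by simp
  from MVT2[OF this, of arctan "\<lambda>x. inverse (1 + x\<^sup>2)"] obtain z where
   z: "real k * s < z" "z < real (Suc k) * s"
    "arctan (real (Suc k) * s) - arctan (real k * s) = (real (Suc k) * s - real k * s) * inverse (1 + z\<^sup>2)"
   by (auto intro: DERIV_arctan)
  have z0: "0 < z" using z(1) s by (smt (verit) mult_nonneg_nonneg of_nat_0_le_iff)
  have "z\<^sup>2 \<le> (real (Suc k) * s)\<^sup>2" using z z0 by (intro power_mono) auto
  then have zz: "z\<^sup>2 \<le> (real (Suc k))\<^sup>2 * \<tau>" using s by (simp add: power_mult_distrib)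
  have "decay k \<tau> = inverse (exp ((real (Suc k))\<^sup>2 * \<tau>))" by (simp add: exp_minus)
  also have "\<dots> \<le> inverse (1 + z\<^sup>2)"
   using order_trans[OF add_left_mono[OF zz, of 1] exp_ge_add_one_self]
   by (intro le_imp_inverse_le) (auto intro: add_pos_nonneg)
  also have "\<dots> = (arctan (real (Suc k) * s) - arctan (real k * s)) / s"
  proof -
   have "real (Suc k) * s - real k * s = s" by (simp add: algebra_simps)
   then show ?thesis unfolding z(3) using s by simp
  qed
  finally show ?thesis .
 qed
 have "(\<Sum>k<n. decay k \<tau>) \<le> (\<Sum>k<n. (arctan (real (Suc k) * s) - arctan (real k * s)) / s)"
  by (intro sum_mono term_le)
 also have "\<dots> = (arctan (real n * s) - arctan (real 0 * s)) / s"
  unfolding sum_divide_distrib[symmetric] by (subst sum_lessThan_telescope) simp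
 also have "\<dots> \<le> 2 / s"
  using s arctan_ubound[of "real n * s"] pi_less_4 by (intro divide_right_mono) auto
 also have "\<dots> = 2 * \<tau> powr (- 1 / 2)"
  unfolding s_def using assms by (simp add: powr_minus_divide powr_half_sqrt)
 finally show ?thesis .
qed

text \<open>This absorbs powers of the frequency into part of the exponential decay of a coefficient.\<close>

lemma powr_mult_exp_minus_le:
 fixes z p :: real
 assumes "z > 0" "p \<ge> 0"
 shows "z powr p * exp (- z) \<le> (1 + p) powr p"
proof -
 have "z / (1 + p) \<le> exp (z / (1 + p))" using exp_ge_add_one_self[of "z / (1 + p)"] by linarith
 then have "(z / (1 + p)) powr p \<le> exp (z / (1 + p)) powr p"
  using assms by (intro powr_mono2) auto
 also have "\<dots> = exp (p * (z / (1 + p)))" by (simp add: powr_def)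
 also have "p * (z / (1 + p)) \<le> z" using assms by (simp add: field_simps)
 finally have "(z / (1 + p)) powr p \<le> exp z" by simp
 then have "z powr p \<le> (1 + p) powr p * exp z"
  using assms by (simp add: powr_divide field_simps)
 then show ?thesis by (simp add: exp_minus field_simps)
qed

lemma decay_square_sum:
 assumes tau: "\<tau> > 0" and p: "p \<ge> 0"
  and a: "\<And>k. \<bar>\<alpha> k\<bar> \<le> A * real (Suc k) powr p * decay k \<tau>"
 shows "(\<Sum>k<n. (\<alpha> k)\<^sup>2) \<le> 2 * (1 + p) powr p * A\<^sup>2 * \<tau> powr (- (2 * p + 1) / 2)"
proof -
 have "(\<alpha> k)\<^sup>2 \<le> A\<^sup>2 * (1 + p) powr p * \<tau> powr (- p) * decay k \<tau>" for k
 proof -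
  define K where "K = real (Suc k)"
  have K: "K > 0" unfolding K_def by simp
  have "(\<alpha> k)\<^sup>2 \<le> (A * K powr p * exp (- K\<^sup>2 * \<tau>))\<^sup>2"
   using a[of k] unfolding K_def[symmetric]
   by (metis abs_ge_zero power2_abs power_mono)
  also have "\<dots> = A\<^sup>2 * ((K\<^sup>2 * \<tau>) powr p * \<tau> powr (- p)) * (exp (- (K\<^sup>2 * \<tau>)) * exp (- K\<^sup>2 * \<tau>))"
  proof -
   have "(K powr p)\<^sup>2 = (K\<^sup>2 * \<tau>) powr p * \<tau> powr (- p)"
    using K tau by (simp add: powr_mult powr_minus powr_power power2_eq_square)
   then show ?thesis by (simp add: power_mult_distrib power2_eq_square[of "exp _"])
  qed
  also have "\<dots> = A\<^sup>2 * ((K\<^sup>2 * \<tau>) powr p * exp (- (K\<^sup>2 * \<tau>))) * (\<tau> powr (- p) * exp (- K\<^sup>2 * \<tau>))"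
   by (simp only: mult_ac)
  also have "\<dots> \<le> A\<^sup>2 * ((1 + p) powr p) * (\<tau> powr (- p) * exp (- K\<^sup>2 * \<tau>))"
   using K tau p by (intro mult_right_mono mult_left_mono powr_mult_exp_minus_le) auto
  finally show ?thesis unfolding K_def by (simp add: mult_ac)
 qed
 then have "(\<Sum>k<n. (\<alpha> k)\<^sup>2) \<le> (\<Sum>k<n. A\<^sup>2 * (1 + p) powr p * \<tau> powr (- p) * decay k \<tau>)"
  by (intro sum_mono)
 also have "\<dots> = A\<^sup>2 * (1 + p) powr p * \<tau> powr (- p) * (\<Sum>k<n. decay k \<tau>)"
  by (simp add: sum_distrib_left)
 also have "\<dots> \<le> A\<^sup>2 * (1 + p) powr p * \<tau> powr (- p) * (2 * \<tau> powr (- 1 / 2))"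
  by (intro mult_left_mono sum_exp_squares_le tau) auto
 also have "\<dots> = 2 * (1 + p) powr p * A\<^sup>2 * (\<tau> powr (- p) * \<tau> powr (- 1 / 2))" by simp
 also have "\<tau> powr (- p) * \<tau> powr (- 1 / 2) = \<tau> powr (- (2 * p + 1) / 2)"
  unfolding powr_add[symmetric] by (rule arg_cong[where f = "\<lambda>e. \<tau> powr e"]) (simp add: field_simps)
 finally show ?thesis .
qed

lemma summable_decay:
 assumes tau: "\<tau> > 0" and p: "p \<ge> 0"
 shows "summable (\<lambda>k. real (Suc k) powr p * decay k \<tau>)"
proof -
 define \<alpha> where "\<alpha> k = real (Suc k) powr (p / 2) * decay k (\<tau> / 2)" for k
 have sq: "(\<alpha> k)\<^sup>2 = real (Suc k) powr p * decay k \<tau>" for k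
 proof -
  have "(\<alpha> k)\<^sup>2 = (real (Suc k) powr (p / 2))\<^sup>2 * (decay k (\<tau> / 2))\<^sup>2"
   unfolding \<alpha>_def power_mult_distrib ..
  also have "(real (Suc k) powr (p / 2))\<^sup>2 = real (Suc k) powr p"
   by (simp add: powr_power)
  also have "(decay k (\<tau> / 2))\<^sup>2 = decay k \<tau>"
   unfolding power2_eq_square exp_add[symmetric] by (simp add: field_simps)
  finally show ?thesis .
 qed
 have "summable (\<lambda>k. (\<alpha> k)\<^sup>2)"
 proof (rule bounded_imp_summable)
  fix n
  show "(\<Sum>k\<le>n. (\<alpha> k)\<^sup>2) \<le> 2 * (1 + p/2) powr (p/2) * 1\<^sup>2 * (\<tau>/2) powr (- (2 * (p/2) + 1) / 2)"
   using decay_square_sum[of "\<tau>/2" "p/2" \<alpha> 1 "Suc n"] assms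
   unfolding lessThan_Suc_atMost by (simp add: \<alpha>_def)
 qed auto
 then show ?thesis unfolding sq .
qed

lemma summable_decay_bound:
 assumes tau: "\<tau> > 0" and p: "p \<ge> 0"
  and a: "\<And>k. \<bar>\<alpha> k\<bar> \<le> A * real (Suc k) powr p * decay k \<tau>"
 shows "summable (\<lambda>k. \<bar>\<alpha> k\<bar>)"
 by (rule summable_comparison_test'[OF summable_mult[OF summable_decay[OF tau p], of A], of 0])
  (use a in \<open>simp add: mult.assoc\<close>)

text \<open>Parseval bounds the \<open>L\<^sup>2\<close> norm by \<open>S\<close>; the inequality \<open>2 * \<bar>f\<bar> \<le> \<delta> + f\<^sup>2 / \<delta>\<close> turns this into an \<open>L\<^sup>1\<close> bound,
  with \<open>\<delta>\<close> left free. Partial sums and Fatou's lemma avoid square integrability of the full series.\<close>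

lemma sine_series_L1_aux:
 assumes sm: "summable (\<lambda>k. \<bar>\<alpha> k\<bar>)" and d: "\<delta> > 0" and S: "\<And>n. (\<Sum>k<n. (\<alpha> k)\<^sup>2) \<le> S"
 shows "(NN y. ennreal \<bar>\<Sum>k. \<alpha> k * smode k y\<bar> * ind_I y)
  \<le> ennreal ((pi * \<delta> + S / \<delta>) / 2)"
proof -
 define g where "g n y = (\<Sum>k<n. \<alpha> k * smode k y)" for n y
 have lim: "(\<lambda>n. g n y) \<longlonglongrightarrow> (\<Sum>k. \<alpha> k * smode k y)" for y
 proof -
  have "summable (\<lambda>k. \<alpha> k * smode k y)"
  proof (rule summable_comparison_test'[OF sm, of 0])
   fix k
   show "norm (\<alpha> k * smode k y) \<le> \<bar>\<alpha> k\<bar>"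
    using mult_left_mono[OF abs_mode_le(1)[of "Suc k" y], of "\<bar>\<alpha> k\<bar>"] by (simp add: abs_mult)
  qed
  then show ?thesis unfolding g_def by (rule summable_LIMSEQ)
 qed
 have gm [measurable]: "g n \<in> borel_fun" for n unfolding g_def by measurable
 have sq: "integrable_I (\<lambda>y. (g n y)\<^sup>2)"
  "(LI y. (g n y)\<^sup>2) = (\<Sum>k<n. (\<alpha> k)\<^sup>2)" for n
 proof -
  have e: "(g n y)\<^sup>2 = (\<Sum>j<n. \<Sum>k<n. (\<alpha> j * \<alpha> k) * (smode j y * smode k y))" for y
   unfolding g_def power2_eq_square sum_product by (intro sum.cong refl) (simp only: mult_ac)
  have i: "integrable_I (\<lambda>y. (\<alpha> j * \<alpha> k) * (smode j y * smode k y))" for j k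
   using dirichlet_mode_orthonormal(1)[of j k] by simp
  show "integrable_I (\<lambda>y. (g n y)\<^sup>2)"
   unfolding e by (intro set_integral_finite_sum i)
  have "(LI y. (g n y)\<^sup>2) = (\<Sum>j<n. \<Sum>k<n. LI y. (\<alpha> j * \<alpha> k) * (smode j y * smode k y))"
   unfolding e by (simp only: set_integral_finite_sum set_integral_finite_sum(1) i)
  also have "\<dots> = (\<Sum>j<n. \<Sum>k<n. (\<alpha> j * \<alpha> k) * (if j = k then 1 else 0))"
   by (simp only: set_integral_mult_right dirichlet_mode_orthonormal(2))
  also have "\<dots> = (\<Sum>k<n. (\<alpha> k)\<^sup>2)"
   by (simp add: if_distrib[of "\<lambda>x. _ * x"] power2_eq_square cong: if_cong)
  finally show "(LI y. (g n y)\<^sup>2) = (\<Sum>k<n. (\<alpha> k)\<^sup>2)" .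
 qed
 have S0: "0 \<le> S" using S[of 0] by simp
 have bound: "(NN y. ennreal \<bar>g n y\<bar> * ind_I y) \<le> ennreal ((pi * \<delta> + S / \<delta>) / 2)" for n
 proof -
  have pt: "\<bar>g n y\<bar> \<le> \<delta> / 2 + (1 / (2 * \<delta>)) * (g n y)\<^sup>2" for y
  proof -
   have "0 \<le> (\<bar>g n y\<bar> - \<delta>)\<^sup>2" by simp
   then show ?thesis using d by (simp add: field_simps power2_eq_square)
  qed
  have ii: "integrable_I (\<lambda>y. \<delta> / 2 + (1 / (2 * \<delta>)) * (g n y)\<^sup>2)"
   using sq(1)[of n] by (intro set_integral_add set_integrable_mult_right)
    (auto simp: set_integrable_def)
  have "(NN y. ennreal \<bar>g n y\<bar> * ind_I y)
   \<le> (NN y. ennreal (ind_I y *\<^sub>R (\<delta> / 2 + (1 / (2 * \<delta>)) * (g n y)\<^sup>2)))"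
   using pt by (intro nn_integral_mono) (auto simp: indicator_def intro: ennreal_leI)
  also have "\<dots> = ennreal (LI y. \<delta> / 2 + (1 / (2 * \<delta>)) * (g n y)\<^sup>2)"
   unfolding set_lebesgue_integral_def using ii d
   by (intro nn_integral_eq_integral) (auto simp: set_integrable_def)
  also have "(LI y. \<delta> / 2 + (1 / (2 * \<delta>)) * (g n y)\<^sup>2) = pi * \<delta> / 2 + (1 / (2 * \<delta>)) * (\<Sum>k<n. (\<alpha> k)\<^sup>2)"
  proof -
   have c: "integrable_I (\<lambda>y. \<delta> / 2)" "(LI y. \<delta> / 2) = pi * \<delta> / 2"
    by (auto simp: set_integrable_def set_lebesgue_integral_def)
   show ?thesis
    by (subst set_integral_add(2)) (use sq[of n] c in \<open>auto simp: set_integral_mult_right\<close>)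
  qed
  also have "ennreal \<dots> \<le> ennreal ((pi * \<delta> + S / \<delta>) / 2)"
   using S[of n] d by (intro ennreal_leI) (simp add: field_simps)
  finally show ?thesis .
 qed
 have "(NN y. ennreal \<bar>\<Sum>k. \<alpha> k * smode k y\<bar> * ind_I y)
  = (NN y. liminf (\<lambda>n. ennreal \<bar>g n y\<bar> * ind_I y))"
 proof (intro nn_integral_cong)
  fix y
  have "(\<lambda>n. ennreal \<bar>g n y\<bar> * ind_I y) \<longlonglongrightarrow> ennreal \<bar>\<Sum>k. \<alpha> k * smode k y\<bar> * ind_I y"
   using lim[of y] by (auto simp: indicator_def intro!: tendsto_intros)
  then show "ennreal \<bar>\<Sum>k. \<alpha> k * smode k y\<bar> * ind_I y
   = liminf (\<lambda>n. ennreal \<bar>g n y\<bar> * ind_I y)"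
   by (intro lim_imp_Liminf[symmetric]) auto
 qed
 also have "\<dots> \<le> liminf (\<lambda>n. NN y. ennreal \<bar>g n y\<bar> * ind_I y)"
  by (intro nn_integral_liminf) measurable
 also have "\<dots> \<le> ennreal ((pi * \<delta> + S / \<delta>) / 2)"
  by (rule Liminf_le) (use bound in auto)
 finally show ?thesis .
qed

definition decay_const :: "real \<Rightarrow> real" where
 "decay_const p = (pi + 2 * (1 + p) powr p) / 2"

lemma decay_const_pos: "0 < decay_const p"
 unfolding decay_const_def by (simp add: add_pos_nonneg)

text \<open>All kernel bounds below are instances. The choice of \<open>\<delta>\<close> balances the two terms of the preceding bound.\<close>

lemma sine_series_L1:
 assumes tau: "\<tau> > 0" and p: "p \<ge> 0" and A: "A \<ge> 0"
  and a: "\<And>k. \<bar>\<alpha> k\<bar> \<le> A * real (Suc k) powr p * decay k \<tau>"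
 shows "(NN y. ennreal \<bar>\<Sum>k. \<alpha> k * smode k y\<bar> * ind_I y)
  \<le> ennreal (decay_const p * A * \<tau> powr (- (2 * p + 1) / 4))"
proof (cases "A = 0")
 case True
 then have "\<alpha> k = 0" for k using a[of k] by simp
 then show ?thesis by simp
next
 case False
 define \<delta> where "\<delta> = A * \<tau> powr (- (2 * p + 1) / 4)"
 have d: "\<delta> > 0" using False A tau unfolding \<delta>_def by simp
 define S where "S = 2 * (1 + p) powr p * A\<^sup>2 * \<tau> powr (- (2 * p + 1) / 2)"
 have "S = 2 * (1 + p) powr p * (\<delta> * \<delta>)"
 proof -
  have "\<tau> powr (- (2 * p + 1) / 2) = \<tau> powr (- (2 * p + 1) / 4) * \<tau> powr (- (2 * p + 1) / 4)"
   unfolding powr_add[symmetric] by (rule arg_cong[where f = "\<lambda>e. \<tau> powr e"]) (simp add: field_simps)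
  then show ?thesis unfolding S_def \<delta>_def by (simp add: power2_eq_square)
 qed
 then have e: "(pi * \<delta> + S / \<delta>) / 2 = decay_const p * \<delta>"
  using d unfolding decay_const_def by (simp add: field_simps)
 show ?thesis
  using sine_series_L1_aux[OF summable_decay_bound[OF tau p a] d, of S] decay_square_sum[OF tau p a]
  unfolding S_def[symmetric] e by (simp add: \<delta>_def mult.assoc)
qed

section \<open>The Dirichlet heat kernel\<close>

lemma DERIV_dirichlet_series:
 assumes sm: "summable (\<lambda>k. real (Suc k) * \<bar>c k\<bar>)"
 shows "((\<lambda>x. \<Sum>k. c k * smode k x) has_real_derivative
   (\<Sum>k. c k * (real (Suc k) * cmode k x))) (at x)"
proof -
 have b: "\<bar>c k * (real (Suc k) * cmode k x)\<bar> \<le> real (Suc k) * \<bar>c k\<bar>" for k x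
  using mult_left_mono[OF abs_mode_le(2)[of "Suc k" x], of "real (Suc k) * \<bar>c k\<bar>"]
  by (simp add: abs_mult mult_ac)
 have "uniformly_convergent_on UNIV (\<lambda>n x. \<Sum>k<n. c k * (real (Suc k) * cmode k x))"
  by (rule Weierstrass_m_test'[OF _ sm]) (use b in simp)
 then show ?thesis
  by (intro has_field_derivative_series'(2)[of UNIV "\<lambda>k x. c k * smode k x"
     "\<lambda>k x. c k * (real (Suc k) * cmode k x)" 0])
   (auto intro!: derivative_eq_intros DERIV_modes[THEN DERIV_subset] simp: mode_boundary)
qed

text \<open>The kernel is set to \<open>0\<close> outside \<open>0 < \<tau> < T\<close>. An integral over \<open>0 < s < t\<close> of \<open>heatK T (t - s)\<close> is then an integral
  over all of space-time.\<close>

definition heatK :: "real \<Rightarrow> real \<Rightarrow> real \<Rightarrow> real \<Rightarrow> real" where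
 "heatK T \<tau> x y = (if 0 < \<tau> \<and> \<tau> < T then
  (\<Sum>k. decay k \<tau> * smode k x * smode k y) else 0)"

definition heatKx :: "real \<Rightarrow> real \<Rightarrow> real \<Rightarrow> real \<Rightarrow> real" where
 "heatKx T \<tau> x y = (if 0 < \<tau> \<and> \<tau> < T then
  (\<Sum>k. decay k \<tau> * (real (Suc k) * cmode k x) * smode k y) else 0)"

abbreviation pK :: "real \<Rightarrow> real \<Rightarrow> real \<Rightarrow> real \<times> real \<Rightarrow> real" where "pK T t x z \<equiv> heatK T (t - fst z) x (snd z)"
abbreviation pKx :: "real \<Rightarrow> real \<Rightarrow> real \<Rightarrow> real \<times> real \<Rightarrow> real" where "pKx T t x z \<equiv> heatKx T (t - fst z) x (snd z)"

lemma heatK_sym: "heatK T \<tau> x y = heatK T \<tau> y x"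
 unfolding heatK_def by (simp add: mult_ac)

lemma measurable_heatK [measurable (raw)]:
 assumes [measurable]: "f \<in> borel_measurable M" "g \<in> borel_measurable M" "h \<in> borel_measurable M"
 shows "(\<lambda>w. heatK T (f w) (g w) (h w)) \<in> borel_measurable M"
  "(\<lambda>w. heatKx T (f w) (g w) (h w)) \<in> borel_measurable M"
 unfolding heatK_def heatKx_def by measurable

lemma decay_coeff_bound:
 assumes "\<bar>X\<bar> \<le> A * real (Suc k) powr p"
 shows "\<bar>decay k \<tau> * X\<bar> \<le> A * real (Suc k) powr p * decay k \<tau>"
 using mult_right_mono[OF assms, of "decay k \<tau>"] by (simp add: abs_mult mult_ac)

lemma summable_decay_exp:
 assumes tau: "\<tau> > 0" and p: "p \<ge> 0" and X: "\<And>k. \<bar>X k\<bar> \<le> A * real (Suc k) powr p"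
 shows "summable (\<lambda>k. \<bar>decay k \<tau> * X k\<bar>)" "summable (\<lambda>k. decay k \<tau> * X k)"
proof -
 show s: "summable (\<lambda>k. \<bar>decay k \<tau> * X k\<bar>)"
  by (rule summable_decay_bound[OF tau p decay_coeff_bound[OF X]])
 show "summable (\<lambda>k. decay k \<tau> * X k)"
  by (rule summable_rabs_cancel[OF s])
qed

lemma abs_mult_mode_le:
 assumes "\<bar>X\<bar> \<le> B"
 shows "\<bar>X * dirichlet_mode k x\<bar> \<le> B" "\<bar>X * neumann_mode k x\<bar> \<le> B"
 using mult_mono[OF assms abs_mode_le(1)[of k x]] mult_mono[OF assms abs_mode_le(2)[of k x]] assms
 by (auto simp: abs_mult)

lemma summable_heat_terms:
 assumes "0 < \<tau>"
 shows "summable (\<lambda>k. decay k \<tau> * smode k x * smode k y)"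
  "summable (\<lambda>k. decay k \<tau> * (real (Suc k) * cmode k x) * smode k y)"
proof -
 have "\<bar>smode k x * smode k y\<bar> \<le> 1 * real (Suc k) powr 0" for k
  using abs_mult_mode_le(1)[OF abs_mode_le(1)[of "Suc k" x]] by simp
 from summable_decay_exp(2)[OF assms _ this]
 show "summable (\<lambda>k. decay k \<tau> * smode k x * smode k y)"
  by (simp add: mult.assoc)
 have "\<bar>(real (Suc k) * cmode k x) * smode k y\<bar> \<le> 1 * real (Suc k) powr 1" for k
  using abs_mult_mode_le(1)[OF abs_mult_mode_le(2)[of "real (Suc k)" "real (Suc k)" "Suc k" x]] by simp
 from summable_decay_exp(2)[OF assms _ this]
 show "summable (\<lambda>k. decay k \<tau> * (real (Suc k) * cmode k x) * smode k y)"
  by (simp add: mult.assoc)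
qed

lemma kernel_L1:
 assumes tau: "0 < \<tau>" and p: "p \<ge> 0" and A: "A \<ge> 0"
  and X: "\<And>k. \<bar>X k\<bar> \<le> A * real (Suc k) powr p"
 shows "(NN y. ennreal \<bar>\<Sum>k. decay k \<tau> * X k * smode k y\<bar> * ind_I y)
  \<le> ennreal (decay_const p * A * \<tau> powr (- (2 * p + 1) / 4))"
 by (rule sine_series_L1[OF tau p A decay_coeff_bound[OF X]])

lemma heatK_L1:
 assumes "0 < \<tau>" "\<tau> < T"
 shows "(NN y. ennreal \<bar>heatK T \<tau> x y\<bar> * ind_I y)
  \<le> ennreal (decay_const 0 * \<tau> powr (- 1 / 4))"
 unfolding heatK_def
 using kernel_L1[of \<tau> 0 1 "\<lambda>k. smode k x"] abs_mode_le(1) assms by simp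

text \<open>Integration runs over the other variable, and \<open>\<bar>sin (k * y)\<bar> \<le> k * sin y\<close> extracts the weight at the price of one power of
  the frequency.\<close>

lemma heatK_L1_weight:
 assumes "0 < \<tau>" "\<tau> < T" and y: "y \<in> {0..pi}"
 shows "(NN x. ennreal \<bar>heatK T \<tau> x y\<bar> * ind_I x)
  \<le> ennreal (decay_const 1 * sin y * \<tau> powr (- 3 / 4))"
proof -
 have "0 \<le> sin y" using y by (auto intro: sin_ge_zero)
 moreover have "\<bar>smode k y\<bar> \<le> sin y * real (Suc k) powr 1" for k
  using abs_dirichlet_mode_le_sin[OF y, of "Suc k"] by (simp add: mult.commute)
 note kernel_L1[OF assms(1) _ _ this]
 ultimately show ?thesis
  unfolding heatK_sym[of T \<tau> _ y] unfolding heatK_def using assms by simp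
qed

lemma heatKx_L1:
 assumes "0 < \<tau>" "\<tau> < T"
 shows "(NN y. ennreal \<bar>heatKx T \<tau> x y\<bar> * ind_I y)
  \<le> ennreal (decay_const 1 * \<tau> powr (- 3 / 4))"
 unfolding heatKx_def
 using kernel_L1[of \<tau> 1 1 "\<lambda>k. real (Suc k) * cmode k x"]
  abs_mult_mode_le(2)[of "real (Suc _)" "real (Suc _)"] assms
 by simp

text \<open>The estimate \<open>1 - s \<le> exp (- s)\<close> replaces the mean value theorem; the polynomial factor is then absorbed by half of the exponential decay.\<close>

lemma q_difference:
 assumes "\<tau> > 0"
 defines "q \<equiv> \<lambda>n. real n * exp (- (real n)\<^sup>2 * \<tau>)"
 shows "\<bar>q i - q (i + 2)\<bar> \<le> 18 * exp (- (real i)\<^sup>2 * \<tau> / 2)"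
proof -
 define z where "z = (real i)\<^sup>2 * \<tau>"
 define e where "e = exp (- (real i)\<^sup>2 * \<tau>)"
 define e' where "e' = exp (- (real (i + 2))\<^sup>2 * \<tau>)"
 have z: "0 \<le> z" unfolding z_def using assms by simp
 have e': "e' = e * exp (- ((4 * real i + 4) * \<tau>))"
  unfolding e'_def e_def exp_add[symmetric] by (simp add: algebra_simps power2_eq_square)
 have "exp (- ((4 * real i + 4) * \<tau>)) \<ge> 1 - (4 * real i + 4) * \<tau>"
  using exp_ge_add_one_self[of "- ((4 * real i + 4) * \<tau>)"] by linarith
 then have "e' \<ge> e * (1 - (4 * real i + 4) * \<tau>)"
  unfolding e' by (intro mult_left_mono) (auto simp: e_def)
 then have d1: "e - e' \<le> e * ((4 * real i + 4) * \<tau>)" by (simp add: algebra_simps)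
 have ele: "e' \<le> e" unfolding e' using assms(1) by (simp add: e_def mult_le_cancel_left1)
 have half: "exp (- (real i)\<^sup>2 * \<tau> / 2) = exp (- (z / 2))" unfolding z_def by simp
 have e2: "e = exp (- (z / 2)) * exp (- (z / 2))" unfolding e_def z_def exp_add[symmetric] by simp
 have eh: "e \<le> exp (- (z / 2))" unfolding e_def z_def using assms by simp
 have "real i * (e - e') \<le> real i * (e * ((4 * real i + 4) * \<tau>))" by (intro mult_left_mono d1) auto
 also have "\<dots> \<le> 8 * z * e"
 proof -
  have "real i * (4 * real i + 4) \<le> 8 * (real i)\<^sup>2"
  proof (cases i)
   case (Suc n) then show ?thesis by (simp add: power2_eq_square algebra_simps)
  qed simp
  then have "real i * (4 * real i + 4) * (e * \<tau>) \<le> 8 * (real i)\<^sup>2 * (e * \<tau>)"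
   using assms by (intro mult_right_mono) (auto simp: e_def)
  then show ?thesis unfolding z_def by (simp add: mult_ac)
 qed
 also have "\<dots> \<le> 16 * exp (- (z / 2))"
 proof -
  have "z / 2 \<le> exp (z / 2)" using exp_ge_add_one_self[of "z / 2"] by linarith
  then have "z / 2 * exp (- (z / 2)) \<le> 1" by (simp add: exp_minus field_simps)
  then have "(z / 2 * exp (- (z / 2))) * exp (- (z / 2)) \<le> 1 * exp (- (z / 2))" by (intro mult_right_mono) auto
  then show ?thesis unfolding e2 by simp
 qed
 finally have b: "real i * (e - e') \<le> 16 * exp (- (z / 2))" .
 have "q i - q (i + 2) = real i * (e - e') - 2 * e'"
  unfolding q_def e_def e'_def by (simp add: algebra_simps)
 moreover have "0 \<le> e'" unfolding e'_def by simp
 moreover have "0 \<le> real i * (e - e')" using ele by simp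
 ultimately show ?thesis unfolding half using b ele eh by (intro abs_leI; linarith)
qed

text \<open>Here \<open>sin x * cos (k x)\<close> is expanded into sines, and neighbouring coefficients cancel. This
 gains the factor \<open>sin y\<close> at the cost of no power of \<open>\<tau>\<close>.\<close>

lemma heatKx_L1_weight:
 assumes tau: "0 < \<tau>" "\<tau> < T" and y: "y \<in> {0..pi}"
 shows "(NN x. ennreal (sin x * \<bar>heatKx T \<tau> x y\<bar>) * ind_I x)
  \<le> ennreal (160 * exp (T / 8) * decay_const 1 * sin y * \<tau> powr (- 3 / 4))"
proof -
 define q where "q n = real n * exp (- (real n)\<^sup>2 * \<tau>)" for n
 define Q where "Q n = (1 / pi) * q n * sin (real n * y)" for n
 define \<alpha> where "\<alpha> i = (Q i - Q (i + 2)) / sqrt (2 / pi)" for i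
 have s: "0 \<le> sin y" using y by (auto intro: sin_ge_zero)
 have q0: "0 \<le> q n" for n unfolding q_def by simp
 have bound: "\<bar>\<alpha> i\<bar> \<le> (20 * exp (T / 8) * sin y) * real (Suc i) powr 1 * decay i (\<tau> / 8)" for i
 proof -
  define j where "j = real (Suc i)"
  have ij: "real i = j - 1" "real (i + 2) = j + 1" unfolding j_def by auto
  have e: "q i * sin (real i * y) - q (i + 2) * sin (real (i + 2) * y)
   = (q i - q (i + 2)) * (sin (j * y) * cos y) - (q i + q (i + 2)) * (cos (j * y) * sin y)"
   unfolding ij left_diff_distrib distrib_right mult_1_left sin_diff sin_add by (simp add: algebra_simps)
  have eh: "exp (- (real i)\<^sup>2 * \<tau>) \<le> exp (- (real i)\<^sup>2 * \<tau> / 2)" using tau by simp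
  have "q (i + 2) \<le> (j + 1) * exp (- (real i)\<^sup>2 * \<tau> / 2)"
  proof -
   have "exp (- (real (i + 2))\<^sup>2 * \<tau>) \<le> exp (- (real i)\<^sup>2 * \<tau>)"
    using tau by (auto intro!: mult_right_mono power_mono)
   from order_trans[OF this eh] show ?thesis unfolding q_def
    unfolding ij(2) by (intro mult_left_mono) (auto simp: j_def)
  qed
  moreover have "q i \<le> (j - 1) * exp (- (real i)\<^sup>2 * \<tau> / 2)"
   unfolding q_def ij(1) using eh unfolding ij(1) by (intro mult_left_mono) (auto simp: j_def)
  ultimately have b2: "q i + q (i + 2) \<le> 2 * j * exp (- (real i)\<^sup>2 * \<tau> / 2)" by (simp add: algebra_simps)
  have b1: "\<bar>q i - q (i + 2)\<bar> \<le> 18 * exp (- (real i)\<^sup>2 * \<tau> / 2)"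
   unfolding q_def by (rule q_difference[OF tau(1)])
  have c1: "\<bar>sin (j * y) * cos y\<bar> \<le> j * sin y"
   using mult_mono[OF abs_sin_mult_le[OF y, of "Suc i"] abs_cos_le_one[of y]] s
   by (simp add: abs_mult j_def)
  have c2: "\<bar>cos (j * y) * sin y\<bar> \<le> sin y"
   using mult_right_mono[OF abs_cos_le_one[of "j * y"] s] s by (simp add: abs_mult)
  have "\<bar>q i * sin (real i * y) - q (i + 2) * sin (real (i + 2) * y)\<bar>
   \<le> \<bar>q i - q (i + 2)\<bar> * \<bar>sin (j * y) * cos y\<bar> + \<bar>q i + q (i + 2)\<bar> * \<bar>cos (j * y) * sin y\<bar>"
   unfolding e abs_mult[symmetric] by (rule abs_triangle_ineq4)
  also have "\<dots> \<le> (18 * exp (- (real i)\<^sup>2 * \<tau> / 2)) * (j * sin y) + (2 * j * exp (- (real i)\<^sup>2 * \<tau> / 2)) * sin y"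
   using b1 b2 c1 c2 q0[of i] q0[of "i + 2"] by (intro add_mono mult_mono) (auto simp: j_def)
  also have "\<dots> = 20 * sin y * j * exp (- (real i)\<^sup>2 * \<tau> / 2)" by (simp add: algebra_simps)
  also have "exp (- (real i)\<^sup>2 * \<tau> / 2) \<le> exp (T / 8) * exp (- j\<^sup>2 * (\<tau> / 8))"
  proof -
   have "j\<^sup>2 - 1 \<le> 4 * (real i)\<^sup>2"
    unfolding j_def by (cases i) (auto simp: power2_eq_square algebra_simps)
   then have "(j\<^sup>2 - 1) * (\<tau> / 8) \<le> (4 * (real i)\<^sup>2) * (\<tau> / 8)" using tau by (intro mult_right_mono) auto
   then show ?thesis unfolding exp_add[symmetric] using tau by (simp add: algebra_simps)
  qed
  finally have f: "\<bar>q i * sin (real i * y) - q (i + 2) * sin (real (i + 2) * y)\<bar>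
   \<le> 20 * sin y * j * (exp (T / 8) * exp (- j\<^sup>2 * (\<tau> / 8)))"
   using s by (auto simp: j_def mult_left_mono)
  have "\<bar>\<alpha> i\<bar> = \<bar>q i * sin (real i * y) - q (i + 2) * sin (real (i + 2) * y)\<bar> * (1 / pi / sqrt (2 / pi))"
   unfolding \<alpha>_def Q_def by (simp add: abs_mult abs_divide algebra_simps flip: diff_divide_distrib)
  also have "\<dots> \<le> \<bar>q i * sin (real i * y) - q (i + 2) * sin (real (i + 2) * y)\<bar> * 1"
  proof (intro mult_left_mono)
   have "1 / pi = sqrt (2 / pi) * sqrt (2 / pi) / 2" using sqrt_2_pi(3) by simp
   then have "1 / pi / sqrt (2 / pi) = sqrt (2 / pi) / 2"
    using sqrt_2_pi(1) by (metis nonzero_mult_div_cancel_left order_less_irrefl times_divide_eq_right)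
   then show "1 / pi / sqrt (2 / pi) \<le> 1" using sqrt_2_pi(2) by linarith
  qed auto
  finally have "\<bar>\<alpha> i\<bar> \<le> \<bar>q i * sin (real i * y) - q (i + 2) * sin (real (i + 2) * y)\<bar>" by simp
  note order_trans[OF this f]
  also have "20 * sin y * j * (exp (T / 8) * exp (- j\<^sup>2 * (\<tau> / 8))) =
   (20 * exp (T / 8) * sin y) * j powr 1 * exp (- j\<^sup>2 * (\<tau> / 8))"
   unfolding j_def by (simp only: powr_one of_nat_0_le_iff mult_ac)
  finally show ?thesis unfolding j_def .
 qed
 have eq: "sin x * heatKx T \<tau> x y = (\<Sum>i. \<alpha> i * smode i x)" for x
 proof -
  define f where "f i = Q i * sin (real (i + 1) * x)" for i
  define g where "g i = Q (i + 1) * sin (real i * x)" for i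
  have fg0: "f 0 = 0" "g 0 = 0" by (simp_all add: f_def g_def Q_def q_def)
  have Qs: "summable (\<lambda>k. \<bar>Q (Suc k)\<bar>)"
  proof -
   have "\<bar>Q (Suc k)\<bar> \<le> 1 * real (Suc k) powr 1 * decay k \<tau>" for k
   proof -
    have "\<bar>Q (Suc k)\<bar> = (1 / pi * \<bar>sin (real (Suc k) * y)\<bar>) * q (Suc k)"
     unfolding Q_def using q0 by (simp add: abs_mult)
    also have "\<dots> \<le> (1 * 1) * q (Suc k)"
     using q0 pi_gt3 by (intro mult_right_mono mult_mono) auto
    finally show ?thesis unfolding q_def by simp
   qed
   from summable_decay_bound[OF tau(1) _ this] show ?thesis by simp
  qed
  have sQ: "summable (\<lambda>k. Q (Suc k) * sin (a k))" for a
   by (rule summable_comparison_test'[OF Qs, of 0])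
    (use mult_left_mono[OF abs_sin_le_one] in \<open>auto simp: abs_mult\<close>)
  have sf1: "summable (\<lambda>k. f (Suc k))" unfolding f_def by (rule sQ)
  have sf: "summable f" using sf1 by (simp only: summable_Suc_iff)
  have sg: "summable g" unfolding g_def by (simp only: add.commute[of _ 1] plus_1_eq_Suc) (rule sQ)
  have sg1: "summable (\<lambda>k. g (Suc k))" using sg by (simp only: summable_Suc_iff)
  have "sin x * heatKx T \<tau> x y = (\<Sum>k. sin x * (decay k \<tau> * (real (Suc k) * cmode k x) * smode k y))"
   unfolding heatKx_def using tau
   by (simp only: if_True simp_thms suminf_mult[OF summable_heat_terms(2)[OF tau(1)]])
  also have "\<dots> = (\<Sum>k. f (Suc k) - g k)"
  proof (rule suminf_cong)
   fix k
   have a: "sin x * cos (real (Suc k) * x) = (sin (real (Suc (Suc k)) * x) - sin (real k * x)) / 2"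
   proof -
    have "real (Suc (Suc k)) * x = real (Suc k) * x + x" "real k * x = real (Suc k) * x - x" by (simp_all add: algebra_simps)
    note r = this
    show ?thesis unfolding r sin_add sin_diff by simp
   qed
   have "sin x * (decay k \<tau> * (real (Suc k) * cmode k x) * smode k y)
    = (sqrt (2 / pi) * sqrt (2 / pi)) * q (Suc k) * sin (real (Suc k) * y) * (sin x * cos (real (Suc k) * x))"
    unfolding neumann_mode_def dirichlet_mode_def q_def by (simp only: mult_ac)
   also have "\<dots> = Q (Suc k) * sin (real (Suc (Suc k)) * x) - Q (Suc k) * sin (real k * x)"
    unfolding sqrt_2_pi(3) a Q_def by (simp add: field_simps)
   finally show "sin x * (decay k \<tau> * (real (Suc k) * cmode k x) * smode k y)
    = f (Suc k) - g k" unfolding f_def g_def by simp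
  qed
  also have "\<dots> = (\<Sum>k. f (Suc k)) - (\<Sum>k. g k)" by (rule suminf_diff[OF sf1 sg, symmetric])
  also have "(\<Sum>k. f (Suc k)) = (\<Sum>k. f k)"
   using suminf_split_head[OF sf] fg0(1) by simp
  also have "(\<Sum>k. g k) = (\<Sum>k. g (Suc k))"
   using suminf_split_head[OF sg] fg0(2) by simp
  also have "(\<Sum>k. f k) - (\<Sum>k. g (Suc k)) = (\<Sum>k. f k - g (Suc k))" by (rule suminf_diff[OF sf sg1])
  also have "\<dots> = (\<Sum>i. \<alpha> i * smode i x)"
  proof (rule suminf_cong)
   fix i
   have "\<alpha> i * smode i x = (\<alpha> i * sqrt (2 / pi)) * sin (real (Suc i) * x)"
    unfolding dirichlet_mode_def by simp
   also have "\<alpha> i * sqrt (2 / pi) = Q i - Q (i + 2)" unfolding \<alpha>_def using sqrt_2_pi(1) by simp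
   finally show "f i - g (Suc i) = \<alpha> i * smode i x"
    unfolding f_def g_def by (simp add: left_diff_distrib)
  qed
  finally show ?thesis .
 qed
 have "(NN x. ennreal (sin x * \<bar>heatKx T \<tau> x y\<bar>) * ind_I x)
  = (NN x. ennreal \<bar>\<Sum>i. \<alpha> i * smode i x\<bar> * ind_I x)"
  unfolding eq[symmetric]
  by (intro nn_integral_cong) (auto simp: indicator_def abs_mult abs_of_pos sin_gt_zero)
 also have "\<dots> \<le> ennreal (decay_const 1 * (20 * exp (T / 8) * sin y) * (\<tau> / 8) powr (- (2 * 1 + 1) / 4))"
  using s tau by (intro sine_series_L1 bound) auto
 also have "\<dots> \<le> ennreal (160 * exp (T / 8) * decay_const 1 * sin y * \<tau> powr (- 3 / 4))"
 proof (rule ennreal_leI)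
  have "(\<tau> / 8) powr (- 3 / 4) = 8 powr (3 / 4) * \<tau> powr (- 3 / 4)"
   using tau by (simp add: powr_divide powr_minus field_simps)
  also have "\<dots> \<le> 8 powr 1 * \<tau> powr (- 3 / 4)" by (intro mult_right_mono powr_mono) auto
  finally have "(\<tau> / 8) powr (- 3 / 4) \<le> 8 * \<tau> powr (- 3 / 4)" by simp
  then have "decay_const 1 * (20 * exp (T / 8) * sin y) * (\<tau> / 8) powr (- 3 / 4)
   \<le> decay_const 1 * (20 * exp (T / 8) * sin y) * (8 * \<tau> powr (- 3 / 4))"
   using s decay_const_pos[of 1] by (intro mult_left_mono) auto
  then show "decay_const 1 * (20 * exp (T / 8) * sin y) * (\<tau> / 8) powr (- (2 * 1 + 1) / 4)
   \<le> 160 * exp (T / 8) * decay_const 1 * sin y * \<tau> powr (- 3 / 4)" by (simp add: mult_ac)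
 qed
 finally show ?thesis .
qed

text \<open>Interpolation between a trivial bound and a Lipschitz bound; all Hoelder estimates of the kernel come from here.\<close>

lemma min_1_le_powr:
 fixes z a :: real
 assumes "0 \<le> z" "0 \<le> a" "a \<le> 1"
 shows "min 1 z \<le> z powr a"
proof (cases "z = 0 \<or> 1 \<le> z")
 case True
 then show ?thesis using assms by (auto simp: ge_one_powr_ge_zero)
next
 case False
 then have "z powr 1 \<le> z powr a" using assms by (intro powr_mono') auto
 then show ?thesis using False assms by simp
qed

lemma neumann_mode_diff:
 assumes "0 \<le> a" "a \<le> 1"
 shows "\<bar>neumann_mode k x - neumann_mode k x'\<bar> \<le> 2 * (real k * \<bar>x - x'\<bar>) powr a"
proof -
 have "\<bar>neumann_mode k x - neumann_mode k x'\<bar> \<le> 2"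
  using abs_mode_le(2)[of k x] abs_mode_le(2)[of k x'] by linarith
 moreover have "\<bar>neumann_mode k x - neumann_mode k x'\<bar> \<le> real k * \<bar>x - x'\<bar>"
 proof -
  have "norm (neumann_mode k x - neumann_mode k x') \<le> real k * norm (x - x')"
  proof (rule field_differentiable_bound[of UNIV _ "\<lambda>x. - real k * dirichlet_mode k x"])
   fix z
   show "norm (- real k * dirichlet_mode k z) \<le> real k"
    using mult_left_mono[OF abs_mode_le(1)[of k z], of "real k"] by (simp add: abs_mult)
   show "(neumann_mode k has_real_derivative - real k * dirichlet_mode k z) (at z within UNIV)"
    using DERIV_modes(2) by simp
  qed auto
  then show ?thesis by simp
 qed
 ultimately have "\<bar>neumann_mode k x - neumann_mode k x'\<bar> \<le> 2 * min 1 (real k * \<bar>x - x'\<bar>)" by auto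
 also have "\<dots> \<le> 2 * (real k * \<bar>x - x'\<bar>) powr a" using min_1_le_powr[of _ a] assms by simp
 finally show ?thesis .
qed

lemma heatKx_space_diff:
 assumes tau: "0 < \<tau>" "\<tau> < T" and a: "0 \<le> a" "a \<le> 1"
 shows "(NN y. ennreal \<bar>heatKx T \<tau> x y - heatKx T \<tau> x' y\<bar> * ind_I y)
  \<le> ennreal (decay_const (1 + a) * (2 * \<bar>x - x'\<bar> powr a) * \<tau> powr (- (2 * (1 + a) + 1) / 4))"
proof -
 have e: "heatKx T \<tau> x y - heatKx T \<tau> x' y =
   (\<Sum>k. decay k \<tau> * (real (Suc k) * (cmode k x - cmode k x')) * smode k y)" for y
  unfolding heatKx_def using tau
  by (simp only: if_True simp_thms suminf_diff[OF summable_heat_terms(2)[OF tau(1)] summable_heat_terms(2)[OF tau(1)]])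
   (simp add: algebra_simps)
 have "\<bar>real (Suc k) * (cmode k x - cmode k x')\<bar> \<le> (2 * \<bar>x - x'\<bar> powr a) * real (Suc k) powr (1 + a)" for k
 proof -
  have "\<bar>real (Suc k) * (cmode k x - cmode k x')\<bar>
   \<le> real (Suc k) * (2 * (real (Suc k) * \<bar>x - x'\<bar>) powr a)"
   unfolding abs_mult using neumann_mode_diff[OF a, of "Suc k" x x'] by (intro mult_mono) auto
  also have "\<dots> = (2 * \<bar>x - x'\<bar> powr a) * real (Suc k) powr (1 + a)"
   by (subst powr_mult) (auto simp: powr_add)
  finally show ?thesis .
 qed
 from kernel_L1[OF tau(1) _ _ this] show ?thesis unfolding e using a by simp
qed

lemma heat_time_coeff:
 assumes a: "0 \<le> a" "a \<le> 1" and h: "0 \<le> h" and X: "\<bar>X\<bar> \<le> real (Suc k) powr p"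
 shows "\<bar>(1 - decay k h) * X\<bar> \<le> h powr a * real (Suc k) powr (p + 2 * a)"
proof -
 have "1 - decay k h \<le> min 1 ((real (Suc k))\<^sup>2 * h)"
  using exp_ge_add_one_self[of "- (real (Suc k))\<^sup>2 * h"] by auto
 also have "\<dots> \<le> ((real (Suc k))\<^sup>2 * h) powr a" using a h by (intro min_1_le_powr) auto
 also have "\<dots> = h powr a * real (Suc k) powr (2 * a)"
  using h by (subst powr_mult) (auto simp: powr_powr mult.commute simp flip: powr_numeral)
 finally have "\<bar>1 - decay k h\<bar> \<le> h powr a * real (Suc k) powr (2 * a)"
  using h by simp
 then have "\<bar>(1 - decay k h) * X\<bar> \<le> (h powr a * real (Suc k) powr (2 * a)) * real (Suc k) powr p"
  unfolding abs_mult using X by (intro mult_mono) auto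
 then show ?thesis by (simp add: powr_add mult_ac)
qed

lemma heatK_time_diff:
 assumes tau: "0 < \<tau>" "0 \<le> h" "\<tau> + h < T" and a: "0 \<le> a" "a \<le> 1"
 shows "(NN y. ennreal \<bar>heatK T (\<tau> + h) x y - heatK T \<tau> x y\<bar> * ind_I y)
   \<le> ennreal (decay_const (2 * a) * h powr a * \<tau> powr (- (4 * a + 1) / 4))"
  "(NN y. ennreal \<bar>heatKx T (\<tau> + h) x y - heatKx T \<tau> x y\<bar> * ind_I y)
   \<le> ennreal (decay_const (1 + 2 * a) * h powr a * \<tau> powr (- (4 * a + 3) / 4))"
proof -
 have t: "0 < \<tau> + h" "\<tau> < T" using tau by auto
 have ex: "decay k (\<tau> + h) = decay k \<tau> * decay k h" for k
  unfolding exp_add[symmetric] by (simp add: algebra_simps)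
 have e1': "heatK T \<tau> x y - heatK T (\<tau> + h) x y =
   (\<Sum>k. decay k \<tau> * ((1 - decay k h) * smode k x) * smode k y)" for y
  unfolding heatK_def using tau t
  by (simp only: if_True simp_thms suminf_diff[OF summable_heat_terms(1)[OF tau(1)] summable_heat_terms(1)[OF t(1)]])
   (rule suminf_cong, simp only: ex, algebra)
 have e2': "heatKx T \<tau> x y - heatKx T (\<tau> + h) x y =
   (\<Sum>k. decay k \<tau> * ((1 - decay k h) * (real (Suc k) * cmode k x)) * smode k y)" for y
  unfolding heatKx_def using tau t
  by (simp only: if_True simp_thms suminf_diff[OF summable_heat_terms(2)[OF tau(1)] summable_heat_terms(2)[OF t(1)]])
   (rule suminf_cong, simp only: ex, algebra)
 have e1: "\<bar>heatK T (\<tau> + h) x y - heatK T \<tau> x y\<bar> = \<bar>heatK T \<tau> x y - heatK T (\<tau> + h) x y\<bar>"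
  and e2: "\<bar>heatKx T (\<tau> + h) x y - heatKx T \<tau> x y\<bar> = \<bar>heatKx T \<tau> x y - heatKx T (\<tau> + h) x y\<bar>" for y
  by (rule abs_minus_commute)+
 have "\<bar>(1 - decay k h) * smode k x\<bar> \<le> h powr a * real (Suc k) powr (2 * a)" for k
  using heat_time_coeff[OF a tau(2), of "smode k x" k 0] abs_mode_le(1) by simp
 from kernel_L1[OF tau(1) _ _ this] show "(NN y. ennreal \<bar>heatK T (\<tau> + h) x y - heatK T \<tau> x y\<bar> * ind_I y)
   \<le> ennreal (decay_const (2 * a) * h powr a * \<tau> powr (- (4 * a + 1) / 4))"
  unfolding e1 e1' using a by simp
 have "\<bar>(1 - decay k h) * (real (Suc k) * cmode k x)\<bar> \<le> h powr a * real (Suc k) powr (1 + 2 * a)" for k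
  by (rule heat_time_coeff[OF a tau(2)]) (use abs_mult_mode_le(2)[of "real (Suc k)" "real (Suc k)"] in simp)
 from kernel_L1[OF tau(1) _ _ this] show "(NN y. ennreal \<bar>heatKx T (\<tau> + h) x y - heatKx T \<tau> x y\<bar> * ind_I y)
   \<le> ennreal (decay_const (1 + 2 * a) * h powr a * \<tau> powr (- (4 * a + 3) / 4))"
  unfolding e2 e2' using a by (simp add: algebra_simps)
qed

lemma dirichlet_heat_kernel_eq:
 assumes "0 < \<tau>" "\<tau> < T"
 shows "dirichlet_heat_kernel \<tau> x y = heatK T \<tau> x y" "dirichlet_heat_kernel_y \<tau> x y = heatKx T \<tau> y x"
proof -
 show e: "dirichlet_heat_kernel \<tau> x y = heatK T \<tau> x y" for x y
  using assms unfolding dirichlet_heat_kernel_def heatK_def by simp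
 have "\<bar>real (Suc k) * smode k x\<bar> \<le> 1 * real (Suc k) powr 1" for k
  using abs_mult_mode_le(1)[of "real (Suc k)" "real (Suc k)" "Suc k" x] by simp
 from summable_decay_exp(1)[OF assms(1) _ this]
 have "summable (\<lambda>k. real (Suc k) * \<bar>decay k \<tau> * smode k x\<bar>)"
  by (simp add: abs_mult mult_ac)
 from DERIV_dirichlet_series[OF this, of y]
 have "((\<lambda>y. heatK T \<tau> x y) has_real_derivative heatKx T \<tau> y x) (at y)"
  using assms unfolding heatK_def heatKx_def by (simp add: mult_ac)
 then show "dirichlet_heat_kernel_y \<tau> x y = heatKx T \<tau> y x"
  unfolding dirichlet_heat_kernel_y_def e by (rule DERIV_imp_deriv)
qed

lemma DERIV_heatK:
 assumes "0 < \<tau>" "\<tau> < T"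
 shows "((\<lambda>x. heatK T \<tau> x y) has_real_derivative heatKx T \<tau> x y) (at x)"
proof -
 have "\<bar>real (Suc k) * smode k y\<bar> \<le> 1 * real (Suc k) powr 1" for k
  using abs_mult_mode_le(1)[of "real (Suc k)" "real (Suc k)" "Suc k" y] by simp
 from summable_decay_exp(1)[OF assms(1) _ this]
 have "summable (\<lambda>k. real (Suc k) * \<bar>decay k \<tau> * smode k y\<bar>)"
  by (simp add: abs_mult mult_ac)
 from DERIV_dirichlet_series[OF this, of x]
 show ?thesis using assms unfolding heatK_def heatKx_def by (simp add: mult_ac)
qed

section \<open>Duhamel integrals with a singular kernel\<close>

text \<open>The truncated Abel kernel, the model for all time singularities.\<close>

definition abel :: "real \<Rightarrow> real \<Rightarrow> real \<Rightarrow> real" where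
 "abel T \<theta> \<tau> = (if 0 < \<tau> \<and> \<tau> < T then \<tau> powr (- \<theta>) else 0)"

lemma abel_nonneg: "0 \<le> abel T \<theta> \<tau>"
 unfolding abel_def by simp

lemma measurable_abel [measurable]: "abel T \<theta> \<in> borel_fun"
 unfolding abel_def[abs_def] by measurable

lemma nn_integral_abel:
 assumes "0 < T" "\<theta> < 1"
 shows "(NN \<tau>. ennreal (abel T \<theta> \<tau>)) = ennreal (T powr (1 - \<theta>) / (1 - \<theta>))"
proof (rule nn_integral_has_integral_lborel)
 have "((\<lambda>\<tau>. \<tau> powr (- \<theta>)) has_integral (T powr (- \<theta> + 1) / (- \<theta> + 1))) {0..T}"
  using assms by (intro has_integral_powr_from_0) auto
 then have "((\<lambda>\<tau>. \<tau> powr (- \<theta>)) has_integral (T powr (1 - \<theta>) / (1 - \<theta>))) {0<..<T}"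
  by (simp add: has_integral_Icc_iff_Ioo add.commute)
 then have "((\<lambda>\<tau>. if \<tau> \<in> {0<..<T} then \<tau> powr (- \<theta>) else 0) has_integral (T powr (1 - \<theta>) / (1 - \<theta>))) UNIV"
  by (subst has_integral_restrict_UNIV)
 then show "(abel T \<theta> has_integral (T powr (1 - \<theta>) / (1 - \<theta>))) UNIV"
  unfolding abel_def[abs_def] by simp
qed (auto simp: abel_nonneg)

lemma nn_integral_abel_reflect:
 assumes "0 < T" "\<theta> < 1"
 shows "(NN s. ennreal (abel T \<theta> (t - s))) = ennreal (T powr (1 - \<theta>) / (1 - \<theta>))"
proof -
 have "(NN \<tau>. ennreal (abel T \<theta> \<tau>)) = (NN s. ennreal (abel T \<theta> (t - s)))"
  using nn_integral_real_affine[of "\<lambda>\<tau>. ennreal (abel T \<theta> \<tau>)" "-1" t] by simp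
 then show ?thesis using nn_integral_abel[OF assms] by simp
qed

text \<open>Exponential discounting makes the Abel kernel small in \<open>L\<^sup>1\<close>; one eighth of a power of \<open>\<tau>\<close> is traded for the decay in \<open>lam\<close>.\<close>

lemma abel_discount:
 assumes T: "0 < T" and lam: "0 < lam"
 shows "(NN \<tau>. ennreal (exp (- lam * \<tau>) * abel T (3/4) \<tau>)) \<le> ennreal (lam powr (- 1 / 8) * (8 * T powr (1 / 8)))"
proof -
 have "(NN \<tau>. ennreal (exp (- lam * \<tau>) * abel T (3/4) \<tau>))
   \<le> (NN \<tau>. ennreal (lam powr (- 1 / 8)) * ennreal (abel T (7/8) \<tau>))"
 proof (rule nn_integral_mono)
  fix \<tau>
  have "exp (- lam * \<tau>) * abel T (3/4) \<tau> \<le> lam powr (- 1 / 8) * abel T (7/8) \<tau>"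
  proof (cases "0 < \<tau> \<and> \<tau> < T")
   case True
   define z where "z = lam * \<tau>"
   have z: "z > 0" using True lam unfolding z_def by simp
   have "z \<le> exp z" using exp_ge_add_one_self[of z] by linarith
   then have "z powr (1/8) \<le> exp z powr (1/8)" using z by (intro powr_mono2) auto
   also have "\<dots> = exp (z / 8)" by (simp add: powr_def)
   also have "\<dots> \<le> exp z" using z by simp
   finally have "exp (- z) \<le> z powr (- (1 / 8))"
    using z by (simp add: exp_minus powr_minus le_imp_inverse_le)
   then have "exp (- lam * \<tau>) * \<tau> powr (- (3/4)) \<le> (lam * \<tau>) powr (- (1 / 8)) * \<tau> powr (- (3/4))"
    unfolding z_def by (intro mult_right_mono) auto
   also have "\<dots> = lam powr (- 1 / 8) * \<tau> powr (- (7/8))"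
    using True lam by (simp add: powr_mult flip: powr_add)
   finally show ?thesis unfolding abel_def using True by simp
  qed (auto simp: abel_def)
  then show "ennreal (exp (- lam * \<tau>) * abel T (3/4) \<tau>) \<le> ennreal (lam powr (- 1 / 8)) * ennreal (abel T (7/8) \<tau>)"
   by (simp add: ennreal_leI flip: ennreal_mult')
 qed
 also have "\<dots> = ennreal (lam powr (- 1 / 8)) * ennreal (T powr (1 - 7/8) / (1 - 7/8))"
  by (subst nn_integral_cmult) (use T in \<open>auto simp: nn_integral_abel\<close>)
 also have "\<dots> = ennreal (lam powr (- 1 / 8) * (8 * T powr (1 / 8)))"
  by (simp add: mult.commute flip: ennreal_mult')
 finally show ?thesis .
qed

lemma measurable_fst_snd_borel [measurable]:
 "(fst :: real \<times> real \<Rightarrow> real) \<in> borel_fun" "(snd :: real \<times> real \<Rightarrow> real) \<in> borel_fun"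
 by (intro borel_measurable_continuous_onI continuous_intros)+

lemma measurable_uncurried3:
 fixes k :: "real \<Rightarrow> real \<Rightarrow> real \<Rightarrow> 'r::topological_space"
 assumes km: "(\<lambda>(\<tau>, x, y). k \<tau> x y) \<in> borel_fun"
  and [measurable]: "f \<in> borel_measurable M" "g \<in> borel_measurable M" "h \<in> borel_measurable M"
 shows "(\<lambda>w. k (f w) (g w) (h w)) \<in> borel_measurable M"
proof -
 have "(\<lambda>w. (f w, g w, h w)) \<in> M \<rightarrow>\<^sub>M borel"
  unfolding borel_prod[symmetric] by measurable
 from measurable_compose[OF this km] show ?thesis by simp
qed

text \<open>A Duhamel operator with a discount factor is bounded on weighted \<open>L\<^sup>1\<close> by the discounted norm of its kernel.\<close>

lemma nn_duhamel_tonelli: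
 fixes k :: "real \<Rightarrow> real \<Rightarrow> real \<Rightarrow> ennreal" and h :: "real \<times> real \<Rightarrow> ennreal"
 assumes km: "(\<lambda>(\<tau>, x, y). k \<tau> x y) \<in> borel_fun"
  and [measurable]: "p \<in> borel_fun" "q \<in> borel_fun" "\<beta> \<in> borel_fun"
   "h \<in> borel_fun"
  and supp: "\<And>z. snd z \<notin> Ipi \<Longrightarrow> h z = 0"
  and kb: "\<And>\<tau> y. y \<in> Ipi \<Longrightarrow> (NN x. p x * k \<tau> x y) \<le> q y * \<beta> \<tau>"
 shows "(NN t. NN x. ennreal (exp (- lam * t)) * (p x * (NN z. k (t - fst z) x (snd z) * h z)))
  \<le> (NN \<tau>. ennreal (exp (- lam * \<tau>)) * \<beta> \<tau>) * (NN z. ennreal (exp (- lam * fst z)) * (q (snd z) * h z))"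
proof -
 note [measurable (raw)] = measurable_uncurried3[OF km]
 let ?e = "\<lambda>t. ennreal (exp (- lam * t))"
 have "(NN t. NN x. ?e t * (p x * (NN z. k (t - fst z) x (snd z) * h z)))
  \<le> (NN t. NN z. ?e t * (\<beta> (t - fst z) * (q (snd z) * h z)))"
 proof (rule nn_integral_mono)
  fix t
  have "(NN x. ?e t * (p x * (NN z. k (t - fst z) x (snd z) * h z)))
   = (NN x. NN z. ?e t * (p x * (k (t - fst z) x (snd z) * h z)))"
  proof (rule nn_integral_cong)
   fix x
   have "(NN z. ?e t * (p x * (k (t - fst z) x (snd z) * h z)))
    = (NN z. (?e t * p x) * (k (t - fst z) x (snd z) * h z))" by (simp only: mult.assoc)
   also have "\<dots> = (?e t * p x) * (NN z. k (t - fst z) x (snd z) * h z)"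
    by (rule nn_integral_cmult) measurable
   finally show "?e t * (p x * (NN z. k (t - fst z) x (snd z) * h z))
    = (NN z. ?e t * (p x * (k (t - fst z) x (snd z) * h z)))" by (simp only: mult.assoc)
  qed
  also have "\<dots> = (NN z. NN x. ?e t * (p x * (k (t - fst z) x (snd z) * h z)))"
   by (rule lborel_pair.Fubini'[symmetric]) measurable
  also have "\<dots> \<le> (NN z. ?e t * (\<beta> (t - fst z) * (q (snd z) * h z)))"
  proof (rule nn_integral_mono)
   fix z :: "real \<times> real"
   have "(NN x. ?e t * (p x * (k (t - fst z) x (snd z) * h z)))
    = ?e t * ((NN x. p x * k (t - fst z) x (snd z)) * h z)"
   proof -
    have "(NN x. ?e t * (p x * (k (t - fst z) x (snd z) * h z)))
     = (NN x. (?e t * h z) * (p x * k (t - fst z) x (snd z)))" by (simp add: mult_ac)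
    also have "\<dots> = (?e t * h z) * (NN x. p x * k (t - fst z) x (snd z))"
     by (rule nn_integral_cmult) measurable
    finally show ?thesis by (simp add: mult_ac)
   qed
   also have "\<dots> \<le> ?e t * ((q (snd z) * \<beta> (t - fst z)) * h z)"
   proof (cases "snd z \<in> Ipi")
    case True
    show ?thesis by (intro mult_left_mono mult_right_mono kb True) auto
   next
    case False
    then show ?thesis using supp by simp
   qed
   finally show "(NN x. ?e t * (p x * (k (t - fst z) x (snd z) * h z)))
    \<le> ?e t * (\<beta> (t - fst z) * (q (snd z) * h z))" by (simp add: mult_ac)
  qed
  finally show "(NN x. ?e t * (p x * (NN z. k (t - fst z) x (snd z) * h z)))
   \<le> (NN z. ?e t * (\<beta> (t - fst z) * (q (snd z) * h z)))" .
 qed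
 also have "\<dots> = (NN z. NN t. ?e t * (\<beta> (t - fst z) * (q (snd z) * h z)))"
  by (rule lborel_pair.Fubini'[symmetric]) measurable
 also have "\<dots> = (NN z. (NN \<tau>. ?e \<tau> * \<beta> \<tau>) * (?e (fst z) * (q (snd z) * h z)))"
 proof (rule nn_integral_cong)
  fix z :: "real \<times> real"
  have "(NN t. ?e t * (\<beta> (t - fst z) * (q (snd z) * h z)))
   = (NN t. (?e t * \<beta> (t - fst z)) * (q (snd z) * h z))" by (simp add: mult_ac)
  also have "\<dots> = (NN t. ?e t * \<beta> (t - fst z)) * (q (snd z) * h z)"
   by (rule nn_integral_multc) measurable
  also have "(NN t. ?e t * \<beta> (t - fst z)) = (NN \<tau>. ?e (fst z + 1 * \<tau>) * \<beta> (fst z + 1 * \<tau> - fst z))"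
   by (subst nn_integral_real_affine[of _ 1 "fst z"]) auto
  also have "\<dots> = (NN \<tau>. ?e (fst z) * (?e \<tau> * \<beta> \<tau>))"
  proof (intro nn_integral_cong)
   fix \<tau>
   have "?e (fst z + 1 * \<tau>) = ?e (fst z) * ?e \<tau>"
    unfolding ennreal_mult'[symmetric, OF exp_ge_zero] exp_add[symmetric] by (simp add: algebra_simps)
   then show "?e (fst z + 1 * \<tau>) * \<beta> (fst z + 1 * \<tau> - fst z) = ?e (fst z) * (?e \<tau> * \<beta> \<tau>)"
    by (simp add: mult.assoc)
  qed
  also have "\<dots> = ?e (fst z) * (NN \<tau>. ?e \<tau> * \<beta> \<tau>)"
   by (rule nn_integral_cmult) measurable
  finally show "(NN t. ?e t * (\<beta> (t - fst z) * (q (snd z) * h z)))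
   = (NN \<tau>. ?e \<tau> * \<beta> \<tau>) * (?e (fst z) * (q (snd z) * h z))" by (simp add: mult_ac)
 qed
 also have "\<dots> = (NN \<tau>. ?e \<tau> * \<beta> \<tau>) * (NN z. ?e (fst z) * (q (snd z) * h z))"
  by (rule nn_integral_cmult) measurable
 finally show ?thesis .
qed

text \<open>For data that are only integrable with weight \<open>q\<close>, the Duhamel integral still exists for almost every time.\<close>

lemma duhamel_AE:
 fixes k :: "real \<Rightarrow> real \<Rightarrow> real \<Rightarrow> real" and h :: "real \<times> real \<Rightarrow> real"
 assumes T: "0 < T"
  and km: "(\<lambda>(\<tau>, x, y). k \<tau> x y) \<in> borel_fun"
  and pm [measurable]: "p \<in> borel_fun" and qm [measurable]: "q \<in> borel_fun"
  and hm [measurable]: "h \<in> borel_fun"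
  and supp: "\<And>z. snd z \<notin> Ipi \<Longrightarrow> h z = 0"
  and q: "\<And>y. y \<in> Ipi \<Longrightarrow> 0 \<le> q y"
  and kb: "\<And>\<tau> y. y \<in> Ipi \<Longrightarrow> (NN x. ennreal \<bar>p x * k \<tau> x y\<bar>) \<le> ennreal (q y * abel T (3/4) \<tau>)"
  and qh: "integrable lborel (\<lambda>z. q (snd z) * h z)"
 shows "(NN t. NN x. (NN z. ennreal \<bar>p x * k (t - fst z) x (snd z) * h z\<bar>)) < \<infinity>"
  "AE t in lborel. integrable (lborel2) (\<lambda>(x, z). p x * k (t - fst z) x (snd z) * h z)"
proof -
 note km' [measurable (raw)] = measurable_uncurried3[OF km]
 have "(NN t. NN x. (NN z. ennreal \<bar>p x * k (t - fst z) x (snd z) * h z\<bar>))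
  = (NN t. NN x. ennreal (exp (- 0 * t)) * (ennreal \<bar>p x\<bar> * (NN z. ennreal \<bar>k (t - fst z) x (snd z)\<bar> * ennreal \<bar>h z\<bar>)))"
 proof (intro nn_integral_cong)
  fix t x
  have "(NN z. ennreal \<bar>p x * k (t - fst z) x (snd z) * h z\<bar>)
   = (NN z. ennreal \<bar>p x\<bar> * (ennreal \<bar>k (t - fst z) x (snd z)\<bar> * ennreal \<bar>h z\<bar>))"
   by (simp add: abs_mult ennreal_mult' mult.assoc)
  also have "\<dots> = ennreal \<bar>p x\<bar> * (NN z. ennreal \<bar>k (t - fst z) x (snd z)\<bar> * ennreal \<bar>h z\<bar>)"
   by (rule nn_integral_cmult) measurable
  finally show "(NN z. ennreal \<bar>p x * k (t - fst z) x (snd z) * h z\<bar>)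
   = ennreal (exp (- 0 * t)) * (ennreal \<bar>p x\<bar> * (NN z. ennreal \<bar>k (t - fst z) x (snd z)\<bar> * ennreal \<bar>h z\<bar>))"
   by simp
 qed
 also have "\<dots> \<le> (NN \<tau>. ennreal (exp (- 0 * \<tau>)) * ennreal (abel T (3/4) \<tau>))
   * (NN z. ennreal (exp (- 0 * fst z)) * (ennreal \<bar>q (snd z)\<bar> * ennreal \<bar>h z\<bar>))"
 proof (rule nn_duhamel_tonelli)
  show "(\<lambda>(\<tau>, x, y). ennreal \<bar>k \<tau> x y\<bar>) \<in> borel_fun"
   using km unfolding split_beta by measurable
  fix \<tau> y :: real assume y: "y \<in> Ipi"
  show "(NN x. ennreal \<bar>p x\<bar> * ennreal \<bar>k \<tau> x y\<bar>) \<le> ennreal \<bar>q y\<bar> * ennreal (abel T (3/4) \<tau>)"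
   using kb[OF y, of \<tau>] q[OF y] by (simp add: abs_mult ennreal_mult')
 qed (use supp in \<open>auto simp del: ennreal_mult\<close>)
 also have "\<dots> < \<infinity>"
 proof -
  have "(NN z. ennreal \<bar>q (snd z) * h z\<bar>) < \<infinity>"
   using qh unfolding integrable_iff_bounded by simp
  then show ?thesis using T
   by (simp add: nn_integral_abel abs_mult ennreal_mult' ennreal_mult_less_top)
 qed
 finally show fin: "(NN t. NN x. (NN z. ennreal \<bar>p x * k (t - fst z) x (snd z) * h z\<bar>)) < \<infinity>" .
 have "AE t in lborel. (NN x. (NN z. ennreal \<bar>p x * k (t - fst z) x (snd z) * h z\<bar>)) \<noteq> \<infinity>"
  by (rule nn_integral_PInf_AE) (use fin in auto)
 then show "AE t in lborel. integrable (lborel2) (\<lambda>(x, z). p x * k (t - fst z) x (snd z) * h z)"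
 proof eventually_elim
  case (elim t)
  have "(\<lambda>(x, z). p x * k (t - fst z) x (snd z) * h z) \<in> borel_measurable (lborel2)"
   unfolding split_beta by measurable
  moreover have "(\<integral>\<^sup>+w. ennreal (norm (case w of (x, z) \<Rightarrow> p x * k (t - fst z) x (snd z) * h z)) \<partial>(lborel2))
   = (NN x. (NN z. ennreal \<bar>p x * k (t - fst z) x (snd z) * h z\<bar>))"
   by (subst lborel.nn_integral_fst[symmetric]) auto
  ultimately show ?case using elim unfolding integrable_iff_bounded by (simp add: less_top)
 qed
qed

lemma duhamel_fubini:
 fixes k :: "real \<Rightarrow> real \<Rightarrow> real \<Rightarrow> real" and h :: "real \<times> real \<Rightarrow> real"
 assumes i: "integrable (lborel2) (\<lambda>(x, z). p x * k (t - fst z) x (snd z) * h z)"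
  and [measurable]: "\<zeta> \<in> borel_fun" and bd: "\<And>x. \<bar>\<zeta> x\<bar> \<le> (B::real)"
 shows "AE x in lborel. p x \<noteq> 0 \<longrightarrow> integrable lborel (\<lambda>z. k (t - fst z) x (snd z) * h z)"
  "integrable lborel (\<lambda>x. \<zeta> x * p x * (LB z. k (t - fst z) x (snd z) * h z))"
  "integrable lborel (\<lambda>z. (LB x. \<zeta> x * p x * k (t - fst z) x (snd z)) * h z)"
  "(LB x. \<zeta> x * p x * (LB z. k (t - fst z) x (snd z) * h z))
   = (LB z. (LB x. \<zeta> x * p x * k (t - fst z) x (snd z)) * h z)"
proof -
 have i2: "integrable (lborel2) (\<lambda>(x, z). \<zeta> x * p x * k (t - fst z) x (snd z) * h z)"
 proof (rule Bochner_Integration.integrable_bound[OF integrable_mult_right[OF i, of B]])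
  have e: "(\<lambda>(x, z). \<zeta> x * p x * k (t - fst z) x (snd z) * h z)
   = (\<lambda>w. \<zeta> (fst w) * (case w of (x, z) \<Rightarrow> p x * k (t - fst z) x (snd z) * h z))"
   by (auto simp: fun_eq_iff)
  show "(\<lambda>(x, z). \<zeta> x * p x * k (t - fst z) x (snd z) * h z) \<in> borel_measurable (lborel2)"
   unfolding e using borel_measurable_integrable[OF i] by measurable
  show "AE w in lborel2. norm (case w of (x, z) \<Rightarrow> \<zeta> x * p x * k (t - fst z) x (snd z) * h z)
   \<le> norm (B * (case w of (x, z) \<Rightarrow> p x * k (t - fst z) x (snd z) * h z))"
  proof (intro AE_I2)
   fix w :: "real \<times> real \<times> real"
   obtain x z where w: "w = (x, z)" by (cases w)
   have "\<bar>\<zeta> x\<bar> * \<bar>p x * k (t - fst z) x (snd z) * h z\<bar> \<le> \<bar>B\<bar> * \<bar>p x * k (t - fst z) x (snd z) * h z\<bar>"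
    using bd[of x] by (intro mult_right_mono) auto
   then show "norm (case w of (x, z) \<Rightarrow> \<zeta> x * p x * k (t - fst z) x (snd z) * h z)
   \<le> norm (B * (case w of (x, z) \<Rightarrow> p x * k (t - fst z) x (snd z) * h z))"
    unfolding w by (simp add: abs_mult mult.assoc)
  qed
 qed
 have "AE x in lborel. integrable lborel (\<lambda>z. p x * k (t - fst z) x (snd z) * h z)"
  using lborel_pair.AE_integrable_fst'[OF i] by simp
 then show "AE x in lborel. p x \<noteq> 0 \<longrightarrow> integrable lborel (\<lambda>z. k (t - fst z) x (snd z) * h z)"
  by eventually_elim (auto simp: mult.assoc)
 have e1: "(LB z. \<zeta> x * p x * k (t - fst z) x (snd z) * h z)
  = \<zeta> x * p x * (LB z. k (t - fst z) x (snd z) * h z)" for x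
  by (simp add: mult.assoc)
 have e2: "(LB x. \<zeta> x * p x * k (t - fst z) x (snd z) * h z)
  = (LB x. \<zeta> x * p x * k (t - fst z) x (snd z)) * h z" for z
  by simp
 show "integrable lborel (\<lambda>x. \<zeta> x * p x * (LB z. k (t - fst z) x (snd z) * h z))"
  using lborel_pair.integrable_fst'[OF i2] by (simp add: e1 mult.assoc)
 show "integrable lborel (\<lambda>z. (LB x. \<zeta> x * p x * k (t - fst z) x (snd z)) * h z)"
  using lborel_pair.integrable_snd[OF i2] by (simp only: e2)
 show "(LB x. \<zeta> x * p x * (LB z. k (t - fst z) x (snd z) * h z))
   = (LB z. (LB x. \<zeta> x * p x * k (t - fst z) x (snd z)) * h z)"
  using lborel_pair.Fubini_integral[OF i2] by (simp only: e1 e2)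
qed

text \<open>For bounded data the integral exists at every point and is bounded by the time integral of the kernel norms.\<close>

lemma duhamel_sup:
 fixes k :: "real \<Rightarrow> real \<Rightarrow> real" and F :: "real \<times> real \<Rightarrow> real"
 assumes T: "0 < T" and th: "\<theta> < 1" and C: "0 \<le> C" and M: "0 \<le> M"
  and km [measurable]: "(\<lambda>z. k (fst z) (snd z)) \<in> borel_fun"
  and Fm [measurable]: "F \<in> borel_fun"
  and supp: "\<And>z. snd z \<notin> Ipi \<Longrightarrow> F z = 0"
  and Fb: "\<And>z. \<bar>F z\<bar> \<le> M"
  and kb: "\<And>s. (NN y. ennreal \<bar>k s y\<bar> * ind_I y) \<le> ennreal (C * abel T \<theta> (t - s))"
 shows "integrable lborel (\<lambda>z. k (fst z) (snd z) * F z)"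
  "\<bar>LB z. k (fst z) (snd z) * F z\<bar> \<le> C * M * (T powr (1 - \<theta>) / (1 - \<theta>))"
proof -
 have "(NN z. ennreal (norm (k (fst z) (snd z) * F z)))
  \<le> (NN z. ennreal M * (ennreal \<bar>k (fst z) (snd z)\<bar> * ind_I (snd z)))"
 proof (rule nn_integral_mono)
  fix z
  show "ennreal (norm (k (fst z) (snd z) * F z)) \<le> ennreal M * (ennreal \<bar>k (fst z) (snd z)\<bar> * ind_I (snd z))"
  proof (cases "snd z \<in> Ipi")
   case True
   then show ?thesis using mult_left_mono[OF Fb[of z], of "\<bar>k (fst z) (snd z)\<bar>"] M
    by (simp add: abs_mult mult.commute ennreal_leI flip: ennreal_mult')
  qed (simp add: supp)
 qed
 also have "\<dots> = (\<integral>\<^sup>+z. ennreal M * (ennreal \<bar>k (fst z) (snd z)\<bar> * ind_I (snd z)) \<partial>(lborel2))"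
  by (simp add: lborel_prod)
 also have "\<dots> = (NN s. NN y. ennreal M * (ennreal \<bar>k s y\<bar> * ind_I y))"
 proof -
  have [measurable]: "(\<lambda>z. k (fst z) (snd z)) \<in> borel_measurable (lborel2)"
   using km by (simp add: lborel_prod)
  show ?thesis by (subst lborel.nn_integral_fst[symmetric]) auto
 qed
 also have "\<dots> \<le> (NN s. ennreal M * ennreal (C * abel T \<theta> (t - s)))"
 proof (rule nn_integral_mono)
  fix s
  have "(\<lambda>y. (s, y)) \<in> (borel :: real measure) \<rightarrow>\<^sub>M (borel :: (real \<times> real) measure)" by (intro borel_measurable_continuous_onI continuous_intros)
  from measurable_compose[OF this km] have [measurable]: "k s \<in> borel_fun" by simp
  have "(NN y. ennreal M * (ennreal \<bar>k s y\<bar> * ind_I y))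
   = ennreal M * (NN y. ennreal \<bar>k s y\<bar> * ind_I y)"
   by (rule nn_integral_cmult) measurable
  also have "\<dots> \<le> ennreal M * ennreal (C * abel T \<theta> (t - s))" by (intro mult_left_mono kb) auto
  finally show "(NN y. ennreal M * (ennreal \<bar>k s y\<bar> * ind_I y))
   \<le> ennreal M * ennreal (C * abel T \<theta> (t - s))" .
 qed
 also have "\<dots> = ennreal (C * M) * (NN s. ennreal (abel T \<theta> (t - s)))"
  using C M by (subst nn_integral_cmult[symmetric]) (auto simp: ennreal_mult' mult_ac)
 also have "\<dots> = ennreal (C * M * (T powr (1 - \<theta>) / (1 - \<theta>)))"
  using C M th unfolding nn_integral_abel_reflect[OF T th] by (intro ennreal_mult[symmetric]) auto
 finally have b: "(NN z. ennreal (norm (k (fst z) (snd z) * F z))) \<le> ennreal (C * M * (T powr (1 - \<theta>) / (1 - \<theta>)))" .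
 then show i: "integrable lborel (\<lambda>z. k (fst z) (snd z) * F z)"
  unfolding integrable_iff_bounded by (auto simp: le_less_trans)
 have "ennreal \<bar>LB z. k (fst z) (snd z) * F z\<bar> \<le> (NN z. ennreal (norm (k (fst z) (snd z) * F z)))"
  using integral_norm_bound_ennreal[OF i] by simp
 also note b
 finally show "\<bar>LB z. k (fst z) (snd z) * F z\<bar> \<le> C * M * (T powr (1 - \<theta>) / (1 - \<theta>))"
  using C M th by (subst (asm) ennreal_le_iff) auto
qed

lemma triangle_fubini:
 fixes K :: "real \<Rightarrow> real \<Rightarrow> real"
 assumes f: "integrable lborel f" and Km [measurable]: "(\<lambda>(s, r). K s r) \<in> borel_measurable (borel \<Otimes>\<^sub>M borel)"
  and K: "\<And>s r. 0 < r \<Longrightarrow> r < s \<Longrightarrow> s < t \<Longrightarrow> \<bar>K s r\<bar> \<le> B"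
  and c: "\<And>r. 0 < r \<Longrightarrow> r < t \<Longrightarrow> (LINT s:{r<..<t}|lborel. K s r) = c r"
 shows "set_integrable lborel {0<..<t} (\<lambda>s. LINT r:{0<..<s}|lborel. K s r * f r)"
  "(LINT s:{0<..<t}|lborel. LINT r:{0<..<s}|lborel. K s r * f r) = (LINT r:{0<..<t}|lborel. c r * f r)"
proof -
 have fm [measurable]: "f \<in> borel_fun" using borel_measurable_integrable[OF f] by simp
 have fa: "integrable lborel (\<lambda>r. \<bar>f r\<bar>)" using f by simp
 define G where "G = (\<lambda>s r. indicator {0<..<t} s * (indicator {0<..<s} r * (K s r * f r)) :: real)"
 have Ki [measurable]: "(\<lambda>w. K (fst w) (snd w)) \<in> borel_measurable (lborel2)"
  using Km by (simp add: split_beta' lborel_prod borel_prod)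
 have Gm: "(\<lambda>(s, r). G s r) \<in> borel_measurable (lborel2)"
  unfolding G_def split_beta' indicator_def of_bool_def greaterThanLessThan_iff by measurable
 have Gb: "\<bar>G s r\<bar> \<le> \<bar>B\<bar> * (indicator {0<..<t} s * \<bar>f r\<bar>)" for s r
 proof (cases "0 < r \<and> r < s \<and> s < t")
  case True
  then show ?thesis using mult_right_mono[OF order_trans[OF K abs_ge_self], of r s "\<bar>f r\<bar>"]
   unfolding G_def by (auto simp: abs_mult)
 qed (auto simp: G_def indicator_def)
 have i: "integrable (lborel2) (\<lambda>(s, r). G s r)"
 proof (rule integrableI_bounded[OF Gm])
  have "(\<integral>\<^sup>+w. ennreal (norm (case w of (s, r) \<Rightarrow> G s r)) \<partial>(lborel2))
   = (NN s. NN r. ennreal \<bar>G s r\<bar>)"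
   using Gm by (subst lborel.nn_integral_fst[symmetric]) auto
  also have "\<dots> \<le> (NN s. NN r. ennreal (\<bar>B\<bar> * indicator {0<..<t} s) * ennreal \<bar>f r\<bar>)"
   using Gb by (intro nn_integral_mono) (auto simp: ennreal_leI mult.assoc simp flip: ennreal_mult')
  also have "\<dots> = (NN s. ennreal \<bar>B\<bar> * indicator {0<..<t} s * (NN r. ennreal \<bar>f r\<bar>))"
   by (intro nn_integral_cong) (auto simp: nn_integral_cmult ennreal_mult' split: split_indicator)
  also have "\<dots> = ennreal \<bar>B\<bar> * emeasure lborel {0<..<t} * (NN r. ennreal \<bar>f r\<bar>)"
   by (simp add: nn_integral_multc nn_integral_cmult)
  also have "\<dots> < \<infinity>"
  proof -
   have "emeasure lborel {0<..<t} < \<infinity>" by (rule emeasure_bounded_finite) simp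
   then show ?thesis
    using fa unfolding integrable_iff_bounded by (simp add: ennreal_mult_less_top)
  qed
  finally show "(\<integral>\<^sup>+w. ennreal (norm (case w of (s, r) \<Rightarrow> G s r)) \<partial>(lborel2)) < \<infinity>" .
 qed
 have e1: "(LB r. G s r) = indicator {0<..<t} s *\<^sub>R (LINT r:{0<..<s}|lborel. K s r * f r)" for s
  unfolding G_def set_lebesgue_integral_def by simp
 have e2: "(LB s. G s r) = indicator {0<..<t} r *\<^sub>R (c r * f r)" for r
 proof (cases "0 < r \<and> r < t")
  case True
  have "(LB s. G s r) = (LB s. (indicator {r<..<t} s *\<^sub>R K s r) * f r)"
   using True by (intro Bochner_Integration.integral_cong) (auto simp: G_def indicator_def)
  then show ?thesis using True c[of r] unfolding set_lebesgue_integral_def by simp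
 next
  case False
  then have "G s r = 0" for s by (auto simp: G_def indicator_def)
  then show ?thesis using False by auto
 qed
 show "set_integrable lborel {0<..<t} (\<lambda>s. LINT r:{0<..<s}|lborel. K s r * f r)"
  using lborel_pair.integrable_fst[OF i] unfolding set_integrable_def e1 .
 show "(LINT s:{0<..<t}|lborel. LINT r:{0<..<s}|lborel. K s r * f r) = (LINT r:{0<..<t}|lborel. c r * f r)"
  using lborel_pair.Fubini_integral[OF i]
  unfolding set_lebesgue_integral_def[of _ "{0<..<t}"] e1[symmetric] e2[symmetric] by simp
qed

lemma integral_exp_decay:
 fixes r t lam :: real
 assumes "r \<le> t"
 shows "(LINT s:{r<..<t}|lborel. lam * exp (- lam * (s - r))) = 1 - exp (- lam * (t - r))"
  "(LINT s:{r<..<t}|lborel. lam * exp (- lam * (t - s))) = 1 - exp (- lam * (t - r))"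
proof -
 have "(LINT s:{r<..<t}|lborel. lam * exp (- lam * (s - r))) = (- exp (- lam * (t - r))) - (- exp (- lam * (r - r)))"
  by (rule set_integral_FTC(2)[OF assms]) (auto intro!: derivative_eq_intros continuous_intros)
 then show "(LINT s:{r<..<t}|lborel. lam * exp (- lam * (s - r))) = 1 - exp (- lam * (t - r))" by simp
 have "(LINT s:{r<..<t}|lborel. lam * exp (- lam * (t - s))) = exp (- lam * (t - t)) - exp (- lam * (t - r))"
  by (rule set_integral_FTC(2)[OF assms]) (auto intro!: derivative_eq_intros continuous_intros)
 then show "(LINT s:{r<..<t}|lborel. lam * exp (- lam * (t - s))) = 1 - exp (- lam * (t - r))" by simp
qed

lemma integrable_exp_weight:
 fixes f :: "real \<Rightarrow> real"
 assumes f: "integrable lborel f" and lam: "0 \<le> lam"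
 shows "set_integrable lborel {0<..<t} (\<lambda>s. exp (- lam * (t - s)) * f s)"
proof -
 have [measurable]: "f \<in> borel_fun" using borel_measurable_integrable[OF f] by simp
 show ?thesis unfolding set_integrable_def
 proof (rule Bochner_Integration.integrable_bound[OF f])
  show "AE s in lborel. norm (indicator {0<..<t} s *\<^sub>R (exp (- lam * (t - s)) * f s)) \<le> norm (f s)"
   using lam unfolding real_norm_def real_scaleR_def
   by (intro AE_I2) (auto simp: indicator_def abs_mult intro!: mult_left_le_one_le)
 qed measurable
qed

text \<open>Variation of constants for \<open>A' = b - lam * A\<close> with merely integrable \<open>b\<close>; this lemma and the converse below are both Fubini
  on a triangle.\<close>

lemma ode_of_duhamel:
 fixes a0 lam t :: real and b :: "real \<Rightarrow> real"
 assumes b: "integrable lborel b" and lam: "0 \<le> lam" and t: "0 \<le> t"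
 defines "D \<equiv> \<lambda>t. exp (- lam * t) * a0 + (LINT s:{0<..<t}|lborel. exp (- lam * (t - s)) * b s)"
 shows "set_integrable lborel {0<..<t} (\<lambda>s. b s - lam * D s)"
  "D t = a0 + (LINT s:{0<..<t}|lborel. b s - lam * D s)"
proof -
 have K: "\<bar>lam * exp (- lam * (s - r))\<bar> \<le> lam" if "r < s" for s r :: real
  using that lam by (simp add: abs_mult mult_left_le)
 have c: "(LINT s:{r<..<t}|lborel. lam * exp (- lam * (s - r))) = 1 - exp (- lam * (t - r))" if "r < t" for r
  using that by (intro integral_exp_decay) auto
 note tf = triangle_fubini[OF b, of "\<lambda>s r. lam * exp (- lam * (s - r))" t lam "\<lambda>r. 1 - exp (- lam * (t - r))"]
 have tf1: "set_integrable lborel {0<..<t} (\<lambda>s. LINT r:{0<..<s}|lborel. lam * exp (- lam * (s - r)) * b r)"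
  and tf2: "(LINT s:{0<..<t}|lborel. LINT r:{0<..<s}|lborel. lam * exp (- lam * (s - r)) * b r)
   = (LINT r:{0<..<t}|lborel. (1 - exp (- lam * (t - r))) * b r)"
  by (rule tf; use K c in auto)+
 have bi: "set_integrable lborel {0<..<t} b" unfolding set_integrable_def
  using integrable_mult_indicator[OF _ b, of "{0<..<t}"] by simp
 have ei: "set_integrable lborel {0<..<t} (\<lambda>s. lam * exp (- lam * (s - 0)))"
  by (rule set_integrable_subset[OF borel_integrable_atLeastAtMost'[of 0 t]]) (auto intro!: continuous_intros)
 have ei2: "set_integrable lborel {0<..<t} (\<lambda>s. a0 * (lam * exp (- lam * (s - 0))))"
  by (rule set_integrable_mult_right) (rule ei)
 have lD: "lam * D s = a0 * (lam * exp (- lam * (s - 0))) + (LINT r:{0<..<s}|lborel. lam * exp (- lam * (s - r)) * b r)" for s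
  unfolding D_def by (simp add: distrib_left mult.assoc)
 have i2: "set_integrable lborel {0<..<t} (\<lambda>s. lam * D s)"
  unfolding lD by (rule set_integral_add(1)[OF ei2 tf1])
 show "set_integrable lborel {0<..<t} (\<lambda>s. b s - lam * D s)"
  using bi i2 by (rule set_integral_diff)
 have "(LINT s:{0<..<t}|lborel. lam * D s) = a0 * (1 - exp (- lam * t)) + (LINT r:{0<..<t}|lborel. (1 - exp (- lam * (t - r))) * b r)"
  unfolding lD set_integral_add(2)[OF ei2 tf1] tf2 using integral_exp_decay(1)[OF t, of lam] by simp
 also have "(LINT r:{0<..<t}|lborel. (1 - exp (- lam * (t - r))) * b r)
  = (LINT r:{0<..<t}|lborel. b r) - (LINT r:{0<..<t}|lborel. exp (- lam * (t - r)) * b r)"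
  unfolding left_diff_distrib mult_1_left
  by (rule set_integral_diff(2)[OF bi integrable_exp_weight[OF b lam]])
 finally have "(LINT s:{0<..<t}|lborel. lam * D s) = a0 * (1 - exp (- lam * t)) + ((LINT r:{0<..<t}|lborel. b r) - (LINT r:{0<..<t}|lborel. exp (- lam * (t - r)) * b r))" .
 then show "D t = a0 + (LINT s:{0<..<t}|lborel. b s - lam * D s)"
  unfolding set_integral_diff(2)[OF bi i2] unfolding D_def by (simp add: algebra_simps)
qed

lemma duhamel_of_ode:
 fixes a0 lam t :: real and f :: "real \<Rightarrow> real"
 assumes f: "integrable lborel f" and lam: "0 \<le> lam" and t: "0 \<le> t"
 defines "A \<equiv> \<lambda>t. a0 + (LINT s:{0<..<t}|lborel. f s)"
 shows "A t = exp (- lam * t) * a0 + (LINT s:{0<..<t}|lborel. exp (- lam * (t - s)) * (f s + lam * A s))"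
proof -
 have K: "\<bar>lam * exp (- lam * (t - s))\<bar> \<le> lam" if "s < t" for s :: real
  using that lam by (simp add: abs_mult mult_left_le)
 have c: "(LINT s:{r<..<t}|lborel. lam * exp (- lam * (t - s))) = 1 - exp (- lam * (t - r))" if "r < t" for r
  using that by (intro integral_exp_decay) auto
 note tf = triangle_fubini[OF f, of "\<lambda>s r. lam * exp (- lam * (t - s))" t lam "\<lambda>r. 1 - exp (- lam * (t - r))"]
 have tf1: "set_integrable lborel {0<..<t} (\<lambda>s. LINT r:{0<..<s}|lborel. lam * exp (- lam * (t - s)) * f r)"
  and tf2: "(LINT s:{0<..<t}|lborel. LINT r:{0<..<s}|lborel. lam * exp (- lam * (t - s)) * f r)
   = (LINT r:{0<..<t}|lborel. (1 - exp (- lam * (t - r))) * f r)"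
  by (rule tf; use K c in auto)+
 have fi: "set_integrable lborel {0<..<t} f" unfolding set_integrable_def
  using integrable_mult_indicator[OF _ f, of "{0<..<t}"] by simp
 have ei: "set_integrable lborel {0<..<t} (\<lambda>s. lam * exp (- lam * (t - s)))"
  by (rule set_integrable_subset[OF borel_integrable_atLeastAtMost'[of 0 t]]) (auto intro!: continuous_intros)
 have ei2: "set_integrable lborel {0<..<t} (\<lambda>s. a0 * (lam * exp (- lam * (t - s))))"
  by (rule set_integrable_mult_right) (rule ei)
 have lA: "exp (- lam * (t - s)) * (f s + lam * A s) = exp (- lam * (t - s)) * f s +
  (a0 * (lam * exp (- lam * (t - s))) + (LINT r:{0<..<s}|lborel. lam * exp (- lam * (t - s)) * f r))" for s
  unfolding A_def by (simp add: algebra_simps)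
 have "(LINT s:{0<..<t}|lborel. exp (- lam * (t - s)) * (f s + lam * A s)) =
  (LINT s:{0<..<t}|lborel. exp (- lam * (t - s)) * f s) +
  (a0 * (1 - exp (- lam * t)) + (LINT r:{0<..<t}|lborel. (1 - exp (- lam * (t - r))) * f r))"
  unfolding lA set_integral_add(2)[OF integrable_exp_weight[OF f lam] set_integral_add(1)[OF ei2 tf1]]
   set_integral_add(2)[OF ei2 tf1] tf2
  using integral_exp_decay(2)[OF t, of lam] by simp
 also have "(LINT r:{0<..<t}|lborel. (1 - exp (- lam * (t - r))) * f r)
  = (LINT r:{0<..<t}|lborel. f r) - (LINT r:{0<..<t}|lborel. exp (- lam * (t - r)) * f r)"
  unfolding left_diff_distrib mult_1_left
  by (rule set_integral_diff(2)[OF fi integrable_exp_weight[OF f lam]])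
 finally show ?thesis unfolding A_def by (simp add: algebra_simps)
qed

section \<open>Trigonometric polynomials determine integrable functions\<close>

lemma set_integral_FTC_interior:
 fixes f F :: "real \<Rightarrow> real"
 assumes ab: "a \<le> b" and c: "continuous_on {a..b} F"
  and d: "\<And>x. x \<in> {a<..<b} \<Longrightarrow> (F has_real_derivative f x) (at x)"
  and i: "set_integrable lborel {a<..<b} f"
 shows "(LINT x:{a<..<b}|lborel. f x) = F b - F a"
proof -
 have "(f has_integral (F b - F a)) {a..b}"
  by (rule fundamental_theorem_of_calculus_interior[OF ab c])
   (use d in \<open>auto simp: has_real_derivative_iff_has_vector_derivative[symmetric]\<close>)
 then have "(f has_integral (F b - F a)) {a<..<b}" by (simp add: has_integral_Icc_iff_Ioo)
 then show ?thesis unfolding set_borel_integral_eq_integral(2)[OF i] by (rule integral_unique)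
qed

lemma set_integrable_mult_bounded:
 fixes f g :: "real \<Rightarrow> real"
 assumes f: "set_integrable lborel A f" and [measurable]: "A \<in> sets borel"
  and g: "set_borel_measurable borel A g" and b: "\<And>x. x \<in> A \<Longrightarrow> \<bar>g x\<bar> \<le> B"
 shows "set_integrable lborel A (\<lambda>x. f x * g x)"
proof -
 have fm: "set_borel_measurable borel A f"
  using f unfolding set_integrable_def set_borel_measurable_def by auto
 show ?thesis unfolding set_integrable_def
 proof (rule Bochner_Integration.integrable_bound[OF integrable_mult_right[OF f[unfolded set_integrable_def], of B]])
  have "(\<lambda>x. (indicator A x *\<^sub>R f x) * (indicator A x *\<^sub>R g x)) \<in> borel_fun"
   using fm g unfolding set_borel_measurable_def by measurable
  also have "(\<lambda>x. (indicator A x *\<^sub>R f x) * (indicator A x *\<^sub>R g x)) = (\<lambda>x. indicator A x *\<^sub>R (f x * g x))"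
   by (auto simp: indicator_def fun_eq_iff)
  finally show "(\<lambda>x. indicator A x *\<^sub>R (f x * g x)) \<in> borel_measurable lborel" by simp
  show "AE x in lborel. norm (indicator A x *\<^sub>R (f x * g x)) \<le> norm (B * (indicator A x *\<^sub>R f x))"
  proof (intro AE_I2)
   fix x
   show "norm (indicator A x *\<^sub>R (f x * g x)) \<le> norm (B * (indicator A x *\<^sub>R f x))"
   proof (cases "x \<in> A")
    case True
    have "\<bar>f x\<bar> * \<bar>g x\<bar> \<le> \<bar>f x\<bar> * \<bar>B\<bar>" using b[OF True] by (intro mult_left_mono) auto
    then show ?thesis using True by (simp add: abs_mult mult.commute)
   qed simp
  qed
 qed
qed

lemma set_integrable_mult_continuous:
 fixes f g :: "real \<Rightarrow> real"
 assumes f: "set_integrable lborel {a<..<b} f" and g: "continuous_on {a..b} g"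
 shows "set_integrable lborel {a<..<b} (\<lambda>x. f x * g x)"
proof -
 have "compact (g ` {a..b})" using g by (intro compact_continuous_image) auto
 then obtain B where B: "\<forall>x\<in>{a..b}. \<bar>g x\<bar> \<le> B"
  using compact_imp_bounded[of "g ` {a..b}"] unfolding bounded_iff by auto
 have "continuous_on {a<..<b} g" by (rule continuous_on_subset[OF g]) auto
 then have "set_borel_measurable borel {a<..<b} g"
  using borel_measurable_continuous_on_indicator[of "{a<..<b}" g] unfolding set_borel_measurable_def by simp
 then show ?thesis using B by (intro set_integrable_mult_bounded[OF f, of g B]) auto
qed

lemma set_integrable_continuous:
 fixes g :: "real \<Rightarrow> real"
 assumes g: "continuous_on {a..b} g"
 shows "set_integrable lborel {a<..<b} g"
 by (rule set_integrable_subset[OF borel_integrable_atLeastAtMost'[OF g]]) auto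

text \<open>Multiplication by \<open>cos y\<close> shifts frequencies up and down by one. A property of all modes that is linear therefore
  extends to polynomials in \<open>cos y\<close> times the lowest mode.\<close>

lemma trig_induct:
 fixes e :: "nat \<Rightarrow> real \<Rightarrow> real"
 assumes add: "\<And>f g. Q f \<Longrightarrow> Q g \<Longrightarrow> Q (\<lambda>y. f y + g y)" and scale: "\<And>c f. Q f \<Longrightarrow> Q (\<lambda>y. c * f y)"
  and e: "\<And>k. Q (e k)"
  and rec: "\<And>k. \<exists>a b i j. \<forall>y. cos y * e k y = a * e i y + b * e j y"
  and p: "real_polynomial_function p"
 shows "Q (\<lambda>y. p (cos y) * e 0 y)"
proof -
 have pow: "Q (\<lambda>y. cos y ^ n * e k y)" for n k
 proof (induction n arbitrary: k)
  case 0 show ?case using e[of k] by simp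
 next
  case (Suc n)
  obtain a b i j where r: "\<And>y. cos y * e k y = a * e i y + b * e j y" using rec[of k] by blast
  have "cos y ^ Suc n * e k y = cos y ^ n * (cos y * e k y)" for y by (simp only: power_Suc mult_ac)
  then have "(\<lambda>y. cos y ^ Suc n * e k y) = (\<lambda>y. a * (cos y ^ n * e i y) + b * (cos y ^ n * e j y))"
   unfolding r by (auto simp: fun_eq_iff algebra_simps)
  then show ?case by (simp only:) (intro add scale Suc)
 qed
 obtain a n where pe: "p = (\<lambda>x. \<Sum>i\<le>n. a i * x ^ i)" using p unfolding real_polynomial_function_iff_sum by blast
 have "Q (\<lambda>y. \<Sum>i\<le>m. a i * (cos y ^ i * e 0 y))" for m :: nat
 proof (induction m)
  case 0 show ?case using scale[OF pow[of 0 0]] by simp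
 next
  case (Suc m)
  show ?case using add[OF Suc scale[OF pow[of "Suc m" 0]]] by simp
 qed
 from this[of n] show ?thesis unfolding pe sum_distrib_right by (simp add: mult.assoc)
qed

lemma cos_poly_induct:
 assumes "\<And>f g. Q f \<Longrightarrow> Q g \<Longrightarrow> Q (\<lambda>y. f y + g y)" "\<And>c f. Q f \<Longrightarrow> Q (\<lambda>y. c * f y)"
  and "\<And>k. Q (\<lambda>y. cos (real k * y))" and "real_polynomial_function p"
 shows "Q (\<lambda>y. p (cos y))"
proof -
 have rec: "\<exists>a b i j. \<forall>y. cos y * cos (real k * y) = a * cos (real i * y) + b * cos (real j * y)" for k
 proof (cases k)
  case 0
  have "\<forall>y. cos y * cos (real k * y) = 1 * cos (real 1 * y) + 0 * cos (real 1 * y)" using 0 by simp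
  then show ?thesis by blast
 next
  case (Suc n)
  have "cos y * cos (real k * y) = (1/2) * cos (real (Suc k) * y) + (1/2) * cos (real n * y)" for y
  proof -
   have r: "real (Suc k) * y = real k * y + y" "real n * y = real k * y - y" using Suc by (simp_all add: algebra_simps)
   show ?thesis unfolding r cos_add cos_diff by (simp add: field_simps)
  qed
  then show ?thesis by blast
 qed
 have "Q (\<lambda>y. p (cos y) * cos (real 0 * y))"
 proof (rule trig_induct[where Q = Q and e = "\<lambda>k y. cos (real k * y)", OF _ _ _ rec assms(4)])
  show "Q (\<lambda>y. f y + g y)" if "Q f" "Q g" for f g using that by (rule assms(1))
  show "Q (\<lambda>y. c * f y)" if "Q f" for c f using that by (rule assms(2))
  show "Q (\<lambda>y. cos (real k * y))" for k by (rule assms(3))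
 qed
 then show ?thesis by simp
qed

lemma sin_poly_induct:
 assumes "\<And>f g. Q f \<Longrightarrow> Q g \<Longrightarrow> Q (\<lambda>y. f y + g y)" "\<And>c f. Q f \<Longrightarrow> Q (\<lambda>y. c * f y)"
  and "\<And>k. Q (\<lambda>y. sin (real (Suc k) * y))" and "real_polynomial_function p"
 shows "Q (\<lambda>y. p (cos y) * sin y)"
proof -
 have rec: "\<exists>a b i j. \<forall>y. cos y * sin (real (Suc k) * y) = a * sin (real (Suc i) * y) + b * sin (real (Suc j) * y)" for k
 proof (cases k)
  case 0
  have "\<forall>y. cos y * sin (real (Suc k) * y) = (1/2) * sin (real (Suc 1) * y) + 0 * sin (real (Suc 1) * y)"
   using 0 by (simp add: sin_double)
  then show ?thesis by blast
 next
  case (Suc n)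
  have "cos y * sin (real (Suc k) * y) = (1/2) * sin (real (Suc (Suc k)) * y) + (1/2) * sin (real (Suc n) * y)" for y
  proof -
   have r: "real (Suc (Suc k)) * y = real (Suc k) * y + y" "real (Suc n) * y = real (Suc k) * y - y"
    using Suc by (simp_all add: algebra_simps)
   show ?thesis unfolding r sin_add sin_diff by (simp add: field_simps)
  qed
  then show ?thesis by blast
 qed
 have "Q (\<lambda>y. p (cos y) * sin (real (Suc 0) * y))"
 proof (rule trig_induct[where Q = Q and e = "\<lambda>k y. sin (real (Suc k) * y)", OF _ _ _ rec assms(4)])
  show "Q (\<lambda>y. f y + g y)" if "Q f" "Q g" for f g using that by (rule assms(1))
  show "Q (\<lambda>y. c * f y)" if "Q f" for c f using that by (rule assms(2))
  show "Q (\<lambda>y. sin (real (Suc k) * y))" for k by (rule assms(3))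
 qed
 then show ?thesis by simp
qed

text \<open>The substitution \<open>z = cos y\<close> reduces this to the Weierstrass theorem on \<open>{-1..1}\<close>.\<close>

lemma cos_poly_density:
 fixes h :: "real \<Rightarrow> real"
 assumes h: "continuous_on {0..pi} h" and e: "0 < e"
 obtains p where "real_polynomial_function p" "\<And>y. y \<in> {0..pi} \<Longrightarrow> \<bar>h y - p (cos y)\<bar> < e"
proof -
 have "continuous_on {-1..1} (\<lambda>c. h (arccos c))"
  by (rule continuous_on_compose2[OF h continuous_on_arccos']) (auto simp: arccos_lbound arccos_ubound)
 then obtain p where p: "real_polynomial_function p" "\<And>c. c \<in> {-1..1} \<Longrightarrow> \<bar>h (arccos c) - p c\<bar> < e"
  using Stone_Weierstrass_real_polynomial_function[of "{-1..1}" "\<lambda>c. h (arccos c)" e] e by auto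
 show thesis
 proof (rule that[OF p(1)])
  fix y assume "y \<in> {0..pi}"
  then show "\<bar>h y - p (cos y)\<bar> < e" using p(2)[of "cos y"] by (simp add: arccos_cos)
 qed
qed

text \<open>The positive and the negative part define finite measures with the same values on half-lines.\<close>

lemma AE_zero_of_halfline_integrals:
 fixes g :: "real \<Rightarrow> real"
 assumes g: "integrable lborel g" and z: "\<And>x. (LB y. g y * indicator {x<..} y) = 0"
 shows "AE y in lborel. g y = 0"
proof -
 define P where "P y = max 0 (g y)" for y
 define N where "N y = max 0 (- g y)" for y
 have i: "integrable lborel P" "integrable lborel N" unfolding P_def N_def using g by auto
 have [measurable]: "P \<in> borel_fun" "N \<in> borel_fun"
  using borel_measurable_integrable[OF i(1)] borel_measurable_integrable[OF i(2)] by auto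
 have nn: "0 \<le> P y" "0 \<le> N y" for y unfolding P_def N_def by auto
 have em: "emeasure (density lborel (\<lambda>y. ennreal (f y))) {x<..} = ennreal (LB y. f y * indicator {x<..} y)"
  if "integrable lborel f" "\<And>y. 0 \<le> f y" for f :: "real \<Rightarrow> real" and x :: real
 proof -
  have fm: "f \<in> borel_fun" using borel_measurable_integrable[OF that(1)] by simp
  have "emeasure (density lborel (\<lambda>y. ennreal (f y))) {x<..} = (NN y. ennreal (f y) * indicator {x<..} y)"
   using fm by (subst emeasure_density) auto
  also have "\<dots> = (NN y. ennreal (f y * indicator {x<..} y))"
   by (intro nn_integral_cong) (auto simp: indicator_def)
  also have "\<dots> = ennreal (LB y. f y * indicator {x<..} y)"
   using that integrable_mult_indicator[OF _ that(1), of "{x<..}"]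
   by (intro nn_integral_eq_integral) (auto simp: mult.commute)
  finally show ?thesis .
 qed
 have "density lborel (\<lambda>y. ennreal (P y)) = density lborel (\<lambda>y. ennreal (N y))"
 proof (rule measure_eqI_lessThan)
  fix x
  have "(LB y. P y * indicator {x<..} y) - (LB y. N y * indicator {x<..} y)
   = (LB y. P y * indicator {x<..} y - N y * indicator {x<..} y)"
   using integrable_mult_indicator[OF _ i(1), of "{x<..}"] integrable_mult_indicator[OF _ i(2), of "{x<..}"]
   by (intro Bochner_Integration.integral_diff[symmetric]) (auto simp: mult.commute)
  also have "\<dots> = (LB y. g y * indicator {x<..} y)"
   by (intro Bochner_Integration.integral_cong) (auto simp: P_def N_def indicator_def max_def)
  finally show "emeasure (density lborel (\<lambda>y. ennreal (P y))) {x<..} = emeasure (density lborel (\<lambda>y. ennreal (N y))) {x<..}"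
   using z[of x] unfolding em[OF i(1) nn(1)] em[OF i(2) nn(2)] by simp
  show "emeasure (density lborel (\<lambda>y. ennreal (P y))) {x<..} < \<infinity>" unfolding em[OF i(1) nn(1)] by simp
 qed auto
 then have "AE y in lborel. ennreal (P y) = ennreal (N y)" by (intro sigma_finite_measure.density_unique[OF lborel.sigma_finite_measure_axioms]) auto
 then show ?thesis by eventually_elim (auto simp: P_def N_def max_def split: if_splits)
qed

text \<open>Polynomials in \<open>cos y\<close> are uniformly dense, so all integrals against continuous functions vanish; continuous ramps
  approximate indicators of half-lines.\<close>

lemma AE_zero_of_cos_moments:
 fixes f :: "real \<Rightarrow> real"
 assumes f: "integrable_I f"
  and z: "\<And>p. real_polynomial_function p \<Longrightarrow> (LI y. f y * p (cos y)) = 0"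
 shows "AE y in lborel. y \<in> Ipi \<longrightarrow> f y = 0"
proof -
 define A where "A = (LI y. \<bar>f y\<bar>)"
 have fa: "integrable_I (\<lambda>y. \<bar>f y\<bar>)" using f by (rule set_integrable_abs)
 have A: "0 \<le> A" unfolding A_def set_lebesgue_integral_def by (intro integral_nonneg_AE AE_I2) auto
 have cont: "(LI y. f y * h y) = 0" if h: "continuous_on {0..pi} h" for h
 proof (rule ccontr)
  assume n: "(LI y. f y * h y) \<noteq> 0"
  define e where "e = \<bar>LI y. f y * h y\<bar> / (2 * (A + 1))"
  have e: "e > 0" using n A unfolding e_def by simp
  obtain p where p: "real_polynomial_function p" "\<And>y. y \<in> {0..pi} \<Longrightarrow> \<bar>h y - p (cos y)\<bar> < e"
   using cos_poly_density[OF h e] by blast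
  have pc: "continuous_on {0..pi} (\<lambda>y. p (cos y))"
   by (intro continuous_on_compose2[OF continuous_on_polymonial_function[of p UNIV]])
    (use p in \<open>auto simp: real_polynomial_function_eq intro!: continuous_intros\<close>)
  have i: "integrable_I (\<lambda>y. f y * h y)" "integrable_I (\<lambda>y. f y * p (cos y))"
   by (rule set_integrable_mult_continuous[OF f h]) (rule set_integrable_mult_continuous[OF f pc])
  have "\<bar>LI y. f y * h y\<bar> = \<bar>LI y. f y * h y - f y * p (cos y)\<bar>"
   using z[OF p(1)] by (simp add: set_integral_diff(2)[OF i])
  also have "\<dots> \<le> (LI y. \<bar>f y * h y - f y * p (cos y)\<bar>)"
   using set_integral_diff(1)[OF i] set_integral_norm_bound[of lborel "Ipi" "\<lambda>y. f y * h y - f y * p (cos y)"] by simp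
  also have "\<dots> \<le> (LI y. e * \<bar>f y\<bar>)"
  proof (rule set_integral_mono)
   show "integrable_I (\<lambda>y. \<bar>f y * h y - f y * p (cos y)\<bar>)"
    by (rule set_integrable_abs) (rule set_integral_diff(1)[OF i])
   show "integrable_I (\<lambda>y. e * \<bar>f y\<bar>)" using fa by simp
   fix y :: real assume y: "y \<in> Ipi"
   have "\<bar>f y * h y - f y * p (cos y)\<bar> = \<bar>h y - p (cos y)\<bar> * \<bar>f y\<bar>"
    by (simp add: abs_mult[symmetric] algebra_simps)
   also have "\<dots> \<le> e * \<bar>f y\<bar>" using p(2)[of y] y by (intro mult_right_mono) auto
   finally show "\<bar>f y * h y - f y * p (cos y)\<bar> \<le> e * \<bar>f y\<bar>" .
  qed
  also have "\<dots> = e * A" unfolding A_def by simp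
  also have "\<dots> < \<bar>LI y. f y * h y\<bar>" using n A unfolding e_def by (auto simp: field_simps intro!: add_nonneg_pos)
  finally show False by simp
 qed
 define g where "g y = ind_I y * f y" for y
 have g: "integrable lborel g" using f unfolding g_def set_integrable_def by simp
 have "AE y in lborel. g y = 0"
 proof (rule AE_zero_of_halfline_integrals[OF g])
  fix x :: real
  define h where "h n y = min 1 (max 0 (real n * (y - x)))" for n y
  have hb: "0 \<le> h n y" "h n y \<le> 1" for n y unfolding h_def by auto
  have "(\<lambda>n. LB y. g y * h n y) \<longlonglongrightarrow> (LB y. g y * indicator {x<..} y)"
  proof (rule integral_dominated_convergence[where w = "\<lambda>y. \<bar>g y\<bar>"])
   show "AE y in lborel. (\<lambda>n. g y * h n y) \<longlonglongrightarrow> g y * indicator {x<..} y"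
   proof (intro AE_I2 tendsto_mult tendsto_const)
    fix y
    show "(\<lambda>n. h n y) \<longlonglongrightarrow> indicator {x<..} y"
    proof (cases "x < y")
     case True
     obtain m :: nat where m: "1 / (y - x) < real m" using reals_Archimedean2 by blast
     have "\<forall>\<^sub>F n in sequentially. h n y = 1"
     proof (rule eventually_sequentiallyI[of m])
      fix n assume "m \<le> n"
      then have "1 \<le> real n * (y - x)" using m True
       by (smt (verit, ccfv_SIG) divide_less_eq of_nat_le_iff mult_right_mono)
      then show "h n y = 1" unfolding h_def by simp
     qed
     then show ?thesis using True by (simp add: tendsto_eventually)
    next
     case False
     then have "h n y = 0" for n unfolding h_def by (auto simp: mult_nonneg_nonpos)
     then show ?thesis using False by simp
    qed
   qed
   show "AE y in lborel. norm (g y * h n y) \<le> \<bar>g y\<bar>" for n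
    using hb[of n] by (intro AE_I2) (simp add: abs_mult mult_left_le)
   show "integrable lborel (\<lambda>y. \<bar>g y\<bar>)" using g by simp
   have [measurable]: "g \<in> borel_fun" using borel_measurable_integrable[OF g] by simp
   show "(\<lambda>y. g y * indicator {x<..} y) \<in> borel_measurable lborel" by measurable
   show "(\<lambda>y. g y * h n y) \<in> borel_measurable lborel" for n unfolding h_def by measurable
  qed
  moreover have "(LB y. g y * h n y) = 0" for n
  proof -
   have "continuous_on {0..pi} (h n)" unfolding h_def by (intro continuous_intros)
   from cont[OF this] show ?thesis unfolding g_def set_lebesgue_integral_def by (simp add: mult.assoc)
  qed
  ultimately show "(LB y. g y * indicator {x<..} y) = 0" by (simp add: LIMSEQ_const_iff)
 qed
 then show ?thesis by eventually_elim (auto simp: g_def)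
qed

lemma continuous_on_cos_poly:
 assumes "real_polynomial_function p"
 shows "continuous_on A (\<lambda>y::real. p (cos y))"
 by (intro continuous_on_compose2[OF continuous_on_polymonial_function[of p UNIV]])
  (use assms in \<open>auto simp: real_polynomial_function_eq intro!: continuous_intros\<close>)

text \<open>Apply the preceding lemma to \<open>f * sin\<close>.\<close>

lemma AE_zero_of_sine_coefficients:
 fixes f :: "real \<Rightarrow> real"
 assumes f: "integrable_I f"
  and z: "\<And>k. (LI y. f y * smode k y) = 0"
 shows "AE y in lborel. y \<in> Ipi \<longrightarrow> f y = 0"
proof -
 define Q where "Q g \<longleftrightarrow> continuous_on {0..pi} g \<and> (LI y. f y * g y) = 0" for g
 have "(LI y. (f y * sin y) * p (cos y)) = 0" if p: "real_polynomial_function p" for p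
 proof -
  have "Q (\<lambda>y. p (cos y) * sin y)"
  proof (rule sin_poly_induct[OF _ _ _ p])
   fix g h assume q: "Q g" "Q h"
   then show "Q (\<lambda>y. g y + h y)" unfolding Q_def distrib_left
    by (auto intro!: continuous_intros simp: set_integral_add(2) set_integrable_mult_continuous[OF f])
  next
   fix c g assume q: "Q g"
   then show "Q (\<lambda>y. c * g y)" unfolding Q_def
    by (auto intro!: continuous_intros simp: mult.left_commute[of _ c])
  next
   fix k
   have "(LI y. f y * smode k y)
    = sqrt (2 / pi) * (LI y. f y * sin (real (Suc k) * y))"
    unfolding dirichlet_mode_def mult.left_commute[of _ "sqrt (2 / pi)"] by (rule set_integral_mult_right)
   then show "Q (\<lambda>y. sin (real (Suc k) * y))"
    unfolding Q_def using z[of k] sqrt_2_pi(1) by (auto intro!: continuous_intros)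
  qed
  then show ?thesis unfolding Q_def by (simp add: mult_ac)
 qed
 from AE_zero_of_cos_moments[OF set_integrable_mult_continuous[OF f continuous_on_sin[OF continuous_on_id]] this]
 have "AE y in lborel. y \<in> Ipi \<longrightarrow> f y * sin y = 0" .
 then show ?thesis by eventually_elim (use sin_gt_zero in force)
qed

lemma continuous_on_decay_series:
 fixes X :: "nat \<Rightarrow> 'b::metric_space \<Rightarrow> real"
 assumes c: "\<And>k. continuous_on A (X k)" and p: "0 \<le> p"
  and b: "\<And>k x. x \<in> A \<Longrightarrow> \<bar>X k x\<bar> \<le> B * real (Suc k) powr p"
 shows "continuous_on ({0<..} \<times> A) (\<lambda>(t, x). \<Sum>k. decay k t * X k x)"
proof -
 let ?f = "\<lambda>(t, x). \<Sum>k. decay k t * X k x"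
 have loc: "continuous_on ({t0<..} \<times> A) ?f" if t0: "0 < t0" for t0 :: real
 proof (rule uniform_limit_theorem[OF _ _ sequentially_bot])
  have sm: "summable (\<lambda>k. B * (real (Suc k) powr p * decay k t0))"
   by (intro summable_mult summable_decay t0 p)
  have B0: "0 \<le> B * real (Suc k) powr p" if "x \<in> A" for x k using order_trans[OF abs_ge_zero b[OF that, of k]] .
  show "uniform_limit ({t0<..} \<times> A) (\<lambda>n z. \<Sum>k<n. exp (- (real (Suc k))\<^sup>2 * fst z) * X k (snd z)) ?f sequentially"
   unfolding split_beta
  proof (rule Weierstrass_m_test[OF _ sm])
   fix k and z :: "real \<times> 'b" assume z: "z \<in> {t0<..} \<times> A"
   then have zA: "snd z \<in> A" "t0 < fst z" by auto
   have "\<bar>exp (- (real (Suc k))\<^sup>2 * fst z) * X k (snd z)\<bar> \<le> decay k t0 * (B * real (Suc k) powr p)"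
    unfolding abs_mult using zA b[OF zA(1), of k] by (intro mult_mono) auto
   then show "norm (exp (- (real (Suc k))\<^sup>2 * fst z) * X k (snd z)) \<le> B * (real (Suc k) powr p * decay k t0)"
    by (simp add: mult_ac)
  qed
  have "continuous_on ({t0<..} \<times> A) (\<lambda>z. X k (snd z))" for k
   by (rule continuous_on_compose2[OF c]) (auto intro: continuous_intros)
  then show "\<forall>\<^sub>F n in sequentially. continuous_on ({t0<..} \<times> A) (\<lambda>z. \<Sum>k<n. exp (- (real (Suc k))\<^sup>2 * fst z) * X k (snd z))"
   by (intro always_eventually allI continuous_intros)
 qed
 show ?thesis unfolding continuous_on_eq_continuous_within
 proof
  fix z :: "real \<times> 'b" assume z: "z \<in> {0<..} \<times> A"
  define t0 where "t0 = fst z / 2"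
  have t0: "0 < t0" "z \<in> {t0<..} \<times> A" using z unfolding t0_def by auto
  have "continuous (at z within {t0<..} \<times> A) ?f"
   using loc[OF t0(1)] t0(2) unfolding continuous_on_eq_continuous_within by blast
  moreover have "at z within {0<..} \<times> A = at z within {t0<..} \<times> A"
   by (rule at_within_nhd[of z "{t0<..} \<times> UNIV"]) (use t0 in \<open>auto intro: open_Times\<close>)
  ultimately show "continuous (at z within {0<..} \<times> A) ?f" by simp
 qed
qed

section \<open>The heat flow of the initial datum\<close>

definition sine_coeff :: "(real \<Rightarrow> real) \<Rightarrow> nat \<Rightarrow> real" where
 "sine_coeff v k = (LI y. v y * smode k y)"

lemma integral_mult_sine_series:
 fixes v :: "real \<Rightarrow> real"
 assumes v: "integrable_I v" and c: "summable (\<lambda>k. \<bar>c k\<bar>)"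
 shows "(LI y. v y * (\<Sum>k. c k * smode k y)) = (\<Sum>k. c k * sine_coeff v k)"
  "integrable_I (\<lambda>y. v y * (\<Sum>k. c k * smode k y))"
proof -
 define f where "f k y = ind_I y *\<^sub>R (v y * (c k * smode k y))" for k y
 have vi: "integrable_I (\<lambda>y. v y * (c k * smode k y))" for k
  by (intro set_integrable_mult_continuous[OF v] continuous_intros)
 have fi: "integrable lborel (f k)" for k using vi[of k] unfolding f_def set_integrable_def .
 have b: "norm (f k y) \<le> \<bar>c k\<bar> * (ind_I y * \<bar>v y\<bar>)" for k y
 proof -
  have "\<bar>c k * smode k y\<bar> \<le> \<bar>c k\<bar>" by (intro abs_mult_mode_le) simp
  from mult_left_mono[OF this, of "\<bar>v y\<bar>"] show ?thesis
   unfolding f_def by (auto simp: abs_mult mult_ac indicator_def)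
 qed
 have cs: "summable (\<lambda>k. c k * smode k y)" for y
  by (rule summable_comparison_test'[OF c, of 0]) (use abs_mult_mode_le(1) in auto)
 have sn: "AE y in lborel. summable (\<lambda>k. norm (f k y))"
 proof (intro AE_I2)
  fix y
  show "summable (\<lambda>k. norm (f k y))"
   by (rule summable_comparison_test'[OF summable_mult2[OF c, of "ind_I y * \<bar>v y\<bar>"], of 0])
    (use b in simp)
 qed
 have si: "summable (\<lambda>k. LB y. norm (f k y))"
 proof (rule summable_comparison_test'[OF summable_mult2[OF c, of "LB y. ind_I y * \<bar>v y\<bar>"], of 0])
  fix k
  have va: "integrable lborel (\<lambda>y. ind_I y * \<bar>v y\<bar>)"
   using set_integrable_abs[OF v] unfolding set_integrable_def by simp
  have "(LB y. norm (f k y)) \<le> (LB y. \<bar>c k\<bar> * (ind_I y * \<bar>v y\<bar>))"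
   using b fi va by (intro integral_mono) auto
  then show "norm (LB y. norm (f k y)) \<le> \<bar>c k\<bar> * (LB y. ind_I y * \<bar>v y\<bar>)"
   by simp
 qed
 have e: "(\<Sum>k. f k y) = ind_I y *\<^sub>R (v y * (\<Sum>k. c k * smode k y))" for y
  unfolding f_def real_scaleR_def suminf_mult[OF cs, symmetric]
  by (rule suminf_mult) (rule summable_mult[OF cs])
 have "(LI y. v y * (\<Sum>k. c k * smode k y)) = (LB y. (\<Sum>k. f k y))"
  unfolding e set_lebesgue_integral_def ..
 also have "\<dots> = (\<Sum>k. LB y. f k y)" by (rule integral_suminf[OF fi sn si])
 also have "\<dots> = (\<Sum>k. c k * sine_coeff v k)"
 proof (rule suminf_cong)
  fix k
  have "(LB y. f k y) = (LB y. c k * (ind_I y *\<^sub>R (v y * smode k y)))"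
   unfolding f_def by (intro Bochner_Integration.integral_cong) auto
  then show "(LB y. f k y) = c k * sine_coeff v k"
   unfolding sine_coeff_def set_lebesgue_integral_def by simp
 qed
 finally show "(LI y. v y * (\<Sum>k. c k * smode k y)) = (\<Sum>k. c k * sine_coeff v k)" .
 show "integrable_I (\<lambda>y. v y * (\<Sum>k. c k * smode k y))"
  using integrable_suminf[OF fi sn si] unfolding e set_integrable_def .
qed

lemma sine_coeff_series:
 assumes c: "summable (\<lambda>k. \<bar>c k\<bar>)"
 shows "(LI y. smode j y * (\<Sum>k. c k * smode k y)) = c j"
proof -
 have "integrable_I (smode j)"
  by (intro set_integrable_continuous continuous_intros)
 from integral_mult_sine_series(1)[OF this c]
 have "(LI y. smode j y * (\<Sum>k. c k * smode k y))
  = (\<Sum>k. c k * (if j = k then 1 else 0))"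
  unfolding sine_coeff_def dirichlet_mode_orthonormal(2) .
 also have "\<dots> = (\<Sum>k\<in>{j}. c k * (if j = k then 1 else 0))" by (rule suminf_finite) auto
 finally show ?thesis by simp
qed

lemma abs_sine_coeff_le:
 assumes v: "integrable_I v"
 shows "\<bar>sine_coeff v k\<bar> \<le> (LI y. \<bar>v y\<bar>)"
proof -
 have "integrable_I (\<lambda>y. v y * smode k y)"
  by (intro set_integrable_mult_continuous[OF v] continuous_intros)
 then have "\<bar>sine_coeff v k\<bar> \<le> (LI y. \<bar>v y * smode k y\<bar>)"
  unfolding sine_coeff_def using set_integral_norm_bound[of lborel "Ipi" "\<lambda>y. v y * smode k y"] by simp
 also have "\<dots> \<le> (LI y. \<bar>v y\<bar>)"
 proof (rule set_integral_mono)
  show "integrable_I (\<lambda>y. \<bar>v y * smode k y\<bar>)"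
   by (rule set_integrable_abs) fact
  show "integrable_I (\<lambda>y. \<bar>v y\<bar>)" by (rule set_integrable_abs[OF v])
 qed (use abs_mult_mode_le(1)[of "\<bar>v _\<bar>" "\<bar>v _\<bar>"] in \<open>auto simp: abs_mult\<close>)
 finally show ?thesis .
qed

definition heat_flow :: "(real \<Rightarrow> real) \<Rightarrow> real \<Rightarrow> real \<Rightarrow> real" where
 "heat_flow v t x = (\<Sum>k. decay k t * (sine_coeff v k * smode k x))"

lemma dirichlet_heat_flow_eq:
 assumes v: "integrable_I v" and t: "0 < t"
 shows "dirichlet_heat_flow v t x = heat_flow v t x"
proof -
 have s: "summable (\<lambda>k. \<bar>decay k t * smode k x\<bar>)"
  using abs_mode_le(1) by (intro summable_decay_exp(1)[OF t, of 0 _ 1]) auto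
 have "dirichlet_heat_flow v t x = (LI y. v y * (\<Sum>k. (decay k t * smode k x) * smode k y))"
  unfolding dirichlet_heat_flow_def dirichlet_heat_kernel_def using t by (simp add: mult.commute)
 also have "\<dots> = (\<Sum>k. (decay k t * smode k x) * sine_coeff v k)"
  by (rule integral_mult_sine_series(1)[OF v s])
 finally show ?thesis unfolding heat_flow_def by (simp add: mult_ac)
qed

lemma heat_flow_coeff:
 assumes v: "integrable_I v" and t: "0 < t"
 shows "(LI x. smode j x * heat_flow v t x) = decay j t * sine_coeff v j"
proof -
 have s: "summable (\<lambda>k. \<bar>decay k t * sine_coeff v k\<bar>)"
  using abs_sine_coeff_le[OF v] by (intro summable_decay_exp(1)[OF t, of 0]) auto
 show ?thesis using sine_coeff_series[OF s, of j] unfolding heat_flow_def by (simp add: mult.assoc)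
qed

lemma cos_mult_arccos_cos: "cos (real k * arccos (cos w)) = cos (real k * w)"
proof -
 define a where "a = arccos (cos w)"
 have c: "cos a = cos w" unfolding a_def by simp
 have "cos (real k * a) = cos (real k * w) \<and> cos (real (Suc k) * a) = cos (real (Suc k) * w)"
 proof (induction k)
  case 0 show ?case using c by simp
 next
  case (Suc k)
  have r: "cos (real (Suc (Suc k)) * y) = 2 * cos y * cos (real (Suc k) * y) - cos (real k * y)" for y
  proof -
   have e: "real (Suc (Suc k)) * y = real (Suc k) * y + y" "real k * y = real (Suc k) * y - y" by (simp_all add: algebra_simps)
   show ?thesis unfolding e cos_add cos_diff by simp
  qed
  show ?case using Suc c unfolding r by simp
 qed
 then show ?thesis unfolding a_def by simp
qed

lemma arccos_cos_lipschitz: "\<bar>arccos (cos a) - arccos (cos b)\<bar> \<le> \<bar>a - b\<bar>"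
proof (cases "\<bar>a - b\<bar> \<le> pi")
 case False
 have "0 \<le> arccos (cos a)" "arccos (cos a) \<le> pi" "0 \<le> arccos (cos b)" "arccos (cos b) \<le> pi"
  by (auto simp: arccos_lbound arccos_ubound)
 then show ?thesis using False by linarith
next
 case True
 have bd: "0 \<le> arccos (cos w)" "arccos (cos w) \<le> pi" for w by (auto simp: arccos_lbound arccos_ubound)
 have s: "sin (arccos (cos w)) = \<bar>sin w\<bar>" for w
 proof -
  have "(sin (arccos (cos w)))\<^sup>2 = (sin w)\<^sup>2" by (simp add: sin_squared_eq)
  then have "\<bar>sin (arccos (cos w))\<bar> = \<bar>sin w\<bar>" by (simp add: power2_eq_iff abs_eq_iff)
  then show ?thesis using bd[of w] by (simp add: sin_ge_zero)
 qed
 have "cos \<bar>a - b\<bar> \<le> cos \<bar>arccos (cos a) - arccos (cos b)\<bar>"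
 proof -
  have "sin a * sin b \<le> \<bar>sin a\<bar> * \<bar>sin b\<bar>" by (metis abs_ge_self abs_mult)
  then show ?thesis by (simp add: cos_abs_real cos_diff s)
 qed
 moreover have "\<bar>arccos (cos a) - arccos (cos b)\<bar> \<le> pi" using bd[of a] bd[of b] by linarith
 ultimately show ?thesis using True cos_mono_le_eq[of "\<bar>a - b\<bar>" "\<bar>arccos (cos a) - arccos (cos b)\<bar>"] by simp
qed

lemma normal_expectation_cos:
 "integrable std_normal_distribution (\<lambda>z. cos (a + b * z))"
 "(LINT z|std_normal_distribution. cos (a + b * z)) = cos a * exp (- b\<^sup>2 / 2)"
proof -
 interpret S: real_distribution std_normal_distribution by (rule real_dist_normal_dist)
 have i: "integrable std_normal_distribution (\<lambda>z. iexp (b * z))" by (rule S.integrable_iexp) auto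
 have ch: "(CLINT z|std_normal_distribution. iexp (b * z)) = complex_of_real (exp (- b\<^sup>2 / 2))"
  using char_std_normal_distribution unfolding char_def by metis
 have c: "integrable std_normal_distribution (\<lambda>z. cos (b * z))" "(LINT z|std_normal_distribution. cos (b * z)) = exp (- b\<^sup>2 / 2)"
  using integrable_Re[OF i] integral_Re[OF i] ch by (simp_all add: Re_exp)
 have s: "integrable std_normal_distribution (\<lambda>z. sin (b * z))" "(LINT z|std_normal_distribution. sin (b * z)) = 0"
  using integrable_Im[OF i] integral_Im[OF i] ch by (simp_all add: Im_exp)
 show "integrable std_normal_distribution (\<lambda>z. cos (a + b * z))"
  unfolding cos_add using c(1) s(1) by simp
 show "(LINT z|std_normal_distribution. cos (a + b * z)) = cos a * exp (- b\<^sup>2 / 2)"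
  unfolding cos_add using c s by simp
qed

text \<open>The heat flow on the line of the even \<open>2 * \<pi>\<close>-periodic extension \<open>g (arccos (cos x))\<close>, written as a Gaussian average.
  Averages preserve suprema and Hoelder seminorms, which no bound on the spectral series would give.\<close>

definition neumann_flow :: "real \<Rightarrow> (real \<Rightarrow> real) \<Rightarrow> real \<Rightarrow> real" where
 "neumann_flow t g x = (LINT z|std_normal_distribution. g (arccos (cos (x + sqrt (2 * t) * z))))"

definition cosine_coeff :: "(real \<Rightarrow> real) \<Rightarrow> nat \<Rightarrow> real" where
 "cosine_coeff g k = (LI y. g y * cmode k y)"

lemma neumann_flow_integrable:
 fixes g :: "real \<Rightarrow> real"
 assumes g: "continuous_on {0..pi} g"
 shows "integrable std_normal_distribution (\<lambda>z. g (arccos (cos (x + c * z))))"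
proof -
 interpret S: real_distribution std_normal_distribution by (rule real_dist_normal_dist)
 have "compact (g ` {0..pi})" using g by (intro compact_continuous_image) auto
 then obtain B where B: "\<forall>x\<in>{0..pi}. \<bar>g x\<bar> \<le> B"
  using compact_imp_bounded[of "g ` {0..pi}"] unfolding bounded_iff by auto
 have "continuous_on {-1..1} (\<lambda>c. g (arccos c))"
  by (rule continuous_on_compose2[OF g continuous_on_arccos']) (auto simp: arccos_lbound arccos_ubound)
 then have "continuous_on UNIV (\<lambda>z. g (arccos (cos (x + c * z))))"
  by (rule continuous_on_compose2) (auto intro!: continuous_intros)
 then have [measurable]: "(\<lambda>z. g (arccos (cos (x + c * z)))) \<in> borel_fun"
  by (rule borel_measurable_continuous_onI)
 show ?thesis
  by (rule S.integrable_const_bound[of _ B]) (use B in \<open>auto simp: arccos_lbound arccos_ubound\<close>)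
qed

lemma normal_expectation_bound:
 fixes f :: "real \<Rightarrow> real"
 assumes f: "integrable std_normal_distribution f" and b: "\<And>z. \<bar>f z\<bar> \<le> B"
 shows "\<bar>LINT z|std_normal_distribution. f z\<bar> \<le> B"
proof -
 interpret S: real_distribution std_normal_distribution by (rule real_dist_normal_dist)
 have "\<bar>LINT z|std_normal_distribution. f z\<bar> \<le> (LINT z|std_normal_distribution. \<bar>f z\<bar>)"
  using integral_norm_bound[of std_normal_distribution f] by simp
 also have "\<dots> \<le> (LINT z|std_normal_distribution. B)" using f b by (intro integral_mono) auto
 also have "\<dots> = B" using S.prob_space by simp
 finally show ?thesis .
qed

lemma set_integral_abs_bound:
 fixes f :: "real \<Rightarrow> real"
 assumes f: "integrable_I f" and b: "\<And>y. y \<in> Ipi \<Longrightarrow> \<bar>f y\<bar> \<le> B"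
 shows "\<bar>LI y. f y\<bar> \<le> pi * B"
proof -
 have "\<bar>LI y. f y\<bar> \<le> (LI y. \<bar>f y\<bar>)"
  using set_integral_norm_bound[OF f] by simp
 also have "\<dots> \<le> (LI y. B)"
 proof (rule set_integral_mono[OF set_integrable_abs[OF f]])
  show "integrable_I (\<lambda>y. B)" by (intro set_integrable_continuous continuous_intros)
 qed (use b in auto)
 also have "\<dots> = pi * B" by (simp add: set_lebesgue_integral_def)
 finally show ?thesis .
qed

lemma cosine_coeff_cos:
 "cosine_coeff (\<lambda>y. cos (real k * y)) j = (if k = Suc j then sqrt (2 / pi) * (pi / 2) else 0)"
proof -
 have e: "cos (real k * y) * cmode j y = sqrt (2 / pi) / 2 * cos (of_int (int k - int (Suc j)) * y)
  + sqrt (2 / pi) / 2 * cos (of_int (int k + int (Suc j)) * y)" for y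
 proof -
  have "cos (real k * y) * cos (real (Suc j) * y) = (cos (real k * y - real (Suc j) * y) + cos (real k * y + real (Suc j) * y)) / 2"
   by (rule cos_times_cos)
  moreover have "of_int (int k - int (Suc j)) * y = real k * y - real (Suc j) * y"
   "of_int (int k + int (Suc j)) * y = real k * y + real (Suc j) * y" by (simp_all add: algebra_simps)
  moreover have "cos (real k * y) * cmode j y = sqrt (2 / pi) * (cos (real k * y) * cos (real (Suc j) * y))"
   unfolding neumann_mode_def by simp
  ultimately show ?thesis by (simp only:) (simp add: field_simps)
 qed
 have i: "integrable_I (\<lambda>y. sqrt (2 / pi) / 2 * cos (of_int n * y))" for n :: int
  by (rule set_integrable_mult_right) (rule integral_cos_multiple)
 have "cosine_coeff (\<lambda>y. cos (real k * y)) j =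
  sqrt (2 / pi) / 2 * (LI y. cos (of_int (int k - int (Suc j)) * y))
  + sqrt (2 / pi) / 2 * (LI y. cos (of_int (int k + int (Suc j)) * y))"
  unfolding cosine_coeff_def e set_integral_add(2)[OF i i] set_integral_mult_right ..
 then show ?thesis unfolding integral_cos_multiple(2) by auto
qed

text \<open>Both sides agree for cosines, hence for polynomials in \<open>cos\<close>, and both depend continuously on \<open>g\<close> in the uniform norm.\<close>

lemma neumann_flow_series:
 assumes g: "continuous_on {0..pi} g" and t: "0 < t"
 shows "neumann_flow t g x = (LI y. g y) / pi
  + (\<Sum>k. decay k t * (cosine_coeff g k * cmode k x))"
proof -
 define R where "R g = (LI y. g y) / pi
  + (\<Sum>k. decay k t * (cosine_coeff g k * cmode k x))" for g
 define E where "E = (\<Sum>k. decay k t)"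
 have Es: "summable (\<lambda>k. decay k t)" using summable_decay[OF t, of 0] by simp
 have i1: "integrable_I g" if "continuous_on {0..pi} g" for g :: "real \<Rightarrow> real"
  using that by (rule set_integrable_continuous)
 have i2: "integrable_I (\<lambda>y. g y * cmode k y)" if "continuous_on {0..pi} g" for g k
  using that by (intro set_integrable_continuous continuous_intros)
 have cb: "\<bar>cosine_coeff g k * cmode k x\<bar> \<le> pi * B"
  if "continuous_on {0..pi} g" "\<And>y. y \<in> Ipi \<Longrightarrow> \<bar>g y\<bar> \<le> B" for g k B
  unfolding cosine_coeff_def using abs_mult_mode_le(2) that(2)
  by (intro abs_mult_mode_le set_integral_abs_bound i2 that(1)) auto
 have bd: "\<exists>B. \<forall>y\<in>{0..pi}. \<bar>g y\<bar> \<le> B" if "continuous_on {0..pi} g" for g :: "real \<Rightarrow> real"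
  using compact_imp_bounded[OF compact_continuous_image[OF that compact_Icc]] unfolding bounded_iff by auto
 have sm: "summable (\<lambda>k. decay k t * (cosine_coeff g k * cmode k x))"
  if c: "continuous_on {0..pi} g" for g
 proof -
  obtain B where B: "\<forall>y\<in>{0..pi}. \<bar>g y\<bar> \<le> B" using bd[OF c] by blast
  show ?thesis using cb[OF c, of B] B by (intro summable_decay_exp(2)[OF t, of 0]) auto
 qed
 have Radd: "R (\<lambda>y. f y + g y) = R f + R g" if c: "continuous_on {0..pi} f" "continuous_on {0..pi} g" for f g
 proof -
  have "cosine_coeff (\<lambda>y. f y + g y) k = cosine_coeff f k + cosine_coeff g k" for k
   unfolding cosine_coeff_def distrib_right by (rule set_integral_add(2)[OF i2[OF c(1)] i2[OF c(2)]])
  then have "(\<Sum>k. decay k t * (cosine_coeff (\<lambda>y. f y + g y) k * cmode k x))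
   = (\<Sum>k. decay k t * (cosine_coeff f k * cmode k x))
   + (\<Sum>k. decay k t * (cosine_coeff g k * cmode k x))"
   unfolding suminf_add[OF sm[OF c(1)] sm[OF c(2)]] by (simp add: distrib_left distrib_right)
  then show ?thesis unfolding R_def set_integral_add(2)[OF i1[OF c(1)] i1[OF c(2)]] by (simp add: add_divide_distrib)
 qed
 have Rscale: "R (\<lambda>y. c * g y) = c * R g" if "continuous_on {0..pi} g" for c g
 proof -
  have "cosine_coeff (\<lambda>y. c * g y) k = c * cosine_coeff g k" for k
   unfolding cosine_coeff_def mult.assoc by (rule set_integral_mult_right)
  then have "(\<Sum>k. decay k t * (cosine_coeff (\<lambda>y. c * g y) k * cmode k x))
   = c * (\<Sum>k. decay k t * (cosine_coeff g k * cmode k x))"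
   unfolding suminf_mult[OF sm[OF that], symmetric] by (simp add: mult_ac)
  then show ?thesis unfolding R_def by (simp add: distrib_left)
 qed
 have Rb: "\<bar>R g\<bar> \<le> (1 + pi * E) * B" if c: "continuous_on {0..pi} g" and B: "\<And>y. y \<in> Ipi \<Longrightarrow> \<bar>g y\<bar> \<le> B" for g B
 proof -
  have "\<bar>LI y. g y\<bar> \<le> pi * B" by (rule set_integral_abs_bound[OF i1[OF c] B])
  then have a: "\<bar>(LI y. g y) / pi\<bar> \<le> B" by (simp add: field_simps)
  have tb: "norm (decay k t * (cosine_coeff g k * cmode k x)) \<le> decay k t * (pi * B)" for k
   using cb[OF c B, of k] by (simp add: abs_mult)
  have "norm (\<Sum>k. decay k t * (cosine_coeff g k * cmode k x)) \<le> (\<Sum>k. decay k t * (pi * B))"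
   by (rule norm_suminf_le[OF tb summable_mult2[OF Es]])
  also have "\<dots> = E * (pi * B)" unfolding E_def by (rule suminf_mult2[OF Es, symmetric])
  finally have b: "\<bar>\<Sum>k. decay k t * (cosine_coeff g k * cmode k x)\<bar> \<le> E * (pi * B)"
   unfolding real_norm_def .
  have "\<bar>R g\<bar> \<le> B + E * (pi * B)"
   unfolding R_def by (rule order_trans[OF abs_triangle_ineq add_mono[OF a b]])
  then show ?thesis by (simp add: algebra_simps)
 qed
 define Q where "Q g \<longleftrightarrow> continuous_on {0..pi} g \<and> neumann_flow t g x = R g" for g
 have Nadd: "neumann_flow t (\<lambda>y. f y + g y) x = neumann_flow t f x + neumann_flow t g x"
  if "continuous_on {0..pi} f" "continuous_on {0..pi} g" for f g
  unfolding neumann_flow_def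
  by (rule Bochner_Integration.integral_add[OF neumann_flow_integrable[OF that(1)] neumann_flow_integrable[OF that(2)]])
 have Qp: "Q (\<lambda>y. p (cos y))" if p: "real_polynomial_function p" for p
 proof (rule cos_poly_induct[OF _ _ _ p])
  fix f g assume "Q f" "Q g"
  then show "Q (\<lambda>y. f y + g y)" unfolding Q_def by (auto intro!: continuous_intros simp: Nadd Radd)
 next
  fix c g assume "Q g"
  then show "Q (\<lambda>y. c * g y)" unfolding Q_def by (auto intro!: continuous_intros simp: Rscale neumann_flow_def)
 next
  fix k
  have "neumann_flow t (\<lambda>y. cos (real k * y)) x = (LINT z|std_normal_distribution. cos (real k * x + (real k * sqrt (2 * t)) * z))"
   unfolding neumann_flow_def cos_mult_arccos_cos by (simp add: algebra_simps)
  also have "\<dots> = cos (real k * x) * exp (- (real k)\<^sup>2 * t)"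
   unfolding normal_expectation_cos(2) using t by (simp add: power_mult_distrib)
  also have "\<dots> = R (\<lambda>y. cos (real k * y))"
  proof (cases k)
   case 0
   have "(LI y. (1::real)) = pi" by (simp add: set_lebesgue_integral_def)
   moreover have "cosine_coeff (\<lambda>y. 1) j = 0" for j using cosine_coeff_cos[of 0 j] by simp
   ultimately show ?thesis unfolding R_def 0 by simp
  next
   case (Suc m)
   have "(\<Sum>j. decay j t * (cosine_coeff (\<lambda>y. cos (real k * y)) j * cmode j x))
    = (\<Sum>j\<in>{m}. decay j t * (cosine_coeff (\<lambda>y. cos (real k * y)) j * cmode j x))"
    unfolding cosine_coeff_cos by (rule suminf_finite) (auto simp: Suc)
   also have "\<dots> = exp (- (real k)\<^sup>2 * t) * (cosine_coeff (\<lambda>y. cos (real k * y)) m * neumann_mode k x)"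
    by (simp add: Suc)
   also have "\<dots> = exp (- (real k)\<^sup>2 * t) * ((sqrt (2 / pi) * sqrt (2 / pi)) * (pi / 2) * cos (real k * x))"
    unfolding cosine_coeff_cos neumann_mode_def if_P[OF Suc] by (simp only: mult_ac)
   also have "\<dots> = exp (- (real k)\<^sup>2 * t) * cos (real k * x)" unfolding sqrt_2_pi(3) by simp
   finally show ?thesis unfolding R_def using integral_cos_multiple(2)[of "int k"] Suc by simp
  qed
  finally show "Q (\<lambda>y. cos (real k * y))" unfolding Q_def by (auto intro!: continuous_intros)
 qed
 have "neumann_flow t g x = R g"
 proof (rule ccontr)
  assume n: "neumann_flow t g x \<noteq> R g"
  have E0: "0 \<le> E" unfolding E_def by (rule suminf_nonneg[OF Es]) simp
  define e where "e = \<bar>neumann_flow t g x - R g\<bar> / (2 * (2 + pi * E))"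
  have dp: "0 < 2 + pi * E" using E0 by (simp add: add_pos_nonneg)
  have e: "e > 0" using n dp unfolding e_def by simp
  obtain p where p: "real_polynomial_function p" "\<And>y. y \<in> {0..pi} \<Longrightarrow> \<bar>g y - p (cos y)\<bar> < e"
   using cos_poly_density[OF g e] by blast
  define d where "d y = g y - p (cos y)" for y
  have pc: "continuous_on {0..pi} (\<lambda>y. p (cos y))" by (rule continuous_on_cos_poly[OF p(1)])
  have dc: "continuous_on {0..pi} d" unfolding d_def by (intro continuous_intros g pc)
  have gd: "g = (\<lambda>y. p (cos y) + d y)" unfolding d_def by simp
  have "neumann_flow t g x - R g = neumann_flow t d x - R d"
   using Qp[OF p(1)] Nadd[OF pc dc] Radd[OF pc dc] unfolding gd[symmetric] Q_def by simp
  moreover have "\<bar>d (arccos (cos w))\<bar> \<le> e" for w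
   using p(2)[of "arccos (cos w)"] by (simp add: d_def arccos_lbound arccos_ubound)
  then have "\<bar>neumann_flow t d x\<bar> \<le> e"
   unfolding neumann_flow_def by (intro normal_expectation_bound neumann_flow_integrable[OF dc])
  moreover have "\<bar>R d\<bar> \<le> (1 + pi * E) * e" using p(2) by (intro Rb[OF dc]) (auto simp: d_def intro!: less_imp_le)
  ultimately have "\<bar>neumann_flow t g x - R g\<bar> \<le> (2 + pi * E) * e" by (simp add: algebra_simps)
  also have "\<dots> = \<bar>neumann_flow t g x - R g\<bar> / 2" unfolding e_def using dp by (simp add: field_simps)
  finally show False using n by simp
 qed
 then show ?thesis unfolding R_def .
qed

lemma DERIV_neumann_series:
 assumes sm: "summable (\<lambda>k. real (Suc k) * \<bar>c k\<bar>)"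
 shows "((\<lambda>x. \<Sum>k. c k * cmode k x) has_real_derivative
   (\<Sum>k. c k * (- real (Suc k) * smode k x))) (at x)"
proof -
 have b: "\<bar>c k * (- real (Suc k) * smode k x)\<bar> \<le> real (Suc k) * \<bar>c k\<bar>" for k x
  using mult_left_mono[OF abs_mode_le(1)[of "Suc k" x], of "real (Suc k) * \<bar>c k\<bar>"]
  by (simp add: abs_mult mult_ac del: of_nat_Suc)
 have u: "uniformly_convergent_on UNIV (\<lambda>n x. \<Sum>k<n. c k * (- real (Suc k) * smode k x))"
  by (rule Weierstrass_m_test'[OF _ sm]) (use b in simp)
 have s0: "summable (\<lambda>k. c k * cmode k 0)"
 proof (rule summable_comparison_test'[OF sm, of 0])
  fix k
  have "\<bar>c k * cmode k 0\<bar> \<le> \<bar>c k\<bar>" by (rule abs_mult_mode_le) simp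
  also have "\<dots> \<le> real (Suc k) * \<bar>c k\<bar>" using mult_right_mono[of 1 "real (Suc k)" "\<bar>c k\<bar>"] by simp
  finally show "norm (c k * cmode k 0) \<le> real (Suc k) * \<bar>c k\<bar>" by simp
 qed
 have d: "((\<lambda>x. c k * cmode k x) has_real_derivative c k * (- real (Suc k) * smode k x)) (at x within UNIV)" for k x
  by (rule DERIV_cmult[OF DERIV_modes(2)])
 show ?thesis
  using has_field_derivative_series'(2)[of UNIV "\<lambda>k x. c k * cmode k x", OF _ d u _ s0] by simp
qed

lemma DERIV_time_series:
 assumes b: "\<And>k. \<bar>c k\<bar> \<le> B * real (Suc k) powr p" and p: "0 \<le> p" and t: "0 < t"
 shows "((\<lambda>t. \<Sum>k. decay k t * c k) has_real_derivative
  (\<Sum>k. decay k t * (- (real (Suc k))\<^sup>2 * c k))) (at t)"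
proof -
 define t0 where "t0 = t / 2"
 have t0: "0 < t0" "t0 < t" using t unfolding t0_def by auto
 have B0: "0 \<le> B" using order_trans[OF abs_ge_zero b[of 0]] by simp
 have b2: "\<bar>- (real (Suc k))\<^sup>2 * c k\<bar> \<le> B * real (Suc k) powr (p + 2)" for k
 proof -
  have "\<bar>- (real (Suc k))\<^sup>2 * c k\<bar> \<le> (real (Suc k))\<^sup>2 * (B * real (Suc k) powr p)"
   using mult_left_mono[OF b[of k], of "(real (Suc k))\<^sup>2"] by (simp add: abs_mult)
  also have "\<dots> = B * real (Suc k) powr (p + 2)" by (simp add: powr_add)
  finally show ?thesis .
 qed
 have sm: "summable (\<lambda>k. B * (real (Suc k) powr (p + 2) * decay k t0))"
  using p by (intro summable_mult summable_decay t0) auto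
 have u: "uniformly_convergent_on {t0<..} (\<lambda>n t. \<Sum>k<n. decay k t * (- (real (Suc k))\<^sup>2 * c k))"
 proof (rule Weierstrass_m_test'[OF _ sm])
  fix k t assume "t \<in> {t0<..}"
  then have "\<bar>decay k t * (- (real (Suc k))\<^sup>2 * c k)\<bar> \<le> decay k t0 * (B * real (Suc k) powr (p + 2))"
   unfolding abs_mult[of "exp _"] using b2[of k] by (intro mult_mono) auto
  then show "norm (decay k t * (- (real (Suc k))\<^sup>2 * c k)) \<le> B * (real (Suc k) powr (p + 2) * decay k t0)"
   by (simp add: mult_ac)
 qed
 have s0: "summable (\<lambda>k. decay k t * c k)"
  using b by (intro summable_decay_exp(2)[OF t p]) auto
 have d: "((\<lambda>t. decay k t * c k) has_real_derivative
   decay k s * (- (real (Suc k))\<^sup>2 * c k)) (at s within {t0<..})" for k s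
  by (auto intro!: derivative_eq_intros)
 have ti: "t \<in> interior {t0<..}" using t0 by (simp add: interior_open)
 have tm: "t \<in> {t0<..}" using t0 by simp
 show ?thesis
  using has_field_derivative_series'(2)[of "{t0<..}" "\<lambda>k t. decay k t * c k", OF _ d u tm s0 ti]
  by simp
qed

definition heat_flow_x :: "(real \<Rightarrow> real) \<Rightarrow> real \<Rightarrow> real \<Rightarrow> real" where
 "heat_flow_x v t x = (\<Sum>k. decay k t * (sine_coeff v k * (real (Suc k) * cmode k x)))"

lemma powr_abs_le_trans:
 fixes z w g :: real
 assumes "\<bar>z\<bar> \<le> w" "0 \<le> g" "0 \<le> H"
 shows "H * \<bar>z\<bar> powr g \<le> H * w powr g"
 using assms by (intro mult_left_mono powr_mono2) auto

text \<open>The Dirichlet datum \<open>v\<close> vanishes at both ends, so the derivative of its heat flow is the Neumann heat flow of \<open>g = v'\<close>.\<close>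

locale initial_datum =
 fixes v g :: "real \<Rightarrow> real" and G H \<gamma> :: real
 assumes v: "continuous_on {0..pi} v" "v 0 = 0" "v pi = 0"
  and dv: "\<And>x. x \<in> Ipi \<Longrightarrow> (v has_real_derivative g x) (at x)"
  and g: "continuous_on {0..pi} g"
  and gb: "\<And>x. x \<in> {0..pi} \<Longrightarrow> \<bar>g x\<bar> \<le> G"
  and gh: "\<And>x y. x \<in> {0..pi} \<Longrightarrow> y \<in> {0..pi} \<Longrightarrow> \<bar>g x - g y\<bar> \<le> H * \<bar>x - y\<bar> powr \<gamma>"
  and gam: "0 < \<gamma>" "\<gamma> \<le> 1" and H: "0 \<le> H"
begin

lemma vi: "integrable_I v"
 by (rule set_integrable_continuous[OF v(1)])

lemma gi: "integrable_I g"
 by (rule set_integrable_continuous[OF g])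

lemma integral_g: "(LI y. g y) = 0"
 using set_integral_FTC_interior[OF pi_ge_zero v(1) dv gi] v by simp

lemma cosine_coeff_g: "cosine_coeff g k = real (Suc k) * sine_coeff v k"
proof -
 have "(LI y. g y * cmode k y - real (Suc k) * (v y * smode k y))
  = v pi * cmode k pi - v 0 * cmode k 0"
 proof (rule set_integral_FTC_interior[OF pi_ge_zero])
  fix x :: real assume "x \<in> Ipi"
  from DERIV_mult[OF dv[OF this] DERIV_modes(2)[of "Suc k" x]]
  show "((\<lambda>x. v x * cmode k x) has_real_derivative g x * cmode k x - real (Suc k) * (v x * smode k x)) (at x)"
   by (simp add: algebra_simps)
 qed (auto intro!: continuous_intros v g set_integrable_continuous)
 moreover have "integrable_I (\<lambda>y. g y * cmode k y)"
  "integrable_I (\<lambda>y. real (Suc k) * (v y * smode k y))"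
  by (auto intro!: continuous_intros v g set_integrable_continuous)
 ultimately show ?thesis
  unfolding cosine_coeff_def sine_coeff_def using v(2,3) by (simp add: set_integral_diff(2) set_integral_mult_right[symmetric] del: set_integral_mult_right)
qed

lemma coeff_bound: "\<exists>B\<ge>0. \<forall>k. \<bar>sine_coeff v k\<bar> \<le> B"
 using abs_sine_coeff_le[OF vi] by (metis abs_ge_zero order_trans)

lemma flow_x_eq:
 assumes t: "0 < t"
 shows "heat_flow_x v t x = neumann_flow t g x"
 unfolding neumann_flow_series[OF g t] integral_g cosine_coeff_g heat_flow_x_def by (simp add: mult_ac)

lemma DERIV_heat_flow:
 assumes t: "0 < t"
 shows "((\<lambda>x. heat_flow v t x) has_real_derivative heat_flow_x v t x) (at x)"
proof -
 obtain B where B: "B \<ge> 0" "\<And>k. \<bar>sine_coeff v k\<bar> \<le> B" using coeff_bound by blast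
 have "\<bar>real (Suc k) * sine_coeff v k\<bar> \<le> B * real (Suc k) powr 1" for k
  using mult_left_mono[OF B(2)[of k], of "real (Suc k)"] by (simp add: abs_mult mult.commute)
 from summable_decay_exp(1)[OF t _ this]
 have "summable (\<lambda>k. real (Suc k) * \<bar>decay k t * sine_coeff v k\<bar>)"
  by (simp add: abs_mult mult_ac)
 from DERIV_dirichlet_series[OF this, of x] show ?thesis
  unfolding heat_flow_def heat_flow_x_def by (simp add: mult.assoc)
qed

lemma flow_x_bound:
 assumes t: "0 < t"
 shows "\<bar>heat_flow_x v t x\<bar> \<le> G"
 unfolding flow_x_eq[OF t] neumann_flow_def
 by (intro normal_expectation_bound neumann_flow_integrable[OF g] gb) (auto simp: arccos_lbound arccos_ubound)

lemma flow_x_holder: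
 assumes t: "0 < t"
 shows "\<bar>heat_flow_x v t x - heat_flow_x v t y\<bar> \<le> H * \<bar>x - y\<bar> powr \<gamma>"
proof -
 let ?c = "sqrt (2 * t)"
 have "heat_flow_x v t x - heat_flow_x v t y
  = (LINT z|std_normal_distribution. g (arccos (cos (x + ?c * z))) - g (arccos (cos (y + ?c * z))))"
  unfolding flow_x_eq[OF t] neumann_flow_def
  by (rule Bochner_Integration.integral_diff[symmetric]) (rule neumann_flow_integrable[OF g])+
 also have "\<bar>\<dots>\<bar> \<le> H * \<bar>x - y\<bar> powr \<gamma>"
 proof (rule normal_expectation_bound)
  show "integrable std_normal_distribution (\<lambda>z. g (arccos (cos (x + ?c * z))) - g (arccos (cos (y + ?c * z))))"
   by (rule Bochner_Integration.integrable_diff) (rule neumann_flow_integrable[OF g])+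
  fix z
  have "\<bar>g (arccos (cos (x + ?c * z))) - g (arccos (cos (y + ?c * z)))\<bar>
   \<le> H * \<bar>arccos (cos (x + ?c * z)) - arccos (cos (y + ?c * z))\<bar> powr \<gamma>"
   by (rule gh) (auto simp: arccos_lbound arccos_ubound)
  also have "\<dots> \<le> H * \<bar>x - y\<bar> powr \<gamma>"
   using arccos_cos_lipschitz[of "x + ?c * z" "y + ?c * z"] gam H by (intro powr_abs_le_trans) auto
  finally show "\<bar>g (arccos (cos (x + ?c * z))) - g (arccos (cos (y + ?c * z)))\<bar> \<le> H * \<bar>x - y\<bar> powr \<gamma>" .
 qed
 finally show ?thesis .
qed

lemma flow_boundary: "heat_flow v t 0 = 0" "heat_flow v t pi = 0"
 unfolding heat_flow_def mode_boundary by simp_all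

lemma flow_bound:
 assumes t: "0 < t" and x: "x \<in> {0..pi}"
 shows "\<bar>heat_flow v t x\<bar> \<le> G * pi"
proof -
 have "norm (heat_flow v t x - heat_flow v t 0) \<le> G * norm (x - 0)"
  by (rule field_differentiable_bound[of UNIV _ "heat_flow_x v t"])
   (use DERIV_heat_flow[OF t] flow_x_bound[OF t] in auto)
 also have "\<dots> \<le> G * pi" using x gb[of 0] by (intro mult_left_mono) auto
 finally show ?thesis by (simp add: flow_boundary)
qed

lemma flow_continuous: "continuous_on ({0<..} \<times> UNIV) (\<lambda>(t, x). heat_flow_x v t x)"
proof -
 obtain B where B: "B \<ge> 0" "\<And>k. \<bar>sine_coeff v k\<bar> \<le> B" using coeff_bound by blast
 show ?thesis unfolding heat_flow_x_def
 proof (rule continuous_on_decay_series[of _ _ 1 B])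
  fix k and x :: real
  have "\<bar>sine_coeff v k\<bar> * \<bar>real (Suc k) * cmode k x\<bar> \<le> B * real (Suc k)"
   using B abs_mult_mode_le(2)[of "real (Suc k)" "real (Suc k)" "Suc k" x] by (intro mult_mono) auto
  then show "\<bar>sine_coeff v k * (real (Suc k) * cmode k x)\<bar> \<le> B * real (Suc k) powr 1"
   by (simp add: abs_mult)
 qed (auto intro!: continuous_intros)
qed

text \<open>The time regularity: \<open>\<Psi>\<close> is an antiderivative of the flow in \<open>x\<close>. Its increment over
 \<open>{x - \<delta>..x + \<delta>}\<close> is \<open>2 * \<delta>\<close> times the flow up to an error of order \<open>\<delta> powr (2 + \<gamma>)\<close>, since the
 first-order term cancels by symmetry, and it changes in time at the rate
 \<open>heat_flow_x v t (x + \<delta>) - heat_flow_x v t (x - \<delta>)\<close>.\<close>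

lemma flow_time_holder_aux:
 assumes s: "0 < s" "s < t"
 shows "\<bar>heat_flow v t x - heat_flow v s x\<bar> \<le> 3 * H * (t - s) powr ((1 + \<gamma>) / 2)"
proof -
 define \<Psi> where "\<Psi> r y = (\<Sum>k. decay k r * ((- sine_coeff v k / real (Suc k)) * cmode k y))" for r y
 obtain B where B: "B \<ge> 0" "\<And>k. \<bar>sine_coeff v k\<bar> \<le> B" using coeff_bound by blast
 have cb: "\<bar>- sine_coeff v k / real (Suc k)\<bar> \<le> B" for k
 proof -
  have "\<bar>sine_coeff v k\<bar> / real (Suc k) \<le> B / 1" using B by (intro frac_le) auto
  then show ?thesis by (simp add: abs_divide)
 qed
 have Psi_y: "(\<Psi> r has_real_derivative heat_flow v r y) (at y)" if r: "0 < r" for r y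
 proof -
  have e: "real (Suc k) * \<bar>decay k r * (- sine_coeff v k / real (Suc k))\<bar> = \<bar>decay k r * sine_coeff v k\<bar>" for k
   by (simp add: abs_mult abs_divide)
  have "summable (\<lambda>k. \<bar>decay k r * sine_coeff v k\<bar>)"
   using B by (intro summable_decay_exp(1)[OF r, of 0 _ B]) auto
  from DERIV_neumann_series[OF this[folded e], of y]
  have "((\<lambda>x. \<Sum>k. decay k r * (- sine_coeff v k / real (Suc k)) * cmode k x) has_real_derivative
   (\<Sum>k. decay k r * (- sine_coeff v k / real (Suc k)) * (- real (Suc k) * smode k y))) (at y)" .
  moreover have "decay k r * (- sine_coeff v k / real (Suc k)) * (- real (Suc k) * smode k y)
   = decay k r * (sine_coeff v k * smode k y)" for k
   by (simp del: of_nat_Suc)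
  ultimately show ?thesis
   unfolding heat_flow_def \<Psi>_def[abs_def] by (simp only: mult.assoc)
 qed
 have Psi_t: "((\<lambda>r. \<Psi> r y) has_real_derivative heat_flow_x v r y) (at r)" if r: "0 < r" for r y
 proof -
  have "\<bar>(- sine_coeff v k / real (Suc k)) * cmode k y\<bar> \<le> B * real (Suc k) powr 0" for k
   using abs_mult_mode_le(2)[OF cb] by simp
  from DERIV_time_series[OF this _ r] show ?thesis
   unfolding heat_flow_x_def \<Psi>_def by (simp add: power2_eq_square mult_ac)
 qed
 define \<delta> where "\<delta> = sqrt (t - s)"
 have d: "\<delta> > 0" "\<delta> * \<delta> = t - s" using s unfolding \<delta>_def by auto
 define K where "K = H * (2 * \<delta>) powr \<gamma>"
 have K: "0 \<le> K" unfolding K_def using H by simp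
 have osc: "\<bar>heat_flow_x v r (x + z) - heat_flow_x v r (x - z)\<bar> \<le> K" if r: "0 < r" and z: "0 \<le> z" "z \<le> \<delta>" for r z
 proof -
  have "\<bar>heat_flow_x v r (x + z) - heat_flow_x v r (x - z)\<bar> \<le> H * \<bar>x + z - (x - z)\<bar> powr \<gamma>"
   by (rule flow_x_holder[OF r])
  also have "\<dots> \<le> K" unfolding K_def using z gam H by (intro powr_abs_le_trans) auto
  finally show ?thesis .
 qed
 have sym: "\<bar>heat_flow v r (x + z) + heat_flow v r (x - z) - 2 * heat_flow v r x\<bar> \<le> K * \<delta>" if r: "0 < r" and z: "0 \<le> z" "z \<le> \<delta>" for r z
 proof -
  define \<phi> where "\<phi> z = heat_flow v r (x + z) + heat_flow v r (x - z)" for z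
  have "norm (\<phi> z - \<phi> 0) \<le> K * norm (z - 0)"
  proof (rule field_differentiable_bound[of "{0..z}" _ "\<lambda>z. heat_flow_x v r (x + z) - heat_flow_x v r (x - z)"])
   fix w assume w: "w \<in> {0..z}"
   have "(\<phi> has_real_derivative heat_flow_x v r (x + w) * 1 + heat_flow_x v r (x - w) * (- 1)) (at w)"
    unfolding \<phi>_def[abs_def]
    by (intro DERIV_add DERIV_chain2[OF DERIV_heat_flow[OF r]]) (auto intro!: derivative_eq_intros)
   then show "(\<phi> has_real_derivative heat_flow_x v r (x + w) - heat_flow_x v r (x - w)) (at w within {0..z})"
    by (auto intro: DERIV_subset)
   show "norm (heat_flow_x v r (x + w) - heat_flow_x v r (x - w)) \<le> K" using osc[OF r, of w] w z by simp
  qed (use z in auto)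
  also have "\<dots> \<le> K * \<delta>" using z K by (intro mult_left_mono) auto
  finally show ?thesis unfolding \<phi>_def by simp
 qed
 have avg: "\<bar>\<Psi> r (x + \<delta>) - \<Psi> r (x - \<delta>) - 2 * \<delta> * heat_flow v r x\<bar> \<le> K * \<delta> * \<delta>" if r: "0 < r" for r
 proof -
  define \<phi> where "\<phi> z = \<Psi> r (x + z) - \<Psi> r (x - z) - 2 * z * heat_flow v r x" for z
  have "norm (\<phi> \<delta> - \<phi> 0) \<le> (K * \<delta>) * norm (\<delta> - 0)"
  proof (rule field_differentiable_bound[of "{0..\<delta>}" _ "\<lambda>z. heat_flow v r (x + z) + heat_flow v r (x - z) - 2 * heat_flow v r x"])
   fix w assume w: "w \<in> {0..\<delta>}"
   have "(\<phi> has_real_derivative heat_flow v r (x + w) * 1 - heat_flow v r (x - w) * (- 1) - 2 * heat_flow v r x) (at w)"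
    unfolding \<phi>_def[abs_def]
    by (intro DERIV_diff DERIV_chain2[OF Psi_y[OF r]]) (auto intro!: derivative_eq_intros)
   then show "(\<phi> has_real_derivative heat_flow v r (x + w) + heat_flow v r (x - w) - 2 * heat_flow v r x) (at w within {0..\<delta>})"
    by (auto intro: DERIV_subset)
   show "norm (heat_flow v r (x + w) + heat_flow v r (x - w) - 2 * heat_flow v r x) \<le> K * \<delta>" using sym[OF r, of w] w by simp
  qed (use d in auto)
  then show ?thesis using d unfolding \<phi>_def by simp
 qed
 have flux: "\<bar>(\<Psi> t (x + \<delta>) - \<Psi> t (x - \<delta>)) - (\<Psi> s (x + \<delta>) - \<Psi> s (x - \<delta>))\<bar> \<le> K * \<delta> * \<delta>"
 proof -
  have "norm ((\<Psi> t (x + \<delta>) - \<Psi> t (x - \<delta>)) - (\<Psi> s (x + \<delta>) - \<Psi> s (x - \<delta>))) \<le> K * norm (t - s)"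
  proof (rule field_differentiable_bound[of "{s..t}" "\<lambda>r. \<Psi> r (x + \<delta>) - \<Psi> r (x - \<delta>)" "\<lambda>r. heat_flow_x v r (x + \<delta>) - heat_flow_x v r (x - \<delta>)"])
   fix r assume r: "r \<in> {s..t}"
   show "((\<lambda>r. \<Psi> r (x + \<delta>) - \<Psi> r (x - \<delta>)) has_real_derivative heat_flow_x v r (x + \<delta>) - heat_flow_x v r (x - \<delta>)) (at r within {s..t})"
    using r s by (intro DERIV_diff DERIV_subset[OF Psi_t]) auto
   show "norm (heat_flow_x v r (x + \<delta>) - heat_flow_x v r (x - \<delta>)) \<le> K"
    using osc[of r \<delta>] r s d by simp
  qed (use s in auto)
  then show ?thesis using d(2) s by (simp add: mult.assoc)
 qed
 have "\<bar>2 * \<delta> * heat_flow v t x - 2 * \<delta> * heat_flow v s x\<bar> \<le> 3 * (K * \<delta> * \<delta>)"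
  using avg[of t] avg[of s] flux s by linarith
 moreover have "2 * \<delta> * heat_flow v t x - 2 * \<delta> * heat_flow v s x = 2 * \<delta> * (heat_flow v t x - heat_flow v s x)"
  by (simp only: right_diff_distrib)
 ultimately have "2 * \<delta> * \<bar>heat_flow v t x - heat_flow v s x\<bar> \<le> 2 * \<delta> * ((3/2) * K * \<delta>)"
  using d(1) by (simp only: abs_mult) simp
 then have "\<bar>heat_flow v t x - heat_flow v s x\<bar> \<le> (3/2) * K * \<delta>" using d(1) by simp
 also have "\<dots> = (3/2) * H * 2 powr \<gamma> * (\<delta> powr \<gamma> * \<delta> powr 1)"
  unfolding K_def using d(1) by (simp add: powr_mult)
 also have "\<delta> powr \<gamma> * \<delta> powr 1 = (t - s) powr ((1 + \<gamma>) / 2)"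
  using s unfolding powr_add[symmetric] \<delta>_def by (simp add: powr_half_sqrt[symmetric] powr_powr add.commute)
 finally have "\<bar>heat_flow v t x - heat_flow v s x\<bar> \<le> (3/2) * H * 2 powr \<gamma> * (t - s) powr ((1 + \<gamma>) / 2)" .
 also have "(3/2) * H * 2 powr \<gamma> * (t - s) powr ((1 + \<gamma>) / 2) \<le> (3/2) * H * 2 powr 1 * (t - s) powr ((1 + \<gamma>) / 2)"
  using gam H by (intro mult_right_mono mult_left_mono powr_mono) auto
 finally show ?thesis by simp
qed

end

section \<open>Integrability of a mild solution\<close>

text \<open>The values at the grid point to the right of \<open>x\<close> are measurable in \<open>t\<close> and converge as the grid is refined.\<close>

lemma measurable_caratheodory:
 fixes f :: "real \<Rightarrow> real \<Rightarrow> real"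
 assumes ct: "\<And>x. x \<in> Ipi \<Longrightarrow> continuous_on {0<..<T} (\<lambda>t. f t x)"
  and cx: "\<And>t. t \<in> {0<..<T} \<Longrightarrow> continuous_on Ipi (f t)"
 shows "(\<lambda>z. indicator ({0<..<T} \<times> Ipi) z * f (fst z) (snd z)) \<in> borel_fun"
proof -
 define F where "F n j t = (if real_of_int (j + 1) / real (Suc n) \<in> Ipi
   then indicator {0<..<T} t * f t (real_of_int (j + 1) / real (Suc n)) else 0)" for n and j :: int and t
 have [measurable]: "F n j \<in> borel_fun" for n j
 proof (cases "real_of_int (j + 1) / real (Suc n) \<in> Ipi")
  case True
  then show ?thesis
   using borel_measurable_continuous_on_indicator[OF _ ct[OF True]] unfolding F_def[abs_def] by simp
 next
  case False
  show ?thesis unfolding F_def[abs_def] if_not_P[OF False] by simp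
 qed
 define Q where "Q = {0<..<T} \<times> Ipi"
 have Qo: "open Q" unfolding Q_def by (intro open_Times) auto
 have [measurable]: "Q \<in> sets borel" using Qo by simp
 define g where "g n z = indicator Q z * F n \<lfloor>real (Suc n) * snd z\<rfloor> (fst z)" for n and z :: "real \<times> real"
 have gm: "g n \<in> borel_fun" for n
 proof -
  have "(\<lambda>z. F n \<lfloor>real (Suc n) * snd z\<rfloor> (fst z)) \<in> borel_measurable (borel :: (real \<times> real) measure)"
  proof (rule measurable_compose_countable[where g = "\<lambda>z::real \<times> real. \<lfloor>real (Suc n) * snd z\<rfloor>"])
   show "(\<lambda>z. F n i (fst z)) \<in> borel_measurable (borel :: (real \<times> real) measure)" for i by measurable
   show "(\<lambda>z. \<lfloor>real (Suc n) * snd z\<rfloor>) \<in> (borel :: (real \<times> real) measure) \<rightarrow>\<^sub>M count_space UNIV" by measurable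
  qed
  then show ?thesis unfolding g_def[abs_def] by measurable
 qed
 show ?thesis
 proof (rule borel_measurable_LIMSEQ_real[OF _ gm])
  fix z :: "real \<times> real"
  show "(\<lambda>n. g n z) \<longlonglongrightarrow> indicator ({0<..<T} \<times> Ipi) z * f (fst z) (snd z)"
  proof (cases "z \<in> Q")
   case False
   then show ?thesis unfolding g_def Q_def by simp
  next
   case True
   then obtain t x where z: "z = (t, x)" "t \<in> {0<..<T}" "x \<in> Ipi" unfolding Q_def by auto
   define r where "r n = real_of_int (\<lfloor>real (Suc n) * x\<rfloor> + 1) / real (Suc n)" for n
   have rb: "x < r n" "r n \<le> x + 1 / real (Suc n)" for n
   proof -
    have "real (Suc n) * x < of_int (\<lfloor>real (Suc n) * x\<rfloor> + 1)" "of_int (\<lfloor>real (Suc n) * x\<rfloor> + 1) \<le> real (Suc n) * x + 1"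
     by linarith+
    then have "x < r n" "r n \<le> (real (Suc n) * x + 1) / real (Suc n)"
     unfolding r_def by (simp_all only: pos_less_divide_eq of_nat_0_less_iff zero_less_Suc mult.commute divide_right_mono of_nat_0_le_iff)
    moreover have "(real (Suc n) * x + 1) / real (Suc n) = x + 1 / real (Suc n)"
     unfolding add_divide_distrib by (simp del: of_nat_Suc)
    ultimately show "x < r n" "r n \<le> x + 1 / real (Suc n)" by simp_all
   qed
   have "(\<lambda>n. x + 1 / real (Suc n)) \<longlonglongrightarrow> x + 0"
    by (intro tendsto_intros LIMSEQ_inverse_real_of_nat[unfolded inverse_eq_divide])
   then have rl: "r \<longlonglongrightarrow> x"
    using rb by (intro tendsto_sandwich[of "\<lambda>_. x" r sequentially "\<lambda>n. x + 1 / real (Suc n)"]) (auto intro!: always_eventually less_imp_le)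
   have ev: "\<forall>\<^sub>F n in sequentially. r n < pi" using rl z(3) by (auto dest: order_tendstoD(2))
   have "isCont (f t) x" using cx[OF z(2)] z(3) by (simp add: continuous_on_eq_continuous_at)
   then have "(\<lambda>n. f t (r n)) \<longlonglongrightarrow> f t x" using rl by (rule isCont_tendsto_compose)
   moreover have "\<forall>\<^sub>F n in sequentially. f t (r n) = g n z"
    using ev
   proof eventually_elim
    case (elim n)
    then have "r n \<in> Ipi" using rb(1)[of n] z(3) by auto
    then show ?case using True z unfolding g_def F_def r_def by simp
   qed
   ultimately show ?thesis using True z unfolding Q_def by (auto intro: Lim_transform_eventually)
  qed
 qed
qed

text \<open>Difference quotients converge; near the right end of the interval they enter only from some index on.\<close>

lemma measurable_space_derivative:
 fixes f f' :: "real \<Rightarrow> real \<Rightarrow> real"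
 assumes m: "(\<lambda>z. indicator ({0<..<T} \<times> Ipi) z * f (fst z) (snd z)) \<in> borel_fun"
  and d: "\<And>t x. t \<in> {0<..<T} \<Longrightarrow> x \<in> Ipi \<Longrightarrow> (f t has_real_derivative f' t x) (at x)"
 shows "(\<lambda>z. indicator ({0<..<T} \<times> Ipi) z * f' (fst z) (snd z)) \<in> borel_fun"
proof -
 define Q where "Q = {0<..<T} \<times> Ipi"
 have Qo: "open Q" unfolding Q_def by (intro open_Times) auto
 have [measurable]: "Q \<in> sets borel" using Qo by simp
 define F where "F z = indicator Q z * f (fst z) (snd z)" for z
 have [measurable]: "F \<in> borel_fun" using m unfolding F_def[abs_def] Q_def .
 define g where "g n z = indicator Q z * ((F (fst z, snd z + 1 / real (Suc n)) - F z) / (1 / real (Suc n)))" for n z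
 have sh: "(\<lambda>z. (fst z, snd z + 1 / real (Suc n))) \<in> (borel :: (real \<times> real) measure) \<rightarrow>\<^sub>M (borel :: (real \<times> real) measure)" for n
  by (intro borel_measurable_continuous_onI continuous_intros)
 have gm: "g n \<in> borel_fun" for n
  using measurable_compose[OF sh[of n], of F borel] unfolding g_def[abs_def] by measurable
 show ?thesis
 proof (rule borel_measurable_LIMSEQ_real[OF _ gm])
  fix z :: "real \<times> real"
  show "(\<lambda>n. g n z) \<longlonglongrightarrow> indicator ({0<..<T} \<times> Ipi) z * f' (fst z) (snd z)"
  proof (cases "z \<in> Q")
   case False
   then show ?thesis unfolding g_def Q_def by simp
  next
   case True
   then obtain t x where z: "z = (t, x)" "t \<in> {0<..<T}" "x \<in> Ipi" unfolding Q_def by auto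
   have h0: "(\<lambda>n. 1 / real (Suc n)) \<longlonglongrightarrow> 0" by (rule LIMSEQ_inverse_real_of_nat[unfolded inverse_eq_divide])
   have dq: "((\<lambda>h. (f t (x + h) - f t x) / h) \<longlongrightarrow> f' t x) (at 0)" using d[OF z(2,3)] unfolding DERIV_def .
   have "filterlim (\<lambda>n. 1 / real (Suc n)) (at 0) sequentially"
    unfolding filterlim_at using h0 by auto
   from filterlim_compose[OF dq this]
   have "(\<lambda>n. (f t (x + 1 / real (Suc n)) - f t x) / (1 / real (Suc n))) \<longlonglongrightarrow> f' t x" .
   moreover have "\<forall>\<^sub>F n in sequentially. (f t (x + 1 / real (Suc n)) - f t x) / (1 / real (Suc n)) = g n z"
   proof -
    have "\<forall>\<^sub>F n in sequentially. 1 / real (Suc n) < pi - x"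
     using order_tendstoD(2)[OF h0, of "pi - x"] z(3) by simp
    then show ?thesis
    proof eventually_elim
     case (elim n)
     have "0 < 1 / real (Suc n)" by simp
     then have "(t, x + 1 / real (Suc n)) \<in> Q" using z elim unfolding Q_def by (auto intro: add_pos_pos)
     then show ?case using True z unfolding g_def F_def by simp
    qed
   qed
   ultimately show ?thesis using True z unfolding Q_def by (auto intro: Lim_transform_eventually)
  qed
 qed
qed

text \<open>A kernel whose expansion in \<open>x\<close> has, for every \<open>y\<close>, a nonzero coefficient does not vanish
 identically in \<open>x\<close>; by compactness finitely many values of \<open>x\<close> detect every point of the rectangle.\<close>

lemma integrable_of_kernel_integrable:
 fixes c :: "nat \<Rightarrow> real \<Rightarrow> real" and h :: "real \<times> real \<Rightarrow> real"
 assumes t: "0 < t'" "t' < t"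
  and c: "\<And>k. continuous_on {0..pi} (c k)" and p: "0 \<le> p"
  and cb: "\<And>k y. y \<in> {0..pi} \<Longrightarrow> \<bar>c k y\<bar> \<le> B * real (Suc k) powr p"
  and nz: "\<And>y. y \<in> {0..pi} \<Longrightarrow> \<exists>k. c k y \<noteq> 0"
  and hm [measurable]: "(\<lambda>z. indicator ({0<..<t'} \<times> Ipi) z * h z) \<in> borel_fun"
  and i: "\<And>x. x \<in> Ipi \<Longrightarrow> set_integrable lborel ({0<..<t} \<times> Ipi)
   (\<lambda>z. (\<Sum>k. decay k (t - fst z) * (c k (snd z) * smode k x)) * h z)"
 shows "integrable lborel (\<lambda>z. indicator ({0<..<t'} \<times> Ipi) z * h z)"
proof -
 define \<kappa> where "\<kappa> x z = (\<Sum>k. decay k (t - fst z) * (c k (snd z) * smode k x))" for x z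
 define K where "K = {0..t'} \<times> {0..pi}"
 have K: "compact K" unfolding K_def by (intro compact_Times) auto
 have cont: "continuous_on K (\<kappa> x)" for x
 proof -
  have "continuous_on ({0<..} \<times> {0..pi}) (\<lambda>(\<tau>, y). \<Sum>k. decay k \<tau> * (c k y * smode k x))"
  proof (rule continuous_on_decay_series[OF _ p])
   show "\<bar>c k y * smode k x\<bar> \<le> B * real (Suc k) powr p" if "y \<in> {0..pi}" for k y
    by (rule abs_mult_mode_le[OF cb[OF that]])
  qed (intro continuous_intros c)
  then have "continuous_on K (\<lambda>z. (\<lambda>(\<tau>, y). \<Sum>k. decay k \<tau> * (c k y * smode k x)) (t - fst z, snd z))"
   by (rule continuous_on_compose2) (use t in \<open>auto simp: K_def intro!: continuous_intros\<close>)
  then show ?thesis unfolding \<kappa>_def by simp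
 qed
 have "\<exists>x U. x \<in> Ipi \<and> open U \<and> z \<in> U \<and> (\<exists>e>0. \<forall>z'\<in>U \<inter> K. e \<le> \<bar>\<kappa> x z'\<bar>)" if z: "z \<in> K" for z
 proof -
  have tz: "0 < t - fst z" and yz: "snd z \<in> {0..pi}" using z t unfolding K_def by auto
  have "\<exists>x\<in>Ipi. \<kappa> x z \<noteq> 0"
  proof (rule ccontr)
   assume "\<not> ?thesis"
   then have z0: "\<kappa> x z = 0" if "x \<in> Ipi" for x using that by blast
   obtain k where k: "c k (snd z) \<noteq> 0" using nz[OF yz] by blast
   have s: "summable (\<lambda>k. \<bar>decay k (t - fst z) * c k (snd z)\<bar>)"
    by (rule summable_decay_exp(1)[OF tz p cb[OF yz]])
   have "decay k (t - fst z) * c k (snd z) = (LI x. smode k x * \<kappa> x z)"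
    unfolding \<kappa>_def using sine_coeff_series[OF s, of k] by (simp add: mult.assoc)
   also have "\<dots> = (LI x. 0)"
    by (rule set_lebesgue_integral_cong) (use z0 in auto)
   finally show False using k by simp
  qed
  then obtain x where x: "x \<in> Ipi" "\<kappa> x z \<noteq> 0" by blast
  define e where "e = \<bar>\<kappa> x z\<bar> / 2"
  have "open {e<..}" by simp
  then obtain U where U: "open U" "(\<lambda>z. \<bar>\<kappa> x z\<bar>) -` {e<..} \<inter> K = U \<inter> K"
   using continuous_on_open_invariant[of K "\<lambda>z. \<bar>\<kappa> x z\<bar>"] cont[of x] continuous_on_rabs[OF cont[of x]] by metis
  have "z \<in> U" using U(2) z x unfolding e_def by auto
  moreover have "e \<le> \<bar>\<kappa> x z'\<bar>" if "z' \<in> U \<inter> K" for z' using that U(2) by (auto intro: less_imp_le)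
  moreover have "e > 0" using x unfolding e_def by simp
  ultimately show ?thesis using x U by blast
 qed
 then obtain X U where XU: "\<And>z. z \<in> K \<Longrightarrow> X z \<in> Ipi \<and> open (U z) \<and> z \<in> U z \<and> (\<exists>e>0. \<forall>z'\<in>U z \<inter> K. e \<le> \<bar>\<kappa> (X z) z'\<bar>)"
  by metis
 then obtain e where e: "\<And>z. z \<in> K \<Longrightarrow> e z > 0 \<and> (\<forall>z'\<in>U z \<inter> K. e z \<le> \<bar>\<kappa> (X z) z'\<bar>)" by metis
 obtain C where C: "C \<subseteq> K" "finite C" "K \<subseteq> (\<Union>z\<in>C. U z)"
  using compactE_image[OF K, of K U] XU by blast
 define Q where "Q = {0<..<t} \<times> Ipi"
 have dom: "integrable lborel (\<lambda>z. \<Sum>z0\<in>C. (1 / e z0) * \<bar>indicator Q z *\<^sub>R (\<kappa> (X z0) z * h z)\<bar>)"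
 proof (rule Bochner_Integration.integrable_sum)
  fix z0 assume z0: "z0 \<in> C"
  then have "X z0 \<in> Ipi" using XU C(1) by blast
  from i[OF this] show "integrable lborel (\<lambda>z. (1 / e z0) * \<bar>indicator Q z *\<^sub>R (\<kappa> (X z0) z * h z)\<bar>)"
   unfolding set_integrable_def Q_def \<kappa>_def by (intro integrable_mult_right integrable_abs)
 qed
 show ?thesis
 proof (rule Bochner_Integration.integrable_bound[OF dom])
  show "AE z in lborel. norm (indicator ({0<..<t'} \<times> Ipi) z * h z)
   \<le> norm (\<Sum>z0\<in>C. (1 / e z0) * \<bar>indicator Q z *\<^sub>R (\<kappa> (X z0) z * h z)\<bar>)"
  proof (intro AE_I2)
   fix z :: "real \<times> real"
   have nn: "0 \<le> (1 / e z0) * \<bar>indicator Q z *\<^sub>R (\<kappa> (X z0) z * h z)\<bar>" if "z0 \<in> C" for z0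
    using e[of z0] that C(1) by (intro mult_nonneg_nonneg) (auto intro: less_imp_le)
   show "norm (indicator ({0<..<t'} \<times> Ipi) z * h z)
   \<le> norm (\<Sum>z0\<in>C. (1 / e z0) * \<bar>indicator Q z *\<^sub>R (\<kappa> (X z0) z * h z)\<bar>)"
   proof (cases "z \<in> {0<..<t'} \<times> Ipi")
    case True
    then have zK: "z \<in> K" and zQ: "z \<in> Q" using t unfolding K_def Q_def by auto
    then obtain z0 where z0: "z0 \<in> C" "z \<in> U z0" using C by blast
    then have ez: "e z0 > 0" "e z0 \<le> \<bar>\<kappa> (X z0) z\<bar>" using e[of z0] C(1) zK by auto
    have "\<bar>h z\<bar> \<le> (1 / e z0) * \<bar>indicator Q z *\<^sub>R (\<kappa> (X z0) z * h z)\<bar>"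
     using ez zQ mult_right_mono[OF ez(2), of "\<bar>h z\<bar>"] by (simp add: abs_mult field_simps)
    also have "\<dots> \<le> (\<Sum>z0\<in>C. (1 / e z0) * \<bar>indicator Q z *\<^sub>R (\<kappa> (X z0) z * h z)\<bar>)"
     using z0(1) nn C(2) by (intro member_le_sum) auto
    finally show ?thesis using True by simp
   qed simp
  qed
 qed simp
qed

text \<open>The quotient \<open>sin ((k + 1) * y) / sin y\<close>, free of its removable singularities.\<close>

fun chebyshev_U :: "nat \<Rightarrow> real \<Rightarrow> real" where
 "chebyshev_U 0 y = 1"
| "chebyshev_U (Suc k) y = chebyshev_U k y * cos y + cos (real (Suc k) * y)"

lemma chebyshev_U: "chebyshev_U k y * sin y = sin (real (Suc k) * y)"
proof (induction k)
 case (Suc k)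
 have "real (Suc (Suc k)) * y = real (Suc k) * y + y" by (simp add: algebra_simps)
 then have "sin (real (Suc (Suc k)) * y) = sin (real (Suc k) * y) * cos y + cos (real (Suc k) * y) * sin y"
  by (simp only: sin_add)
 then show ?case using Suc by (simp add: algebra_simps)
qed simp

lemma chebyshev_U_bound: "\<bar>chebyshev_U k y\<bar> \<le> real (Suc k)"
proof (induction k)
 case (Suc k)
 have "\<bar>chebyshev_U k y * cos y + cos (real (Suc k) * y)\<bar> \<le> \<bar>chebyshev_U k y\<bar> * \<bar>cos y\<bar> + \<bar>cos (real (Suc k) * y)\<bar>"
  by (metis abs_mult abs_triangle_ineq)
 also have "\<dots> \<le> real (Suc k) * 1 + 1" using Suc by (intro add_mono mult_mono) auto
 finally show ?case by simp
qed simp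

lemma chebyshev_U_continuous: "continuous_on A (chebyshev_U k)"
 by (induction k) (auto intro!: continuous_intros simp del: of_nat_Suc)

text \<open>For one path; \<open>w\<close> may be altered outside the interval, so it is continuous and bounded on the whole line.\<close>

locale mild =
 fixes w u0 :: "real \<Rightarrow> real" and T Wb :: real and u :: "real \<Rightarrow> real \<Rightarrow> real"
 assumes T: "0 < T" and w: "continuous_on UNIV w" and wb: "\<And>y. \<bar>w y\<bar> \<le> Wb"
  and u0: "continuous_on {0..pi} u0" and ms: "mild_solution w T u0 u"
begin

lemma u_t: "x \<in> Ipi \<Longrightarrow> continuous_on {0<..<T} (\<lambda>t. u t x)"
 using ms unfolding mild_solution_def by blast

lemma u_deriv: "t \<in> {0<..<T} \<Longrightarrow> x \<in> Ipi \<Longrightarrow> (u t has_real_derivative deriv (u t) x) (at x)"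
 using ms unfolding mild_solution_def Ck_on_def by (auto simp: DERIV_deriv_iff_field_differentiable)

lemma u_deriv_continuous: "t \<in> {0<..<T} \<Longrightarrow> continuous_on Ipi (deriv (u t))"
 using ms unfolding mild_solution_def Ck_on_def by (metis One_nat_def funpow_simps_right(2) funpow_0 le_numeral_extra(4) o_apply)

lemma u_x: "t \<in> {0<..<T} \<Longrightarrow> continuous_on Ipi (u t)"
 using ms unfolding mild_solution_def Ck_on_def by (metis funpow_0 zero_le)

definition rect :: "real \<Rightarrow> (real \<times> real) set" where "rect t = {0<..<t} \<times> Ipi"

lemma rect_sets [measurable]: "rect t \<in> sets borel"
 unfolding rect_def by (intro borel_open open_Times) auto

definition uw :: "real \<Rightarrow> real \<times> real \<Rightarrow> real" where
 "uw t' z = indicator (rect t') z * (u (fst z) (snd z) * w (snd z))"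

definition dw :: "real \<Rightarrow> real \<times> real \<Rightarrow> real" where
 "dw t' z = indicator (rect t') z * (deriv (u (fst z)) (snd z) * w (snd z))"

definition ur :: "real \<Rightarrow> real \<times> real \<Rightarrow> real" where
 "ur t' z = indicator (rect t') z * u (fst z) (snd z)"

lemma w_measurable [measurable]: "w \<in> borel_fun"
 using w by (rule borel_measurable_continuous_onI)

lemma ur_T_measurable: "ur T \<in> borel_fun"
 unfolding ur_def[abs_def] rect_def by (rule measurable_caratheodory) (use u_t u_x in auto)

lemma ur_measurable [measurable]:
 assumes "t' \<le> T"
 shows "ur t' \<in> borel_fun"
proof -
 note ur_T_measurable [measurable]
 have "ur t' = (\<lambda>z. indicator (rect t') z * ur T z)"
  using assms unfolding ur_def[abs_def] rect_def by (auto simp: fun_eq_iff indicator_def)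
 also have "\<dots> \<in> borel_fun" by measurable
 finally show ?thesis .
qed

lemma dr_measurable:
 assumes "t' \<le> T"
 shows "(\<lambda>z. indicator (rect t') z * deriv (u (fst z)) (snd z)) \<in> borel_fun"
proof -
 have [measurable]: "(\<lambda>z. indicator (rect T) z * deriv (u (fst z)) (snd z)) \<in> borel_fun"
  using ur_T_measurable u_deriv unfolding rect_def ur_def[abs_def]
  by (intro measurable_space_derivative[where f = u and f' = "\<lambda>t. deriv (u t)"]) auto
 have "(\<lambda>z. indicator (rect t') z * deriv (u (fst z)) (snd z))
   = (\<lambda>z. indicator (rect t') z * (indicator (rect T) z * deriv (u (fst z)) (snd z)))"
  using assms unfolding rect_def by (auto simp: fun_eq_iff indicator_def)
 also have "\<dots> \<in> borel_fun" by measurable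
 finally show ?thesis .
qed

lemma uw_measurable [measurable]: "t' \<le> T \<Longrightarrow> uw t' \<in> borel_fun"
proof -
 assume [measurable]: "t' \<le> T"
 have "uw t' = (\<lambda>z. ur t' z * w (snd z))" unfolding uw_def[abs_def] ur_def[abs_def] by (simp add: mult.assoc)
 then show ?thesis by simp
qed

lemma dw_measurable [measurable]: "t' \<le> T \<Longrightarrow> dw t' \<in> borel_fun"
proof -
 assume "t' \<le> T"
 note [measurable] = dr_measurable[OF this]
 have "dw t' = (\<lambda>z. (indicator (rect t') z * deriv (u (fst z)) (snd z)) * w (snd z))"
  unfolding dw_def[abs_def] by (simp add: mult.assoc)
 then show ?thesis by simp
qed

lemma mild_eq:
 assumes t: "t \<in> {0<..<T}" and x: "x \<in> Ipi"
 shows "set_integrable lborel ({0<..<t} \<times> Ipi) (\<lambda>(s, y). dirichlet_heat_kernel_y (t - s) x y * u s y * w y)"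
  "set_integrable lborel ({0<..<t} \<times> Ipi) (\<lambda>(s, y). dirichlet_heat_kernel (t - s) x y * deriv (u s) y * w y)"
  "u t x = dirichlet_heat_flow u0 t x
     - (LINT s:{0<..<t}|lborel. LI y. dirichlet_heat_kernel_y (t - s) x y * u s y * w y)
     - (LINT s:{0<..<t}|lborel. LI y. dirichlet_heat_kernel (t - s) x y * deriv (u s) y * w y)"
 using ms t x unfolding mild_solution_def by blast+

lemma kernel_uw_eq:
 assumes t: "t \<le> t'" "t' \<le> T"
 shows "indicator ({0<..<t} \<times> Ipi) z *\<^sub>R (case z of (s, y) \<Rightarrow> dirichlet_heat_kernel_y (t - s) x y * u s y * w y)
   = heatKx T (t - fst z) (snd z) x * uw t' z"
  "indicator ({0<..<t} \<times> Ipi) z *\<^sub>R (case z of (s, y) \<Rightarrow> dirichlet_heat_kernel (t - s) x y * deriv (u s) y * w y)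
   = pK T t x z * dw t' z"
proof -
 obtain s y where z: "z = (s, y)" by (cases z)
 consider "0 < s" "s < t" "y \<in> Ipi" | "s \<le> 0" | "t \<le> s" | "y \<notin> Ipi" by fastforce
 then have "indicator ({0<..<t} \<times> Ipi) z *\<^sub>R (case z of (s, y) \<Rightarrow> dirichlet_heat_kernel_y (t - s) x y * u s y * w y)
   = heatKx T (t - fst z) (snd z) x * uw t' z \<and>
   indicator ({0<..<t} \<times> Ipi) z *\<^sub>R (case z of (s, y) \<Rightarrow> dirichlet_heat_kernel (t - s) x y * deriv (u s) y * w y)
   = pK T t x z * dw t' z"
 proof cases
  case 1
  then have "0 < t - s" "t - s < T" using t by auto
  from dirichlet_heat_kernel_eq[OF this] show ?thesis
   using 1 t unfolding z uw_def dw_def rect_def by (simp add: mult.assoc)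
 qed (auto simp: z uw_def dw_def rect_def heatK_def heatKx_def)
 then show "indicator ({0<..<t} \<times> Ipi) z *\<^sub>R (case z of (s, y) \<Rightarrow> dirichlet_heat_kernel_y (t - s) x y * u s y * w y)
   = heatKx T (t - fst z) (snd z) x * uw t' z"
  "indicator ({0<..<t} \<times> Ipi) z *\<^sub>R (case z of (s, y) \<Rightarrow> dirichlet_heat_kernel (t - s) x y * deriv (u s) y * w y)
   = pK T t x z * dw t' z" by blast+
qed

lemma set_integral_rect:
 fixes F :: "real \<times> real \<Rightarrow> real"
 assumes "set_integrable lborel ({0<..<t} \<times> Ipi) F"
 shows "(LINT s:{0<..<t}|lborel. LI y. F (s, y)) = (LINT z:{0<..<t} \<times> Ipi|lborel. F z)"
proof -
 have "integrable (lborel2) (\<lambda>z. indicator ({0<..<t} \<times> Ipi) z *\<^sub>R F z)"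
  using assms unfolding set_integrable_def lborel_prod .
 from lborel_pair.integral_fst'[OF this]
 have "(LINT z:{0<..<t} \<times> Ipi|lborel. F z) = (LB s. LB y. indicator ({0<..<t} \<times> Ipi) (s, y) *\<^sub>R F (s, y))"
  unfolding set_lebesgue_integral_def lborel_prod by simp
 also have "\<dots> = (LINT s:{0<..<t}|lborel. LI y. F (s, y))"
  unfolding set_lebesgue_integral_def
  by (intro Bochner_Integration.integral_cong) (auto simp: indicator_times mult.assoc)
 finally show ?thesis ..
qed

lemma representation:
 assumes t: "0 < t" "t < T" and t': "t \<le> t'" "t' \<le> T" and x: "x \<in> Ipi"
 shows "integrable lborel (\<lambda>z. heatKx T (t - fst z) (snd z) x * uw t' z)"
  "integrable lborel (\<lambda>z. pK T t x z * dw t' z)"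
  "u t x = heat_flow u0 t x - (LB z. heatKx T (t - fst z) (snd z) x * uw t' z)
   - (LB z. pK T t x z * dw t' z)"
proof -
 have tt: "t \<in> {0<..<T}" using t by simp
 note m = mild_eq[OF tt x]
 show "integrable lborel (\<lambda>z. heatKx T (t - fst z) (snd z) x * uw t' z)"
  "integrable lborel (\<lambda>z. pK T t x z * dw t' z)"
  using m(1,2) unfolding set_integrable_def kernel_uw_eq[OF t'] .
 show "u t x = heat_flow u0 t x - (LB z. heatKx T (t - fst z) (snd z) x * uw t' z)
   - (LB z. pK T t x z * dw t' z)"
  using m(3) set_integral_rect[OF m(1)] set_integral_rect[OF m(2)]
  unfolding dirichlet_heat_flow_eq[OF set_integrable_continuous[OF u0] t(1)]
  unfolding set_lebesgue_integral_def[of _ "{0<..<t} \<times> Ipi"] kernel_uw_eq[OF t'] by simp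
qed

text \<open>The cosine modes of order \<open>1\<close> and \<open>2\<close> have no common zero, so the kernel \<open>P\<^sub>y\<close> has a nonzero coefficient at every \<open>y\<close>.\<close>

lemma uw_integrable:
 assumes t': "0 < t'" "t' < T"
 shows "integrable lborel (uw t')"
proof -
 (* The solution at a time strictly between t' and T sees the whole rectangle below t' through a smooth kernel. *)
 define t where "t = (t' + T) / 2"
 have t: "t' < t" "t < T" "0 < t" using t' unfolding t_def by auto
 have "integrable lborel (\<lambda>z. indicator ({0<..<t'} \<times> Ipi) z * (uw t z))"
 proof (rule integrable_of_kernel_integrable[OF t'(1) t(1), where p = 1 and B = 1 and c = "\<lambda>k y. real (Suc k) * cmode k y"])
  show "\<bar>real (Suc k) * cmode k y\<bar> \<le> 1 * real (Suc k) powr 1" for k y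
   using abs_mult_mode_le(2)[of "real (Suc k)" "real (Suc k)"] by simp
  show "\<exists>k. real (Suc k) * cmode k y \<noteq> 0" for y
  proof (cases "cos y = 0")
   case True
   then have "cos (2 * y) = -1" using cos_double_cos[of y] by simp
   then have "real (Suc 1) * cmode 1 y \<noteq> 0" using sqrt_2_pi(1) unfolding neumann_mode_def by simp
   then show ?thesis by blast
  next
   case False
   then have "real (Suc 0) * cmode 0 y \<noteq> 0" using sqrt_2_pi(1) unfolding neumann_mode_def by simp
   then show ?thesis by blast
  qed
  show "(\<lambda>z. indicator ({0<..<t'} \<times> Ipi) z * uw t z) \<in> borel_fun"
  proof -
   have [measurable]: "uw t \<in> borel_fun" using t by (intro uw_measurable) auto
   show ?thesis unfolding rect_def[symmetric] by measurable
  qed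
  fix x :: real assume x: "x \<in> Ipi"
  have e: "indicator ({0<..<t} \<times> Ipi) z *\<^sub>R ((\<Sum>k. decay k (t - fst z) * ((real (Suc k) * cmode k (snd z)) * smode k x)) * uw t z)
   = heatKx T (t - fst z) (snd z) x * uw t z" for z
  proof (cases "z \<in> {0<..<t} \<times> Ipi")
   case True
   then show ?thesis using t unfolding heatKx_def by (auto simp: mult.assoc)
  qed (simp add: uw_def rect_def)
  show "set_integrable lborel ({0<..<t} \<times> Ipi)
   (\<lambda>z. (\<Sum>k. decay k (t - fst z) * ((real (Suc k) * cmode k (snd z)) * smode k x)) * uw t z)"
   unfolding set_integrable_def e using t by (intro representation x) auto
 qed (auto intro!: continuous_intros)
 also have "(\<lambda>z. indicator ({0<..<t'} \<times> Ipi) z * uw t z) = uw t'"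
  using t unfolding uw_def rect_def by (auto simp: fun_eq_iff indicator_def)
 finally show ?thesis .
qed

text \<open>All coefficients of the kernel \<open>P\<close> vanish at the ends of the interval, where only the weighted function is controlled:
  after division by \<open>sin y\<close> the lowest coefficient is constant.\<close>

lemma sin_dw_integrable:
 assumes t': "0 < t'" "t' < T"
 shows "integrable lborel (\<lambda>z. sin (snd z) * dw t' z)"
proof -
 define t where "t = (t' + T) / 2"
 have t: "t' < t" "t < T" "0 < t" using t' unfolding t_def by auto
 have "integrable lborel (\<lambda>z. indicator ({0<..<t'} \<times> Ipi) z * (sin (snd z) * dw t z))"
 proof (rule integrable_of_kernel_integrable[OF t'(1) t(1), where p = 1 and B = 1 and c = "\<lambda>k y. sqrt (2 / pi) * chebyshev_U k y"])
  show "\<bar>sqrt (2 / pi) * chebyshev_U k y\<bar> \<le> 1 * real (Suc k) powr 1" for k y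
   using mult_mono[OF sqrt_2_pi(2) chebyshev_U_bound[of k y]] sqrt_2_pi(1) by (simp add: abs_mult)
  show "\<exists>k. sqrt (2 / pi) * chebyshev_U k y \<noteq> 0" for y
   using sqrt_2_pi(1) by (intro exI[of _ 0]) simp
  show "(\<lambda>z. indicator ({0<..<t'} \<times> Ipi) z * (sin (snd z) * dw t z)) \<in> borel_fun"
  proof -
   have [measurable]: "dw t \<in> borel_fun" using t by (intro dw_measurable) auto
   show ?thesis unfolding rect_def[symmetric] by measurable
  qed
  fix x :: real assume x: "x \<in> Ipi"
  have e: "indicator ({0<..<t} \<times> Ipi) z *\<^sub>R ((\<Sum>k. decay k (t - fst z) * ((sqrt (2 / pi) * chebyshev_U k (snd z)) * smode k x)) * (sin (snd z) * dw t z))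
   = pK T t x z * dw t z" for z
  proof (cases "z \<in> {0<..<t} \<times> Ipi")
   case True
   have s: "summable (\<lambda>k. decay k (t - fst z) * ((sqrt (2 / pi) * chebyshev_U k (snd z)) * smode k x))"
   proof (rule summable_decay_exp(2)[of _ 1 _ 1])
    fix k
    have "\<bar>sqrt (2 / pi) * chebyshev_U k (snd z)\<bar> \<le> real (Suc k)"
     using mult_mono[OF sqrt_2_pi(2) chebyshev_U_bound[of k "snd z"]] sqrt_2_pi(1) by (simp add: abs_mult)
    from abs_mult_mode_le(1)[OF this]
    show "\<bar>(sqrt (2 / pi) * chebyshev_U k (snd z)) * smode k x\<bar> \<le> 1 * real (Suc k) powr 1" by simp
   qed (use True in auto)
   have "(\<Sum>k. decay k (t - fst z) * ((sqrt (2 / pi) * chebyshev_U k (snd z)) * smode k x)) * sin (snd z)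
    = (\<Sum>k. decay k (t - fst z) * smode k x * smode k (snd z))"
    unfolding suminf_mult2[OF s]
    by (rule suminf_cong, unfold dirichlet_mode_def chebyshev_U[of _ "snd z", symmetric], simp only: mult_ac)
   then show ?thesis using True t unfolding heatK_def by (auto simp: mult.assoc[symmetric])
  qed (simp add: dw_def rect_def)
  show "set_integrable lborel ({0<..<t} \<times> Ipi)
   (\<lambda>z. (\<Sum>k. decay k (t - fst z) * ((sqrt (2 / pi) * chebyshev_U k (snd z)) * smode k x)) * (sin (snd z) * dw t z))"
   unfolding set_integrable_def e using t by (intro representation x) auto
 qed (auto intro!: continuous_intros chebyshev_U_continuous)
 also have "(\<lambda>z. indicator ({0<..<t'} \<times> Ipi) z * (sin (snd z) * dw t z)) = (\<lambda>z. sin (snd z) * dw t' z)"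
  using t unfolding dw_def rect_def by (auto simp: fun_eq_iff indicator_def)
 finally show ?thesis .
qed

end

section \<open>The weak formulation for sine modes\<close>

lemma heatK_outside:
 assumes "\<not> (0 < \<tau> \<and> \<tau> < T)"
 shows "heatK T \<tau> x y = 0" "heatKx T \<tau> x y = 0"
 unfolding heatK_def heatKx_def if_not_P[OF assms] by simp_all

lemma heatK_duhamel_bound:
 assumes y: "y \<in> Ipi"
 shows "(NN x. ennreal \<bar>ind_I x * heatK T \<tau> x y\<bar>) \<le> ennreal (decay_const 1 * sin y * abel T (3/4) \<tau>)"
proof (cases "0 < \<tau> \<and> \<tau> < T")
 case True
 have "(NN x. ennreal \<bar>ind_I x * heatK T \<tau> x y\<bar>)
  = (NN x. ennreal \<bar>heatK T \<tau> x y\<bar> * ind_I x)"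
  by (intro nn_integral_cong) (auto simp: indicator_def)
 also have "\<dots> \<le> ennreal (decay_const 1 * sin y * \<tau> powr (- 3 / 4))"
  using True y by (intro heatK_L1_weight) auto
 finally show ?thesis using True unfolding abel_def by simp
next
 case False
 show ?thesis unfolding heatK_outside[OF False] abel_def if_not_P[OF False] by simp
qed

lemma heatKx_swap_duhamel_bound:
 "(NN x. ennreal \<bar>ind_I x * heatKx T \<tau> y x\<bar>) \<le> ennreal (decay_const 1 * abel T (3/4) \<tau>)"
proof (cases "0 < \<tau> \<and> \<tau> < T")
 case True
 have "(NN x. ennreal \<bar>ind_I x * heatKx T \<tau> y x\<bar>)
  = (NN x. ennreal \<bar>heatKx T \<tau> y x\<bar> * ind_I x)"
  by (intro nn_integral_cong) (auto simp: indicator_def)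
 also have "\<dots> \<le> ennreal (decay_const 1 * \<tau> powr (- 3 / 4))"
  using True by (intro heatKx_L1) auto
 finally show ?thesis using True unfolding abel_def by simp
next
 case False
 show ?thesis unfolding heatK_outside[OF False] abel_def if_not_P[OF False] by simp
qed

lemma heatKx_duhamel_bound:
 assumes y: "y \<in> Ipi"
 shows "(NN x. ennreal \<bar>(ind_I x * sin x) * heatKx T \<tau> x y\<bar>)
  \<le> ennreal (160 * exp (T / 8) * decay_const 1 * sin y * abel T (3/4) \<tau>)"
proof (cases "0 < \<tau> \<and> \<tau> < T")
 case True
 have "(NN x. ennreal \<bar>(ind_I x * sin x) * heatKx T \<tau> x y\<bar>)
  = (NN x. ennreal (sin x * \<bar>heatKx T \<tau> x y\<bar>) * ind_I x)"
  by (intro nn_integral_cong) (auto simp: indicator_def abs_mult sin_ge_zero)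
 also have "\<dots> \<le> ennreal (160 * exp (T / 8) * decay_const 1 * sin y * \<tau> powr (- 3 / 4))"
  using True y by (intro heatKx_L1_weight) auto
 finally show ?thesis using True unfolding abel_def by simp
next
 case False
 show ?thesis unfolding heatK_outside[OF False] abel_def if_not_P[OF False] by simp
qed

lemma heatK_measurable3:
 "(\<lambda>(\<tau>, x, y). heatK T \<tau> x y) \<in> borel_fun"
 "(\<lambda>(\<tau>, x, y). heatKx T \<tau> x y) \<in> borel_fun"
 "(\<lambda>(\<tau>, x, y). heatKx T \<tau> y x) \<in> borel_fun"
 unfolding split_beta' borel_prod[symmetric] by measurable

lemma heatK_coeff:
 assumes "0 < \<tau>" "\<tau> < T"
 shows "(LB x. smode k x * ind_I x * heatK T \<tau> x y)
   = decay k \<tau> * smode k y"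
  "(LB x. smode k x * ind_I x * heatKx T \<tau> y x)
   = decay k \<tau> * (real (Suc k) * cmode k y)"
proof -
 have s1: "summable (\<lambda>k. \<bar>decay k \<tau> * smode k y\<bar>)"
  using abs_mode_le(1) by (intro summable_decay_exp(1)[OF assms(1), of 0 _ 1]) auto
 have "\<bar>real (Suc k) * cmode k y\<bar> \<le> 1 * real (Suc k) powr 1" for k
  using abs_mult_mode_le(2)[of "real (Suc k)" "real (Suc k)" "Suc k" y] by simp
 from summable_decay_exp(1)[OF assms(1) _ this]
 have s2: "summable (\<lambda>k. \<bar>decay k \<tau> * (real (Suc k) * cmode k y)\<bar>)" by simp
 have r: "(LB x. smode k x * ind_I x * f x)
  = (LI x. smode k x * f x)" for f
  unfolding set_lebesgue_integral_def by (intro Bochner_Integration.integral_cong) auto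
 show "(LB x. smode k x * ind_I x * heatK T \<tau> x y)
   = decay k \<tau> * smode k y"
  using sine_coeff_series[OF s1, of k] assms unfolding r heatK_def by (simp add: mult_ac)
 show "(LB x. smode k x * ind_I x * heatKx T \<tau> y x)
   = decay k \<tau> * (real (Suc k) * cmode k y)"
  using sine_coeff_series[OF s2, of k] assms unfolding r heatKx_def by simp
qed

text \<open>Fubini; the common core of the Duhamel formulas for coefficients.\<close>

lemma duhamel_coefficient:
 fixes k :: "real \<Rightarrow> real \<Rightarrow> real \<Rightarrow> real" and h :: "real \<times> real \<Rightarrow> real"
 assumes t: "t < T" and i: "integrable lborel2 (\<lambda>(x, z). ind_I x * k (t - fst z) x (snd z) * h z)"
  and m: "m \<in> borel_fun" "\<And>x. \<bar>m x\<bar> \<le> 1" and supp: "\<forall>z. z \<notin> {0<..<t'} \<times> Ipi \<longrightarrow> h z = 0"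
  and zero: "\<forall>\<tau> x y. \<tau> \<le> 0 \<longrightarrow> k \<tau> x y = 0"
  and c: "\<And>\<tau> y. 0 < \<tau> \<Longrightarrow> \<tau> < T \<Longrightarrow> (LB x. m x * ind_I x * k \<tau> x y) = e \<tau> * c y"
 defines "J \<equiv> \<lambda>x. LB z. k (t - fst z) x (snd z) * h z"
 shows "integrable_I (\<lambda>x. m x * J x)"
  "(LI x. m x * J x) = (LB z. indicator ({0<..<t} \<times> Ipi) z * (e (t - fst z) * (h z * c (snd z))))"
proof -
 note F = duhamel_fubini[where k = k, OF i m]
 have j: "m x * ind_I x * (LB z. k (t - fst z) x (snd z) * h z) = ind_I x *\<^sub>R (m x * J x)" for x by (simp add: J_def)
 show "integrable_I (\<lambda>x. m x * J x)" using F(2) unfolding j set_integrable_def .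
 have "(LI x. m x * J x) = (LB z. (LB x. m x * ind_I x * k (t - fst z) x (snd z)) * h z)"
  using F(4) unfolding j set_lebesgue_integral_def .
 also have "\<dots> = (LB z. indicator ({0<..<t} \<times> Ipi) z * (e (t - fst z) * (h z * c (snd z))))"
 proof (intro Bochner_Integration.integral_cong refl)
  fix z :: "real \<times> real"
  consider "z \<in> {0<..<t} \<times> Ipi" | "h z = 0" | "t \<le> fst z" using supp[rule_format, of z] by (cases z) force
  then show "(LB x. m x * ind_I x * k (t - fst z) x (snd z)) * h z = indicator ({0<..<t} \<times> Ipi) z * (e (t - fst z) * (h z * c (snd z)))"
  proof cases
   case 1
   then have "0 < t - fst z" "t - fst z < T" using t by auto
   from c[OF this, of "snd z"] show ?thesis using 1 by simp
  qed (auto simp: zero indicator_def)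
 qed
 finally show "(LI x. m x * J x) = (LB z. indicator ({0<..<t} \<times> Ipi) z * (e (t - fst z) * (h z * c (snd z))))" .
qed

text \<open>The inner space integral is a density in time alone, to which the formulas for linear differential equations apply.\<close>

lemma planar_time_integral:
 fixes g :: "real \<times> real \<Rightarrow> real" and e :: "real \<Rightarrow> real"
 assumes g: "integrable lborel g" and supp: "\<And>z. snd z \<notin> Ipi \<Longrightarrow> g z = 0"
  and em [measurable]: "e \<in> borel_fun" and eb: "\<And>s. s \<in> {0<..<t} \<Longrightarrow> \<bar>e s\<bar> \<le> B"
 shows "integrable lborel (\<lambda>s. LB y. g (s, y))"
  "integrable lborel (\<lambda>z. indicator ({0<..<t} \<times> Ipi) z * (e (fst z) * g z))"
  "(LB z. indicator ({0<..<t} \<times> Ipi) z * (e (fst z) * g z))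
   = (LINT s:{0<..<t}|lborel. e s * (LB y. g (s, y)))"
proof -
 have gp: "integrable (lborel2) g" using g unfolding lborel_prod .
 show "integrable lborel (\<lambda>s. LB y. g (s, y))" by (rule lborel_pair.integrable_fst'[OF gp])
 have gm: "g \<in> borel_fun" using borel_measurable_integrable[OF g] by simp
 have rm: "{0<..<t} \<times> Ipi \<in> sets (borel :: (real \<times> real) measure)" by (intro borel_open open_Times) auto
 show i: "integrable lborel (\<lambda>z. indicator ({0<..<t} \<times> Ipi) z * (e (fst z) * g z))"
 proof (rule Bochner_Integration.integrable_bound[OF integrable_mult_right[OF g, of B]])
  show "(\<lambda>z. indicator ({0<..<t} \<times> Ipi) z * (e (fst z) * g z)) \<in> borel_measurable lborel"
   using gm rm by measurable
  show "AE z in lborel. norm (indicator ({0<..<t} \<times> Ipi) z * (e (fst z) * g z)) \<le> norm (B * g z)"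
  proof (intro AE_I2)
   fix z :: "real \<times> real"
   show "norm (indicator ({0<..<t} \<times> Ipi) z * (e (fst z) * g z)) \<le> norm (B * g z)"
   proof (cases "z \<in> {0<..<t} \<times> Ipi")
    case True
    then have "fst z \<in> {0<..<t}" by auto
    from eb[OF this] have "\<bar>e (fst z)\<bar> \<le> \<bar>B\<bar>" by linarith
    from mult_right_mono[OF this, of "\<bar>g z\<bar>"] show ?thesis using True by (simp add: abs_mult)
   qed simp
  qed
 qed
 have ip: "integrable (lborel2) (\<lambda>z. indicator ({0<..<t} \<times> Ipi) z * (e (fst z) * g z))"
  using i unfolding lborel_prod .
 have "(LB z. indicator ({0<..<t} \<times> Ipi) z * (e (fst z) * g z))
  = (LB s. LB y. indicator ({0<..<t} \<times> Ipi) (s, y) * (e s * g (s, y)))"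
  using lborel_pair.integral_fst'[OF ip] unfolding lborel_prod by simp
 also have "\<dots> = (LB s. LB y. (indicator {0<..<t} s * e s) * g (s, y))"
 proof (intro Bochner_Integration.integral_cong refl)
  fix s y :: real
  show "indicator ({0<..<t} \<times> Ipi) (s, y) * (e s * g (s, y)) = (indicator {0<..<t} s * e s) * g (s, y)"
   using supp[of "(s, y)"] by (cases "y \<in> Ipi") (auto simp: indicator_times)
 qed
 also have "\<dots> = (LINT s:{0<..<t}|lborel. e s * (LB y. g (s, y)))"
  unfolding set_lebesgue_integral_def by (simp add: mult.assoc)
 finally show "(LB z. indicator ({0<..<t} \<times> Ipi) z * (e (fst z) * g z))
   = (LINT s:{0<..<t}|lborel. e s * (LB y. g (s, y)))" .
qed

lemma heat_flow_crude_bound: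
 assumes v: "continuous_on {0..pi} v" and t: "0 < t"
 shows "\<bar>heat_flow v t x\<bar> \<le> 2 * (LI y. \<bar>v y\<bar>) * t powr (- 1 / 2)"
proof -
 define B where "B = (LI y. \<bar>v y\<bar>)"
 have B: "\<bar>sine_coeff v k\<bar> \<le> B" for k unfolding B_def by (rule abs_sine_coeff_le[OF set_integrable_continuous[OF v]])
 have B0: "0 \<le> B" using order_trans[OF abs_ge_zero B[of 0]] .
 have b: "norm (decay k t * (sine_coeff v k * smode k x)) \<le> decay k t * B" for k
  using abs_mult_mode_le(1)[OF B] by (simp add: abs_mult[of "exp _"])
 have s: "summable (\<lambda>k. decay k t)" using summable_decay[OF t, of 0] by simp
 have "norm (heat_flow v t x) \<le> (\<Sum>k. decay k t * B)"
  unfolding heat_flow_def by (rule norm_suminf_le[OF b summable_mult2[OF s]])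
 also have "\<dots> = (\<Sum>k. decay k t) * B" by (rule suminf_mult2[OF s, symmetric])
 also have "\<dots> \<le> (2 * t powr (- 1 / 2)) * B"
  by (intro mult_right_mono suminf_le_const[OF s] sum_exp_squares_le t B0)
 finally show ?thesis unfolding B_def by (simp add: mult_ac)
qed

context mild
begin

lemma supports: "snd z \<notin> Ipi \<Longrightarrow> uw t' z = 0" "snd z \<notin> Ipi \<Longrightarrow> dw t' z = 0" "snd z \<notin> Ipi \<Longrightarrow> ur t' z = 0"
 by (auto simp: uw_def dw_def ur_def rect_def indicator_def)

lemma duhamel_facts:
 assumes t': "0 < t'" "t' < T"
 shows "(NN t. NN x. (NN z. ennreal \<bar>ind_I x * heatKx T (t - fst z) (snd z) x * uw t' z\<bar>)) < \<infinity>"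
  "AE t in lborel. integrable (lborel2) (\<lambda>(x, z). ind_I x * heatKx T (t - fst z) (snd z) x * uw t' z)"
  "(NN t. NN x. (NN z. ennreal \<bar>ind_I x * pK T t x z * dw t' z\<bar>)) < \<infinity>"
  "AE t in lborel. integrable (lborel2) (\<lambda>(x, z). ind_I x * pK T t x z * dw t' z)"
proof -
 note A = duhamel_AE[OF T heatK_measurable3(3)[of T], where p = "ind_I" and q = "\<lambda>_. decay_const 1" and h = "uw t'"]
 show "(NN t. NN x. (NN z. ennreal \<bar>ind_I x * heatKx T (t - fst z) (snd z) x * uw t' z\<bar>)) < \<infinity>"
  "AE t in lborel. integrable (lborel2) (\<lambda>(x, z). ind_I x * heatKx T (t - fst z) (snd z) x * uw t' z)"
  by (rule A; use t' uw_measurable supports(1) heatKx_swap_duhamel_bound decay_const_pos[of 1] uw_integrable[OF t'] in \<open>auto intro: less_imp_le\<close>)+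
 have q: "integrable lborel (\<lambda>z. (decay_const 1 * sin (snd z)) * dw t' z)"
  using sin_dw_integrable[OF t'] by (simp add: mult.assoc)
 note A = duhamel_AE[OF T heatK_measurable3(1)[of T], where p = "ind_I" and q = "\<lambda>y. decay_const 1 * sin y" and h = "dw t'", OF _ _ _ _ _ _ q]
 show "(NN t. NN x. (NN z. ennreal \<bar>ind_I x * pK T t x z * dw t' z\<bar>)) < \<infinity>"
  "AE t in lborel. integrable (lborel2) (\<lambda>(x, z). ind_I x * pK T t x z * dw t' z)"
  by (rule A; use t' dw_measurable supports(2) heatK_duhamel_bound decay_const_pos[of 1] in \<open>auto intro!: mult_nonneg_nonneg sin_ge_zero less_imp_le[OF decay_const_pos]\<close>)+
qed

text \<open>The function \<open>u\<close> itself is integrable, also where \<open>w\<close> vanishes: integrate the mild equation over the rectangle.\<close>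

lemma ur_integrable:
 assumes t': "0 < t'" "t' < T"
 shows "integrable lborel (ur t')"
proof -
 define A where "A = 2 * (LI y. \<bar>u0 y\<bar>)"
 have A0: "0 \<le> A" unfolding A_def set_lebesgue_integral_def by (intro mult_nonneg_nonneg integral_nonneg_AE AE_I2) auto
 define J1 where "J1 t x = (NN z. ennreal \<bar>ind_I x * heatKx T (t - fst z) (snd z) x * uw t' z\<bar>)" for t x
 define J2 where "J2 t x = (NN z. ennreal \<bar>ind_I x * pK T t x z * dw t' z\<bar>)" for t x
 have [measurable]: "ur t' \<in> borel_fun" "uw t' \<in> borel_fun" "dw t' \<in> borel_fun"
  using t' by (auto intro!: ur_measurable uw_measurable dw_measurable)
 have Jm [measurable]: "(\<lambda>w. J1 (f w) (g w)) \<in> borel_measurable N" "(\<lambda>w. J2 (f w) (g w)) \<in> borel_measurable N"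
  if [measurable]: "f \<in> borel_measurable N" "g \<in> borel_measurable N" for f g and N :: "'n measure"
  unfolding J1_def J2_def by measurable
 have pt: "ennreal \<bar>ur t' (t, x)\<bar> \<le> ennreal (A * abel T (1/2) t) * ind_I x + (J1 t x + J2 t x)" for t x
 proof (cases "(t, x) \<in> rect t'")
  case True
  then have t: "0 < t" "t < T" "t \<le> t'" "t' \<le> T" and x: "x \<in> Ipi" using t' unfolding rect_def by auto
  note R = representation[OF t x]
  have "\<bar>u t x\<bar> \<le> A * abel T (1/2) t + (\<bar>LB z. heatKx T (t - fst z) (snd z) x * uw t' z\<bar>
   + \<bar>LB z. pK T t x z * dw t' z\<bar>)"
   unfolding R(3) using heat_flow_crude_bound[OF u0 t(1), of x] t unfolding A_def abel_def by simp
  then have "ennreal \<bar>u t x\<bar> \<le> ennreal (A * abel T (1/2) t) + (ennreal \<bar>LB z. heatKx T (t - fst z) (snd z) x * uw t' z\<bar>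
   + ennreal \<bar>LB z. pK T t x z * dw t' z\<bar>)"
   using A0 abel_nonneg by (simp flip: ennreal_plus add: ennreal_leI)
  also have "\<dots> \<le> ennreal (A * abel T (1/2) t) + (J1 t x + J2 t x)"
   unfolding J1_def J2_def
   using integral_norm_bound_ennreal[OF R(1)] integral_norm_bound_ennreal[OF R(2)] x
   by (intro add_mono order_refl) (auto simp: abs_mult)
  finally show ?thesis using True x by (simp add: ur_def)
 qed (simp add: ur_def)
 have "(NN z. ennreal (norm (ur t' z))) = (\<integral>\<^sup>+z. ennreal \<bar>ur t' z\<bar> \<partial>(lborel2))"
  unfolding lborel_prod by simp
 also have "\<dots> = (NN t. NN x. ennreal \<bar>ur t' (t, x)\<bar>)"
  by (subst lborel.nn_integral_fst[symmetric]) (auto simp: lborel_prod)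
 also have "\<dots> \<le> (NN t. NN x. ennreal (A * abel T (1/2) t) * ind_I x + (J1 t x + J2 t x))"
  by (intro nn_integral_mono pt)
 also have "\<dots> = (NN t. ennreal (A * abel T (1/2) t) * ennreal pi + ((NN x. J1 t x) + (NN x. J2 t x)))"
  by (intro nn_integral_cong) (simp add: nn_integral_add nn_integral_cmult)
 also have "\<dots> = (NN t. ennreal (A * abel T (1/2) t)) * ennreal pi
  + ((NN t. NN x. J1 t x) + (NN t. NN x. J2 t x))"
  by (simp add: nn_integral_add nn_integral_multc)
 also have "\<dots> < \<infinity>"
 proof -
  have "(NN t. ennreal (A * abel T (1/2) t)) = ennreal A * (NN t. ennreal (abel T (1/2) t))"
   using A0 by (simp add: ennreal_mult' nn_integral_cmult)
  then show ?thesis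
   using duhamel_facts(1,3)[OF t'] T unfolding J1_def[symmetric] J2_def[symmetric]
   by (simp add: nn_integral_abel ennreal_mult_less_top)
 qed
 finally show ?thesis by (intro integrableI_bounded) auto
qed

lemma AE_u_integrable:
 assumes t': "0 < t'" "t' < T"
 shows "AE t in lborel. t \<in> {0<..<t'} \<longrightarrow> integrable_I (u t)"
proof -
 have "integrable (lborel2) (ur t')" using ur_integrable[OF t'] unfolding lborel_prod .
 from lborel_pair.AE_integrable_fst'[OF this]
 show ?thesis
 proof eventually_elim
  case (elim t)
  show ?case
  proof
   assume t: "t \<in> {0<..<t'}"
   have "(\<lambda>x. ur t' (t, x)) = (\<lambda>x. ind_I x *\<^sub>R u t x)"
    using t unfolding ur_def rect_def by (auto simp: fun_eq_iff indicator_def)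
   with elim show "integrable_I (u t)" unfolding set_integrable_def by simp
  qed
 qed
qed

lemma integrable_test:
 assumes t': "0 < t'" "t' < T"
 shows "continuous_on {0..pi} \<psi> \<Longrightarrow> integrable lborel (\<lambda>z. ur t' z * \<psi> (snd z))"
  "continuous_on {0..pi} \<psi> \<Longrightarrow> integrable lborel (\<lambda>z. uw t' z * \<psi> (snd z))"
  "continuous_on {0..pi} \<psi> \<Longrightarrow> (\<And>y. y \<in> Ipi \<Longrightarrow> \<bar>\<psi> y\<bar> \<le> C * sin y) \<Longrightarrow> integrable lborel (\<lambda>z. dw t' z * \<psi> (snd z))"
proof -
 have gen: "integrable lborel (\<lambda>z. h z * \<psi> (snd z))"
  if h: "integrable lborel (\<lambda>z. h z * \<sigma> (snd z))" and hm: "h \<in> borel_fun"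
   and supp: "\<And>z. snd z \<notin> Ipi \<Longrightarrow> h z = 0"
   and c: "continuous_on {0..pi} \<psi>" and b: "\<And>y. y \<in> Ipi \<Longrightarrow> \<bar>\<psi> y\<bar> \<le> C * \<bar>\<sigma> y\<bar>"
  for h :: "real \<times> real \<Rightarrow> real" and \<psi> \<sigma> :: "real \<Rightarrow> real" and C
 proof (rule Bochner_Integration.integrable_bound[OF integrable_mult_right[OF h, of C]])
  have "continuous_on Ipi \<psi>" by (rule continuous_on_subset[OF c]) auto
  then have m: "(\<lambda>y. ind_I y * \<psi> y) \<in> borel_fun"
   using borel_measurable_continuous_on_indicator[of "Ipi" \<psi>] by simp
  have e: "(\<lambda>z. h z * \<psi> (snd z)) = (\<lambda>z. h z * (\<lambda>y. ind_I y * \<psi> y) (snd z))"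
  proof (rule ext)
   fix z
   show "h z * \<psi> (snd z) = h z * (\<lambda>y. ind_I y * \<psi> y) (snd z)"
    by (cases "snd z \<in> Ipi") (simp_all add: supp)
  qed
  have "(\<lambda>z::real \<times> real. (\<lambda>y. ind_I y * \<psi> y) (snd z)) \<in> borel_fun"
   by (rule measurable_compose[OF measurable_fst_snd_borel(2) m])
  then show "(\<lambda>z. h z * \<psi> (snd z)) \<in> borel_measurable lborel"
   unfolding e using hm by measurable
  show "AE z in lborel. norm (h z * \<psi> (snd z)) \<le> norm (C * (h z * \<sigma> (snd z)))"
  proof (intro AE_I2)
   fix z :: "real \<times> real"
   show "norm (h z * \<psi> (snd z)) \<le> norm (C * (h z * \<sigma> (snd z)))"
   proof (cases "snd z \<in> Ipi")
    case True
    have "\<bar>\<psi> (snd z)\<bar> \<le> \<bar>C\<bar> * \<bar>\<sigma> (snd z)\<bar>"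
     using b[OF True] by (rule order_trans) (intro mult_right_mono, auto)
    from mult_left_mono[OF this, of "\<bar>h z\<bar>"] show ?thesis by (simp add: abs_mult mult_ac)
   qed (simp add: supp)
  qed
 qed
 have bd: "\<exists>B. \<forall>y\<in>{0..pi}. \<bar>\<psi> y\<bar> \<le> B" if "continuous_on {0..pi} \<psi>" for \<psi> :: "real \<Rightarrow> real"
  using compact_imp_bounded[OF compact_continuous_image[OF that compact_Icc]] unfolding bounded_iff by auto
 have m: "ur t' \<in> borel_fun" "uw t' \<in> borel_fun" "dw t' \<in> borel_fun"
  using t' by (auto intro!: ur_measurable uw_measurable dw_measurable)
 show "integrable lborel (\<lambda>z. ur t' z * \<psi> (snd z))" if c: "continuous_on {0..pi} \<psi>"
 proof -
  obtain B where B: "\<forall>y\<in>{0..pi}. \<bar>\<psi> y\<bar> \<le> B" using bd[OF c] by blast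
  show ?thesis by (rule gen[of _ "\<lambda>_. 1" _ B]) (use ur_integrable[OF t'] m supports c B in auto)
 qed
 show "integrable lborel (\<lambda>z. uw t' z * \<psi> (snd z))" if c: "continuous_on {0..pi} \<psi>"
 proof -
  obtain B where B: "\<forall>y\<in>{0..pi}. \<bar>\<psi> y\<bar> \<le> B" using bd[OF c] by blast
  show ?thesis by (rule gen[of _ "\<lambda>_. 1" _ B]) (use uw_integrable[OF t'] m supports c B in auto)
 qed
 show "integrable lborel (\<lambda>z. dw t' z * \<psi> (snd z))"
  if c: "continuous_on {0..pi} \<psi>" and b: "\<And>y. y \<in> Ipi \<Longrightarrow> \<bar>\<psi> y\<bar> \<le> C * sin y"
 proof (rule gen[of _ sin _ C])
  show "integrable lborel (\<lambda>z. dw t' z * sin (snd z))" using sin_dw_integrable[OF t'] by (simp add: mult.commute)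
  show "\<bar>\<psi> y\<bar> \<le> C * \<bar>sin y\<bar>" if "y \<in> Ipi" for y
   using b[OF that] that by (simp add: sin_gt_zero abs_of_pos)
 qed (use m supports c in auto)
qed

text \<open>The integrand of the weak formulation with test function \<open>\<phi>\<close>; the noise \<open>u * w'\<close> has been integrated by parts.\<close>

definition weak_density :: "real \<Rightarrow> (real \<Rightarrow> real) \<Rightarrow> (real \<Rightarrow> real) \<Rightarrow> (real \<Rightarrow> real) \<Rightarrow> real \<times> real \<Rightarrow> real" where
 "weak_density t' \<phi> \<phi>' \<phi>'' z = ur t' z * \<phi>'' (snd z) - uw t' z * \<phi>' (snd z) - dw t' z * \<phi> (snd z)"

lemma weak_density_integrable:
 assumes t': "0 < t'" "t' < T"
  and c: "continuous_on {0..pi} \<phi>" "continuous_on {0..pi} \<phi>'" "continuous_on {0..pi} \<phi>''"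
  and b: "\<And>y. y \<in> Ipi \<Longrightarrow> \<bar>\<phi> y\<bar> \<le> C * sin y"
 shows "integrable lborel (weak_density t' \<phi> \<phi>' \<phi>'')"
 unfolding weak_density_def[abs_def]
 by (intro Bochner_Integration.integrable_diff integrable_test[OF t'] c) (rule b)

definition weak_eq :: "real \<Rightarrow> (real \<Rightarrow> real) \<Rightarrow> (real \<Rightarrow> real) \<Rightarrow> (real \<Rightarrow> real) \<Rightarrow> bool" where
 "weak_eq t' \<phi> \<phi>' \<phi>'' \<longleftrightarrow> (AE t in lborel. t \<in> {0<..<t'} \<longrightarrow>
  (LI x. u t x * \<phi> x) = (LI x. u0 x * \<phi> x)
   + (LB z. indicator (rect t) z * weak_density t' \<phi> \<phi>' \<phi>'' z))"

text \<open>Sine modes diagonalise the kernel.\<close>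

lemma coefficient_duhamel:
 fixes k :: nat
 assumes t': "0 < t'" "t' < T"
 defines "G \<equiv> \<lambda>z. - (uw t' z * (real (Suc k) * cmode k (snd z))) - dw t' z * smode k (snd z)"
 shows "integrable lborel G"
  "AE t in lborel. t \<in> {0<..<t'} \<longrightarrow> (LI x. u t x * smode k x)
   = decay k t * sine_coeff u0 k
    + (LB z. indicator (rect t) z * (decay k (t - fst z) * G z))"
proof -
 let ?m = "smode k"
 let ?e = "\<lambda>\<tau>. decay k \<tau>"
 let ?I = "Ipi"
 have gu: "integrable lborel (\<lambda>z. uw t' z * (real (Suc k) * cmode k (snd z)))"
  by (rule integrable_test(2)[OF t']) (intro continuous_intros)
 have gd: "integrable lborel (\<lambda>z. dw t' z * ?m (snd z))"
  by (rule integrable_test(3)[OF t', of _ "real (Suc k)"]) (auto intro!: continuous_intros abs_dirichlet_mode_le_sin simp del: of_nat_Suc)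
 show Gi: "integrable lborel G" unfolding G_def
  by (intro Bochner_Integration.integrable_diff Bochner_Integration.integrable_minus gu gd)
 show "AE t in lborel. t \<in> {0<..<t'} \<longrightarrow> (LI x. u t x * ?m x) = ?e t * sine_coeff u0 k
    + (LB z. indicator (rect t) z * (?e (t - fst z) * G z))"
  using duhamel_facts(2,4)[OF t']
 proof eventually_elim
  case (elim t)
  show ?case
  proof
   assume "t \<in> {0<..<t'}"
   then have t: "0 < t" "t < T" "t \<le> t'" "t' \<le> T" using t' by auto
   have mm: "?m \<in> borel_fun" by measurable
   define J1 where "J1 x = (LB z. heatKx T (t - fst z) (snd z) x * uw t' z)" for x
   define J2 where "J2 x = (LB z. pK T t x z * dw t' z)" for x
   have h: "integrable_I (\<lambda>x. ?m x * heat_flow u0 t x)"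
   proof -
    have s: "summable (\<lambda>k. \<bar>decay k t * sine_coeff u0 k\<bar>)"
     using abs_sine_coeff_le[OF set_integrable_continuous[OF u0]] by (intro summable_decay_exp(1)[OF t(1), of 0]) auto
    have "integrable_I ?m" by (intro set_integrable_continuous continuous_intros)
    from integral_mult_sine_series(2)[OF this s] show ?thesis unfolding heat_flow_def by (simp add: mult.assoc)
   qed
   have sup: "\<forall>z. z \<notin> {0<..<t'} \<times> Ipi \<longrightarrow> uw t' z = 0" "\<forall>z. z \<notin> {0<..<t'} \<times> Ipi \<longrightarrow> dw t' z = 0"
    by (auto simp: uw_def dw_def rect_def)
   have z0: "\<forall>\<tau> x y. \<tau> \<le> 0 \<longrightarrow> heatKx T \<tau> y x = 0" "\<forall>\<tau> x y. \<tau> \<le> 0 \<longrightarrow> heatK T \<tau> x y = 0" by (auto simp: heatK_outside)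
   note j1 = duhamel_coefficient[where k = "\<lambda>\<tau> x y. heatKx T \<tau> y x", OF t(2) elim(1) mm abs_mode_le(1) sup(1) z0(1) heatK_coeff(2), folded J1_def rect_def, simplified simp_thms]
   note j2 = duhamel_coefficient[where k = "heatK T", OF t(2) elim(2) mm abs_mode_le(1) sup(2) z0(2) heatK_coeff(1), folded J2_def rect_def, simplified simp_thms]
   have em: "(\<lambda>s. ?e (t - s)) \<in> borel_fun" by measurable
   have eb: "\<bar>?e (t - s)\<bar> \<le> 1" if "s \<in> {0<..<t}" for s using that by simp
   note P1 = planar_time_integral(2)[OF gu _ em eb, folded rect_def]
   note P2 = planar_time_integral(2)[OF gd _ em eb, folded rect_def]
   have "(LI x. u t x * ?m x) = (LI x. ?m x * heat_flow u0 t x - ?m x * J1 x - ?m x * J2 x)"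
   proof (intro set_lebesgue_integral_cong allI impI)
    fix x assume x: "x \<in> ?I"
    show "u t x * ?m x = ?m x * heat_flow u0 t x - ?m x * J1 x - ?m x * J2 x"
     unfolding representation(3)[OF t x] J1_def[symmetric] J2_def[symmetric] by (simp add: algebra_simps)
   qed auto
   also have "\<dots> = (LI x. ?m x * heat_flow u0 t x) - (LI x. ?m x * J1 x) - (LI x. ?m x * J2 x)"
    using h j1(1) j2(1) by (simp add: set_integral_diff)
   also have "\<dots> = ?e t * sine_coeff u0 k - (LB z. indicator (rect t) z * (?e (t - fst z) * (uw t' z * (real (Suc k) * cmode k (snd z)))))
    - (LB z. indicator (rect t) z * (?e (t - fst z) * (dw t' z * ?m (snd z))))"
    by (simp only: heat_flow_coeff[OF set_integrable_continuous[OF u0] t(1)] j1(2) j2(2))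
   also have "\<dots> = ?e t * sine_coeff u0 k
    + (LB z. - (indicator (rect t) z * (?e (t - fst z) * (uw t' z * (real (Suc k) * cmode k (snd z)))))
     - indicator (rect t) z * (?e (t - fst z) * (dw t' z * ?m (snd z))))"
    using P1 P2 supports by simp
   also have "(LB z. - (indicator (rect t) z * (?e (t - fst z) * (uw t' z * (real (Suc k) * cmode k (snd z)))))
     - indicator (rect t) z * (?e (t - fst z) * (dw t' z * ?m (snd z))))
    = (LB z. indicator (rect t) z * (?e (t - fst z) * G z))"
    unfolding G_def by (intro Bochner_Integration.integral_cong) (auto simp: algebra_simps)
   finally show "(LI x. u t x * ?m x) = ?e t * sine_coeff u0 k
    + (LB z. indicator (rect t) z * (?e (t - fst z) * G z))" .
  qed
 qed
qed

text \<open>The Duhamel formula for a coefficient is the solution of a linear differential equation, whose integrated form is the weak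
  formulation.\<close>

lemma weak_eq_mode:
 assumes t': "0 < t'" "t' < T"
 shows "weak_eq t' (smode k) (\<lambda>y. real (Suc k) * cmode k y) (\<lambda>y. - (real (Suc k))\<^sup>2 * smode k y)"
proof -
 let ?m = "smode k"
 let ?I = "Ipi"
 define lam where "lam = (real (Suc k))\<^sup>2"
 have lam: "0 \<le> lam" unfolding lam_def by simp
 define G where "G = (\<lambda>z. - (uw t' z * (real (Suc k) * cmode k (snd z))) - dw t' z * ?m (snd z))"
 have CD: "integrable lborel G"
  "AE t in lborel. t \<in> {0<..<t'} \<longrightarrow> (LI x. u t x * smode k x)
   = decay k t * sine_coeff u0 k
    + (LB z. indicator (rect t) z * (decay k (t - fst z) * G z))"
  unfolding G_def by (rule coefficient_duhamel[OF t'])+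
 have Gs: "G z = 0" if "snd z \<notin> ?I" for z using that supports unfolding G_def by simp
 define b where "b s = (LB y. G (s, y))" for s
 have bi: "integrable lborel b"
  using planar_time_integral(1)[OF CD(1) Gs, of "\<lambda>_. 0" 0 0] unfolding b_def by simp
 define D where "D t = exp (- lam * t) * sine_coeff u0 k + (LINT s:{0<..<t}|lborel. exp (- lam * (t - s)) * b s)" for t
 have uD: "AE t in lborel. t \<in> {0<..<t'} \<longrightarrow> (LI x. u t x * ?m x) = D t"
  using CD(2)
 proof eventually_elim
  case (elim t)
  have "(LB z. indicator (rect t) z * (decay k (t - fst z) * G z)) = (LINT s:{0<..<t}|lborel. exp (- lam * (t - s)) * b s)"
   unfolding rect_def b_def lam_def
  proof (rule planar_time_integral(3)[OF CD(1) Gs])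
   show "\<bar>decay k (t - s)\<bar> \<le> 1" if "s \<in> {0<..<t}" for s using that by simp
  qed auto
  then show ?case using elim unfolding D_def lam_def by simp
 qed
 have ui: "integrable lborel (\<lambda>z. ur t' z * ?m (snd z))"
  by (rule integrable_test(1)[OF t']) (intro continuous_intros)
 show ?thesis unfolding weak_eq_def
  using uD
 proof eventually_elim
  case (elim t)
  show ?case
  proof
   assume t: "t \<in> {0<..<t'}"
   have "D t = sine_coeff u0 k + (LINT s:{0<..<t}|lborel. b s - lam * D s)"
    unfolding D_def by (rule ode_of_duhamel(2)[OF bi lam]) (use t in auto)
   also have "(LINT s:{0<..<t}|lborel. b s - lam * D s) = (LINT s:{0<..<t}|lborel. 1 * (LB y. G (s, y) - lam * (ur t' (s, y) * ?m y)))"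
    unfolding set_lebesgue_integral_def
   proof (rule integral_cong_AE)
    have [measurable]: "b \<in> borel_fun" using borel_measurable_integrable[OF bi] by simp
    have Gu: "integrable lborel (\<lambda>z. G z - lam * (ur t' z * ?m (snd z)))" using CD(1) ui by simp
    have AEi: "AE s in lborel. integrable lborel (\<lambda>y. G (s, y)) \<and> integrable lborel (\<lambda>y. ur t' (s, y) * ?m y)"
     using lborel_pair.AE_integrable_fst'[of G] lborel_pair.AE_integrable_fst'[of "\<lambda>z. ur t' z * ?m (snd z)"] CD(1) ui
     unfolding lborel_prod by auto
    show "AE s in lborel. indicator {0<..<t} s *\<^sub>R (b s - lam * D s) = indicator {0<..<t} s *\<^sub>R (1 * (LB y. G (s, y) - lam * (ur t' (s, y) * ?m y)))"
     using uD AEi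
    proof eventually_elim
     case (elim s)
     show ?case
     proof (cases "s \<in> {0<..<t}")
      case s: True
      have "(LB y. ur t' (s, y) * ?m y) = (LI x. u s x * ?m x)"
       unfolding set_lebesgue_integral_def using s t
       by (intro Bochner_Integration.integral_cong) (auto simp: ur_def rect_def indicator_def)
      also have "\<dots> = D s" using elim(1) s t by simp
      finally show ?thesis
       using elim(2) unfolding b_def by simp
     qed simp
    qed
    have "set_integrable lborel {0<..<t} (\<lambda>s. b s - lam * D s)"
     unfolding D_def by (rule ode_of_duhamel(1)[OF bi lam]) (use t in auto)
    then show "(\<lambda>s. indicator {0<..<t} s *\<^sub>R (b s - lam * D s)) \<in> borel_measurable lborel"
     unfolding set_integrable_def by auto
    have "integrable lborel (\<lambda>s. LB y. G (s, y) - lam * (ur t' (s, y) * ?m y))"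
     using lborel_pair.integrable_fst'[of "\<lambda>z. G z - lam * (ur t' z * ?m (snd z))"] Gu unfolding lborel_prod by simp
    then have [measurable]: "(\<lambda>s. LB y. G (s, y) - lam * (ur t' (s, y) * ?m y)) \<in> borel_fun" by auto
    show "(\<lambda>s. indicator {0<..<t} s *\<^sub>R (1 * (LB y. G (s, y) - lam * (ur t' (s, y) * ?m y)))) \<in> borel_measurable lborel"
     by measurable
   qed
   also have "\<dots> = (LB z. indicator (rect t) z * (1 * (G z - lam * (ur t' z * ?m (snd z)))))"
   proof -
    have Gu: "integrable lborel (\<lambda>z. G z - lam * (ur t' z * ?m (snd z)))" using CD(1) ui by simp
    have Gus: "G z - lam * (ur t' z * ?m (snd z)) = 0" if "snd z \<notin> ?I" for z
     using Gs[OF that] supports(3)[OF that] by simp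
    show ?thesis unfolding rect_def
     by (subst planar_time_integral(3)[OF Gu Gus, of "\<lambda>_. 1" t 1]) (auto simp: set_lebesgue_integral_def)
   qed
   also have "\<dots> = (LB z. indicator (rect t) z * weak_density t' ?m (\<lambda>y. real (Suc k) * cmode k y) (\<lambda>y. - (real (Suc k))\<^sup>2 * ?m y) z)"
    unfolding weak_density_def G_def lam_def by (intro Bochner_Integration.integral_cong) (auto simp: algebra_simps)
   finally show "(LI x. u t x * ?m x) = (LI x. u0 x * ?m x)
   + (LB z. indicator (rect t) z * weak_density t' ?m (\<lambda>y. real (Suc k) * cmode k y) (\<lambda>y. - (real (Suc k))\<^sup>2 * ?m y) z)"
    using elim t unfolding sine_coeff_def by simp
  qed
 qed
qed

end

section \<open>The weak formulation for smooth test functions\<close>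

text \<open>The second derivative of \<open>- \<epsilon> * sin\<close> is \<open>\<epsilon> * sin\<close>, so \<open>d - \<epsilon> * sin\<close> and \<open>- d - \<epsilon> * sin\<close> are convex
  with zero boundary values. The derivative \<open>d'\<close> has a zero by Rolle's theorem.\<close>

lemma small_second_derivative:
 fixes d d' d'' :: "real \<Rightarrow> real"
 assumes d: "\<And>y. (d has_real_derivative d' y) (at y)" "\<And>y. (d' has_real_derivative d'' y) (at y)"
  and b: "d 0 = 0" "d pi = 0" and e: "\<And>y. y \<in> {0..pi} \<Longrightarrow> \<bar>d'' y\<bar> \<le> \<epsilon> * sin y"
  and y: "y \<in> {0..pi}"
 shows "\<bar>d y\<bar> \<le> \<epsilon> * sin y" "\<bar>d' y\<bar> \<le> \<epsilon> * pi"
proof -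
 have e0: "0 \<le> \<epsilon>" using e[of "pi / 2"] by simp
 have conv: "c * d y - \<epsilon> * sin y \<le> 0" if c: "\<bar>c\<bar> = 1" for c
 proof -
  have "convex_on {0..pi} (\<lambda>y. c * d y - \<epsilon> * sin y)"
  proof (rule f''_ge0_imp_convex[where f' = "\<lambda>y. c * d' y - \<epsilon> * cos y" and f'' = "\<lambda>y. c * d'' y + \<epsilon> * sin y"])
   fix y :: real assume y: "y \<in> {0..pi}"
   show "((\<lambda>y. c * d y - \<epsilon> * sin y) has_real_derivative c * d' y - \<epsilon> * cos y) (at y)"
    by (auto intro!: derivative_eq_intros d)
   show "((\<lambda>y. c * d' y - \<epsilon> * cos y) has_real_derivative c * d'' y + \<epsilon> * sin y) (at y)"
    by (auto intro!: derivative_eq_intros d)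
   show "0 \<le> c * d'' y + \<epsilon> * sin y"
    using e[OF y] c by (cases "c = 1") (auto simp: abs_if split: if_splits)
  qed auto
  from convex_onD[OF this, of "y / pi" 0 pi] y b show ?thesis by (simp add: field_simps)
 qed
 show "\<bar>d y\<bar> \<le> \<epsilon> * sin y" using conv[of 1] conv[of "-1"] by simp
 obtain z where z: "0 < z" "z < pi" "d pi - d 0 = (pi - 0) * d' z" using MVT2[of 0 pi d d'] d pi_gt_zero by blast
 then have dz: "d' z = 0" using b by simp
 have "norm (d' y - d' z) \<le> \<epsilon> * norm (y - z)"
 proof (rule field_differentiable_bound[of "{0..pi}" d' d''])
  fix w :: real assume w: "w \<in> {0..pi}"
  show "(d' has_real_derivative d'' w) (at w within {0..pi})" using d(2) by (rule DERIV_subset) auto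
  have "\<epsilon> * sin w \<le> \<epsilon> * 1" using e0 by (intro mult_left_mono) auto
  then show "norm (d'' w) \<le> \<epsilon>" using e[OF w] by simp
 qed (use y z in auto)
 also have "\<dots> \<le> \<epsilon> * pi" using y z e0 by (intro mult_left_mono) auto
 finally show "\<bar>d' y\<bar> \<le> \<epsilon> * pi" using dz by simp
qed

text \<open>An antiderivative on the whole line, vanishing at \<open>0\<close>.\<close>

definition prim :: "(real \<Rightarrow> real) \<Rightarrow> real \<Rightarrow> real" where
 "prim f y = (LBINT z=0..y. f z)"

lemma prim_0 [simp]: "prim f 0 = 0"
 unfolding prim_def by (simp flip: zero_ereal_def)

lemma DERIV_prim:
 assumes f: "continuous_on UNIV f"
 shows "(prim f has_real_derivative f y) (at y)"
proof -
 define a where "a = min 0 y - 1"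
 define b where "b = max 0 y + 1"
 have ab: "a \<le> 0" "0 \<le> b" "a < y" "y < b" unfolding a_def b_def by auto
 have "((\<lambda>u. LBINT y=0..u. f y) has_vector_derivative f y) (at y within {a..b})"
 proof -
  have "((\<lambda>u. LBINT y=ereal 0..ereal u. f y) has_vector_derivative f y) (at y within {a..b})"
   by (rule interval_integral_FTC2[OF ab(1,2) continuous_on_subset[OF f subset_UNIV]]) (use ab in auto)
  then show ?thesis by (simp add: zero_ereal_def)
 qed
 moreover have "at y within {a..b} = at y" using ab by (intro at_within_Icc_at)
 ultimately show ?thesis
  unfolding prim_def[abs_def] has_real_derivative_iff_has_vector_derivative by simp
qed

lemma continuous_on_prim:
 assumes f: "continuous_on UNIV f"
 shows "continuous_on A (prim f)"
 using DERIV_continuous_on[OF DERIV_subset[OF DERIV_prim[OF f] subset_UNIV]] by blast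

lemma prim_eq:
 assumes "0 \<le> y"
 shows "prim f y = (LINT z:{0<..<y}|lborel. f z)"
 unfolding prim_def interval_lebesgue_integral_def using assms by (simp add: zero_ereal_def)

text \<open>The approximations vanish near the zeros of \<open>w\<close>, which makes them comparable with \<open>w\<close>
 itself: near those zeros nothing is known about the derivative of the solution, only
 about its product with \<open>w\<close>.\<close>

lemma dominated_smooth_approximation:
 fixes w :: "real \<Rightarrow> real"
 assumes w: "continuous_on UNIV w"
 obtains Wn Wn' :: "nat \<Rightarrow> real \<Rightarrow> real" where
  "\<And>n y. (Wn n has_real_derivative Wn' n y) (at y)"
  "\<And>n. continuous_on UNIV (Wn' n)"
  "\<And>n y. y \<in> Ipi \<Longrightarrow> \<bar>Wn n y\<bar> \<le> 2 * \<bar>w y\<bar>"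
  "\<And>n. \<exists>a b. 0 < a \<and> a < b \<and> b < pi \<and> (\<forall>y. y \<notin> {a..b} \<longrightarrow> Wn n y = 0 \<and> Wn' n y = 0)"
  "\<And>y. y \<in> Ipi \<Longrightarrow> (\<lambda>n. Wn n y) \<longlonglongrightarrow> w y"
proof -
 define \<epsilon> where "\<epsilon> n = 1 / real (Suc n)" for n
 have eps: "0 < \<epsilon> n" "\<epsilon> n \<le> 1" for n unfolding \<epsilon>_def by auto
 define \<theta> where "\<theta> n z = max 0 (z - 2 * \<epsilon> n) + min 0 (z + 2 * \<epsilon> n)" for n z
 define cut where "cut n y = max 0 (min 1 (min y (pi - y) / \<epsilon> n - 1))" for n y
 define g where "g n y = cut n y * \<theta> n (w y)" for n y
 have th: "\<bar>\<theta> n z\<bar> \<le> \<bar>z\<bar>" "\<bar>\<theta> n z - z\<bar> \<le> 2 * \<epsilon> n" for n z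
  using eps(1)[of n] unfolding \<theta>_def by (auto simp: max_def min_def abs_if)
 have th0: "\<theta> n z = 0" if "\<bar>z\<bar> \<le> 2 * \<epsilon> n" for n z
  using that unfolding \<theta>_def by (simp add: abs_le_iff)
 have ch: "0 \<le> cut n y" "cut n y \<le> 1" for n y unfolding cut_def by auto
 have ch0: "cut n y = 0" if "min y (pi - y) \<le> \<epsilon> n" for n y
 proof -
  have "min y (pi - y) / \<epsilon> n \<le> 1" using that eps(1)[of n] by (simp add: divide_le_eq)
  then show ?thesis unfolding cut_def by simp
 qed
 have ch1: "cut n y = 1" if "2 * \<epsilon> n \<le> min y (pi - y)" for n y
 proof -
  have "2 \<le> min y (pi - y) / \<epsilon> n" using that eps(1)[of n] by (simp add: le_divide_eq)
  then show ?thesis unfolding cut_def by simp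
 qed
 have gc: "continuous_on UNIV (g n)" for n
  unfolding g_def cut_def \<theta>_def using eps(1)[of n] by (intro continuous_intros w) auto
 have "\<exists>h. 0 < h \<and> h \<le> \<epsilon> n / 2 \<and> (\<forall>y z. y \<in> {0..pi} \<longrightarrow> y < z \<longrightarrow> z < y + h \<longrightarrow> \<bar>w z - w y\<bar> \<le> \<epsilon> n)" for n
 proof -
  have "uniformly_continuous_on {0..pi + 1} w"
   by (intro compact_uniformly_continuous continuous_on_subset[OF w]) auto
  then obtain d where d: "d > 0" "\<And>y z. y \<in> {0..pi + 1} \<Longrightarrow> z \<in> {0..pi + 1} \<Longrightarrow> dist z y < d \<Longrightarrow> dist (w z) (w y) < \<epsilon> n"
   unfolding uniformly_continuous_on_def using eps(1)[of n] by metis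
  have "\<bar>w z - w y\<bar> \<le> \<epsilon> n" if "y \<in> {0..pi}" "y < z" "z < y + min d (\<epsilon> n / 2)" for y z
  proof -
   have "z < y + d" "z < y + \<epsilon> n / 2" using that(3) by (auto simp: min_def split: if_splits)
   then have "z \<in> {0..pi + 1}" "dist z y < d" using that(1,2) eps(2)[of n] by (auto simp: dist_real_def)
   from d(2)[OF _ this] show ?thesis using that(1) by (simp add: dist_real_def less_imp_le)
  qed
  then show ?thesis using d(1) eps(1)[of n] by (intro exI[of _ "min d (\<epsilon> n / 2)"]) auto
 qed
 then obtain h where h: "\<And>n. 0 < h n" "\<And>n. h n \<le> \<epsilon> n / 2"
   "\<And>n y z. y \<in> {0..pi} \<Longrightarrow> y < z \<Longrightarrow> z < y + h n \<Longrightarrow> \<bar>w z - w y\<bar> \<le> \<epsilon> n"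
  by metis
 define Wn where "Wn n y = (prim (g n) (y + h n) - prim (g n) y) / h n" for n y
 define Wn' where "Wn' n y = (g n (y + h n) - g n y) / h n" for n y
 have mv: "\<exists>x. y < x \<and> x < y + h n \<and> Wn n y = g n x" for n y
 proof -
  obtain x where "y < x" "x < y + h n" "prim (g n) (y + h n) - prim (g n) y = (y + h n - y) * g n x"
   using MVT2[of y "y + h n" "prim (g n)" "g n"] h(1)[of n] DERIV_prim[OF gc] by auto
  then show ?thesis using h(1)[of n] unfolding Wn_def by auto
 qed
 have gb: "\<bar>g n x\<bar> \<le> \<bar>\<theta> n (w x)\<bar>" for n x
  using mult_right_mono[OF ch(2)[of n x], of "\<bar>\<theta> n (w x)\<bar>"] ch(1)[of n x] unfolding g_def by (simp add: abs_mult)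
 show thesis
 proof (rule that[of Wn Wn'])
  fix n y
  have "((\<lambda>y. prim (g n) (y + h n)) has_real_derivative g n (y + h n) * 1) (at y)"
   by (rule DERIV_chain2[OF DERIV_prim[OF gc]]) (auto intro!: derivative_eq_intros)
  then show "(Wn n has_real_derivative Wn' n y) (at y)"
   unfolding Wn_def[abs_def] Wn'_def using DERIV_prim[OF gc, of n y]
   by (intro DERIV_cdivide DERIV_diff) auto
 next
  fix n
  show "continuous_on UNIV (Wn' n)" unfolding Wn'_def using h(1)[of n]
   by (intro continuous_intros continuous_on_compose2[OF gc] gc) auto
  define a where "a = \<epsilon> n / 2"
  define b where "b = pi - \<epsilon> n / 2"
  have "g n x = 0" if "x \<le> \<epsilon> n \<or> pi - \<epsilon> n \<le> x" for x
   using ch0[of x n] that unfolding g_def by (auto simp: min_def)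
  moreover have "\<epsilon> n / 2 + h n \<le> \<epsilon> n" using h(2)[of n] by simp
  ultimately have g0: "g n x = 0" if "y \<notin> {a..b}" "y \<le> x" "x \<le> y + h n" for x y
   using that eps[of n] unfolding a_def b_def by (cases "y < a") (auto simp: a_def)
  have "Wn n y = 0 \<and> Wn' n y = 0" if y: "y \<notin> {a..b}" for y
  proof -
   obtain x where x: "y < x" "x < y + h n" "Wn n y = g n x" using mv by blast
   have "Wn n y = 0" using g0[OF y, of x] x by simp
   moreover have "g n y = 0" "g n (y + h n) = 0" using g0[OF y, of y] g0[OF y, of "y + h n"] h(1)[of n] by auto
   ultimately show ?thesis unfolding Wn'_def by simp
  qed
  moreover have "0 < a" "a < b" "b < pi" using eps[of n] pi_gt3 unfolding a_def b_def by auto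
  ultimately show "\<exists>a b. 0 < a \<and> a < b \<and> b < pi \<and> (\<forall>y. y \<notin> {a..b} \<longrightarrow> Wn n y = 0 \<and> Wn' n y = 0)" by blast
 next
  fix n and y :: real assume y: "y \<in> Ipi"
  obtain x where x: "y < x" "x < y + h n" "Wn n y = g n x" using mv by blast
  have d: "\<bar>w x - w y\<bar> \<le> \<epsilon> n" using h(3)[of y x n] x y by auto
  show "\<bar>Wn n y\<bar> \<le> 2 * \<bar>w y\<bar>"
  proof (cases "\<bar>w y\<bar> \<le> \<epsilon> n")
   case True
   then have "\<theta> n (w x) = 0" using d by (intro th0) linarith
   then show ?thesis using gb[of n x] x(3) by simp
  next
   case False
   then show ?thesis using gb[of n x] th(1)[of n "w x"] d x(3) by linarith
  qed
 next
  fix y :: real assume y: "y \<in> Ipi"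
  have e0: "\<epsilon> \<longlonglongrightarrow> 0" unfolding \<epsilon>_def[abs_def] by (rule LIMSEQ_inverse_real_of_nat[unfolded inverse_eq_divide])
  have "\<forall>\<^sub>F n in sequentially. \<epsilon> n < min y (pi - y) / 3"
   using order_tendstoD(2)[OF e0, of "min y (pi - y) / 3"] y by simp
  then have "\<forall>\<^sub>F n in sequentially. norm (Wn n y - w y) \<le> 3 * \<epsilon> n"
  proof eventually_elim
   case (elim n)
   obtain x where x: "y < x" "x < y + h n" "Wn n y = g n x" using mv by blast
   have d: "\<bar>w x - w y\<bar> \<le> \<epsilon> n" using h(3)[of y x n] x y by auto
   have "2 * \<epsilon> n \<le> min x (pi - x)" using elim x h(2)[of n] eps(1)[of n] by (auto simp: min_def split: if_splits)
   then have "Wn n y = \<theta> n (w x)" using x(3) ch1 unfolding g_def by simp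
   then show ?case using th(2)[of n "w x"] d unfolding real_norm_def by linarith
  qed
  moreover have "(\<lambda>n. 3 * \<epsilon> n) \<longlonglongrightarrow> 0" using tendsto_mult[OF tendsto_const[of 3] e0] by simp
  ultimately have "(\<lambda>n. Wn n y - w y) \<longlonglongrightarrow> 0" by (rule Lim_null_comparison)
  then show "(\<lambda>n. Wn n y) \<longlonglongrightarrow> w y" by (rule LIM_zero_cancel)
 qed
qed

lemma set_integral_dominated_limit:
 fixes f :: "real \<Rightarrow> real" and g :: "nat \<Rightarrow> real \<Rightarrow> real"
 assumes f: "set_integrable lborel {a<..<b} f"
  and gc: "\<And>n. continuous_on {a..b} (g n)" and hc: "continuous_on {a..b} h"
  and b: "\<And>n y. y \<in> {a<..<b} \<Longrightarrow> \<bar>g n y\<bar> \<le> B" and lim: "\<And>y. y \<in> {a<..<b} \<Longrightarrow> (\<lambda>n. g n y) \<longlonglongrightarrow> h y"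
 shows "(\<lambda>n. LINT y:{a<..<b}|lborel. f y * g n y) \<longlonglongrightarrow> (LINT y:{a<..<b}|lborel. f y * h y)"
 unfolding set_lebesgue_integral_def
proof (rule integral_dominated_convergence[where w = "\<lambda>y. B * \<bar>indicator {a<..<b} y *\<^sub>R f y\<bar>"])
 show "(\<lambda>y. indicator {a<..<b} y *\<^sub>R (f y * h y)) \<in> borel_measurable lborel"
  using set_integrable_mult_continuous[OF f hc] unfolding set_integrable_def by auto
 show "(\<lambda>y. indicator {a<..<b} y *\<^sub>R (f y * g n y)) \<in> borel_measurable lborel" for n
  using set_integrable_mult_continuous[OF f gc[of n]] unfolding set_integrable_def by auto
 show "integrable lborel (\<lambda>y. B * \<bar>indicator {a<..<b} y *\<^sub>R f y\<bar>)"
  using f unfolding set_integrable_def by simp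
 show "AE y in lborel. (\<lambda>n. indicator {a<..<b} y *\<^sub>R (f y * g n y)) \<longlonglongrightarrow> indicator {a<..<b} y *\<^sub>R (f y * h y)"
  using lim by (intro AE_I2) (auto simp: indicator_def intro!: tendsto_intros)
 show "AE y in lborel. norm (indicator {a<..<b} y *\<^sub>R (f y * g n y)) \<le> B * \<bar>indicator {a<..<b} y *\<^sub>R f y\<bar>" for n
 proof (intro AE_I2)
  fix y
  show "norm (indicator {a<..<b} y *\<^sub>R (f y * g n y)) \<le> B * \<bar>indicator {a<..<b} y *\<^sub>R f y\<bar>"
   using mult_left_mono[OF b[of y n], of "\<bar>f y\<bar>"] by (cases "y \<in> {a<..<b}") (auto simp: abs_mult mult.commute)
 qed
qed

context mild
begin

text \<open>The bound by \<open>sin\<close> compensates that \<open>u\<^sub>y * w\<close> is only integrable with this weight.\<close>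

definition good_test :: "(real \<Rightarrow> real) \<Rightarrow> (real \<Rightarrow> real) \<Rightarrow> (real \<Rightarrow> real) \<Rightarrow> bool" where
 "good_test \<phi> \<phi>' \<phi>'' \<longleftrightarrow> (\<forall>y. (\<phi> has_real_derivative \<phi>' y) (at y)) \<and> (\<forall>y. (\<phi>' has_real_derivative \<phi>'' y) (at y)) \<and>
  continuous_on UNIV \<phi>'' \<and> \<phi> 0 = 0 \<and> \<phi> pi = 0 \<and> (\<exists>C. \<forall>y\<in>{0..pi}. \<bar>\<phi> y\<bar> \<le> C * sin y)"

lemma good_test_continuous:
 assumes "good_test \<phi> \<phi>' \<phi>''"
 shows "continuous_on A \<phi>" "continuous_on A \<phi>'" "continuous_on A \<phi>''"
proof -
 show "continuous_on A \<phi>" "continuous_on A \<phi>'"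
  using assms unfolding good_test_def by (blast intro: DERIV_continuous_on DERIV_subset)+
 show "continuous_on A \<phi>''" using assms unfolding good_test_def by (blast intro: continuous_on_subset)
qed

lemma good_test_integrable:
 assumes t': "0 < t'" "t' < T" and g: "good_test \<phi> \<phi>' \<phi>''"
 shows "integrable lborel (weak_density t' \<phi> \<phi>' \<phi>'')"
  "integrable lborel (\<lambda>z. indicator (rect t) z * weak_density t' \<phi> \<phi>' \<phi>'' z)"
proof -
 obtain C where "\<forall>y\<in>{0..pi}. \<bar>\<phi> y\<bar> \<le> C * sin y" using g unfolding good_test_def by blast
 then show i: "integrable lborel (weak_density t' \<phi> \<phi>' \<phi>'')"
  by (intro weak_density_integrable[OF t'] good_test_continuous[OF g]) auto
 show "integrable lborel (\<lambda>z. indicator (rect t) z * weak_density t' \<phi> \<phi>' \<phi>'' z)"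
  using integrable_mult_indicator[OF _ i, of "rect t"] by simp
qed

lemma weak_eq_linear:
 assumes t': "0 < t'" "t' < T" and g: "good_test \<phi> \<phi>' \<phi>''" "good_test \<psi> \<psi>' \<psi>''"
  and e: "weak_eq t' \<phi> \<phi>' \<phi>''" "weak_eq t' \<psi> \<psi>' \<psi>''"
 shows "good_test (\<lambda>y. a * \<phi> y + b * \<psi> y) (\<lambda>y. a * \<phi>' y + b * \<psi>' y) (\<lambda>y. a * \<phi>'' y + b * \<psi>'' y)"
  "weak_eq t' (\<lambda>y. a * \<phi> y + b * \<psi> y) (\<lambda>y. a * \<phi>' y + b * \<psi>' y) (\<lambda>y. a * \<phi>'' y + b * \<psi>'' y)"
proof -
 obtain C D where CD: "\<forall>y\<in>{0..pi}. \<bar>\<phi> y\<bar> \<le> C * sin y" "\<forall>y\<in>{0..pi}. \<bar>\<psi> y\<bar> \<le> D * sin y"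
  using g unfolding good_test_def by blast
 have "\<bar>a * \<phi> y + b * \<psi> y\<bar> \<le> (\<bar>a\<bar> * C + \<bar>b\<bar> * D) * sin y" if y: "y \<in> {0..pi}" for y
 proof -
  have "\<bar>a * \<phi> y + b * \<psi> y\<bar> \<le> \<bar>a\<bar> * \<bar>\<phi> y\<bar> + \<bar>b\<bar> * \<bar>\<psi> y\<bar>" unfolding abs_mult[symmetric] by (rule abs_triangle_ineq)
  also have "\<dots> \<le> \<bar>a\<bar> * (C * sin y) + \<bar>b\<bar> * (D * sin y)" using CD y by (intro add_mono mult_left_mono) auto
  finally show ?thesis by (simp add: algebra_simps)
 qed
 then have ex: "\<exists>C. \<forall>y\<in>{0..pi}. \<bar>a * \<phi> y + b * \<psi> y\<bar> \<le> C * sin y" by blast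
 show "good_test (\<lambda>y. a * \<phi> y + b * \<psi> y) (\<lambda>y. a * \<phi>' y + b * \<psi>' y) (\<lambda>y. a * \<phi>'' y + b * \<psi>'' y)"
  unfolding good_test_def using g ex unfolding good_test_def
  by (intro conjI allI DERIV_add DERIV_cmult continuous_intros) auto
 show "weak_eq t' (\<lambda>y. a * \<phi> y + b * \<psi> y) (\<lambda>y. a * \<phi>' y + b * \<psi>' y) (\<lambda>y. a * \<phi>'' y + b * \<psi>'' y)"
  unfolding weak_eq_def
  using e[unfolded weak_eq_def] AE_u_integrable[OF t']
 proof eventually_elim
  case (elim t)
  show ?case
  proof
   assume t: "t \<in> {0<..<t'}"
   have lin: "(LI x. f x * (a * \<phi> x + b * \<psi> x)) = a * (LI x. f x * \<phi> x) + b * (LI x. f x * \<psi> x)"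
    if f: "integrable_I f" for f
   proof -
    have i: "integrable_I (\<lambda>x. a * (f x * \<phi> x))" "integrable_I (\<lambda>x. b * (f x * \<psi> x))"
     by (rule set_integrable_mult_right, rule set_integrable_mult_continuous[OF f], rule good_test_continuous(1)[OF g(1)])
      (rule set_integrable_mult_right, rule set_integrable_mult_continuous[OF f], rule good_test_continuous(1)[OF g(2)])
    have "(LI x. f x * (a * \<phi> x + b * \<psi> x)) = (LI x. a * (f x * \<phi> x) + b * (f x * \<psi> x))"
     by (simp add: algebra_simps)
    then show ?thesis unfolding set_integral_add(2)[OF i] by simp
   qed
   have "(LB z. indicator (rect t) z * weak_density t' (\<lambda>y. a * \<phi> y + b * \<psi> y) (\<lambda>y. a * \<phi>' y + b * \<psi>' y) (\<lambda>y. a * \<phi>'' y + b * \<psi>'' y) z)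
    = (LB z. a * (indicator (rect t) z * weak_density t' \<phi> \<phi>' \<phi>'' z) + b * (indicator (rect t) z * weak_density t' \<psi> \<psi>' \<psi>'' z))"
    unfolding weak_density_def by (intro Bochner_Integration.integral_cong) (auto simp: algebra_simps)
   also have "\<dots> = a * (LB z. indicator (rect t) z * weak_density t' \<phi> \<phi>' \<phi>'' z) + b * (LB z. indicator (rect t) z * weak_density t' \<psi> \<psi>' \<psi>'' z)"
    using good_test_integrable(2)[OF t' g(1)] good_test_integrable(2)[OF t' g(2)] by simp
   finally show "(LI x. u t x * (a * \<phi> x + b * \<psi> x)) = (LI x. u0 x * (a * \<phi> x + b * \<psi> x))
    + (LB z. indicator (rect t) z * weak_density t' (\<lambda>y. a * \<phi> y + b * \<psi> y) (\<lambda>y. a * \<phi>' y + b * \<psi>' y) (\<lambda>y. a * \<phi>'' y + b * \<psi>'' y) z)"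
    using elim t lin[of "u t"] lin[OF set_integrable_continuous[OF u0]] by (simp add: algebra_simps)
  qed
 qed
qed

text \<open>Each sine mode is a multiple of its own second derivative, so the second derivatives of admissible
  test functions include all polynomials in \<open>cos\<close> times \<open>sin\<close>.\<close>

lemma weak_eq_sine_poly:
 assumes t': "0 < t'" "t' < T" and p: "real_polynomial_function p"
 shows "\<exists>\<phi> \<phi>'. good_test \<phi> \<phi>' (\<lambda>y. p (cos y) * sin y) \<and> weak_eq t' \<phi> \<phi>' (\<lambda>y. p (cos y) * sin y)"
proof (rule sin_poly_induct[OF _ _ _ p])
 fix f g assume "\<exists>\<phi> \<phi>'. good_test \<phi> \<phi>' f \<and> weak_eq t' \<phi> \<phi>' f" "\<exists>\<phi> \<phi>'. good_test \<phi> \<phi>' g \<and> weak_eq t' \<phi> \<phi>' g"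
 then obtain \<phi> \<phi>' \<psi> \<psi>' where h: "good_test \<phi> \<phi>' f" "weak_eq t' \<phi> \<phi>' f" "good_test \<psi> \<psi>' g" "weak_eq t' \<psi> \<psi>' g" by blast
 from weak_eq_linear[OF t' h(1,3,2,4), of 1 1]
 show "\<exists>\<phi> \<phi>'. good_test \<phi> \<phi>' (\<lambda>y. f y + g y) \<and> weak_eq t' \<phi> \<phi>' (\<lambda>y. f y + g y)" by auto
next
 fix c f assume "\<exists>\<phi> \<phi>'. good_test \<phi> \<phi>' f \<and> weak_eq t' \<phi> \<phi>' f"
 then obtain \<phi> \<phi>' where h: "good_test \<phi> \<phi>' f" "weak_eq t' \<phi> \<phi>' f" by blast
 from weak_eq_linear[OF t' h(1,1,2,2), of c 0]
 show "\<exists>\<phi> \<phi>'. good_test \<phi> \<phi>' (\<lambda>y. c * f y) \<and> weak_eq t' \<phi> \<phi>' (\<lambda>y. c * f y)" by auto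
next
 fix k
 let ?m = "smode k"
 have g: "good_test ?m (\<lambda>y. real (Suc k) * cmode k y) (\<lambda>y. - (real (Suc k))\<^sup>2 * ?m y)"
  unfolding good_test_def
 proof (intro conjI allI)
  fix y
  show "((\<lambda>y. real (Suc k) * cmode k y) has_real_derivative - (real (Suc k))\<^sup>2 * ?m y) (at y)"
   using DERIV_cmult[OF DERIV_modes(2)[of "Suc k" y], of "real (Suc k)"]
   by (simp add: power2_eq_square mult_ac del: of_nat_Suc)
  show "\<exists>C. \<forall>y\<in>{0..pi}. \<bar>?m y\<bar> \<le> C * sin y" using abs_dirichlet_mode_le_sin by blast
 qed (auto intro!: continuous_intros DERIV_modes(1) simp: mode_boundary simp del: of_nat_Suc)
 define c where "c = - 1 / ((real (Suc k))\<^sup>2 * sqrt (2 / pi))"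
 have "c * (- (real (Suc k))\<^sup>2 * ?m y) = sin (real (Suc k) * y)" for y
  unfolding c_def dirichlet_mode_def using sqrt_2_pi(1) by (simp del: of_nat_Suc)
 then have e: "(\<lambda>y. c * (- (real (Suc k))\<^sup>2 * ?m y) + 0 * (- (real (Suc k))\<^sup>2 * ?m y)) = (\<lambda>y. sin (real (Suc k) * y))" by simp
 from weak_eq_linear[OF t' g g weak_eq_mode[OF t'] weak_eq_mode[OF t'], of c 0]
 show "\<exists>\<phi> \<phi>'. good_test \<phi> \<phi>' (\<lambda>y. sin (real (Suc k) * y)) \<and> weak_eq t' \<phi> \<phi>' (\<lambda>y. sin (real (Suc k) * y))"
  unfolding e by blast
qed

text \<open>A limit of test functions passes through the weak formulation when the densities are dominated.\<close>

lemma weak_limit: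
 assumes t': "0 < t'" "t' < T"
  and e: "AE t in lborel. \<forall>n. t \<in> {0<..<t'} \<longrightarrow> (LI x. u t x * \<phi> n x) = (LI x. u0 x * \<phi> n x) + (LB z. indicator (rect t) z * d n z)"
  and c: "\<And>n. continuous_on {0..pi} (\<phi> n)" "continuous_on {0..pi} \<phi>l"
  and b: "\<And>n y. y \<in> Ipi \<Longrightarrow> \<bar>\<phi> n y\<bar> \<le> B" and l: "\<And>y. y \<in> Ipi \<Longrightarrow> (\<lambda>n. \<phi> n y) \<longlonglongrightarrow> \<phi>l y"
  and dm: "\<And>n. d n \<in> borel_fun" and Z: "integrable lborel Z" "\<And>z. 0 \<le> Z z"
  and db: "\<And>n z. snd z \<in> Ipi \<Longrightarrow> \<bar>d n z\<bar> \<le> Z z" and dl: "\<And>z. snd z \<in> Ipi \<Longrightarrow> (\<lambda>n. d n z) \<longlonglongrightarrow> dl z"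
 shows "AE t in lborel. t \<in> {0<..<t'} \<longrightarrow> (LI x. u t x * \<phi>l x) = (LI x. u0 x * \<phi>l x) + (LB z. indicator (rect t) z * dl z)"
 using e AE_u_integrable[OF t']
proof eventually_elim
 case (elim t)
 show ?case
 proof
  assume t: "t \<in> {0<..<t'}"
  then have ui: "integrable_I (u t)" using elim by blast
  note L1 = set_integral_dominated_limit[OF ui c b l]
  note L2 = set_integral_dominated_limit[OF set_integrable_continuous[OF u0] c b l]
  have lim: "(\<lambda>n. indicator (rect t) z * d n z) \<longlonglongrightarrow> indicator (rect t) z * dl z" for z
   by (cases "z \<in> rect t") (auto intro!: tendsto_intros dl simp: rect_def)
  have m: "(\<lambda>z. indicator (rect t) z * d n z) \<in> borel_fun" for n using dm[of n] by measurable
  have L3: "(\<lambda>n. LB z. indicator (rect t) z * d n z) \<longlonglongrightarrow> (LB z. indicator (rect t) z * dl z)"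
  proof (rule integral_dominated_convergence[OF _ _ Z(1)])
   show "(\<lambda>z. indicator (rect t) z * dl z) \<in> borel_measurable lborel" using borel_measurable_LIMSEQ_real[OF lim m] by simp
   show "AE z in lborel. norm (indicator (rect t) z * d n z) \<le> Z z" for n
    using db[of _ n] Z(2) by (intro AE_I2) (auto simp: rect_def indicator_def)
  qed (use m lim in auto)
  have "(\<lambda>n. LI x. u t x * \<phi> n x) = (\<lambda>n. (LI x. u0 x * \<phi> n x) + (LB z. indicator (rect t) z * d n z))"
   using elim(1) t by auto
  with L1 have "(\<lambda>n. (LI x. u0 x * \<phi> n x) + (LB z. indicator (rect t) z * d n z)) \<longlonglongrightarrow> (LI x. u t x * \<phi>l x)" by simp
  from LIMSEQ_unique[OF this tendsto_add[OF L2 L3]]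
  show "(LI x. u t x * \<phi>l x) = (LI x. u0 x * \<phi>l x) + (LB z. indicator (rect t) z * dl z)" .
 qed
qed

text \<open>Approximate the second derivative by \<open>p (cos y) * sin y\<close> with error \<open>\<epsilon> * sin y\<close>. Two integrations carry the same error over to
  the test function, including its decay at the boundary.\<close>

lemma weak_eq_general:
 assumes t': "0 < t'" "t' < T"
  and d: "\<And>y. (\<phi> has_real_derivative \<phi>' y) (at y)" "\<And>y. (\<phi>' has_real_derivative \<phi>'' y) (at y)"
  and c: "continuous_on UNIV \<phi>''" and b: "\<phi> 0 = 0" "\<phi> pi = 0"
  and h: "continuous_on {0..pi} h" "\<And>y. y \<in> {0..pi} \<Longrightarrow> \<phi>'' y = h y * sin y"
 shows "weak_eq t' \<phi> \<phi>' \<phi>''" "good_test \<phi> \<phi>' \<phi>''"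
proof -
 have sn: "0 \<le> sin y" if "y \<in> {0..pi}" for y :: real using that by (simp add: sin_ge_zero)
 obtain B where B: "\<forall>y\<in>{0..pi}. \<bar>h y\<bar> \<le> B"
  using compact_imp_bounded[OF compact_continuous_image[OF h(1) compact_Icc]] unfolding bounded_iff by auto
 have "\<bar>\<phi>'' y\<bar> \<le> B * sin y" if y: "y \<in> {0..pi}" for y
  using mult_right_mono[OF bspec[OF B y] sn[OF y]] sn[OF y] unfolding h(2)[OF y] by (simp add: abs_mult)
 from small_second_derivative(1)[OF d b this]
 show g: "good_test \<phi> \<phi>' \<phi>''" unfolding good_test_def using d c b by blast
 have "\<exists>\<psi> \<psi>' s. good_test \<psi> \<psi>' s \<and> weak_eq t' \<psi> \<psi>' s \<and> (\<forall>y\<in>{0..pi}. \<bar>\<phi>'' y - s y\<bar> \<le> 1 / real (Suc n) * sin y)" for n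
 proof -
  obtain p where p: "real_polynomial_function p" "\<And>y. y \<in> {0..pi} \<Longrightarrow> \<bar>h y - p (cos y)\<bar> < 1 / real (Suc n)"
   using cos_poly_density[OF h(1), of "1 / real (Suc n)"] by auto
  have "\<bar>\<phi>'' y - p (cos y) * sin y\<bar> \<le> 1 / real (Suc n) * sin y" if y: "y \<in> {0..pi}" for y
  proof -
   have "\<bar>\<phi>'' y - p (cos y) * sin y\<bar> = \<bar>h y - p (cos y)\<bar> * sin y"
    unfolding h(2)[OF y] left_diff_distrib[symmetric] abs_mult using sn[OF y] by simp
   then show ?thesis using mult_right_mono[OF less_imp_le[OF p(2)[OF y]] sn[OF y]] by simp
  qed
  then show ?thesis using weak_eq_sine_poly[OF t' p(1)] by blast
 qed
 then obtain \<psi> \<psi>' s where ps: "\<And>n. good_test (\<psi> n) (\<psi>' n) (s n)" "\<And>n. weak_eq t' (\<psi> n) (\<psi>' n) (s n)"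
   "\<And>n y. y \<in> {0..pi} \<Longrightarrow> \<bar>\<phi>'' y - s n y\<bar> \<le> 1 / real (Suc n) * sin y" by metis
 have AEn: "AE t in lborel. \<forall>n. t \<in> {0<..<t'} \<longrightarrow>
  (LI x. u t x * \<psi> n x) = (LI x. u0 x * \<psi> n x)
   + (LB z. indicator (rect t) z * weak_density t' (\<psi> n) (\<psi>' n) (s n) z)"
  unfolding AE_all_countable using ps(2) unfolding weak_eq_def by blast
 have db: "\<bar>\<phi> y - \<psi> n y\<bar> \<le> 1 / real (Suc n) * sin y" "\<bar>\<phi>' y - \<psi>' n y\<bar> \<le> 1 / real (Suc n) * pi" if y: "y \<in> {0..pi}" for y n
 proof -
  have gt: "(\<psi> n has_real_derivative \<psi>' n y) (at y)" "(\<psi>' n has_real_derivative s n y) (at y)" "\<psi> n 0 = 0" "\<psi> n pi = 0" for y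
   using ps(1)[of n] unfolding good_test_def by auto
  have z: "\<phi> 0 - \<psi> n 0 = 0" "\<phi> pi - \<psi> n pi = 0" using gt b by auto
  note S = small_second_derivative[OF DERIV_diff[OF d(1) gt(1)] DERIV_diff[OF d(2) gt(2)] z ps(3) y]
  show "\<bar>\<phi> y - \<psi> n y\<bar> \<le> 1 / real (Suc n) * sin y" "\<bar>\<phi>' y - \<psi>' n y\<bar> \<le> 1 / real (Suc n) * pi"
   using S by auto
 qed
 obtain B0 where B0: "\<And>y. y \<in> {0..pi} \<Longrightarrow> \<bar>\<phi> y\<bar> \<le> B0"
  using compact_imp_bounded[OF compact_continuous_image[OF good_test_continuous(1)[OF g] compact_Icc]] unfolding bounded_iff by force
 define X where "X z = \<bar>ur t' z\<bar> + pi * \<bar>uw t' z\<bar> + \<bar>sin (snd z) * dw t' z\<bar>" for z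
 have X: "0 \<le> X z" for z unfolding X_def by (intro add_nonneg_nonneg mult_nonneg_nonneg) auto
 have diff: "\<bar>weak_density t' (\<psi> n) (\<psi>' n) (s n) z - weak_density t' \<phi> \<phi>' \<phi>'' z\<bar> \<le> 1 / real (Suc n) * X z" if "snd z \<in> Ipi" for n z
 proof -
  let ?y = "snd z" and ?e = "1 / real (Suc n)"
  have y: "?y \<in> {0..pi}" using that by auto
  have "weak_density t' (\<psi> n) (\<psi>' n) (s n) z - weak_density t' \<phi> \<phi>' \<phi>'' z
   = - (ur t' z * (\<phi>'' ?y - s n ?y) - uw t' z * (\<phi>' ?y - \<psi>' n ?y) - dw t' z * (\<phi> ?y - \<psi> n ?y))"
   unfolding weak_density_def by (simp add: algebra_simps)
  also have "\<bar>\<dots>\<bar> \<le> \<bar>ur t' z\<bar> * \<bar>\<phi>'' ?y - s n ?y\<bar> + \<bar>uw t' z\<bar> * \<bar>\<phi>' ?y - \<psi>' n ?y\<bar> + \<bar>dw t' z\<bar> * \<bar>\<phi> ?y - \<psi> n ?y\<bar>"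
   unfolding abs_mult[symmetric] by linarith
  also have "\<dots> \<le> \<bar>ur t' z\<bar> * (?e * 1) + \<bar>uw t' z\<bar> * (?e * pi) + \<bar>dw t' z\<bar> * (?e * sin ?y)"
  proof (intro add_mono mult_left_mono)
   have "?e * sin ?y \<le> ?e * 1" by (intro mult_left_mono) auto
   then show "\<bar>\<phi>'' ?y - s n ?y\<bar> \<le> ?e * 1" using ps(3)[OF y, of n] by linarith
  qed (use db[OF y, of n] in auto)
  also have "\<dots> = ?e * X z" unfolding X_def using sn[OF y] by (simp add: abs_mult algebra_simps)
  finally show ?thesis .
 qed
 have e1: "1 / real (Suc n) * r \<le> r" if "0 \<le> r" for n r using that by (simp add: divide_le_eq mult_le_cancel_left1)
 have e0: "(\<lambda>n. 1 / real (Suc n) * r) \<longlonglongrightarrow> 0" for r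
  using tendsto_mult[OF LIMSEQ_inverse_real_of_nat tendsto_const[of r]] by (simp add: inverse_eq_divide)
 show "weak_eq t' \<phi> \<phi>' \<phi>''" unfolding weak_eq_def
 proof (rule weak_limit[OF t' AEn])
  show "continuous_on {0..pi} (\<psi> n)" "continuous_on {0..pi} \<phi>" for n
   using good_test_continuous(1)[OF g] good_test_continuous(1)[OF ps(1)] by auto
  show "\<bar>\<psi> n y\<bar> \<le> B0 + 1" if "y \<in> Ipi" for n y
  proof -
   have y: "y \<in> {0..pi}" using that by simp
   show ?thesis using B0[OF y] db(1)[OF y, of n] order_trans[OF e1[OF sn[OF y], of n] sin_le_one] by linarith
  qed
  show "(\<lambda>n. \<psi> n y) \<longlonglongrightarrow> \<phi> y" if "y \<in> Ipi" for y
   by (rule LIM_zero_cancel, rule Lim_null_comparison[OF _ e0[of "sin y"]]) (use db(1)[of y] that in \<open>auto simp: abs_minus_commute\<close>)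
  show "weak_density t' (\<psi> n) (\<psi>' n) (s n) \<in> borel_fun" for n
   using borel_measurable_integrable[OF good_test_integrable(1)[OF t' ps(1)]] by simp
  show "integrable lborel (\<lambda>z. \<bar>weak_density t' \<phi> \<phi>' \<phi>'' z\<bar> + X z)"
   using ur_integrable[OF t'] uw_integrable[OF t'] sin_dw_integrable[OF t'] good_test_integrable(1)[OF t' g] unfolding X_def by simp
  show "0 \<le> \<bar>weak_density t' \<phi> \<phi>' \<phi>'' z\<bar> + X z" for z using X[of z] by simp
  show "\<bar>weak_density t' (\<psi> n) (\<psi>' n) (s n) z\<bar> \<le> \<bar>weak_density t' \<phi> \<phi>' \<phi>'' z\<bar> + X z" if "snd z \<in> Ipi" for n z
   using diff[OF that, of n] e1[OF X[of z], of n] by linarith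
  show "(\<lambda>n. weak_density t' (\<psi> n) (\<psi>' n) (s n) z) \<longlonglongrightarrow> weak_density t' \<phi> \<phi>' \<phi>'' z" if "snd z \<in> Ipi" for z
   by (rule LIM_zero_cancel, rule Lim_null_comparison[OF _ e0[of "X z"]]) (use diff[OF that] in auto)
 qed
qed

end

section \<open>The gauge transformation\<close>

context mild
begin

definition V :: "real \<Rightarrow> real" where "V = prim w"

lemma V_deriv: "(V has_real_derivative w y) (at y)"
 unfolding V_def by (rule DERIV_prim[OF w])

lemma V_continuous: "continuous_on A V"
 unfolding V_def by (rule continuous_on_prim[OF w])

lemma Wb_nonneg: "0 \<le> Wb"
 using wb[of 0] by linarith

text \<open>The source term of the heat equation for \<open>exp V * u\<close>.\<close>

definition FF :: "real \<Rightarrow> real \<times> real \<Rightarrow> real" where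
 "FF t' z = - (exp (V (snd z)) * (2 * dw t' z + w (snd z) * uw t' z))"

definition dr :: "real \<Rightarrow> real \<times> real \<Rightarrow> real" where
 "dr t' z = indicator (rect t') z * deriv (u (fst z)) (snd z)"

lemma dr_w: "dr t' z * w (snd z) = dw t' z" "ur t' z * w (snd z) = uw t' z"
 unfolding dr_def dw_def ur_def uw_def by simp_all

text \<open>The test function \<open>exp (V y) * m y\<close> is not twice differentiable, as \<open>w\<close> is only continuous. It
 is the limit of \<open>exp (V\<^sub>n y) * m y\<close> with twice differentiable \<open>V\<^sub>n\<close>; integrating by parts the
 term with \<open>V\<^sub>n''\<close> removes the only quantity that does not converge.\<close>

lemma gauge_weak:
 assumes t': "0 < t'" "t' < T"
 shows "AE t in lborel. t \<in> {0<..<t'} \<longrightarrow>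
  (LI x. u t x * (exp (V x) * smode k x)) =
  (LI x. u0 x * (exp (V x) * smode k x))
  + (LB z. indicator (rect t) z *
    (FF t' z * smode k (snd z)
    - (real (Suc k))\<^sup>2 * (ur t' z * (exp (V (snd z)) * smode k (snd z)))))"
proof -
 obtain Wn Wn' :: "nat \<Rightarrow> real \<Rightarrow> real" where
  Wd: "\<And>n y. (Wn n has_real_derivative Wn' n y) (at y)" and
  Wc': "\<And>n. continuous_on UNIV (Wn' n)" and
  Wle: "\<And>n y. y \<in> Ipi \<Longrightarrow> \<bar>Wn n y\<bar> \<le> 2 * \<bar>w y\<bar>" and
  Wsupp: "\<And>n. \<exists>a b. 0 < a \<and> a < b \<and> b < pi \<and> (\<forall>y. y \<notin> {a..b} \<longrightarrow> Wn n y = 0 \<and> Wn' n y = 0)" and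
  Wlim: "\<And>y. y \<in> Ipi \<Longrightarrow> (\<lambda>n. Wn n y) \<longlonglongrightarrow> w y"
  using dominated_smooth_approximation[OF w] by blast
 have Wc: "continuous_on A (Wn n)" for A n
  using DERIV_continuous_on[OF DERIV_subset[OF Wd subset_UNIV]] by blast
 have Wle': "\<bar>Wn n y\<bar> \<le> 2 * Wb" if "y \<in> {0..pi}" for n y
 proof (cases "y \<in> Ipi")
  case True then show ?thesis using Wle[OF True, of n] wb[of y] by linarith
 next
  case False
  then have "y = 0 \<or> y = pi" using that by auto
  then have "Wn n y = 0" using Wsupp[of n] by auto
  then show ?thesis using Wb_nonneg by simp
 qed
 define Vn where "Vn n = prim (Wn n)" for n
 have Vd: "(Vn n has_real_derivative Wn n y) (at y)" for n y
  unfolding Vn_def by (rule DERIV_prim[OF Wc])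
 have Vc: "continuous_on A (Vn n)" for A n unfolding Vn_def by (rule continuous_on_prim[OF Wc])
 have Vb: "Vn n y \<le> 2 * Wb * pi" if y: "y \<in> {0..pi}" for n y
 proof -
  have "norm (Vn n y - Vn n 0) \<le> (2 * Wb) * norm (y - 0)"
   by (rule field_differentiable_bound[of "{0..pi}" _ "Wn n"])
    (use y Wle' pi_ge_zero in \<open>auto intro: DERIV_subset[OF Vd]\<close>)
  also have "\<dots> \<le> 2 * Wb * pi" using y Wb_nonneg by (intro mult_left_mono) auto
  finally show ?thesis unfolding Vn_def by simp
 qed
 have Vlim: "(\<lambda>n. Vn n y) \<longlonglongrightarrow> V y" if y: "y \<in> {0..pi}" for y
 proof -
  have one: "set_integrable lborel {0<..<y} (\<lambda>_. 1 :: real)" by (intro set_integrable_continuous continuous_intros)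
  have "(\<lambda>n. LINT z:{0<..<y}|lborel. 1 * Wn n z) \<longlonglongrightarrow> (LINT z:{0<..<y}|lborel. 1 * w z)"
  proof (rule set_integral_dominated_limit[where B = "2 * Wb", OF one Wc continuous_on_subset[OF w subset_UNIV]])
   fix n z assume "z \<in> {0<..<y}"
   then have "z \<in> {0..pi}" "z \<in> Ipi" using y by auto
   then show "\<bar>Wn n z\<bar> \<le> 2 * Wb" "(\<lambda>n. Wn n z) \<longlonglongrightarrow> w z" using Wle' Wlim by blast+
  qed
  then show ?thesis unfolding V_def Vn_def using y by (simp add: prim_eq)
 qed
 define K where "K = real (Suc k)"
 have K: "1 \<le> K" unfolding K_def by simp
 define m where "m = smode k"
 define m' where "m' y = K * cmode k y" for y
 have md: "(m has_real_derivative m' y) (at y)" for y unfolding m_def m'_def K_def by (rule DERIV_modes)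
 have md': "(m' has_real_derivative - K\<^sup>2 * m y) (at y)" for y
  using DERIV_cmult[OF DERIV_modes(2)[of "Suc k" y], of K] unfolding m_def m'_def[abs_def] K_def
  by (simp add: power2_eq_square mult_ac del: of_nat_Suc)
 have mc: "continuous_on A m" "continuous_on A m'" for A unfolding m_def m'_def[abs_def] by (intro continuous_intros)+
 have mb: "\<bar>m y\<bar> \<le> 1" "\<bar>m' y\<bar> \<le> K" for y
  unfolding m_def m'_def using abs_mode_le(1) abs_mult_mode_le(2)[of K K] K by auto
 have ms: "\<bar>m y\<bar> \<le> K * sin y" if "y \<in> {0..pi}" for y unfolding m_def K_def by (rule abs_dirichlet_mode_le_sin[OF that])
 have mU: "m y = sqrt (2 / pi) * chebyshev_U k y * sin y" for y
  unfolding m_def dirichlet_mode_def using chebyshev_U[of k y] by simp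
 define \<phi> where "\<phi> n y = exp (Vn n y) * m y" for n y
 define \<phi>' where "\<phi>' n y = exp (Vn n y) * (m' y + Wn n y * m y)" for n y
 define \<phi>'' where "\<phi>'' n y = exp (Vn n y) * (- K\<^sup>2 * m y + 2 * (Wn n y * m' y) + Wn' n y * m y + (Wn n y)\<^sup>2 * m y)" for n y
 (* The part of the second derivative that is free of the derivative of Wn. *)
 define \<psi> where "\<psi> n y = exp (Vn n y) * (- K\<^sup>2 * m y + 2 * (Wn n y * m' y) + (Wn n y)\<^sup>2 * m y)" for n y
 have pd: "(\<phi> n has_real_derivative \<phi>' n y) (at y)" for n y
  unfolding \<phi>_def[abs_def] \<phi>'_def by (rule derivative_eq_intros Vd md refl)+ (simp add: algebra_simps)
 have pd': "(\<phi>' n has_real_derivative \<phi>'' n y) (at y)" for n y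
  unfolding \<phi>'_def[abs_def] \<phi>''_def
  by (rule derivative_eq_intros Vd Wd md md' refl)+ (simp add: algebra_simps power2_eq_square)
 have pc: "continuous_on A (\<phi> n)" "continuous_on A (\<phi>' n)" "continuous_on A (\<phi>'' n)" "continuous_on A (\<psi> n)" for A n
  unfolding \<phi>_def[abs_def] \<phi>'_def[abs_def] \<phi>''_def[abs_def] \<psi>_def[abs_def]
  by (intro continuous_intros Vc Wc mc continuous_on_subset[OF Wc' subset_UNIV])+
 define EB where "EB = exp (2 * Wb * pi)"
 have EB: "0 < EB" unfolding EB_def by simp
 have eb: "exp (Vn n y) \<le> EB" if "y \<in> {0..pi}" for n y using Vb[OF that, of n] unfolding EB_def by simp
 define C2 where "C2 = EB * (K + 2 * Wb)"
 define C1 where "C1 = EB * (K\<^sup>2 + 4 * Wb * K + (2 * Wb)\<^sup>2)"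
 have C0: "0 \<le> C1" "0 \<le> C2" unfolding C1_def C2_def using EB K Wb_nonneg by auto
 have b0: "\<bar>\<phi> n y\<bar> \<le> EB * K * sin y" if "y \<in> {0..pi}" for n y
  using mult_mono[OF eb[OF that, of n] ms[OF that]] EB unfolding \<phi>_def by (simp add: abs_mult mult.assoc)
 have wm: "\<bar>Wn n y * m y\<bar> \<le> 2 * Wb" if "y \<in> {0..pi}" for n y
  using mult_mono[OF Wle'[OF that, of n] mb(1)[of y]] Wb_nonneg by (simp add: abs_mult)
 have b1: "\<bar>\<phi>' n y\<bar> \<le> C2" if y: "y \<in> {0..pi}" for n y
 proof -
  have "\<bar>m' y + Wn n y * m y\<bar> \<le> K + 2 * Wb" using mb(2)[of y] wm[OF y, of n] by linarith
  from mult_mono[OF eb[OF y, of n] this] show ?thesis unfolding \<phi>'_def C2_def using EB by (simp add: abs_mult)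
 qed
 have b2: "\<bar>\<psi> n y\<bar> \<le> C1" if y: "y \<in> {0..pi}" for n y
 proof -
  have "\<bar>- K\<^sup>2 * m y\<bar> \<le> K\<^sup>2" using mult_left_mono[OF mb(1)[of y], of "K\<^sup>2"] by (simp add: abs_mult)
  moreover have "\<bar>2 * (Wn n y * m' y)\<bar> \<le> 4 * Wb * K"
   using mult_mono[OF Wle'[OF y, of n] mb(2)[of y]] Wb_nonneg by (simp add: abs_mult mult_ac)
  moreover have "\<bar>(Wn n y)\<^sup>2 * m y\<bar> \<le> (2 * Wb)\<^sup>2 * 1"
  proof -
   have "(Wn n y)\<^sup>2 \<le> (2 * Wb)\<^sup>2" using power_mono[OF Wle'[OF y, of n] abs_ge_zero, of 2] by simp
   then show ?thesis unfolding abs_mult using mb(1)[of y] by (intro mult_mono) auto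
  qed
  ultimately have "\<bar>- K\<^sup>2 * m y + 2 * (Wn n y * m' y) + (Wn n y)\<^sup>2 * m y\<bar> \<le> K\<^sup>2 + 4 * Wb * K + (2 * Wb)\<^sup>2" by linarith
  from mult_mono[OF eb[OF y, of n] this] show ?thesis unfolding \<psi>_def C1_def using EB by (simp add: abs_mult)
 qed
 have we: "weak_eq t' (\<phi> n) (\<phi>' n) (\<phi>'' n)" and gt: "good_test (\<phi> n) (\<phi>' n) (\<phi>'' n)" for n
 proof -
  obtain a b where ab: "0 < a" "a < b" "b < pi" "\<forall>y. y \<notin> {a..b} \<longrightarrow> Wn n y = 0 \<and> Wn' n y = 0" using Wsupp by blast
  obtain z where z: "z \<in> {a..b}" "\<forall>y\<in>{a..b}. sin z \<le> sin y"
   using continuous_attains_inf[of "{a..b}" sin, OF _ _ continuous_on_sin[OF continuous_on_id]] ab by auto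
  have sz: "0 < sin z" using z ab by (intro sin_gt_zero) auto
  (* The test function needs a second derivative that is a continuous multiple of sin. Wn vanishes near the
   ends, so the maximum merely keeps the denominator positive. *)
  define q where "q y = Wn n y / max (sin y) (sin z)" for y
  have qc: "continuous_on {0..pi} q" unfolding q_def[abs_def] using sz by (intro continuous_intros Wc) auto
  have qs: "Wn n y = q y * sin y" for y
  proof (cases "y \<in> {a..b}")
   case True
   then have "sin z \<le> sin y" using z(2) by blast
   then show ?thesis using sz unfolding q_def by (simp add: max_absorb1)
  qed (use ab(4) in \<open>simp add: q_def\<close>)
  define h where "h y = exp (Vn n y) * ((- K\<^sup>2 + Wn' n y + (Wn n y)\<^sup>2) * (sqrt (2 / pi) * chebyshev_U k y) + 2 * (q y * m' y))" for y
  have hc: "continuous_on {0..pi} h" unfolding h_def[abs_def]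
   by (intro continuous_intros Vc Wc mc qc chebyshev_U_continuous continuous_on_subset[OF Wc' subset_UNIV])
  have hs: "\<phi>'' n y = h y * sin y" for y
  proof -
   have "h y * sin y = exp (Vn n y) * ((- K\<^sup>2 + Wn' n y + (Wn n y)\<^sup>2) * (sqrt (2 / pi) * chebyshev_U k y * sin y) + 2 * ((q y * sin y) * m' y))"
    unfolding h_def by (simp only: distrib_right distrib_left mult_ac)
   also have "\<dots> = \<phi>'' n y" unfolding mU[symmetric] qs[symmetric] \<phi>''_def by (simp only: distrib_right distrib_left add_ac)
   finally show ?thesis ..
  qed
  have bb: "\<phi> n 0 = 0" "\<phi> n pi = 0" unfolding \<phi>_def m_def mode_boundary by simp_all
  show "weak_eq t' (\<phi> n) (\<phi>' n) (\<phi>'' n)" "good_test (\<phi> n) (\<phi>' n) (\<phi>'' n)"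
   by (rule weak_eq_general[OF t' pd pd' pc(3) bb hc hs])+
 qed
 (* The density splits into a convergent part and the divergence df of u * Wn * phi. *)
 define wd where "wd n z = ur t' z * \<psi> n (snd z) - uw t' z * \<phi>' n (snd z) - dw t' z * \<phi> n (snd z)
   - ur t' z * (Wn n (snd z) * \<phi>' n (snd z)) - dr t' z * (Wn n (snd z) * \<phi> n (snd z))" for n z
 define df where "df n z = ur t' z * (Wn' n (snd z) * \<phi> n (snd z)) + ur t' z * (Wn n (snd z) * \<phi>' n (snd z)) + dr t' z * (Wn n (snd z) * \<phi> n (snd z))" for n z
 have split: "weak_density t' (\<phi> n) (\<phi>' n) (\<phi>'' n) z = wd n z + df n z" for n z
  unfolding weak_density_def wd_def df_def \<psi>_def \<phi>''_def \<phi>_def by (simp add: algebra_simps)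
 have [measurable]: "dr t' \<in> borel_fun" unfolding dr_def[abs_def] using t' by (intro dr_measurable) auto
 (* Here the comparison of Wn with w is used: only the product of the derivative with w is integrable. *)
 have drb: "\<bar>dr t' z * (Wn n (snd z) * \<phi> n (snd z))\<bar> \<le> 2 * \<bar>dw t' z * \<phi> n (snd z)\<bar>" for n z
 proof (cases "snd z \<in> Ipi")
  case True
  have "\<bar>dr t' z * (Wn n (snd z) * \<phi> n (snd z))\<bar> = \<bar>Wn n (snd z)\<bar> * (\<bar>dr t' z\<bar> * \<bar>\<phi> n (snd z)\<bar>)" by (simp add: abs_mult)
  also have "\<dots> \<le> (2 * \<bar>w (snd z)\<bar>) * (\<bar>dr t' z\<bar> * \<bar>\<phi> n (snd z)\<bar>)" by (intro mult_right_mono Wle True) auto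
  finally show ?thesis unfolding dr_w(1)[symmetric] by (simp add: abs_mult mult_ac)
 next
  case False
  then have "dr t' z = 0" by (auto simp: dr_def rect_def indicator_def)
  then show ?thesis by simp
 qed
 have dfi: "integrable lborel (df n)" for n
 proof -
  have "integrable lborel (\<lambda>z. dw t' z * \<phi> n (snd z))"
   by (rule integrable_test(3)[OF t' pc(1), of _ "EB * K"]) (use b0 in auto)
  then have i: "integrable lborel (\<lambda>z. 2 * \<bar>dw t' z * \<phi> n (snd z)\<bar>)" by simp
  have [measurable]: "Wn n \<in> borel_fun" by (rule borel_measurable_continuous_onI[OF Wc])
  have [measurable]: "\<phi> n \<in> borel_fun" by (rule borel_measurable_continuous_onI[OF pc(1)])
  have "integrable lborel (\<lambda>z. dr t' z * (Wn n (snd z) * \<phi> n (snd z)))"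
  proof (rule Bochner_Integration.integrable_bound[OF i])
   show "(\<lambda>z. dr t' z * (Wn n (snd z) * \<phi> n (snd z))) \<in> borel_measurable lborel" by measurable
   show "AE z in lborel. norm (dr t' z * (Wn n (snd z) * \<phi> n (snd z))) \<le> norm (2 * \<bar>dw t' z * \<phi> n (snd z)\<bar>)"
    using drb by (intro AE_I2) simp
  qed
  moreover have "integrable lborel (\<lambda>z. ur t' z * (Wn' n (snd z) * \<phi> n (snd z)))" "integrable lborel (\<lambda>z. ur t' z * (Wn n (snd z) * \<phi>' n (snd z)))"
   by (intro integrable_test(1)[OF t', of "\<lambda>y. Wn' n y * \<phi> n y"] integrable_test(1)[OF t', of "\<lambda>y. Wn n y * \<phi>' n y"] continuous_intros pc Wc continuous_on_subset[OF Wc' subset_UNIV])+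
  ultimately show ?thesis unfolding df_def[abs_def] by simp
 qed
 have df0: "(LB z. indicator (rect t) z * df n z) = 0" if t: "t \<in> {0<..<t'}" for n t
 proof -
  obtain a b where ab: "0 < a" "a < b" "b < pi" "\<forall>y. y \<notin> {a..b} \<longrightarrow> Wn n y = 0 \<and> Wn' n y = 0" using Wsupp by blast
  have inner: "(LB y. df n (s, y)) = 0" if s: "s \<in> {0<..<t}" for s
  proof -
   have sT: "s \<in> {0<..<T}" using s t t' by auto
   define a' where "a' = a / 2"
   define b' where "b' = (b + pi) / 2"
   have ab': "0 < a'" "a' < a" "b < b'" "b' < pi" "a' \<le> b'" using ab unfolding a'_def b'_def by auto
   define F where "F y = u s y * (Wn n y * \<phi> n y)" for y
   define f where "f y = deriv (u s) y * (Wn n y * \<phi> n y) + u s y * (Wn' n y * \<phi> n y + Wn n y * \<phi>' n y)" for y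
   have e: "df n (s, y) = indicator {a'<..<b'} y *\<^sub>R f y" for y
   proof (cases "y \<in> {a..b}")
    case True
    then show ?thesis using ab ab' s t unfolding df_def f_def ur_def dr_def rect_def by (simp add: algebra_simps)
   next
    case False
    then show ?thesis using ab(4) unfolding df_def f_def by simp
   qed
   have "(LINT y:{a'<..<b'}|lborel. f y) = F b' - F a'"
   proof (rule set_integral_FTC(2)[OF ab'(5)])
    fix x assume x: "x \<in> {a'..b'}"
    then have "x \<in> Ipi" using ab' by auto
    from DERIV_mult[OF u_deriv[OF sT this] DERIV_mult[OF Wd[of n x] pd[of n x]]]
    show "(F has_real_derivative f x) (at x)" unfolding F_def[abs_def] f_def by (simp add: algebra_simps)
   next
    have "{a'..b'} \<subseteq> Ipi" using ab' by auto
    then show "continuous_on {a'..b'} f" unfolding f_def[abs_def]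
     by (intro continuous_intros pc Wc continuous_on_subset[OF Wc' subset_UNIV] continuous_on_subset[OF u_deriv_continuous[OF sT]] continuous_on_subset[OF u_x[OF sT]])
   qed
   also have "\<dots> = 0" using ab(4) ab' unfolding F_def by simp
   finally show ?thesis unfolding e set_lebesgue_integral_def .
  qed
  have "(LB z. indicator (rect t) z * (1 * df n z)) = (LINT s:{0<..<t}|lborel. 1 * (LB y. df n (s, y)))"
   unfolding rect_def
  proof (rule planar_time_integral(3)[OF dfi])
   show "df n z = 0" if "snd z \<notin> Ipi" for z
    using that supports(3)[OF that] by (auto simp: df_def dr_def rect_def indicator_def)
  qed auto
  also have "\<dots> = (LINT s:{0<..<t}|lborel. 0)" by (rule set_lebesgue_integral_cong) (use inner in auto)
  finally show ?thesis by simp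
 qed
 define \<phi>l where "\<phi>l y = exp (V y) * m y" for y
 define wl where "wl z = FF t' z * m (snd z) - K\<^sup>2 * (ur t' z * (exp (V (snd z)) * m (snd z)))" for z
 have plc: "continuous_on A \<phi>l" for A unfolding \<phi>l_def[abs_def] by (intro continuous_intros V_continuous mc)
 have pl: "(\<lambda>n. \<phi> n y) \<longlonglongrightarrow> \<phi>l y" if "y \<in> {0..pi}" for y
  unfolding \<phi>_def \<phi>l_def by (intro tendsto_intros Vlim that)
 have wlim: "(\<lambda>n. wd n z) \<longlonglongrightarrow> wl z" if "snd z \<in> Ipi" for z
 proof -
  let ?y = "snd z"
  have y: "?y \<in> {0..pi}" using that by auto
  have "(\<lambda>n. wd n z) \<longlonglongrightarrow> ur t' z * (exp (V ?y) * (- K\<^sup>2 * m ?y + 2 * (w ?y * m' ?y) + (w ?y)\<^sup>2 * m ?y))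
    - uw t' z * (exp (V ?y) * (m' ?y + w ?y * m ?y)) - dw t' z * \<phi>l ?y
    - ur t' z * (w ?y * (exp (V ?y) * (m' ?y + w ?y * m ?y))) - dr t' z * (w ?y * \<phi>l ?y)"
   unfolding wd_def \<psi>_def \<phi>'_def by (intro tendsto_intros Vlim[OF y] Wlim[OF that] pl[OF y])
  also have "ur t' z * (exp (V ?y) * (- K\<^sup>2 * m ?y + 2 * (w ?y * m' ?y) + (w ?y)\<^sup>2 * m ?y))
    - uw t' z * (exp (V ?y) * (m' ?y + w ?y * m ?y)) - dw t' z * \<phi>l ?y
    - ur t' z * (w ?y * (exp (V ?y) * (m' ?y + w ?y * m ?y))) - dr t' z * (w ?y * \<phi>l ?y) = wl z"
   unfolding wl_def FF_def \<phi>l_def dr_w[symmetric] by (simp add: algebra_simps power2_eq_square)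
  finally show ?thesis .
 qed
 have wdm: "wd n \<in> borel_fun" for n
 proof -
  have "integrable lborel (weak_density t' (\<phi> n) (\<phi>' n) (\<phi>'' n))" by (rule good_test_integrable(1)[OF t' gt])
  then have "integrable lborel (\<lambda>z. weak_density t' (\<phi> n) (\<phi>' n) (\<phi>'' n) z - df n z)" using dfi by simp
  then have "integrable lborel (wd n)" unfolding split by simp
  then show ?thesis by auto
 qed
 define Z where "Z z = (C1 + 2 * Wb * C2) * \<bar>ur t' z\<bar> + C2 * \<bar>uw t' z\<bar> + 3 * (EB * K) * \<bar>sin (snd z) * dw t' z\<bar>" for z
 have Zi: "integrable lborel Z" unfolding Z_def[abs_def]
  using ur_integrable[OF t'] uw_integrable[OF t'] sin_dw_integrable[OF t'] by simp
 have wdb: "\<bar>wd n z\<bar> \<le> Z z" if yy: "snd z \<in> Ipi" for n z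
 proof -
  let ?y = "snd z"
  have y: "?y \<in> {0..pi}" using yy by auto
  have s: "0 < sin ?y" using yy by (intro sin_gt_zero) auto
  have p: "\<bar>dw t' z * \<phi> n ?y\<bar> \<le> (EB * K) * \<bar>sin ?y * dw t' z\<bar>"
   using mult_left_mono[OF b0[OF y, of n], of "\<bar>dw t' z\<bar>"] s by (simp add: abs_mult mult_ac)
  have "\<bar>ur t' z * \<psi> n ?y\<bar> \<le> C1 * \<bar>ur t' z\<bar>" "\<bar>uw t' z * \<phi>' n ?y\<bar> \<le> C2 * \<bar>uw t' z\<bar>"
   using mult_left_mono[OF b2[OF y, of n], of "\<bar>ur t' z\<bar>"] mult_left_mono[OF b1[OF y, of n], of "\<bar>uw t' z\<bar>"]
   by (simp_all add: abs_mult mult_ac)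
  moreover have "\<bar>ur t' z * (Wn n ?y * \<phi>' n ?y)\<bar> \<le> 2 * Wb * C2 * \<bar>ur t' z\<bar>"
  proof -
   have "\<bar>Wn n ?y * \<phi>' n ?y\<bar> \<le> 2 * Wb * C2"
    unfolding abs_mult using Wle'[OF y, of n] b1[OF y, of n] Wb_nonneg by (intro mult_mono) auto
   from mult_left_mono[OF this, of "\<bar>ur t' z\<bar>"] show ?thesis by (simp add: abs_mult mult_ac)
  qed
  ultimately show ?thesis unfolding wd_def Z_def distrib_right using p drb[of z n] by linarith
 qed
 have AEn: "AE t in lborel. \<forall>n. t \<in> {0<..<t'} \<longrightarrow>
  (LI x. u t x * \<phi> n x) = (LI x. u0 x * \<phi> n x)
   + (LB z. indicator (rect t) z * weak_density t' (\<phi> n) (\<phi>' n) (\<phi>'' n) z)"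
  unfolding AE_all_countable using we unfolding weak_eq_def by blast
 have eq: "(LB z. indicator (rect t) z * weak_density t' (\<phi> n) (\<phi>' n) (\<phi>'' n) z) = (LB z. indicator (rect t) z * wd n z)" if "t \<in> {0<..<t'}" for n t
 proof -
  have i1: "integrable lborel (\<lambda>z. indicator (rect t) z * weak_density t' (\<phi> n) (\<phi>' n) (\<phi>'' n) z)" by (rule good_test_integrable(2)[OF t' gt])
  have i2: "integrable lborel (\<lambda>z. indicator (rect t) z * df n z)" using integrable_mult_indicator[OF _ dfi, of "rect t" n] by simp
  have "(LB z. indicator (rect t) z * wd n z) = (LB z. indicator (rect t) z * weak_density t' (\<phi> n) (\<phi>' n) (\<phi>'' n) z - indicator (rect t) z * df n z)"
   unfolding split by (simp add: algebra_simps)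
  also have "\<dots> = (LB z. indicator (rect t) z * weak_density t' (\<phi> n) (\<phi>' n) (\<phi>'' n) z) - 0"
   unfolding Bochner_Integration.integral_diff[OF i1 i2] df0[OF that] ..
  finally show ?thesis by simp
 qed
 have "AE t in lborel. t \<in> {0<..<t'} \<longrightarrow> (LI x. u t x * \<phi>l x) = (LI x. u0 x * \<phi>l x) + (LB z. indicator (rect t) z * wl z)"
 proof (rule weak_limit[OF t' _ pc(1) plc _ _ wdm Zi])
  show "AE t in lborel. \<forall>n. t \<in> {0<..<t'} \<longrightarrow> (LI x. u t x * \<phi> n x) = (LI x. u0 x * \<phi> n x) + (LB z. indicator (rect t) z * wd n z)"
   using AEn by eventually_elim (use eq in auto)
  show "\<bar>\<phi> n y\<bar> \<le> EB * K" if "y \<in> Ipi" for n y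
  proof -
   have "EB * K * sin y \<le> EB * K * 1" using EB K by (intro mult_left_mono) auto
   then show ?thesis using b0[of y n] that by simp
  qed
  show "0 \<le> Z z" for z unfolding Z_def using C0 EB K Wb_nonneg by (intro add_nonneg_nonneg mult_nonneg_nonneg) auto
 qed (use pl wdb wlim in auto)
 then show ?thesis unfolding \<phi>l_def wl_def m_def K_def .
qed

end

section \<open>Comparison for a singular Volterra inequality\<close>

lemma abs_integral_le_nn_integral: "ennreal \<bar>LINT z|N. f z\<bar> \<le> (\<integral>\<^sup>+z. ennreal \<bar>f z :: real\<bar> \<partial>N)"
proof (cases "integrable N f")
 case True
 then show ?thesis using integral_norm_bound_ennreal[OF True] by simp
qed (simp add: not_integrable_integral_eq)

text \<open>A subsolution of a linear Volterra inequality that is integrable with the weight \<open>sin\<close> is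
 bounded by twice the constant inhomogeneity times an exponential: the excess over that
 bound is again a subsolution, with no inhomogeneity, and the discounted kernel
 halves its weighted norm.\<close>

lemma kernel_comparison:
 fixes k :: "real \<Rightarrow> real \<Rightarrow> real \<Rightarrow> ennreal" and F :: "real \<times> real \<Rightarrow> real"
 assumes T: "0 < T" and C: "0 \<le> C" and M0: "0 \<le> M0" and lam: "0 < lam"
  and small: "C * (lam powr (- 1 / 8) * (8 * T powr (1 / 8))) \<le> 1 / 2"
  and km: "(\<lambda>(\<tau>, x, y). k \<tau> x y) \<in> borel_fun"
  and Fm [measurable]: "F \<in> borel_fun"
  and supp: "\<And>z. z \<notin> {0<..<t'} \<times> Ipi \<Longrightarrow> F z = 0"
  and k1: "\<And>\<tau> x. (NN y. k \<tau> x y * ind_I y) \<le> ennreal (C * abel T (3/4) \<tau>)"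
  and k2: "\<And>\<tau> y. y \<in> Ipi \<Longrightarrow> (NN x. ennreal (ind_I x * sin x) * k \<tau> x y) \<le> ennreal (sin y) * ennreal (C * abel T (3/4) \<tau>)"
  and fin: "(NN z. ennreal \<bar>sin (snd z) * F z\<bar>) < \<infinity>"
  and ineq: "AE z in lborel. z \<in> {0<..<t'} \<times> Ipi \<longrightarrow>
   ennreal \<bar>F z\<bar> \<le> ennreal M0 + (\<integral>\<^sup>+z'. k (fst z - fst z') (snd z) (snd z') * ennreal \<bar>F z'\<bar> \<partial>lborel)"
 shows "AE z in lborel. \<bar>F z\<bar> \<le> 2 * M0 * exp (lam * fst z)"
proof -
 note km' [measurable (raw)] = measurable_uncurried3[OF km]
 define M where "M = 2 * M0"
 have M: "0 \<le> M" using M0 unfolding M_def by simp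
 define G where "G z = max 0 (\<bar>F z\<bar> - M * exp (lam * fst z))" for z
 have G0: "0 \<le> G z" for z unfolding G_def by simp
 have Gs: "G z = 0" if "z \<notin> {0<..<t'} \<times> Ipi" for z using supp[OF that] M unfolding G_def by simp
 have [measurable]: "G \<in> borel_fun" unfolding G_def[abs_def] by measurable
 have FG: "\<bar>F z\<bar> \<le> M * exp (lam * fst z) * ind_I (snd z) + G z" for z
 proof (cases "z \<in> {0<..<t'} \<times> Ipi")
  case False
  then show ?thesis using supp[OF False] G0[of z] M by simp
 next
  case True
  then show ?thesis unfolding G_def by auto
 qed
 have disc: "(NN \<tau>. ennreal (exp (- lam * \<tau>)) * ennreal (C * abel T (3/4) \<tau>)) \<le> ennreal (1 / 2)"
 proof -
  have "(NN \<tau>. ennreal (exp (- lam * \<tau>)) * ennreal (C * abel T (3/4) \<tau>))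
   = (NN \<tau>. ennreal C * ennreal (exp (- lam * \<tau>) * abel T (3/4) \<tau>))"
   using C abel_nonneg by (intro nn_integral_cong) (simp add: ennreal_mult[symmetric] mult_ac)
  also have "\<dots> = ennreal C * (NN \<tau>. ennreal (exp (- lam * \<tau>) * abel T (3/4) \<tau>))"
   by (rule nn_integral_cmult) measurable
  also have "\<dots> \<le> ennreal C * ennreal (lam powr (- 1 / 8) * (8 * T powr (1 / 8)))"
   by (intro mult_left_mono abel_discount T lam) auto
  also have "\<dots> = ennreal (C * (lam powr (- 1 / 8) * (8 * T powr (1 / 8))))" using C by (intro ennreal_mult[symmetric]) auto
  also have "\<dots> \<le> ennreal (1 / 2)" by (rule ennreal_leI[OF small])
  finally show ?thesis .
 qed
 have const: "(\<integral>\<^sup>+z'. k (t - fst z') x (snd z') * ennreal (M * exp (lam * fst z') * ind_I (snd z')) \<partial>lborel) \<le> ennreal (M / 2 * exp (lam * t))" for t x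
 proof -
  have "(\<integral>\<^sup>+z'. k (t - fst z') x (snd z') * ennreal (M * exp (lam * fst z') * ind_I (snd z')) \<partial>lborel)
   = (\<integral>\<^sup>+z'. ennreal (M * exp (lam * fst z')) * (k (t - fst z') x (snd z') * ind_I (snd z')) \<partial>(lborel2))"
   unfolding lborel_prod using M by (intro nn_integral_cong) (auto simp: indicator_def mult_ac)
  also have "\<dots> = (NN s. NN y. ennreal (M * exp (lam * s)) * (k (t - s) x y * ind_I y))"
   by (subst lborel.nn_integral_fst[symmetric]) (auto simp: lborel_prod)
  also have "\<dots> \<le> (NN s. ennreal (M * exp (lam * s)) * ennreal (C * abel T (3/4) (t - s)))"
  proof (rule nn_integral_mono)
   fix s
   have "(NN y. ennreal (M * exp (lam * s)) * (k (t - s) x y * ind_I y))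
    = ennreal (M * exp (lam * s)) * (NN y. k (t - s) x y * ind_I y)"
    by (rule nn_integral_cmult) measurable
   also have "\<dots> \<le> ennreal (M * exp (lam * s)) * ennreal (C * abel T (3/4) (t - s))" by (intro mult_left_mono k1) auto
   finally show "(NN y. ennreal (M * exp (lam * s)) * (k (t - s) x y * ind_I y))
    \<le> ennreal (M * exp (lam * s)) * ennreal (C * abel T (3/4) (t - s))" .
  qed
  also have "\<dots> = (NN \<tau>. ennreal (M * exp (lam * (t + (- 1) * \<tau>))) * ennreal (C * abel T (3/4) (t - (t + (- 1) * \<tau>))))"
   by (subst nn_integral_real_affine[of _ "- 1" t]) auto
  also have "\<dots> = (NN \<tau>. ennreal (M * exp (lam * t)) * (ennreal (exp (- lam * \<tau>)) * ennreal (C * abel T (3/4) \<tau>)))"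
  proof (intro nn_integral_cong)
   fix \<tau>
   have "exp (lam * (t + (- 1) * \<tau>)) = exp (lam * t) * exp (- lam * \<tau>)" unfolding exp_add[symmetric] by (simp add: algebra_simps)
   then have "M * exp (lam * (t + (- 1) * \<tau>)) = (M * exp (lam * t)) * exp (- lam * \<tau>)" by simp
   then have e: "ennreal (M * exp (lam * (t + (- 1) * \<tau>))) = ennreal (M * exp (lam * t)) * ennreal (exp (- lam * \<tau>))"
    using M by (simp only:) (rule ennreal_mult, auto)
   show "ennreal (M * exp (lam * (t + (- 1) * \<tau>))) * ennreal (C * abel T (3/4) (t - (t + (- 1) * \<tau>)))
    = ennreal (M * exp (lam * t)) * (ennreal (exp (- lam * \<tau>)) * ennreal (C * abel T (3/4) \<tau>))"
    unfolding e by (simp add: mult.assoc)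
  qed
  also have "\<dots> = ennreal (M * exp (lam * t)) * (NN \<tau>. ennreal (exp (- lam * \<tau>)) * ennreal (C * abel T (3/4) \<tau>))"
   by (rule nn_integral_cmult) measurable
  also have "\<dots> \<le> ennreal (M * exp (lam * t)) * ennreal (1 / 2)" by (intro mult_left_mono disc) auto
  also have "\<dots> = ennreal ((M * exp (lam * t)) * (1 / 2))" by (rule ennreal_mult[symmetric]) (use M in auto)
  also have "(M * exp (lam * t)) * (1 / 2) = M / 2 * exp (lam * t)" by simp
  finally show ?thesis .
 qed
 define KG where "KG t x = (\<integral>\<^sup>+z'. k (t - fst z') x (snd z') * ennreal (G z') \<partial>lborel)" for t x
 have Gle: "AE z in lborel. ennreal (G z) \<le> KG (fst z) (snd z)"
  using ineq
 proof eventually_elim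
  case (elim z)
  show ?case
  proof (cases "z \<in> {0<..<t'} \<times> Ipi")
   case False then show ?thesis using Gs by simp
  next
   case True
   then have tz: "0 < fst z" by auto
   have "ennreal \<bar>F z\<bar> \<le> ennreal M0 + (\<integral>\<^sup>+z'. k (fst z - fst z') (snd z) (snd z') * ennreal \<bar>F z'\<bar> \<partial>lborel)" using elim True by blast
   also have "\<dots> \<le> ennreal M0 + (\<integral>\<^sup>+z'. k (fst z - fst z') (snd z) (snd z') * ennreal (M * exp (lam * fst z') * ind_I (snd z'))
     + k (fst z - fst z') (snd z) (snd z') * ennreal (G z') \<partial>lborel)"
   proof (intro add_left_mono nn_integral_mono)
    fix z'
    have "ennreal \<bar>F z'\<bar> \<le> ennreal (M * exp (lam * fst z') * ind_I (snd z')) + ennreal (G z')"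
    proof -
     have "ennreal \<bar>F z'\<bar> \<le> ennreal (M * exp (lam * fst z') * ind_I (snd z') + G z')" by (rule ennreal_leI[OF FG])
     also have "\<dots> = ennreal (M * exp (lam * fst z') * ind_I (snd z')) + ennreal (G z')"
      by (rule ennreal_plus) (use G0[of z'] M in auto)
     finally show ?thesis .
    qed
    then show "k (fst z - fst z') (snd z) (snd z') * ennreal \<bar>F z'\<bar> \<le> k (fst z - fst z') (snd z) (snd z') * ennreal (M * exp (lam * fst z') * ind_I (snd z'))
     + k (fst z - fst z') (snd z) (snd z') * ennreal (G z')"
     unfolding distrib_left[symmetric] by (intro mult_left_mono) auto
   qed
   also have "\<dots> = ennreal M0 + ((\<integral>\<^sup>+z'. k (fst z - fst z') (snd z) (snd z') * ennreal (M * exp (lam * fst z') * ind_I (snd z')) \<partial>lborel) + KG (fst z) (snd z))"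
    unfolding KG_def by (subst nn_integral_add) auto
   also have "\<dots> \<le> ennreal M0 + (ennreal (M / 2 * exp (lam * fst z)) + KG (fst z) (snd z))"
    by (intro add_left_mono add_right_mono const)
   also have "\<dots> = ennreal (M0 + M / 2 * exp (lam * fst z)) + KG (fst z) (snd z)"
    using M M0 by (subst ennreal_plus) (auto simp: add.assoc)
   also have "\<dots> \<le> ennreal (M * exp (lam * fst z)) + KG (fst z) (snd z)"
   proof -
    have "1 \<le> exp (lam * fst z)" using tz lam by simp
    then have "M0 * 1 \<le> M0 * exp (lam * fst z)" using M0 by (intro mult_left_mono) auto
    then have "M0 + M / 2 * exp (lam * fst z) \<le> M * exp (lam * fst z)" unfolding M_def by simp
    then show ?thesis by (intro add_right_mono ennreal_leI)
   qed
   finally have le: "ennreal \<bar>F z\<bar> \<le> ennreal (M * exp (lam * fst z)) + KG (fst z) (snd z)" .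
   have "ennreal (G z) = ennreal \<bar>F z\<bar> - ennreal (M * exp (lam * fst z))"
    using M unfolding G_def by (subst ennreal_minus) (auto simp: max_def ennreal_neg)
   also have "\<dots> \<le> KG (fst z) (snd z)" using le by (simp add: ennreal_minus_le_iff)
   finally show ?thesis .
  qed
 qed
 define N where "N = (NN z. ennreal (exp (- lam * fst z)) * (ennreal (sin (snd z)) * ennreal (G z)))"
 have Nfin: "N < \<infinity>"
 proof -
  have "N \<le> (NN z. ennreal \<bar>sin (snd z) * F z\<bar>)" unfolding N_def
  proof (rule nn_integral_mono)
   fix z :: "real \<times> real"
   show "ennreal (exp (- lam * fst z)) * (ennreal (sin (snd z)) * ennreal (G z)) \<le> ennreal \<bar>sin (snd z) * F z\<bar>"
   proof (cases "z \<in> {0<..<t'} \<times> Ipi")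
    case True
    then have s: "0 \<le> sin (snd z)" and t: "0 < fst z" by (auto intro: sin_ge_zero)
    have "G z \<le> \<bar>F z\<bar>" unfolding G_def using M by simp
    then have "exp (- lam * fst z) * (sin (snd z) * G z) \<le> 1 * (sin (snd z) * \<bar>F z\<bar>)"
     using s t lam G0[of z] by (intro mult_mono) auto
    then show ?thesis using s G0[of z] by (simp add: ennreal_mult[symmetric] abs_mult ennreal_leI)
   qed (simp add: Gs)
  qed
  then show ?thesis using fin by (rule le_less_trans)
 qed
 have "N \<le> (NN z. ennreal (exp (- lam * fst z)) * (ennreal (ind_I (snd z) * sin (snd z)) * KG (fst z) (snd z)))"
  unfolding N_def
 proof (rule nn_integral_mono_AE, use Gle in eventually_elim)
  case (elim z)
  show ?case
  proof (cases "z \<in> {0<..<t'} \<times> Ipi")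
   case True
   then have "ind_I (snd z) * sin (snd z) = sin (snd z)" by auto
   then show ?thesis using elim by (auto intro!: mult_left_mono)
  qed (simp add: Gs)
 qed
 also have "\<dots> = (NN t. NN x. ennreal (exp (- lam * t)) * (ennreal (ind_I x * sin x) * KG t x))"
 proof -
  have "(\<integral>\<^sup>+z. ennreal (exp (- lam * fst z)) * (ennreal (ind_I (snd z) * sin (snd z)) * KG (fst z) (snd z)) \<partial>(lborel2))
   = (NN t. NN x. ennreal (exp (- lam * t)) * (ennreal (ind_I x * sin x) * KG t x))"
   unfolding KG_def by (subst lborel.nn_integral_fst[symmetric]) auto
  then show ?thesis unfolding lborel_prod .
 qed
 also have "\<dots> \<le> (NN \<tau>. ennreal (exp (- lam * \<tau>)) * ennreal (C * abel T (3/4) \<tau>)) * N"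
  unfolding KG_def N_def
 proof (rule nn_duhamel_tonelli[OF km])
  show "ennreal (G z) = 0" if "snd z \<notin> Ipi" for z
  proof -
   have "z \<notin> {0<..<t'} \<times> Ipi" using that by (auto simp: mem_Times_iff)
   then show ?thesis by (simp add: Gs)
  qed
 qed (use k2 in auto)
 also have "\<dots> \<le> ennreal (1 / 2) * N" by (intro mult_right_mono disc) auto
 finally have half: "N \<le> ennreal (1 / 2) * N" .
 have "N = 0"
 proof -
  obtain r where r: "0 \<le> r" "N = ennreal r" using Nfin by (cases N) auto
  have "ennreal r \<le> ennreal (1 / 2) * ennreal r" using half unfolding r(2) .
  also have "\<dots> = ennreal (1 / 2 * r)" by (rule ennreal_mult[symmetric]) (use r in auto)
  finally have "r \<le> 1 / 2 * r" using r by (subst (asm) ennreal_le_iff) auto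
  then show ?thesis using r by simp
 qed
 then have "AE z in lborel. ennreal (exp (- lam * fst z)) * (ennreal (sin (snd z)) * ennreal (G z)) = 0"
  unfolding N_def by (subst (asm) nn_integral_0_iff_AE) auto
 then show ?thesis
 proof eventually_elim
  case (elim z)
  have "G z = 0"
  proof (cases "z \<in> {0<..<t'} \<times> Ipi")
   case True
   then have "0 < sin (snd z)" by (auto intro: sin_gt_zero)
   then show ?thesis using elim G0[of z] by (auto simp: ennreal_eq_0_iff)
  qed (simp add: Gs)
  then show ?case unfolding G_def M_def by (simp add: max_def split: if_splits)
 qed
qed

text \<open>The kernel that dominates the two Duhamel formulas satisfies the hypotheses of the comparison lemma.\<close>

lemma heat_kernels_integral_bounds:
 assumes T: "0 < T" and A: "0 \<le> A"
 defines "C \<equiv> A * (decay_const 1 + decay_const 0 * T powr (1/2) + 160 * exp (T / 8) * decay_const 1)"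
 defines "k \<equiv> \<lambda>\<tau> x y. ennreal (A * (\<bar>heatKx T \<tau> x y\<bar> + \<bar>heatK T \<tau> x y\<bar>))"
 shows "(NN y. k \<tau> x y * ind_I y) \<le> ennreal (C * abel T (3/4) \<tau>)"
  "y \<in> Ipi \<Longrightarrow> (NN x. ennreal (ind_I x * sin x) * k \<tau> x y) \<le> ennreal (sin y) * ennreal (C * abel T (3/4) \<tau>)"
  "(\<lambda>(\<tau>, x, y). k \<tau> x y) \<in> borel_fun" "0 \<le> C"
proof -
 note d = less_imp_le[OF decay_const_pos[of 0]] less_imp_le[OF decay_const_pos[of 1]]
 show C: "0 \<le> C" unfolding C_def using A d by (intro mult_nonneg_nonneg add_nonneg_nonneg) auto
 show "(\<lambda>(\<tau>, x, y). k \<tau> x y) \<in> borel_fun"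
  unfolding k_def split_beta' borel_prod[symmetric] by measurable
 show "(NN y. k \<tau> x y * ind_I y) \<le> ennreal (C * abel T (3/4) \<tau>)"
 proof (cases "0 < \<tau> \<and> \<tau> < T")
  case False
  show ?thesis unfolding k_def heatK_outside[OF False] by simp
 next
  case True
  have pw: "\<tau> powr (- 1 / 4) \<le> T powr (1/2) * \<tau> powr (- 3 / 4)"
  proof -
   have "\<tau> powr (- 1 / 4) = \<tau> powr (1/2) * \<tau> powr (- 3 / 4)" unfolding powr_add[symmetric] by simp
   also have "\<dots> \<le> T powr (1/2) * \<tau> powr (- 3 / 4)" using True by (intro mult_right_mono powr_mono2) auto
   finally show ?thesis .
  qed
  have "(NN y. k \<tau> x y * ind_I y)
   = (NN y. ennreal A * (ennreal \<bar>heatKx T \<tau> x y\<bar> * ind_I y + ennreal \<bar>heatK T \<tau> x y\<bar> * ind_I y))"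
   unfolding k_def using A by (intro nn_integral_cong) (simp add: ennreal_mult distrib_right mult.assoc)
  also have "\<dots> = ennreal A * ((NN y. ennreal \<bar>heatKx T \<tau> x y\<bar> * ind_I y) + (NN y. ennreal \<bar>heatK T \<tau> x y\<bar> * ind_I y))"
   by (subst nn_integral_cmult) (auto simp: nn_integral_add)
  also have "\<dots> \<le> ennreal A * (ennreal (decay_const 1 * \<tau> powr (- 3 / 4)) + ennreal (decay_const 0 * \<tau> powr (- 1 / 4)))"
   using True by (intro mult_left_mono add_mono heatKx_L1 heatK_L1) auto
  also have "\<dots> = ennreal (A * (decay_const 1 * \<tau> powr (- 3 / 4) + decay_const 0 * \<tau> powr (- 1 / 4)))"
   using A d by (simp add: ennreal_mult ennreal_plus)
  also have "\<dots> \<le> ennreal (C * abel T (3/4) \<tau>)"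
  proof (rule ennreal_leI)
   have "decay_const 0 * \<tau> powr (- 1 / 4) \<le> decay_const 0 * (T powr (1/2) * \<tau> powr (- 3 / 4))"
    by (intro mult_left_mono pw d)
   then have "decay_const 1 * \<tau> powr (- 3 / 4) + decay_const 0 * \<tau> powr (- 1 / 4)
    \<le> (decay_const 1 + decay_const 0 * T powr (1/2) + 160 * exp (T / 8) * decay_const 1) * \<tau> powr (- 3 / 4)"
   proof -
    have "0 \<le> 160 * exp (T / 8) * decay_const 1 * \<tau> powr (- 3 / 4)" using d by simp
    then show ?thesis using \<open>decay_const 0 * \<tau> powr (- 1 / 4) \<le> decay_const 0 * (T powr (1/2) * \<tau> powr (- 3 / 4))\<close>
     unfolding distrib_right mult.assoc by linarith
   qed
   from mult_left_mono[OF this A] show "A * (decay_const 1 * \<tau> powr (- 3 / 4) + decay_const 0 * \<tau> powr (- 1 / 4)) \<le> C * abel T (3/4) \<tau>"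
    using True unfolding C_def abel_def by (simp add: mult.assoc)
  qed
  finally show ?thesis .
 qed
 show "(NN x. ennreal (ind_I x * sin x) * k \<tau> x y) \<le> ennreal (sin y) * ennreal (C * abel T (3/4) \<tau>)"
  if y: "y \<in> Ipi"
 proof -
  have sy: "0 \<le> sin y" using y by (simp add: sin_ge_zero)
  have "(NN x. ennreal (ind_I x * sin x) * k \<tau> x y)
   \<le> (NN x. ennreal A * (ennreal \<bar>(ind_I x * sin x) * heatKx T \<tau> x y\<bar> + ennreal \<bar>ind_I x * heatK T \<tau> x y\<bar>))"
  proof (rule nn_integral_mono)
   fix x
   show "ennreal (ind_I x * sin x) * k \<tau> x y \<le> ennreal A * (ennreal \<bar>(ind_I x * sin x) * heatKx T \<tau> x y\<bar> + ennreal \<bar>ind_I x * heatK T \<tau> x y\<bar>)"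
   proof (cases "x \<in> Ipi")
    case True
    then have s: "0 \<le> sin x" by (simp add: sin_ge_zero)
    have "sin x * \<bar>heatK T \<tau> x y\<bar> \<le> 1 * \<bar>heatK T \<tau> x y\<bar>" by (intro mult_right_mono) auto
    then have "sin x * (A * (\<bar>heatKx T \<tau> x y\<bar> + \<bar>heatK T \<tau> x y\<bar>)) \<le> A * (\<bar>sin x * heatKx T \<tau> x y\<bar> + \<bar>heatK T \<tau> x y\<bar>)"
     using mult_left_mono[of "sin x * \<bar>heatKx T \<tau> x y\<bar> + sin x * \<bar>heatK T \<tau> x y\<bar>" "\<bar>sin x * heatKx T \<tau> x y\<bar> + \<bar>heatK T \<tau> x y\<bar>" A] A s
     by (simp add: abs_mult algebra_simps)
    then show ?thesis using True s A unfolding k_def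
     by (simp add: ennreal_mult[symmetric] ennreal_plus[symmetric] ennreal_leI del: ennreal_plus)
   qed simp
  qed
  also have "\<dots> = ennreal A * ((NN x. ennreal \<bar>(ind_I x * sin x) * heatKx T \<tau> x y\<bar>) + (NN x. ennreal \<bar>ind_I x * heatK T \<tau> x y\<bar>))"
   by (subst nn_integral_cmult) (auto simp: nn_integral_add)
  also have "\<dots> \<le> ennreal A * (ennreal (160 * exp (T / 8) * decay_const 1 * sin y * abel T (3/4) \<tau>) + ennreal (decay_const 1 * sin y * abel T (3/4) \<tau>))"
   by (intro mult_left_mono add_mono heatKx_duhamel_bound heatK_duhamel_bound y) auto
  also have "\<dots> = ennreal (A * (160 * exp (T / 8) * decay_const 1 * sin y * abel T (3/4) \<tau> + decay_const 1 * sin y * abel T (3/4) \<tau>))"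
   using A d sy abel_nonneg by (simp add: ennreal_mult ennreal_plus)
  also have "\<dots> \<le> ennreal (sin y * (C * abel T (3/4) \<tau>))"
  proof (rule ennreal_leI)
   have "0 \<le> A * (sin y * (decay_const 0 * (T powr (1/2) * abel T (3/4) \<tau>)))"
    using A d sy abel_nonneg by (intro mult_nonneg_nonneg) auto
   then show "A * (160 * exp (T / 8) * decay_const 1 * sin y * abel T (3/4) \<tau> + decay_const 1 * sin y * abel T (3/4) \<tau>) \<le> sin y * (C * abel T (3/4) \<tau>)"
    unfolding C_def by (simp add: algebra_simps)
  qed
  also have "\<dots> = ennreal (sin y) * ennreal (C * abel T (3/4) \<tau>)" using sy by (rule ennreal_mult')
  finally show ?thesis .
 qed
qed

section \<open>The Duhamel formula for the gauged solution\<close>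

lemma AE_imp_ex_in_interval:
 fixes a b :: real
 assumes ae: "AE x in lborel. P x" and ab: "a < b"
 shows "\<exists>x\<in>{a<..<b}. P x"
proof (rule ccontr)
 assume "\<not> ?thesis"
 then have "AE x in lborel. x \<notin> {a<..<b}" using ae by (auto elim: eventually_mono)
 moreover have "{x. a < x \<and> x < b} = {a<..<b}" by auto
 ultimately have "emeasure lborel {a<..<b} = 0" by (subst (asm) AE_iff_measurable[OF _ refl]) auto
 then show False using ab by simp
qed

text \<open>The integral over \<open>{x<..}\<close> is right-continuous in \<open>x\<close>.\<close>

lemma AE_zero_of_AE_halfline_integrals:
 fixes f :: "real \<Rightarrow> real"
 assumes f: "integrable lborel f" and z: "AE x in lborel. (LB y. f y * indicator {x<..} y) = 0"
 shows "AE y in lborel. f y = 0"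
proof (rule AE_zero_of_halfline_integrals[OF f])
 fix x
 have "\<exists>r. \<forall>n. r n \<in> {x<..<x + 1 / real (Suc n)} \<and> (LB y. f y * indicator {r n<..} y) = 0"
  using AE_imp_ex_in_interval[OF z, of x "x + 1 / real (Suc n)" for n] by (intro choice allI) (auto simp: Bex_def)
 then obtain r where r: "\<And>n. r n \<in> {x<..<x + 1 / real (Suc n)}" "\<And>n. (LB y. f y * indicator {r n<..} y) = 0" by blast
 have rl: "r \<longlonglongrightarrow> x"
 proof (rule tendsto_sandwich[OF _ _ tendsto_const])
  show "(\<lambda>n. x + 1 / real (Suc n)) \<longlonglongrightarrow> x" using LIMSEQ_inverse_real_of_nat_add[of x] by (simp add: inverse_eq_divide)
 qed (use r(1) in \<open>auto intro!: always_eventually less_imp_le simp del: of_nat_Suc\<close>)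
 have "(\<lambda>n. LB y. f y * indicator {r n<..} y) \<longlonglongrightarrow> (LB y. f y * indicator {x<..} y)"
 proof (rule integral_dominated_convergence[where w = "\<lambda>y. \<bar>f y\<bar>"])
  show "AE y in lborel. (\<lambda>n. f y * indicator {r n<..} y) \<longlonglongrightarrow> f y * indicator {x<..} y"
  proof (intro AE_I2)
   fix y
   have "\<forall>\<^sub>F n in sequentially. f y * indicator {r n<..} y = f y * indicator {x<..} y"
   proof (cases "x < y")
    case True
    from order_tendstoD(2)[OF rl this] show ?thesis by eventually_elim (use True in auto)
   next
    case False
    then have "\<not> r n < y" for n using r(1)[of n] by simp
    then show ?thesis using False by (intro always_eventually allI) simp
   qed
   then show "(\<lambda>n. f y * indicator {r n<..} y) \<longlonglongrightarrow> f y * indicator {x<..} y" by (rule tendsto_eventually)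
  qed
 qed (use f in \<open>auto simp: indicator_def\<close>)
 then show "(LB y. f y * indicator {x<..} y) = 0" unfolding r(2) using LIMSEQ_unique tendsto_const by blast
qed

text \<open>Fubini, with the fundamental theorem applied to the kernel for each \<open>z\<close>. The weight \<open>p\<close> admits data whose
  integrability is known only with a weight that vanishes at the ends of the interval.\<close>

lemma duhamel_FTC:
 fixes h :: "real \<times> real \<Rightarrow> real"
 assumes ab: "a < b" and c: "0 < c" and p: "\<And>x. x \<in> {a<..<b} \<Longrightarrow> c \<le> p x"
  and pm [measurable]: "p \<in> borel_fun"
  and i: "integrable (lborel2) (\<lambda>(x, z). p x * pKx T t x z * h z)"
  and ia: "integrable lborel (\<lambda>z. pK T t a z * h z)"
  and ib: "integrable lborel (\<lambda>z. pK T t b z * h z)"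
 shows "set_integrable lborel {a<..<b} (\<lambda>x. LB z. pKx T t x z * h z)"
  "(LINT x:{a<..<b}|lborel. LB z. pKx T t x z * h z)
   = (LB z. pK T t b z * h z) - (LB z. pK T t a z * h z)"
proof -
 define \<zeta> where "\<zeta> x = indicator {a<..<b} x / p x" for x
 have zm: "\<zeta> \<in> borel_fun" unfolding \<zeta>_def[abs_def] by measurable
 have zp: "\<zeta> x * p x = indicator {a<..<b} x" for x using p[of x] c by (auto simp: \<zeta>_def indicator_def)
 have zb: "\<bar>\<zeta> x\<bar> \<le> 1 / c" for x using p[of x] c by (auto simp: \<zeta>_def indicator_def intro!: divide_left_mono)
 note F = duhamel_fubini[where k = "heatKx T", OF i zm zb, unfolded zp]
 show "set_integrable lborel {a<..<b} (\<lambda>x. LB z. pKx T t x z * h z)"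
  using F(2) unfolding set_integrable_def by simp
 have K: "(LB x. indicator {a<..<b} x * heatKx T \<tau> x y) = heatK T \<tau> b y - heatK T \<tau> a y" for \<tau> y
 proof (cases "0 < \<tau> \<and> \<tau> < T")
  case True
  then have d: "((\<lambda>x. heatK T \<tau> x y) has_real_derivative heatKx T \<tau> x y) (at x)" for x by (intro DERIV_heatK) auto
  have c: "continuous_on {a..b} (\<lambda>x. heatKx T \<tau> x y)"
  proof -
   have "continuous_on ({0<..} \<times> UNIV) (\<lambda>(t, x). \<Sum>k. decay k t * ((real (Suc k) * cmode k x) * smode k y))"
    by (rule continuous_on_decay_series[where B = 1 and p = 1])
     (auto intro!: continuous_intros mult_le_one simp: abs_mult abs_mode_le simp del: of_nat_Suc)
   then have "continuous_on UNIV (\<lambda>x. (\<lambda>(t, x). \<Sum>k. decay k t * ((real (Suc k) * cmode k x) * smode k y)) (\<tau>, x))"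
    by (rule continuous_on_compose2) (use True in \<open>auto intro!: continuous_intros\<close>)
   then show ?thesis using True unfolding heatKx_def by (auto simp: mult.assoc intro: continuous_on_subset)
  qed
  have "(LINT x:{a<..<b}|lborel. heatKx T \<tau> x y) = heatK T \<tau> b y - heatK T \<tau> a y"
   by (rule set_integral_FTC_interior) (use ab d c in \<open>auto intro!: set_integrable_continuous DERIV_continuous_on DERIV_subset[OF d]\<close>)
  then show ?thesis unfolding set_lebesgue_integral_def by simp
 qed (simp add: heatK_outside)
 have "(LINT x:{a<..<b}|lborel. LB z. pKx T t x z * h z) = (LB z. (pK T t b z - pK T t a z) * h z)"
  using F(4) unfolding K set_lebesgue_integral_def by simp
 also have "\<dots> = (LB z. pK T t b z * h z) - (LB z. pK T t a z * h z)"
  using ia ib by (simp add: left_diff_distrib)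
 finally show "(LINT x:{a<..<b}|lborel. LB z. pKx T t x z * h z)
   = (LB z. pK T t b z * h z) - (LB z. pK T t a z * h z)" .
qed

context mild
begin

lemma FF_outside: "z \<notin> rect t' \<Longrightarrow> FF t' z = 0"
 by (simp add: FF_def dw_def uw_def)

lemma V_measurable [measurable]: "V \<in> borel_fun"
 using V_continuous by (rule borel_measurable_continuous_onI)

lemma FF_measurable [measurable]: "t' \<le> T \<Longrightarrow> FF t' \<in> borel_fun"
 unfolding FF_def[abs_def] by measurable

lemma FF_integrable_test:
 assumes t': "0 < t'" "t' < T" and c: "continuous_on {0..pi} \<phi>" and b: "\<And>y. y \<in> Ipi \<Longrightarrow> \<bar>\<phi> y\<bar> \<le> C * sin y"
 shows "integrable lborel (\<lambda>z. FF t' z * \<phi> (snd z))"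
proof -
 have cV: "continuous_on {0..pi} (\<lambda>y. exp (V y) * \<phi> y)" by (intro continuous_intros V_continuous c)
 have "compact ((\<lambda>y. exp (V y)) ` {0..pi})" by (intro compact_continuous_image continuous_intros V_continuous) auto
 then obtain B where B: "\<And>y. y \<in> {0..pi} \<Longrightarrow> exp (V y) \<le> B" using bounded_iff compact_imp_bounded by (metis imageI norm_exp real_norm_def abs_exp_cancel)
 have "\<bar>exp (V y) * \<phi> y\<bar> \<le> (B * C) * sin y" if y: "y \<in> Ipi" for y
  using mult_mono[OF B[of y] b[OF y]] B[of y] y order_trans[OF exp_ge_zero B[of y]] by (simp add: abs_mult mult.assoc)
 from integrable_test(3)[OF t' cV this]
 have 1: "integrable lborel (\<lambda>z. dw t' z * (exp (V (snd z)) * \<phi> (snd z)))" by simp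
 have "continuous_on {0..pi} (\<lambda>y. w y * (exp (V y) * \<phi> y))" by (intro continuous_intros cV continuous_on_subset[OF w]) auto
 from integrable_test(2)[OF t' this]
 have 2: "integrable lborel (\<lambda>z. uw t' z * (w (snd z) * (exp (V (snd z)) * \<phi> (snd z))))" .
 have "integrable lborel (\<lambda>z. - 2 * (dw t' z * (exp (V (snd z)) * \<phi> (snd z))) - uw t' z * (w (snd z) * (exp (V (snd z)) * \<phi> (snd z))))"
  using 1 2 by (intro Bochner_Integration.integrable_diff integrable_mult_right)
 then show ?thesis by (rule arg_cong[where f = "integrable lborel", THEN iffD1, rotated]) (auto simp: FF_def fun_eq_iff algebra_simps)
qed

definition v0 :: "real \<Rightarrow> real" where "v0 x = exp (V x) * u0 x"

lemma v0_continuous: "continuous_on {0..pi} v0"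
 unfolding v0_def[abs_def] by (intro continuous_intros V_continuous u0)

text \<open>The weak formulation with test function \<open>exp V * mode\<close> is an integrated linear differential equation for a coefficient of
  \<open>exp V * u\<close>; solve it by variation of constants.\<close>

lemma gauge_coefficient:
 assumes t': "0 < t'" "t' < T"
 shows "AE t in lborel. t \<in> {0<..<t'} \<longrightarrow> sine_coeff (\<lambda>x. exp (V x) * u t x) k
  = decay k t * sine_coeff v0 k
   + (LB z. indicator (rect t) z * (decay k (t - fst z) * (FF t' z * smode k (snd z))))"
proof -
 let ?m = "smode k"
 let ?I = "Ipi"
 define lam where "lam = (real (Suc k))\<^sup>2"
 have lam: "0 \<le> lam" unfolding lam_def by simp
 have Fi: "integrable lborel (\<lambda>z. FF t' z * ?m (snd z))"
  by (rule FF_integrable_test[OF t', of _ "real (Suc k)"]) (auto intro!: continuous_intros abs_dirichlet_mode_le_sin simp del: of_nat_Suc)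
 have ui: "integrable lborel (\<lambda>z. ur t' z * (exp (V (snd z)) * ?m (snd z)))"
  by (rule integrable_test(1)[OF t']) (intro continuous_intros V_continuous)
 define g where "g z = FF t' z * ?m (snd z) - lam * (ur t' z * (exp (V (snd z)) * ?m (snd z)))" for z
 have gi: "integrable lborel g" unfolding g_def[abs_def] using Fi ui by simp
 have Fs: "FF t' z * ?m (snd z) = 0" if "snd z \<notin> ?I" for z using that FF_outside[of z t'] by (auto simp: rect_def mem_Times_iff)
 have gs: "g z = 0" if "snd z \<notin> ?I" for z using Fs[OF that] supports(3)[OF that] by (simp add: g_def)
 define f where "f s = (LB y. g (s, y))" for s
 define b where "b s = (LB y. FF t' (s, y) * ?m y)" for s
 have fi: "integrable lborel f" using planar_time_integral(1)[OF gi gs, of "\<lambda>_. 0" 0 0] unfolding f_def by simp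
 have bi: "integrable lborel b" using planar_time_integral(1)[OF Fi Fs, of "\<lambda>_. 0" 0 0] unfolding b_def by simp
 define A where "A t = sine_coeff v0 k + (LINT s:{0<..<t}|lborel. f s)" for t
 define L where "L t = sine_coeff (\<lambda>x. exp (V x) * u t x) k" for t
 have LA: "AE t in lborel. t \<in> {0<..<t'} \<longrightarrow> L t = A t"
  using gauge_weak[OF t', of k]
 proof eventually_elim
  case (elim t)
  have "(LB z. indicator (rect t) z * g z) = (LINT s:{0<..<t}|lborel. f s)"
   using planar_time_integral(3)[OF gi gs, of "\<lambda>_. 1" t 1] unfolding rect_def f_def by simp
  then show ?case using elim unfolding L_def A_def g_def lam_def sine_coeff_def v0_def by (simp add: mult_ac)
 qed
 have AEi: "AE s in lborel. integrable lborel (\<lambda>y. FF t' (s, y) * ?m y) \<and> integrable lborel (\<lambda>y. ur t' (s, y) * (exp (V y) * ?m y))"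
  using lborel_pair.AE_integrable_fst'[of "\<lambda>z. FF t' z * ?m (snd z)"] lborel_pair.AE_integrable_fst'[of "\<lambda>z. ur t' z * (exp (V (snd z)) * ?m (snd z))"] Fi ui
  unfolding lborel_prod by auto
 have fb: "AE s in lborel. s \<in> {0<..<t'} \<longrightarrow> f s + lam * A s = b s"
  using LA AEi
 proof eventually_elim
  case (elim s)
  show ?case
  proof
   assume s: "s \<in> {0<..<t'}"
   have "(LB y. ur t' (s, y) * (exp (V y) * ?m y)) = L s"
    unfolding L_def sine_coeff_def set_lebesgue_integral_def using s
    by (intro Bochner_Integration.integral_cong) (auto simp: ur_def rect_def indicator_def)
   then show "f s + lam * A s = b s" using elim s unfolding f_def b_def g_def by simp
  qed
 qed
 show ?thesis using LA
 proof eventually_elim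
  case (elim t)
  show ?case
  proof
   assume t: "t \<in> {0<..<t'}"
   have "L t = A t" using elim t by simp
   also have "\<dots> = exp (- lam * t) * sine_coeff v0 k + (LINT s:{0<..<t}|lborel. exp (- lam * (t - s)) * (f s + lam * A s))"
    unfolding A_def by (rule duhamel_of_ode[OF fi lam]) (use t in simp)
   also have "(LINT s:{0<..<t}|lborel. exp (- lam * (t - s)) * (f s + lam * A s)) = (LINT s:{0<..<t}|lborel. exp (- lam * (t - s)) * b s)"
   proof (rule set_lebesgue_integral_cong_AE)
    have [measurable]: "f \<in> borel_fun" "b \<in> borel_fun" using fi bi by auto
    have [measurable]: "f \<in> borel_measurable lborel" using fi by auto
    have "(\<lambda>p. if 0 < snd p \<and> snd p < fst p then f (snd p) else 0) \<in> borel_measurable (borel \<Otimes>\<^sub>M lborel)" by measurable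
    then have "(\<lambda>(t, s). indicator {0<..<t} s *\<^sub>R f s) \<in> borel_measurable (borel \<Otimes>\<^sub>M lborel)"
     by (rule measurable_cong[THEN iffD1, rotated]) auto
    then have [measurable]: "A \<in> borel_fun" unfolding A_def[abs_def] set_lebesgue_integral_def
     by (intro borel_measurable_add borel_measurable_const lborel.borel_measurable_lebesgue_integral)
    show "(\<lambda>s. exp (- lam * (t - s)) * (f s + lam * A s)) \<in> borel_measurable lborel" by measurable
    show "(\<lambda>s. exp (- lam * (t - s)) * b s) \<in> borel_measurable lborel" by measurable
    show "AE s\<in>{0<..<t} in lborel. exp (- lam * (t - s)) * (f s + lam * A s) = exp (- lam * (t - s)) * b s"
     using fb by eventually_elim (use t in auto)
   qed auto
   also have "\<dots> = (LB z. indicator (rect t) z * (exp (- lam * (t - fst z)) * (FF t' z * ?m (snd z))))"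
    unfolding rect_def b_def
    by (subst planar_time_integral(3)[OF Fi Fs, where B = 1]) (use lam in auto)
   finally show "sine_coeff (\<lambda>x. exp (V x) * u t x) k
    = decay k t * sine_coeff v0 k
   + (LB z. indicator (rect t) z * (decay k (t - fst z) * (FF t' z * ?m (snd z))))"
    unfolding L_def lam_def .
  qed
 qed
qed

lemma FF_supp: "snd z \<notin> Ipi \<Longrightarrow> FF t' z = 0"
 by (rule FF_outside) (auto simp: rect_def mem_Times_iff)

lemma gauge_kernel_integrable:
 assumes t': "0 < t'" "t' < T"
 shows "AE t in lborel. integrable (lborel2) (\<lambda>(x, z). ind_I x * pK T t x z * FF t' z)"
  "AE t in lborel. integrable (lborel2) (\<lambda>(x, z). (ind_I x * sin x) * pKx T t x z * FF t' z)"
proof -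
 note d = less_imp_le[OF decay_const_pos[of 1]]
 have Fm: "FF t' \<in> borel_fun" using t' by simp
 have s: "integrable lborel (\<lambda>z. C * sin (snd z) * FF t' z)" for C
  using integrable_mult_right[OF FF_integrable_test[OF t' continuous_on_sin[OF continuous_on_id], of 1], of C] by (simp add: mult_ac sin_ge_zero)
 have q: "(\<lambda>y. C * sin y) \<in> borel_fun" for C :: real by measurable
 show "AE t in lborel. integrable (lborel2) (\<lambda>(x, z). ind_I x * pK T t x z * FF t' z)"
  by (rule duhamel_AE(2)[OF T heatK_measurable3(1) _ q Fm FF_supp _ _ s]) (auto intro!: heatK_duhamel_bound mult_nonneg_nonneg d sin_ge_zero)
 show "AE t in lborel. integrable (lborel2) (\<lambda>(x, z). (ind_I x * sin x) * pKx T t x z * FF t' z)"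
  by (rule duhamel_AE(2)[OF T heatK_measurable3(2) _ q Fm FF_supp _ _ s[of "160 * exp (T / 8) * decay_const 1"]])
   (auto intro!: heatKx_duhamel_bound mult_nonneg_nonneg d sin_ge_zero)
qed

text \<open>Both sides have the same sine coefficients.\<close>

lemma gauge_duhamel:
 assumes t': "0 < t'" "t' < T"
 shows "AE t in lborel. t \<in> {0<..<t'} \<longrightarrow> (AE x in lborel. x \<in> Ipi \<longrightarrow>
  integrable lborel (\<lambda>z. pK T t x z * FF t' z) \<and>
  exp (V x) * u t x = heat_flow v0 t x + (LB z. pK T t x z * FF t' z))"
proof -
 let ?I = "Ipi"
 have "AE t in lborel. \<forall>k. t \<in> {0<..<t'} \<longrightarrow> sine_coeff (\<lambda>x. exp (V x) * u t x) k
  = decay k t * sine_coeff v0 k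
   + (LB z. indicator (rect t) z * (decay k (t - fst z) * (FF t' z * smode k (snd z))))"
  unfolding AE_all_countable by (intro allI gauge_coefficient[OF t'])
 with gauge_kernel_integrable(1)[OF t'] AE_u_integrable[OF t'] show ?thesis
 proof eventually_elim
  case (elim t)
  define D where "D x = (LB z. pK T t x z * FF t' z)" for x
  show ?case
  proof
   assume t: "t \<in> {0<..<t'}"
   have ui: "integrable_I (\<lambda>x. exp (V x) * u t x)"
    using set_integrable_mult_continuous[OF _ continuous_on_exp[OF V_continuous], of 0 pi "u t"] elim(2) t by (simp add: mult.commute)
   have qi: "integrable_I (heat_flow v0 t)"
   proof -
    have s: "summable (\<lambda>k. \<bar>decay k t * sine_coeff v0 k\<bar>)"
     using abs_sine_coeff_le[OF set_integrable_continuous[OF v0_continuous]] t by (intro summable_decay_exp(1)[of _ 0]) auto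
    have "integrable_I (\<lambda>_. 1::real)" by (intro set_integrable_continuous continuous_intros)
    from integral_mult_sine_series(2)[OF this s] show ?thesis unfolding heat_flow_def by (simp add: mult.assoc)
   qed
   have F: "\<zeta> \<in> borel_fun \<Longrightarrow> (\<And>x. \<bar>\<zeta> x\<bar> \<le> 1) \<Longrightarrow> integrable lborel (\<lambda>x. \<zeta> x * indicator ?I x * D x)"
    "\<zeta> \<in> borel_fun \<Longrightarrow> (\<And>x. \<bar>\<zeta> x\<bar> \<le> 1) \<Longrightarrow> (LB x. \<zeta> x * indicator ?I x * D x)
     = (LB z. (LB x. \<zeta> x * indicator ?I x * pK T t x z) * FF t' z)" for \<zeta>
    unfolding D_def using duhamel_fubini(2,4)[where k = "heatK T", OF elim(1)] by blast+
   have Di: "integrable_I D" using F(1)[of "\<lambda>_. 1"] unfolding set_integrable_def by simp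
   have mm: "smode k \<in> borel_fun" for k by measurable
   have tT: "t < T" using t t' by simp
   have Dm: "(LI x. D x * smode k x) = (LB z. indicator (rect t) z * (decay k (t - fst z) * (FF t' z * smode k (snd z))))" for k
    unfolding mult.commute[of "D _"] unfolding D_def rect_def
    by (rule duhamel_coefficient(2)[where k = "heatK T" and t' = t', OF tT elim(1) mm abs_mode_le(1) _ _ heatK_coeff(1)])
     (auto simp: heatK_outside FF_outside rect_def)
   have "AE x in lborel. x \<in> ?I \<longrightarrow> exp (V x) * u t x - heat_flow v0 t x - D x = 0"
   proof (rule AE_zero_of_sine_coefficients)
    show "integrable_I (\<lambda>x. exp (V x) * u t x - heat_flow v0 t x - D x)" using ui qi Di by (intro set_integral_diff)
    fix k
    let ?m = "smode k"
    have mc: "continuous_on {0..pi} ?m" by (intro continuous_intros)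
    have "(LI x. (exp (V x) * u t x - heat_flow v0 t x - D x) * ?m x)
     = sine_coeff (\<lambda>x. exp (V x) * u t x) k - (LI x. heat_flow v0 t x * ?m x) - (LI x. D x * ?m x)"
     using set_integrable_mult_continuous[OF ui mc] set_integrable_mult_continuous[OF qi mc] set_integrable_mult_continuous[OF Di mc]
     unfolding sine_coeff_def by (simp only: left_diff_distrib set_integral_diff)
    also have "\<dots> = 0"
     using elim(3) t unfolding Dm mult.commute[of "heat_flow v0 t _"]
     by (subst heat_flow_coeff[OF set_integrable_continuous[OF v0_continuous]]) auto
    finally show "(LI x. (exp (V x) * u t x - heat_flow v0 t x - D x) * ?m x) = 0" .
   qed
   moreover have "AE x in lborel. indicator ?I x \<noteq> (0::real) \<longrightarrow> integrable lborel (\<lambda>z. pK T t x z * FF t' z)"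
    by (rule duhamel_fubini(1)[where k = "heatK T" and \<zeta> = "\<lambda>_. 0" and B = 0, OF elim(1)]) auto
   ultimately show "AE x in lborel. x \<in> ?I \<longrightarrow>
     integrable lborel (\<lambda>z. pK T t x z * FF t' z) \<and>
     exp (V x) * u t x = heat_flow v0 t x + (LB z. pK T t x z * FF t' z)"
    unfolding D_def[symmetric] by eventually_elim auto
  qed
 qed
qed

text \<open>The space derivative of \<open>exp V * u\<close>.\<close>

definition vx :: "real \<Rightarrow> real \<Rightarrow> real" where
 "vx t x = exp (V x) * (deriv (u t) x + w x * u t x)"

lemma gauged_deriv:
 "t \<in> {0<..<T} \<Longrightarrow> x \<in> Ipi \<Longrightarrow> ((\<lambda>x. exp (V x) * u t x) has_real_derivative vx t x) (at x)"
 unfolding vx_def by (auto intro!: derivative_eq_intros V_deriv u_deriv simp: algebra_simps)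

lemma vx_continuous: "t \<in> {0<..<T} \<Longrightarrow> continuous_on Ipi (vx t)"
 unfolding vx_def[abs_def] by (intro continuous_intros V_continuous u_deriv_continuous u_x continuous_on_subset[OF w]) auto

end

section \<open>Boundedness of the source term\<close>

text \<open>\<open>g\<close> is the continuous extension of the derivative of the gauged datum to the closed interval.\<close>

locale mild_holder = mild w u0 T Wb u + Q: initial_datum "\<lambda>x. exp (prim w x) * u0 x" g G H \<gamma>
 for w u0 :: "real \<Rightarrow> real" and T Wb :: real and u :: "real \<Rightarrow> real \<Rightarrow> real" and g :: "real \<Rightarrow> real" and G H \<gamma> :: real
begin

lemma v0_eq: "(\<lambda>x. exp (prim w x) * u0 x) = v0"
 by (simp add: v0_def V_def fun_eq_iff)

lemmas flow = Q.DERIV_heat_flow[unfolded v0_eq] Q.flow_x_bound[unfolded v0_eq] Q.flow_x_holder[unfolded v0_eq]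
 Q.flow_bound[unfolded v0_eq] Q.flow_time_holder_aux[unfolded v0_eq]

lemma flow_x_continuous: "0 < t \<Longrightarrow> continuous_on A (heat_flow_x v0 t)"
 using continuous_on_compose2[OF Q.flow_continuous[unfolded v0_eq], of A "\<lambda>x. (t, x)"]
  continuous_on_Pair[OF continuous_on_const[of A t] continuous_on_id[of A]] by auto

text \<open>Both sides of the Duhamel formula are integrals of their space derivatives, so the derivatives agree.\<close>

lemma gauge_duhamel_x:
 assumes t': "0 < t'" "t' < T"
 shows "AE t in lborel. t \<in> {0<..<t'} \<longrightarrow> (AE x in lborel. x \<in> Ipi \<longrightarrow>
  vx t x = heat_flow_x v0 t x + (LB z. pKx T t x z * FF t' z))"
 using gauge_duhamel[OF t'] gauge_kernel_integrable(2)[OF t']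
proof eventually_elim
 case (elim t)
 let ?I = "Ipi"
 define D where "D x = (LB z. pK T t x z * FF t' z)" for x
 define Dx where "Dx x = (LB z. pKx T t x z * FF t' z)" for x
 define P where "P x \<longleftrightarrow> integrable lborel (\<lambda>z. pK T t x z * FF t' z) \<and>
  exp (V x) * u t x = heat_flow v0 t x + D x" for x
 define E where "E x = vx t x - heat_flow_x v0 t x - Dx x" for x
 show ?case
 proof
  assume t: "t \<in> {0<..<t'}"
  then have tT: "t \<in> {0<..<T}" "0 < t" using t' by auto
  have aeP: "AE x in lborel. x \<in> ?I \<longrightarrow> P x" using elim(1) t unfolding P_def D_def by simp
  have E: "set_integrable lborel {a<..<b} E" "(LINT x:{a<..<b}|lborel. E x) = 0"
   if ab: "0 < a" "a < b" "b < pi" and P: "P a" "P b" for a b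
  proof -
   obtain x0 where x0: "x0 \<in> {a..b}" "\<And>x. x \<in> {a..b} \<Longrightarrow> sin x0 \<le> sin x"
    using continuous_attains_inf[OF compact_Icc _ continuous_on_sin[OF continuous_on_id], of a b] ab by auto
   then have c: "0 < sin x0" using ab by (intro sin_gt_zero) auto
   have p: "sin x0 \<le> indicator ?I x * sin x" if "x \<in> {a<..<b}" for x using x0(2)[of x] that ab by auto
   note F = duhamel_FTC[OF ab(2) c p _ elim(2) conjunct1[OF P(1)[unfolded P_def]] conjunct1[OF P(2)[unfolded P_def]], folded Dx_def D_def]
   have sub: "{a..b} \<subseteq> ?I" using ab by auto
   have 1: "set_integrable lborel {a<..<b} (vx t)" "(LINT x:{a<..<b}|lborel. vx t x) = exp (V b) * u t b - exp (V a) * u t a"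
   proof -
    show i: "set_integrable lborel {a<..<b} (vx t)"
     by (intro set_integrable_continuous continuous_on_subset[OF vx_continuous[OF tT(1)] sub])
    show "(LINT x:{a<..<b}|lborel. vx t x) = exp (V b) * u t b - exp (V a) * u t a"
    proof (rule set_integral_FTC_interior[OF _ _ _ i])
     show "continuous_on {a..b} (\<lambda>x. exp (V x) * u t x)"
      by (intro continuous_intros V_continuous continuous_on_subset[OF u_x[OF tT(1)] sub])
    qed (use ab gauged_deriv[OF tT(1)] in auto)
   qed
   have 2: "set_integrable lborel {a<..<b} (heat_flow_x v0 t)" "(LINT x:{a<..<b}|lborel. heat_flow_x v0 t x) = heat_flow v0 t b - heat_flow v0 t a"
   proof -
    show i: "set_integrable lborel {a<..<b} (heat_flow_x v0 t)"
     by (intro set_integrable_continuous flow_x_continuous tT(2))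
    show "(LINT x:{a<..<b}|lborel. heat_flow_x v0 t x) = heat_flow v0 t b - heat_flow v0 t a"
     by (rule set_integral_FTC_interior[OF _ _ flow(1)[OF tT(2)] i])
      (use ab in \<open>auto intro!: DERIV_continuous_on DERIV_subset[OF flow(1)[OF tT(2)]]\<close>)
   qed
   show "set_integrable lborel {a<..<b} E" unfolding E_def[abs_def] using 1(1) 2(1) F(1) by (intro set_integral_diff) auto
   show "(LINT x:{a<..<b}|lborel. E x) = 0"
    unfolding E_def[abs_def] using 1 2 F P by (simp add: set_integral_diff P_def)
  qed
  have loc: "AE x in lborel. x \<in> {1 / real (n + 2)<..<pi - 1 / real (n + 2)} \<longrightarrow> E x = 0" for n
  proof -
   have "1 / real (n + 2) \<le> 1 / 2" by (simp add: field_simps)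
   then have n: "0 < 1 / real (n + 2)" "1 / real (n + 2) < pi / 2" using pi_gt3 by (simp, linarith)
   obtain a where a: "0 < a" "a < 1 / real (n + 2)" "P a"
    using AE_imp_ex_in_interval[OF aeP n(1)] n pi_gt_zero by auto
   obtain b where b: "pi - 1 / real (n + 2) < b" "b < pi" "P b"
    using AE_imp_ex_in_interval[OF aeP, of "pi - 1 / real (n + 2)" pi] n pi_gt_zero by auto
   have ab: "a < b" using a b n by linarith
   have i: "integrable lborel (\<lambda>x. indicator {a<..<b} x * E x)" using E(1)[OF a(1) ab b(2) a(3) b(3)] unfolding set_integrable_def by simp
   have "AE x in lborel. indicator {a<..<b} x * E x = 0"
   proof (rule AE_zero_of_AE_halfline_integrals[OF i])
    show "AE x in lborel. (LB y. indicator {a<..<b} y * E y * indicator {x<..} y) = 0"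
     using aeP
    proof eventually_elim
     case (elim x)
     consider "x \<le> a" | "a < x" "x < b" | "b \<le> x" by linarith
     then show ?case
     proof cases
      case 1
      then have e: "indicator {a<..<b} y * E y * indicator {x<..} y = indicator {a<..<b} y *\<^sub>R E y" for y by (auto simp: indicator_def)
      show ?thesis using E(2)[OF a(1) ab b(2) a(3) b(3)] unfolding e set_lebesgue_integral_def .
     next
      case 2
      then have e: "indicator {a<..<b} y * E y * indicator {x<..} y = indicator {x<..<b} y *\<^sub>R E y" for y by (auto simp: indicator_def)
      have "P x" using elim 2 a b by auto
      then show ?thesis using E(2)[of x b] 2 a b unfolding e set_lebesgue_integral_def by simp
     next
      case 3
      then have e: "indicator {a<..<b} y * E y * indicator {x<..} y = 0" for y by (auto simp: indicator_def)
      show ?thesis unfolding e by simp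
     qed
    qed
   qed
   then show ?thesis by eventually_elim (use a b in \<open>auto simp: indicator_def split: if_splits\<close>)
  qed
  have "AE x in lborel. \<forall>n. x \<in> {1 / real (n + 2)<..<pi - 1 / real (n + 2)} \<longrightarrow> E x = 0"
   unfolding AE_all_countable by (intro allI loc)
  then show "AE x in lborel. x \<in> ?I \<longrightarrow> vx t x = heat_flow_x v0 t x + (LB z. pKx T t x z * FF t' z)"
  proof eventually_elim
   case (elim x)
   show ?case
   proof
    assume x: "x \<in> ?I"
    then obtain n where "inverse (real (Suc n)) < min x (pi - x)" using reals_Archimedean[of "min x (pi - x)"] by auto
    moreover have "1 / real (n + 2) \<le> inverse (real (Suc n))" by (simp add: field_simps)
    ultimately have "x \<in> {1 / real (n + 2)<..<pi - 1 / real (n + 2)}" by auto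
    then have "E x = 0" using elim by blast
    then show "vx t x = heat_flow_x v0 t x + (LB z. pKx T t x z * FF t' z)"
     unfolding E_def Dx_def by simp
   qed
  qed
 qed
qed

text \<open>The right-hand side of the heat equation for the gauged solution is bounded by a linear expression in that
 solution and its derivative, which the Duhamel formula expresses through the
 right-hand side again.\<close>

lemma FF_bounded: "\<exists>B\<ge>0. \<forall>t'. 0 < t' \<longrightarrow> t' < T \<longrightarrow> (AE z in lborel. \<bar>FF t' z\<bar> \<le> B)"
proof -
 define A where "A = 2 * Wb + Wb\<^sup>2"
 have A: "0 \<le> A" using Wb_nonneg unfolding A_def by simp
 define k where "k \<tau> x y = ennreal (A * (\<bar>heatKx T \<tau> x y\<bar> + \<bar>heatK T \<tau> x y\<bar>))" for \<tau> x y
 define C where "C = A * (decay_const 1 + decay_const 0 * T powr (1/2) + 160 * exp (T / 8) * decay_const 1)"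
 note K = heat_kernels_integral_bounds[OF T A, folded k_def C_def]
 (* With this S the discounted kernel has norm at most 1 / 2. *)
 define S where "S = 16 * C * T powr (1/8) + 1"
 have S: "0 < S" unfolding S_def using K(4) by (intro add_nonneg_pos mult_nonneg_nonneg) auto
 define lam where "lam = S powr 8"
 have lam: "0 < lam" unfolding lam_def using S by simp
 have small: "C * (lam powr (- 1 / 8) * (8 * T powr (1 / 8))) \<le> 1 / 2"
 proof -
  have "lam powr (- 1 / 8) = inverse S" unfolding lam_def powr_powr using S by (simp add: powr_minus)
  moreover have "C * (inverse S * (8 * T powr (1 / 8))) \<le> 1 / 2" using S unfolding S_def by (simp add: field_simps)
  ultimately show ?thesis by simp
 qed
 have G: "0 \<le> G" using Q.gb[of 0] by simp
 define M0 where "M0 = 2 * Wb * G + Wb\<^sup>2 * (G * pi)"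
 have M0: "0 \<le> M0" unfolding M0_def using Wb_nonneg G by simp
 have "AE z in lborel. \<bar>FF t' z\<bar> \<le> 2 * M0 * exp (lam * T)" if t': "0 < t'" "t' < T" for t'
 proof -
  have Fm [measurable]: "FF t' \<in> borel_fun" using t' by simp
  have "AE z in lborel. \<bar>FF t' z\<bar> \<le> 2 * M0 * exp (lam * fst z)"
  proof (rule kernel_comparison[OF T K(4) M0 lam small K(3) Fm _ K(1,2)])
   show "FF t' z = 0" if "z \<notin> {0<..<t'} \<times> Ipi" for z using FF_outside[of z t'] that unfolding rect_def by simp
   show "(NN z. ennreal \<bar>sin (snd z) * FF t' z\<bar>) < \<infinity>"
    using FF_integrable_test[OF t' continuous_on_sin[OF continuous_on_id], of 1] by (simp add: integrable_iff_bounded mult.commute sin_ge_zero)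
   define R where "R z \<longleftrightarrow> (z \<in> {0<..<t'} \<times> Ipi \<longrightarrow> ennreal \<bar>FF t' z\<bar> \<le> ennreal M0 + (\<integral>\<^sup>+z'. k (fst z - fst z') (snd z) (snd z') * ennreal \<bar>FF t' z'\<bar> \<partial>lborel))" for z
   note km [measurable (raw)] = measurable_uncurried3[OF K(3)]
   have "Measurable.pred borel R" unfolding R_def[abs_def] rect_def[symmetric] by measurable
   then have Rm: "{z \<in> space (lborel2). R z} \<in> sets (lborel2)"
    unfolding lborel_prod by (simp add: pred_def)
   have "AE t in lborel. AE x in lborel. R (t, x)"
    using gauge_duhamel[OF t'] gauge_duhamel_x[OF t']
   proof eventually_elim
    case (elim t)
    show ?case
    proof (cases "t \<in> {0<..<t'}")
     case t: True
     then have t0: "0 < t" by simp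
     have "AE x in lborel. x \<in> Ipi \<longrightarrow> exp (V x) * u t x = heat_flow v0 t x + (LB z. pK T t x z * FF t' z)"
      using elim(1) t by (auto elim: eventually_mono)
     moreover have "AE x in lborel. x \<in> Ipi \<longrightarrow> vx t x = heat_flow_x v0 t x + (LB z. pKx T t x z * FF t' z)"
      using elim(2) t by simp
     ultimately show ?thesis
     proof eventually_elim
      case (elim x)
      define D where "D = (LB z. pK T t x z * FF t' z)"
      define Dx where "Dx = (LB z. pKx T t x z * FF t' z)"
      show ?case unfolding R_def
      proof
       assume "(t, x) \<in> {0<..<t'} \<times> Ipi"
       then have x: "x \<in> Ipi" by simp
       have eqs: "exp (V x) * u t x = heat_flow v0 t x + D" "vx t x = heat_flow_x v0 t x + Dx" using elim x unfolding D_def Dx_def by auto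
       have F: "FF t' (t, x) = - (2 * (w x * vx t x)) + (w x)\<^sup>2 * (exp (V x) * u t x)"
        using t x unfolding FF_def dw_def uw_def rect_def vx_def by (simp add: algebra_simps power2_eq_square)
       have "\<bar>vx t x\<bar> \<le> G + \<bar>Dx\<bar>" unfolding eqs using flow(2)[OF t0, of x] by linarith
       then have 1: "\<bar>w x\<bar> * \<bar>vx t x\<bar> \<le> Wb * (G + \<bar>Dx\<bar>)" by (intro mult_mono wb) (use Wb_nonneg in auto)
       have "\<bar>exp (V x) * u t x\<bar> \<le> G * pi + \<bar>D\<bar>" unfolding eqs using flow(4)[OF t0, of x] x by auto
       moreover have "(w x)\<^sup>2 \<le> Wb\<^sup>2" using power_mono[OF wb[of x], of 2] by simp
       ultimately have 2: "(w x)\<^sup>2 * \<bar>exp (V x) * u t x\<bar> \<le> Wb\<^sup>2 * (G * pi + \<bar>D\<bar>)" by (intro mult_mono) auto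
       have "\<bar>FF t' (t, x)\<bar> \<le> 2 * (\<bar>w x\<bar> * \<bar>vx t x\<bar>) + (w x)\<^sup>2 * \<bar>exp (V x) * u t x\<bar>"
        unfolding F by (rule order_trans[OF abs_triangle_ineq]) (simp add: abs_mult)
       also have "\<dots> \<le> M0 + (2 * Wb * \<bar>Dx\<bar> + Wb\<^sup>2 * \<bar>D\<bar>)" using 1 2 unfolding M0_def by (simp add: algebra_simps)
       also have "2 * Wb * \<bar>Dx\<bar> + Wb\<^sup>2 * \<bar>D\<bar> \<le> A * \<bar>Dx\<bar> + A * \<bar>D\<bar>"
        using Wb_nonneg unfolding A_def by (intro add_mono mult_right_mono) auto
       finally have "ennreal \<bar>FF t' (t, x)\<bar> \<le> ennreal (M0 + (A * \<bar>Dx\<bar> + A * \<bar>D\<bar>))" by (intro ennreal_leI) simp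
       also have "\<dots> = ennreal M0 + (ennreal A * ennreal \<bar>Dx\<bar> + ennreal A * ennreal \<bar>D\<bar>)"
        using M0 A by (simp add: ennreal_mult ennreal_plus)
       also have "\<dots> \<le> ennreal M0 + (ennreal A * (NN z. ennreal \<bar>pKx T t x z * FF t' z\<bar>)
         + ennreal A * (NN z. ennreal \<bar>pK T t x z * FF t' z\<bar>))"
        unfolding D_def Dx_def by (intro add_left_mono add_mono mult_left_mono abs_integral_le_nn_integral) auto
       also have "\<dots> = ennreal M0 + (NN z. ennreal A * ennreal \<bar>pKx T t x z * FF t' z\<bar> + ennreal A * ennreal \<bar>pK T t x z * FF t' z\<bar>)"
        by (subst nn_integral_add) (auto simp: nn_integral_cmult)
       also have "\<dots> = ennreal M0 + (\<integral>\<^sup>+z'. k (fst (t, x) - fst z') (snd (t, x)) (snd z') * ennreal \<bar>FF t' z'\<bar> \<partial>lborel)"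
        unfolding k_def using A by (intro arg_cong2[where f = "(+)"] nn_integral_cong refl)
         (simp add: ennreal_mult ennreal_plus abs_mult distrib_left distrib_right mult.assoc)
       finally show "ennreal \<bar>FF t' (t, x)\<bar> \<le> ennreal M0 + (\<integral>\<^sup>+z'. k (fst (t, x) - fst z') (snd (t, x)) (snd z') * ennreal \<bar>FF t' z'\<bar> \<partial>lborel)" .
      qed
     qed
    next
     case False
     then have "R (t, x)" for x unfolding R_def by auto
     then show ?thesis by simp
    qed
   qed
   from lborel_pair.AE_pair_measure[OF Rm this]
   show "AE z in lborel. z \<in> {0<..<t'} \<times> Ipi \<longrightarrow> ennreal \<bar>FF t' z\<bar> \<le> ennreal M0 + (\<integral>\<^sup>+z'. k (fst z - fst z') (snd z) (snd z') * ennreal \<bar>FF t' z'\<bar> \<partial>lborel)"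
    unfolding lborel_prod R_def .
  qed
  then show ?thesis
  proof eventually_elim
   case (elim z)
   show ?case
   proof (cases "z \<in> rect t'")
    case True
    then have "2 * M0 * exp (lam * fst z) \<le> 2 * M0 * exp (lam * T)" using M0 lam t' unfolding rect_def by (intro mult_left_mono) auto
    then show ?thesis using elim by linarith
   qed (use M0 in \<open>simp add: FF_outside\<close>)
  qed
 qed
 then show ?thesis using M0 by (intro exI[of _ "2 * M0 * exp (lam * T)"]) auto
qed

end

section \<open>Duhamel integrals of a bounded density\<close>

text \<open>The part of the time integral near the singularity is small because the kernel is integrable there with
 an exponent to spare; the rest sees only the time difference of the kernel.\<close>

lemma duhamel_time_holder:
 fixes k :: "real \<Rightarrow> real \<Rightarrow> real \<Rightarrow> real" and F :: "real \<times> real \<Rightarrow> real"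
 assumes T: "0 < T" and a: "0 \<le> a" "b + a < 1" and c: "0 \<le> c0" "0 \<le> c1" and M: "0 \<le> M"
  and km: "(\<lambda>(\<tau>, x, y). k \<tau> x y) \<in> borel_fun"
  and zero: "\<And>\<tau> y. \<not> (0 < \<tau> \<and> \<tau> < T) \<Longrightarrow> k \<tau> x y = 0"
  and L1: "\<And>\<tau>. 0 < \<tau> \<Longrightarrow> \<tau> < T \<Longrightarrow> (NN y. ennreal \<bar>k \<tau> x y\<bar> * ind_I y) \<le> ennreal (c0 * \<tau> powr (- b))"
  and diff: "\<And>\<tau> h. 0 < \<tau> \<Longrightarrow> 0 \<le> h \<Longrightarrow> \<tau> + h < T \<Longrightarrow>
   (NN y. ennreal \<bar>k (\<tau> + h) x y - k \<tau> x y\<bar> * ind_I y) \<le> ennreal (c1 * h powr a * \<tau> powr (- (b + a)))"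
  and Fm: "F \<in> borel_fun" and supp: "\<And>z. z \<notin> {0<..<T} \<times> Ipi \<Longrightarrow> F z = 0"
  and Fb: "\<And>z. \<bar>F z\<bar> \<le> M"
  and st: "0 < s" "s \<le> t" "t < T"
 shows "\<bar>(LB z. k (t - fst z) x (snd z) * F z) - (LB z. k (s - fst z) x (snd z) * F z)\<bar>
  \<le> (c0 + c1) * M * (T powr (1 - (b + a)) / (1 - (b + a))) * (t - s) powr a"
proof -
 note km' [measurable (raw)] = measurable_uncurried3[OF km]
 have supp': "F z = 0" if "snd z \<notin> Ipi" for z using supp[of z] that by (auto simp: mem_Times_iff)
 have b: "b < 1" using a by simp
 have i: "integrable lborel (\<lambda>z. k (r - fst z) x (snd z) * F z)" for r
 proof (rule duhamel_sup(1)[where k = "\<lambda>s y. k (r - s) x y", OF T b c(1) M _ Fm supp' Fb])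
  show "(NN y. ennreal \<bar>k (r - s) x y\<bar> * ind_I y) \<le> ennreal (c0 * abel T b (r - s))" for s
   using L1[of "r - s"] zero[of "r - s"] by (cases "0 < r - s \<and> r - s < T") (auto simp: abel_def)
 qed measurable
 define k1 where "k1 r y = indicator {0<..<s} r * (k (t - r) x y - k (s - r) x y)" for r y
 define k2 where "k2 r y = indicator {s..<t} r * k (t - r) x y" for r y
 let ?B = "\<lambda>C. C * M * (T powr (1 - (b + a)) / (1 - (b + a)))"
 have D1: "integrable lborel (\<lambda>z. k1 (fst z) (snd z) * F z)" "\<bar>LB z. k1 (fst z) (snd z) * F z\<bar> \<le> ?B (c1 * (t - s) powr a)"
 proof -
  have m: "(\<lambda>z. k1 (fst z) (snd z)) \<in> borel_fun" unfolding k1_def by measurable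
  have kb: "(NN y. ennreal \<bar>k1 r y\<bar> * ind_I y) \<le> ennreal (c1 * (t - s) powr a * abel T (b + a) (s - r))" for r
  proof (cases "0 < r \<and> r < s")
   case True
   then have "s - r + (t - s) = t - r" "0 < s - r" "s - r < T" using st by auto
   then show ?thesis using diff[of "s - r" "t - s"] True st by (simp add: k1_def abel_def)
  qed (auto simp: k1_def)
  note * = duhamel_sup[OF T a(2) _ M m Fm supp' Fb kb]
  show "integrable lborel (\<lambda>z. k1 (fst z) (snd z) * F z)" by (rule *(1)) (use c in auto)
  show "\<bar>LB z. k1 (fst z) (snd z) * F z\<bar> \<le> ?B (c1 * (t - s) powr a)" by (rule *(2)) (use c in auto)
 qed
 have D2: "integrable lborel (\<lambda>z. k2 (fst z) (snd z) * F z)" "\<bar>LB z. k2 (fst z) (snd z) * F z\<bar> \<le> ?B (c0 * (t - s) powr a)"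
 proof -
  have m: "(\<lambda>z. k2 (fst z) (snd z)) \<in> borel_fun" unfolding k2_def by measurable
  have kb: "(NN y. ennreal \<bar>k2 r y\<bar> * ind_I y) \<le> ennreal (c0 * (t - s) powr a * abel T (b + a) (t - r))" for r
  proof (cases "s \<le> r \<and> r < t")
   case True
   then have r: "0 < t - r" "t - r < T" "t - r \<le> t - s" using st by auto
   have "(t - r) powr (- b) = (t - r) powr a * (t - r) powr (- (b + a))" unfolding powr_add[symmetric] by simp
   also have "\<dots> \<le> (t - s) powr a * (t - r) powr (- (b + a))" using r a by (intro mult_right_mono powr_mono2) auto
   finally have "c0 * (t - r) powr (- b) \<le> c0 * (t - s) powr a * (t - r) powr (- (b + a))" using c by (simp add: mult.assoc mult_left_mono)
   then have "ennreal (c0 * (t - r) powr (- b)) \<le> ennreal (c0 * (t - s) powr a * abel T (b + a) (t - r))" using r by (intro ennreal_leI) (simp add: abel_def)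
   then show ?thesis using order_trans[OF L1[OF r(1,2)]] True by (simp add: k2_def)
  qed (auto simp: k2_def)
  note * = duhamel_sup[OF T a(2) _ M m Fm supp' Fb kb]
  show "integrable lborel (\<lambda>z. k2 (fst z) (snd z) * F z)" by (rule *(1)) (use c in auto)
  show "\<bar>LB z. k2 (fst z) (snd z) * F z\<bar> \<le> ?B (c0 * (t - s) powr a)" by (rule *(2)) (use c in auto)
 qed
 have "(LB z. k (t - fst z) x (snd z) * F z) - (LB z. k (s - fst z) x (snd z) * F z)
  = (LB z. k1 (fst z) (snd z) * F z + k2 (fst z) (snd z) * F z)"
  unfolding Bochner_Integration.integral_diff[OF i i, symmetric]
 proof (intro Bochner_Integration.integral_cong refl)
  fix z :: "real \<times> real"
  consider "fst z \<le> 0" | "0 < fst z" "fst z < s" | "s \<le> fst z" "fst z < t" | "t \<le> fst z" by linarith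
  then show "k (t - fst z) x (snd z) * F z - k (s - fst z) x (snd z) * F z = k1 (fst z) (snd z) * F z + k2 (fst z) (snd z) * F z"
  proof cases
   case 1
   then have "F z = 0" by (intro supp) (auto simp: mem_Times_iff)
   then show ?thesis by simp
  qed (use st in \<open>auto simp: k1_def k2_def zero algebra_simps\<close>)
 qed
 also have "\<bar>\<dots>\<bar> \<le> ?B (c1 * (t - s) powr a) + ?B (c0 * (t - s) powr a)"
  using D1 D2 by (simp add: abs_le_iff)
 also have "\<dots> = (c0 + c1) * M * (T powr (1 - (b + a)) / (1 - (b + a))) * (t - s) powr a"
  by (simp add: algebra_simps add_divide_distrib)
 finally show ?thesis .
qed

lemma continuous_on_holder_pair:
 fixes f :: "real \<Rightarrow> real \<Rightarrow> real"
 assumes a: "0 < a" "0 < b"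
  and h: "\<And>s t x y. s \<in> A \<Longrightarrow> t \<in> A \<Longrightarrow> x \<in> B \<Longrightarrow> y \<in> B \<Longrightarrow> \<bar>f t x - f s y\<bar> \<le> c * \<bar>t - s\<bar> powr a + d * \<bar>x - y\<bar> powr b"
 shows "continuous_on (A \<times> B) (\<lambda>(t, x). f t x)"
proof -
 have "((\<lambda>(t, x). f t x) \<longlongrightarrow> f s y) (at (s, y) within A \<times> B)" if "s \<in> A" "y \<in> B" for s y
 proof (rule LIM_zero_cancel, rule Lim_null_comparison)
  show "\<forall>\<^sub>F p in at (s, y) within A \<times> B. norm ((case p of (t, x) \<Rightarrow> f t x) - f s y) \<le> c * \<bar>fst p - s\<bar> powr a + d * \<bar>snd p - y\<bar> powr b"
   unfolding eventually_at_topological using that h by (intro exI[of _ UNIV]) auto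
  have l: "((\<lambda>p. fst p) \<longlongrightarrow> s) (at (s, y) within A \<times> B)" "((\<lambda>p. snd p) \<longlongrightarrow> y) (at (s, y) within A \<times> B)"
   using tendsto_fst[OF tendsto_ident_at, of "(s, y)"] tendsto_snd[OF tendsto_ident_at, of "(s, y)"] by auto
  have "((\<lambda>p. c * \<bar>fst p - s\<bar> powr a + d * \<bar>snd p - y\<bar> powr b) \<longlongrightarrow> c * 0 + d * 0) (at (s, y) within A \<times> B)"
  proof (intro tendsto_add tendsto_mult tendsto_const)
   have "((\<lambda>p. \<bar>fst p - s\<bar>) \<longlongrightarrow> 0) (at (s, y) within A \<times> B)" "((\<lambda>p. \<bar>snd p - y\<bar>) \<longlongrightarrow> 0) (at (s, y) within A \<times> B)"
    using tendsto_rabs[OF tendsto_diff[OF l(1) tendsto_const[of s]]] tendsto_rabs[OF tendsto_diff[OF l(2) tendsto_const[of y]]] by auto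
   from this[THEN tendsto_zero_powrI, OF tendsto_const always_eventually] a
   show "((\<lambda>p. \<bar>fst p - s\<bar> powr a) \<longlongrightarrow> 0) (at (s, y) within A \<times> B)" "((\<lambda>p. \<bar>snd p - y\<bar> powr b) \<longlongrightarrow> 0) (at (s, y) within A \<times> B)"
    by simp_all
  qed
  then show "((\<lambda>p. c * \<bar>fst p - s\<bar> powr a + d * \<bar>snd p - y\<bar> powr b) \<longlongrightarrow> 0) (at (s, y) within A \<times> B)" by simp
 qed
 then show ?thesis unfolding continuous_on_def by auto
qed

lemma holder_symmetric:
 fixes f :: "real \<Rightarrow> real"
 assumes "\<And>s t. s \<in> A \<Longrightarrow> t \<in> A \<Longrightarrow> s \<le> t \<Longrightarrow> \<bar>f t - f s\<bar> \<le> c * (t - s) powr a" and "s \<in> A" "t \<in> A"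
 shows "\<bar>f t - f s\<bar> \<le> c * \<bar>t - s\<bar> powr a"
 using assms(1)[of s t] assms(1)[of t s] assms(2,3) by (cases "s \<le> t") (auto simp: abs_minus_commute)

locale bounded_density =
 fixes T M \<gamma> :: real and F :: "real \<times> real \<Rightarrow> real"
 assumes T: "0 < T" and M: "0 \<le> M" and Fm: "F \<in> borel_fun"
  and supp: "\<And>z. z \<notin> {0<..<T} \<times> Ipi \<Longrightarrow> F z = 0" and Fb: "\<And>z. \<bar>F z\<bar> \<le> M"
  and gam: "0 < \<gamma>" "\<gamma> < 1 / 2"
begin

definition D :: "real \<Rightarrow> real \<Rightarrow> real" where "D t x = (LB z. pK T t x z * F z)"
definition Dx :: "real \<Rightarrow> real \<Rightarrow> real" where "Dx t x = (LB z. pKx T t x z * F z)"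

lemma supp': "snd z \<notin> Ipi \<Longrightarrow> F z = 0"
 by (rule supp) (auto simp: mem_Times_iff)

lemma dc: "0 \<le> decay_const p"
 using decay_const_pos[of p] by simp

lemma D_facts:
 "integrable lborel (\<lambda>z. pK T t x z * F z)" "\<exists>B. \<forall>t x. \<bar>D t x\<bar> \<le> B"
proof -
 have kb: "(NN y. ennreal \<bar>heatK T (t - s) x y\<bar> * ind_I y) \<le> ennreal (decay_const 0 * abel T (1/4) (t - s))" for t x s
  using heatK_L1[of "t - s" T x] by (cases "0 < t - s \<and> t - s < T") (auto simp: abel_def heatK_outside)
 note * = duhamel_sup[where k = "\<lambda>s y. heatK T (t - s) x y" for t x, OF T _ dc M _ Fm supp' Fb kb]
 show "integrable lborel (\<lambda>z. pK T t x z * F z)" by (rule *(1)) auto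
 have "\<bar>D t x\<bar> \<le> decay_const 0 * M * (T powr (1 - 1/4) / (1 - 1/4))" for t x unfolding D_def by (rule *(2)) auto
 then show "\<exists>B. \<forall>t x. \<bar>D t x\<bar> \<le> B" by blast
qed

lemma kx: "(NN y. ennreal \<bar>heatKx T (t - s) x y\<bar> * ind_I y) \<le> ennreal (decay_const 1 * abel T (3/4) (t - s))"
 using heatKx_L1[of "t - s" T x] by (cases "0 < t - s \<and> t - s < T") (auto simp: abel_def heatK_outside)

lemma Dx_facts:
 "integrable lborel (\<lambda>z. pKx T t x z * F z)" "\<exists>B\<ge>0. \<forall>t x. \<bar>Dx t x\<bar> \<le> B"
proof -
 note * = duhamel_sup[where k = "\<lambda>s y. heatKx T (t - s) x y" for t x, OF T _ dc M _ Fm supp' Fb kx]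
 show "integrable lborel (\<lambda>z. pKx T t x z * F z)" by (rule *(1)) auto
 have "\<bar>Dx t x\<bar> \<le> decay_const 1 * M * (T powr (1 - 3/4) / (1 - 3/4))" for t x unfolding Dx_def by (rule *(2)) auto
 then show "\<exists>B\<ge>0. \<forall>t x. \<bar>Dx t x\<bar> \<le> B" using order_trans[OF abs_ge_zero] by blast
qed

lemma Dx_holder: "\<exists>B\<ge>0. \<forall>t x y. \<bar>Dx t x - Dx t y\<bar> \<le> B * \<bar>x - y\<bar> powr \<gamma>"
proof -
 define \<theta> where "\<theta> = (2 * (1 + \<gamma>) + 1) / 4"
 have th: "\<theta> < 1" using gam unfolding \<theta>_def by simp
 have "\<bar>Dx t x - Dx t y\<bar> \<le> (decay_const (1 + \<gamma>) * 2 * M * (T powr (1 - \<theta>) / (1 - \<theta>))) * \<bar>x - y\<bar> powr \<gamma>" for t x y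
 proof -
  have kb: "(NN \<eta>. ennreal \<bar>heatKx T (t - s) x \<eta> - heatKx T (t - s) y \<eta>\<bar> * ind_I \<eta>)
   \<le> ennreal (decay_const (1 + \<gamma>) * (2 * \<bar>x - y\<bar> powr \<gamma>) * abel T \<theta> (t - s))" for s
   using heatKx_space_diff[of "t - s" T \<gamma> x y] gam unfolding \<theta>_def
   by (cases "0 < t - s \<and> t - s < T") (auto simp: abel_def heatK_outside minus_divide_left)
  have "\<bar>LB z. (pKx T t x z - pKx T t y z) * F z\<bar>
   \<le> decay_const (1 + \<gamma>) * (2 * \<bar>x - y\<bar> powr \<gamma>) * M * (T powr (1 - \<theta>) / (1 - \<theta>))"
   by (rule duhamel_sup(2)[where k = "\<lambda>s \<eta>. heatKx T (t - s) x \<eta> - heatKx T (t - s) y \<eta>", OF T th _ M _ Fm supp' Fb kb]) (auto simp: dc)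
  then show ?thesis
   unfolding Dx_def left_diff_distrib Bochner_Integration.integral_diff[OF Dx_facts(1) Dx_facts(1)] by (simp add: mult_ac)
 qed
 then have "\<forall>t x y. \<bar>Dx t x - Dx t y\<bar> \<le> max 0 (decay_const (1 + \<gamma>) * 2 * M * (T powr (1 - \<theta>) / (1 - \<theta>))) * \<bar>x - y\<bar> powr \<gamma>"
  by (meson max.cobounded2 mult_right_mono order_trans powr_ge_zero)
 then show ?thesis by (intro exI[of _ "max 0 (decay_const (1 + \<gamma>) * 2 * M * (T powr (1 - \<theta>) / (1 - \<theta>)))"]) auto
qed

text \<open>The kernel exponent \<open>1 / 4\<close> plus the Hoelder exponent \<open>(1 + \<gamma>) / 2\<close> stays below \<open>1\<close>.\<close>

lemma D_time_holder: "\<exists>B. \<forall>t\<in>{0<..<T}. \<forall>s\<in>{0<..<T}. \<forall>x. \<bar>D t x - D s x\<bar> \<le> B * \<bar>t - s\<bar> powr ((1 + \<gamma>) / 2)"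
proof -
 let ?a = "(1 + \<gamma>) / 2"
 have "\<bar>D t x - D s x\<bar> \<le> ((decay_const 0 + decay_const (2 * ?a)) * M * (T powr (1 - (1/4 + ?a)) / (1 - (1/4 + ?a)))) * \<bar>t - s\<bar> powr ?a"
  if "t \<in> {0<..<T}" "s \<in> {0<..<T}" for t s x
 proof (rule holder_symmetric[OF _ that(2,1)])
  fix s t assume st: "s \<in> {0<..<T}" "t \<in> {0<..<T}" "s \<le> t"
  show "\<bar>D t x - D s x\<bar> \<le> ((decay_const 0 + decay_const (2 * ?a)) * M * (T powr (1 - (1/4 + ?a)) / (1 - (1/4 + ?a)))) * (t - s) powr ?a"
   unfolding D_def
  proof (rule duhamel_time_holder[OF T _ _ dc dc M heatK_measurable3(1) _ _ _ Fm supp Fb])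
   fix \<tau> h :: real assume th: "0 < \<tau>" "0 \<le> h" "\<tau> + h < T"
   have "- (4 * ?a + 1) / 4 = - (1/4 + ?a)" by (simp add: field_simps)
   from heatK_time_diff(1)[OF th, of ?a x, unfolded this] gam
   show "(NN y. ennreal \<bar>heatK T (\<tau> + h) x y - heatK T \<tau> x y\<bar> * ind_I y) \<le> ennreal (decay_const (2 * ?a) * h powr ?a * \<tau> powr (- (1/4 + ?a)))"
    by argo
  next
   fix \<tau> :: real assume "0 < \<tau>" "\<tau> < T"
   from heatK_L1[OF this, of x] show "(NN y. ennreal \<bar>heatK T \<tau> x y\<bar> * ind_I y) \<le> ennreal (decay_const 0 * \<tau> powr (- (1/4)))" by simp
  qed (use st gam in \<open>auto simp: heatK_outside field_simps\<close>)
 qed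
 then show ?thesis by blast
qed

text \<open>Any exponent below \<open>1 / 4\<close> would serve; the lemma only yields joint continuity.\<close>

lemma Dx_time_holder: "\<exists>B. \<forall>t\<in>{0<..<T}. \<forall>s\<in>{0<..<T}. \<forall>x. \<bar>Dx t x - Dx s x\<bar> \<le> B * \<bar>t - s\<bar> powr (1/8)"
proof -
 have "\<bar>Dx t x - Dx s x\<bar> \<le> ((decay_const 1 + decay_const (1 + 2 * (1/8))) * M * (T powr (1 - (3/4 + 1/8)) / (1 - (3/4 + 1/8)))) * \<bar>t - s\<bar> powr (1/8)"
  if "t \<in> {0<..<T}" "s \<in> {0<..<T}" for t s x
 proof (rule holder_symmetric[OF _ that(2,1)])
  fix s t assume st: "s \<in> {0<..<T}" "t \<in> {0<..<T}" "s \<le> t"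
  show "\<bar>Dx t x - Dx s x\<bar> \<le> ((decay_const 1 + decay_const (1 + 2 * (1/8))) * M * (T powr (1 - (3/4 + 1/8)) / (1 - (3/4 + 1/8)))) * (t - s) powr (1/8)"
   unfolding Dx_def
  proof (rule duhamel_time_holder[OF T _ _ dc dc M heatK_measurable3(2) _ _ _ Fm supp Fb])
   fix \<tau> h :: real assume th: "0 < \<tau>" "0 \<le> h" "\<tau> + h < T"
   from heatK_time_diff(2)[OF th, of "1/8" x]
   show "(NN y. ennreal \<bar>heatKx T (\<tau> + h) x y - heatKx T \<tau> x y\<bar> * ind_I y) \<le> ennreal (decay_const (1 + 2 * (1/8)) * h powr (1/8) * \<tau> powr (- (3/4 + 1/8)))"
    by simp
  next
   fix \<tau> :: real assume "0 < \<tau>" "\<tau> < T"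
   from heatKx_L1[OF this, of x] show "(NN y. ennreal \<bar>heatKx T \<tau> x y\<bar> * ind_I y) \<le> ennreal (decay_const 1 * \<tau> powr (- (3/4)))" by simp
  qed (use st in \<open>auto simp: heatK_outside\<close>)
 qed
 then show ?thesis by blast
qed

lemma Dx_continuous: "continuous_on ({0<..<T} \<times> UNIV) (\<lambda>(t, x). Dx t x)" "continuous_on A (Dx t)"
proof -
 obtain B1 where B1: "\<And>t x y. \<bar>Dx t x - Dx t y\<bar> \<le> B1 * \<bar>x - y\<bar> powr \<gamma>" using Dx_holder by blast
 obtain B2 where B2: "\<And>t s x. t \<in> {0<..<T} \<Longrightarrow> s \<in> {0<..<T} \<Longrightarrow> \<bar>Dx t x - Dx s x\<bar> \<le> B2 * \<bar>t - s\<bar> powr (1/8)"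
  using Dx_time_holder by blast
 show "continuous_on ({0<..<T} \<times> UNIV) (\<lambda>(t, x). Dx t x)"
 proof (rule continuous_on_holder_pair)
  show "\<bar>Dx t x - Dx s y\<bar> \<le> B2 * \<bar>t - s\<bar> powr (1/8) + B1 * \<bar>x - y\<bar> powr \<gamma>" if "s \<in> {0<..<T}" "t \<in> {0<..<T}" for s t x y
   using B1[of s x y] B2[OF that(2,1), of x] by linarith
 qed (use gam in auto)
 have "continuous_on ({t} \<times> UNIV) (\<lambda>(t, x). Dx t x)"
 proof (rule continuous_on_holder_pair[where a = 1 and c = 0])
  show "\<bar>Dx r x - Dx s y\<bar> \<le> 0 * \<bar>r - s\<bar> powr 1 + B1 * \<bar>x - y\<bar> powr \<gamma>" if "s \<in> {t}" "r \<in> {t}" for s r x y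
   using B1[of t x y] that by simp
 qed (use gam in auto)
 from continuous_on_compose2[OF this continuous_on_Pair[OF continuous_on_const[of A t] continuous_on_id[of A]]]
 show "continuous_on A (Dx t)" by auto
qed

text \<open>The derivative is continuous and \<open>D\<close> is its integral.\<close>

lemma D_deriv: "(D t has_real_derivative Dx t x) (at x)"
proof -
 define a where "a = x - 1"
 have FTC: "(LINT \<xi>:{a<..<y}|lborel. Dx t \<xi>) = D t y - D t a" if y: "a < y" for y
 proof -
  define p :: "real \<Rightarrow> real" where "p = indicator {a<..<y}"
  have [measurable]: "p \<in> borel_fun" unfolding p_def by measurable
  note [measurable] = Fm
  have "integrable (lborel2) (\<lambda>(\<xi>, z). p \<xi> * pKx T t \<xi> z * F z)"
  proof (rule lborel_pair.Fubini_integrable)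
   show "(\<lambda>(\<xi>, z). p \<xi> * pKx T t \<xi> z * F z) \<in> borel_measurable (lborel2)" by measurable
   define N where "N \<xi> = (LB z. \<bar>pKx T t \<xi> z * F z\<bar>)" for \<xi>
   have Nm: "N \<in> borel_fun" unfolding N_def[abs_def] by measurable
   have Nb: "\<bar>N \<xi>\<bar> \<le> decay_const 1 * M * (T powr (1 - 3/4) / (1 - 3/4))" for \<xi>
   proof -
    have "\<bar>LB z. \<bar>pKx T t \<xi> z\<bar> * \<bar>F z\<bar>\<bar> \<le> decay_const 1 * M * (T powr (1 - 3/4) / (1 - 3/4))"
     by (rule duhamel_sup(2)[where k = "\<lambda>s \<eta>. \<bar>heatKx T (t - s) \<xi> \<eta>\<bar>" and t = t, OF T _ dc M]) (use kx Fb supp' in auto)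
    then show ?thesis unfolding N_def abs_mult .
   qed
   have "set_integrable lborel {a<..<y} (\<lambda>\<xi>. 1 * N \<xi>)"
    by (rule set_integrable_mult_bounded[OF set_integrable_continuous[OF continuous_on_const] _ _ Nb])
     (use Nm in \<open>auto simp: set_borel_measurable_def\<close>)
   moreover have "(LB z. norm (case (\<xi>, z) of (\<xi>, z) \<Rightarrow> p \<xi> * pKx T t \<xi> z * F z)) = indicator {a<..<y} \<xi> *\<^sub>R (1 * N \<xi>)" for \<xi>
    unfolding p_def N_def by (simp add: abs_mult mult.assoc)
   ultimately show "integrable lborel (\<lambda>\<xi>. LB z. norm (case (\<xi>, z) of (\<xi>, z) \<Rightarrow> p \<xi> * pKx T t \<xi> z * F z))"
    unfolding set_integrable_def by simp
   show "AE \<xi> in lborel. integrable lborel (\<lambda>z. case (\<xi>, z) of (\<xi>, z) \<Rightarrow> p \<xi> * pKx T t \<xi> z * F z)"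
    using Dx_facts(1) by (intro AE_I2) (simp add: mult.assoc)
  qed
  from duhamel_FTC(2)[OF y zero_less_one _ _ this D_facts(1) D_facts(1)]
  show ?thesis unfolding D_def Dx_def p_def by simp
 qed
 have "((\<lambda>y. integral {a..y} (Dx t)) has_real_derivative Dx t x) (at x within {a..x + 1})"
  by (rule integral_has_real_derivative) (auto simp: a_def intro: Dx_continuous)
 then have "((\<lambda>y. integral {a..y} (Dx t)) has_real_derivative Dx t x) (at x)"
  by (subst (asm) at_within_interior) (auto simp: a_def)
 then have "((\<lambda>y. D t a + integral {a..y} (Dx t)) has_real_derivative Dx t x) (at x)" by (auto intro!: derivative_eq_intros)
 then show ?thesis
 proof (rule DERIV_cong_ev[THEN iffD1, OF refl _ refl, rotated])
  have "\<forall>\<^sub>F y in nhds x. y \<in> {a<..}" by (rule eventually_nhds_in_open) (auto simp: a_def)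
  then show "\<forall>\<^sub>F y in nhds x. D t a + integral {a..y} (Dx t) = D t y"
  proof eventually_elim
   case (elim y)
   then have ay: "a < y" by simp
   have "(LINT \<xi>:{a<..<y}|lborel. Dx t \<xi>) = integral {a<..<y} (Dx t)"
    by (rule set_borel_integral_eq_integral(2)[OF set_integrable_continuous[OF Dx_continuous(2)]])
   also have "\<dots> = integral {a..y} (Dx t)" by (simp add: integral_open_interval_real)
   finally show ?case using FTC[OF ay] by simp
  qed
 qed
qed

end

section \<open>Regularity for one path\<close>

text \<open>Separate constants for the supremum and the seminorm make the product rule explicit, hence uniform in time.\<close>

definition holder_bounded :: "real \<Rightarrow> real \<Rightarrow> real \<Rightarrow> (real \<Rightarrow> real) \<Rightarrow> bool" where
 "holder_bounded \<gamma> A C f \<longleftrightarrow> 0 \<le> A \<and> 0 \<le> C \<and> (\<forall>x\<in>Ipi. \<bar>f x\<bar> \<le> A) \<and>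
  (\<forall>x\<in>Ipi. \<forall>y\<in>Ipi. \<bar>f x - f y\<bar> \<le> C * \<bar>x - y\<bar> powr \<gamma>)"

lemma holder_bounded_mult:
 assumes f: "holder_bounded \<gamma> A C f" and g: "holder_bounded \<gamma> B E g"
 shows "holder_bounded \<gamma> (A * B) (A * E + B * C) (\<lambda>x. f x * g x)"
 unfolding holder_bounded_def
proof (intro conjI ballI)
 note F = f[unfolded holder_bounded_def] and G = g[unfolded holder_bounded_def]
 show "0 \<le> A * B" "0 \<le> A * E + B * C" using F G by auto
 fix x :: real assume x: "x \<in> Ipi"
 show "\<bar>f x * g x\<bar> \<le> A * B" using F G x by (auto simp: abs_mult intro!: mult_mono)
 fix y :: real assume y: "y \<in> Ipi"
 have "f x * g x - f y * g y = f x * (g x - g y) + (f x - f y) * g y" by (simp add: algebra_simps)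
 also have "\<bar>\<dots>\<bar> \<le> \<bar>f x\<bar> * \<bar>g x - g y\<bar> + \<bar>f x - f y\<bar> * \<bar>g y\<bar>" by (metis abs_mult abs_triangle_ineq)
 also have "\<dots> \<le> A * (E * \<bar>x - y\<bar> powr \<gamma>) + (C * \<bar>x - y\<bar> powr \<gamma>) * B"
  using F G x y by (intro add_mono mult_mono) auto
 finally show "\<bar>f x * g x - f y * g y\<bar> \<le> (A * E + B * C) * \<bar>x - y\<bar> powr \<gamma>" by (simp add: algebra_simps)
qed

lemma holder_bounded_diff:
 assumes f: "holder_bounded \<gamma> A C f" and g: "holder_bounded \<gamma> B E g"
 shows "holder_bounded \<gamma> (A + B) (C + E) (\<lambda>x. f x - g x)"
 unfolding holder_bounded_def
proof (intro conjI ballI)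
 note F = f[unfolded holder_bounded_def] and G = g[unfolded holder_bounded_def]
 show "0 \<le> A + B" "0 \<le> C + E" using F G by auto
 fix x :: real assume x: "x \<in> Ipi"
 have "\<bar>f x\<bar> \<le> A" "\<bar>g x\<bar> \<le> B" using F G x by auto
 then show "\<bar>f x - g x\<bar> \<le> A + B" by linarith
 fix y :: real assume y: "y \<in> Ipi"
 have "\<bar>f x - f y\<bar> \<le> C * \<bar>x - y\<bar> powr \<gamma>" "\<bar>g x - g y\<bar> \<le> E * \<bar>x - y\<bar> powr \<gamma>" using F G x y by auto
 then show "\<bar>f x - g x - (f y - g y)\<bar> \<le> (C + E) * \<bar>x - y\<bar> powr \<gamma>" unfolding distrib_right by linarith
qed

lemma holder_bounded_of_deriv:
 fixes f f' :: "real \<Rightarrow> real"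
 assumes \<gamma>: "0 < \<gamma>" "\<gamma> \<le> 1" and d: "\<And>x. x \<in> Ipi \<Longrightarrow> (f has_real_derivative f' x) (at x)"
  and b: "\<And>x. x \<in> Ipi \<Longrightarrow> \<bar>f x\<bar> \<le> A" "\<And>x. x \<in> Ipi \<Longrightarrow> \<bar>f' x\<bar> \<le> B"
 shows "holder_bounded \<gamma> A (B * pi powr (1 - \<gamma>)) f"
 unfolding holder_bounded_def
proof (intro conjI ballI b)
 have m: "pi / 2 \<in> Ipi" by simp
 then show "0 \<le> A" using b(1)[of "pi / 2"] by linarith
 have B: "0 \<le> B" using b(2)[OF m] by linarith
 then show "0 \<le> B * pi powr (1 - \<gamma>)" by simp
 fix x y :: real assume xy: "x \<in> Ipi" "y \<in> Ipi"
 have "norm (f x - f y) \<le> B * norm (x - y)"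
  by (rule field_differentiable_bound[where S = "Ipi"]) (use xy b(2) d in \<open>auto intro: has_field_derivative_at_within\<close>)
 also have "norm (x - y) = \<bar>x - y\<bar> powr (1 - \<gamma>) * \<bar>x - y\<bar> powr \<gamma>" by (simp add: powr_add[symmetric])
 also have "\<dots> \<le> pi powr (1 - \<gamma>) * \<bar>x - y\<bar> powr \<gamma>" using xy \<gamma> by (intro mult_right_mono powr_mono2) auto
 finally show "\<bar>f x - f y\<bar> \<le> B * pi powr (1 - \<gamma>) * \<bar>x - y\<bar> powr \<gamma>" using B by (simp add: mult_left_mono mult.assoc)
qed

lemma continuous_AE_eq:
 fixes f g :: "real \<Rightarrow> real"
 assumes c: "continuous_on {a<..<b} f" "continuous_on {a<..<b} g" and ae: "AE x in lborel. x \<in> {a<..<b} \<longrightarrow> f x = g x"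
  and x: "x \<in> {a<..<b}"
 shows "f x = g x"
proof (rule ccontr)
 assume "f x \<noteq> g x"
 have "open ({a<..<b} \<inter> (\<lambda>y. f y - g y) -` (- {0}))"
  using c by (intro continuous_open_preimage continuous_intros) auto
 moreover have "x \<in> {a<..<b} \<inter> (\<lambda>y. f y - g y) -` (- {0})" using x \<open>f x \<noteq> g x\<close> by simp
 ultimately obtain e where e: "0 < e" "ball x e \<subseteq> {a<..<b} \<inter> (\<lambda>y. f y - g y) -` (- {0})" unfolding open_contains_ball by blast
 obtain y where y: "y \<in> {x<..<x + e}" "y \<in> {a<..<b} \<longrightarrow> f y = g y"
  using AE_imp_ex_in_interval[OF ae, of x "x + e"] e(1) by (meson less_add_same_cancel1)
 then have "y \<in> ball x e" by (auto simp: dist_real_def)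
 then show False using e(2) y(2) by auto
qed

lemma continuous_on_time_holder:
 fixes f :: "real \<Rightarrow> real"
 assumes a: "0 < a" and h: "\<And>s t. s \<in> A \<Longrightarrow> t \<in> A \<Longrightarrow> \<bar>f t - f s\<bar> \<le> B * \<bar>t - s\<bar> powr a"
 shows "continuous_on A f"
proof -
 have "continuous_on (A \<times> {0::real}) (\<lambda>(t, x). f t)"
  by (rule continuous_on_holder_pair[where f = "\<lambda>t x. f t" and b = 1 and d = 0, OF a]) (use h in auto)
 from continuous_on_compose2[OF this continuous_on_Pair[OF continuous_on_id[of A] continuous_on_const[of A 0]]]
 show ?thesis by auto
qed

context mild_holder
begin

lemma flow_time:
 assumes "0 < s" "0 < t"
 shows "\<bar>heat_flow v0 t x - heat_flow v0 s x\<bar> \<le> 3 * H * \<bar>t - s\<bar> powr ((1 + \<gamma>) / 2)"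
proof (rule holder_symmetric[of "{0<..}"])
 fix s t :: real assume "s \<in> {0<..}" "t \<in> {0<..}" "s \<le> t"
 then show "\<bar>heat_flow v0 t x - heat_flow v0 s x\<bar> \<le> 3 * H * (t - s) powr ((1 + \<gamma>) / 2)"
  using flow(5)[of s t x] by (cases "s = t") auto
qed (use assms in auto)

text \<open>The density may be changed on a null set to become bounded everywhere. Both sides of the Duhamel formula are
 continuous in each variable separately, so the exceptional set disappears.\<close>

lemma duhamel_everywhere:
 assumes g12: "\<gamma> < 1 / 2"
 shows "\<exists>B F. bounded_density T B \<gamma> F \<and>
  (\<forall>t\<in>{0<..<T}. \<forall>x\<in>Ipi. exp (V x) * u t x = heat_flow v0 t x + bounded_density.D T F t x)"
proof -
 obtain B where B: "0 \<le> B" "\<And>t'. 0 < t' \<Longrightarrow> t' < T \<Longrightarrow> AE z in lborel. \<bar>FF t' z\<bar> \<le> B" using FF_bounded by blast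
 define F where "F z = (if \<bar>FF T z\<bar> \<le> B then FF T z else 0)" for z
 (* The bound is available on rectangles that end before T; these exhaust the whole one. *)
 define tn where "tn n = T - T / real (n + 2)" for n
 have tn: "0 < tn n" "tn n < T" for n unfolding tn_def using T by (auto simp: field_simps intro: add_pos_nonneg)
 have tn_ex: "\<exists>n. t < tn n" if "t < T" for t
 proof -
  have "0 < (T - t) / T" using that T by simp
  from reals_Archimedean[OF this] obtain n where n: "inverse (real (Suc n)) < (T - t) / T" by blast
  have "1 / real (n + 2) \<le> inverse (real (Suc n))" by (simp add: field_simps)
  with n have "1 / real (n + 2) < (T - t) / T" by linarith
  then have "T * (1 / real (n + 2)) < T * ((T - t) / T)" using T by (rule mult_strict_left_mono)
  then show ?thesis unfolding tn_def using T by (intro exI[of _ n]) simp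
 qed
 have Feq: "FF t' z = FF T z" if "z \<in> rect t'" "t' \<le> T" for z t'
 proof -
  have "z \<in> rect T" using that by (auto simp: rect_def)
  then show ?thesis using that by (simp add: FF_def dw_def uw_def)
 qed
 have FT: "AE z in lborel. F z = FF T z"
 proof -
  have "AE z in lborel. \<forall>n. \<bar>FF (tn n) z\<bar> \<le> B" unfolding AE_all_countable using B(2) tn by blast
  then show ?thesis
  proof eventually_elim
   case (elim z)
   show ?case
   proof (cases "z \<in> rect T")
    case True
    then obtain n where n: "fst z < tn n" using tn_ex[of "fst z"] by (auto simp: rect_def)
    then have "z \<in> rect (tn n)" using True by (auto simp: rect_def)
    from Feq[OF this] tn(2)[of n] elim[rule_format, of n] show ?thesis by (simp add: F_def)
   qed (simp add: F_def FF_outside)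
  qed
 qed
 have [measurable]: "F \<in> borel_fun"
 proof -
  have [measurable]: "FF T \<in> borel_fun" by simp
  show ?thesis unfolding F_def[abs_def] by measurable
 qed
 interpret F: bounded_density T B \<gamma> F
 proof
  show "F z = 0" if "z \<notin> {0<..<T} \<times> Ipi" for z using FF_outside[of z T] that by (simp add: F_def rect_def)
 qed (use T B(1) Q.gam g12 in \<open>auto simp: F_def\<close>)
 have "AE t in lborel. \<forall>n. t \<in> {0<..<tn n} \<longrightarrow> (AE x in lborel. x \<in> Ipi \<longrightarrow>
  integrable lborel (\<lambda>z. pK T t x z * FF (tn n) z) \<and>
  exp (V x) * u t x = heat_flow v0 t x + (LB z. pK T t x z * FF (tn n) z))"
  unfolding AE_all_countable by (intro allI gauge_duhamel tn)
 then have ae: "AE t in lborel. t \<in> {0<..<T} \<longrightarrow> (\<forall>x\<in>Ipi. exp (V x) * u t x = heat_flow v0 t x + F.D t x)"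
 proof eventually_elim
  case (elim t)
  show ?case
  proof (intro impI ballI)
   fix x :: real assume t: "t \<in> {0<..<T}" and x: "x \<in> Ipi"
   then obtain n where n: "t < tn n" using tn_ex[of t] by auto
   have D: "(LB z. pK T t x z * FF (tn n) z) = F.D t x" for x
    unfolding F.D_def
   proof (rule integral_cong_AE)
    show "AE z in lborel. pK T t x z * FF (tn n) z = pK T t x z * F z"
     using FT
    proof eventually_elim
     case (elim z)
     show ?case
     proof (cases "z \<in> rect (tn n)")
      case True then show ?thesis using elim Feq[OF True] tn(2)[of n] by simp
     next
      case False
      then have "t - fst z < 0 \<or> z \<notin> rect T" using n by (auto simp: rect_def mem_Times_iff)
      then show ?thesis using elim False by (auto simp: heatK_outside FF_outside)
     qed
    qed
    have [measurable]: "FF (tn n) \<in> borel_fun" using tn(2)[of n] by simp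
    show "(\<lambda>z. pK T t x z * FF (tn n) z) \<in> borel_measurable lborel" by measurable
    show "(\<lambda>z. pK T t x z * F z) \<in> borel_measurable lborel" by measurable
   qed
   show "exp (V x) * u t x = heat_flow v0 t x + F.D t x"
   proof (rule continuous_AE_eq[OF _ _ _ x])
    show "continuous_on Ipi (\<lambda>x. exp (V x) * u t x)" by (intro continuous_intros V_continuous u_x t)
    show "continuous_on Ipi (\<lambda>x. heat_flow v0 t x + F.D t x)"
     by (rule DERIV_continuous_on[OF DERIV_subset[OF DERIV_add[OF flow(1) F.D_deriv]]]) (use t in auto)
    show "AE x in lborel. x \<in> Ipi \<longrightarrow> exp (V x) * u t x = heat_flow v0 t x + F.D t x"
     using elim[rule_format, of n] t n unfolding D by (auto elim: eventually_mono)
   qed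
  qed
 qed
 obtain C where C: "\<And>t s x. t \<in> {0<..<T} \<Longrightarrow> s \<in> {0<..<T} \<Longrightarrow> \<bar>F.D t x - F.D s x\<bar> \<le> C * \<bar>t - s\<bar> powr ((1 + \<gamma>) / 2)"
  using F.D_time_holder by blast
 have "exp (V x) * u t x = heat_flow v0 t x + F.D t x" if t: "t \<in> {0<..<T}" and x: "x \<in> Ipi" for t x
 proof (rule continuous_AE_eq[OF _ _ _ t])
  show "continuous_on {0<..<T} (\<lambda>t. exp (V x) * u t x)" by (intro continuous_intros u_t x)
  have "continuous_on {0<..<T} (\<lambda>t. heat_flow v0 t x)"
   by (rule continuous_on_time_holder[of "(1 + \<gamma>) / 2" _ _ "3 * H"]) (use Q.gam flow_time in auto)
  moreover have "continuous_on {0<..<T} (\<lambda>t. F.D t x)"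
   by (rule continuous_on_time_holder[of "(1 + \<gamma>) / 2" _ _ C]) (use Q.gam C in auto)
  ultimately show "continuous_on {0<..<T} (\<lambda>t. heat_flow v0 t x + F.D t x)" by (intro continuous_on_add)
  show "AE t in lborel. t \<in> {0<..<T} \<longrightarrow> exp (V x) * u t x = heat_flow v0 t x + F.D t x"
   using ae by eventually_elim (use x in auto)
 qed
 with F.bounded_density_axioms show ?thesis by blast
qed

text \<open>Product rule for \<open>u = exp (- V) * v\<close> and \<open>u\<^sub>x = exp (- V) * v\<^sub>x - w * u\<close>. The derivative \<open>v\<^sub>x\<close> is not uniformly
  continuous in time near \<open>0\<close>, so joint continuity of \<open>u\<^sub>x\<close> rests on that of the flow for positive times.\<close>

lemma regularity:
 assumes g12: "\<gamma> < 1 / 2" and wh: "\<And>x y. x \<in> {0..pi} \<Longrightarrow> y \<in> {0..pi} \<Longrightarrow> \<bar>w x - w y\<bar> \<le> Hw * \<bar>x - y\<bar> powr \<gamma>"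
 shows "continuous_on ({0<..<T} \<times> Ipi) (\<lambda>(t, x). u t x)"
  "continuous_on ({0<..<T} \<times> Ipi) (\<lambda>(t, x). deriv (u t) x)"
  "\<exists>K. \<forall>t\<in>{0<..<T}. \<forall>s\<in>{0<..<T}. \<forall>x\<in>Ipi. \<forall>y\<in>Ipi. \<bar>u t x\<bar> \<le> K \<and> \<bar>deriv (u t) x\<bar> \<le> K \<and>
   \<bar>u t x - u s x\<bar> \<le> K * \<bar>t - s\<bar> powr ((1 + \<gamma>) / 2) \<and> \<bar>deriv (u t) x - deriv (u t) y\<bar> \<le> K * \<bar>x - y\<bar> powr \<gamma>"
proof -
 let ?I = "Ipi" and ?J = "{0<..<T}" and ?b = "(1 + \<gamma>) / 2"
 note gam = Q.gam
 obtain B F where F: "bounded_density T B \<gamma> F"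
  and eq: "\<And>t x. t \<in> ?J \<Longrightarrow> x \<in> ?I \<Longrightarrow> exp (V x) * u t x = heat_flow v0 t x + bounded_density.D T F t x"
  using duhamel_everywhere[OF g12] by blast
 interpret F: bounded_density T B \<gamma> F by (rule F)
 define v where "v t x = exp (V x) * u t x" for t x
 have vx: "vx t x = heat_flow_x v0 t x + F.Dx t x" if "t \<in> ?J" "x \<in> ?I" for t x
 proof (rule DERIV_unique[OF gauged_deriv[OF that]])
  have "((\<lambda>x. heat_flow v0 t x + F.D t x) has_real_derivative heat_flow_x v0 t x + F.Dx t x) (at x)"
   using that by (intro DERIV_add flow(1) F.D_deriv) simp
  then show "((\<lambda>x. exp (V x) * u t x) has_real_derivative heat_flow_x v0 t x + F.Dx t x) (at x)"
   by (rule has_field_derivative_transform_within_open[of _ _ _ ?I]) (use that eq in auto)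
 qed
 obtain B0 where B0: "\<And>t x. \<bar>F.D t x\<bar> \<le> B0" using F.D_facts(2) by blast
 obtain B1 where B1: "\<And>t x. \<bar>F.Dx t x\<bar> \<le> B1" "0 \<le> B1" using F.Dx_facts(2) by blast
 obtain B2 where B2: "\<And>t x y. \<bar>F.Dx t x - F.Dx t y\<bar> \<le> B2 * \<bar>x - y\<bar> powr \<gamma>" "0 \<le> B2" using F.Dx_holder by blast
 obtain B3 where B3: "\<And>t s x. t \<in> ?J \<Longrightarrow> s \<in> ?J \<Longrightarrow> \<bar>F.D t x - F.D s x\<bar> \<le> B3 * \<bar>t - s\<bar> powr ?b"
  using F.D_time_holder by blast
 have vb: "\<bar>v t x\<bar> \<le> G * pi + B0" if "t \<in> ?J" "x \<in> ?I" for t x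
  unfolding v_def eq[OF that] using flow(4)[of t x] B0[of t x] that by auto
 have vxb: "\<bar>vx t x\<bar> \<le> G + B1" if "t \<in> ?J" "x \<in> ?I" for t x
  unfolding vx[OF that] using flow(2)[of t x] B1(1)[of t x] that by auto
 have vt: "\<bar>v t x - v s x\<bar> \<le> (3 * H + B3) * \<bar>t - s\<bar> powr ?b" if "t \<in> ?J" "s \<in> ?J" "x \<in> ?I" for t s x
 proof -
  have "\<bar>heat_flow v0 t x - heat_flow v0 s x\<bar> \<le> 3 * H * \<bar>t - s\<bar> powr ?b" using that by (intro flow_time) auto
  then show ?thesis using B3[OF that(1,2), of x] that unfolding v_def by (simp add: eq distrib_right)
 qed
 have HV: "holder_bounded \<gamma> (G * pi + B0) ((G + B1) * pi powr (1 - \<gamma>)) (v t)" if t: "t \<in> ?J" for t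
  by (rule holder_bounded_of_deriv[OF gam]) (use gauged_deriv[OF t] vb[OF t] vxb[OF t] in \<open>auto simp: v_def[abs_def]\<close>)
 have G: "0 \<le> G" using Q.gb[of 0] by simp
 have HVX: "holder_bounded \<gamma> (G + B1) (H + B2) (vx t)" if t: "t \<in> ?J" for t
  unfolding holder_bounded_def
 proof (intro conjI ballI vxb[OF t])
  show "0 \<le> G + B1" "0 \<le> H + B2" using G Q.H B1 B2 by auto
  fix x y assume xy: "x \<in> ?I" "y \<in> ?I"
  have "\<bar>heat_flow_x v0 t x - heat_flow_x v0 t y\<bar> \<le> H * \<bar>x - y\<bar> powr \<gamma>" using flow(3)[of t x y] t by simp
  then show "\<bar>vx t x - vx t y\<bar> \<le> (H + B2) * \<bar>x - y\<bar> powr \<gamma>"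
   unfolding vx[OF t xy(1)] vx[OF t xy(2)] distrib_right using B2(1)[of t x y] by linarith
 qed
 define em where "em x = exp (- V x)" for x
 have emc: "continuous_on A em" for A unfolding em_def[abs_def] by (intro continuous_intros V_continuous)
 have "bounded (em ` {0..pi})" by (intro compact_imp_bounded compact_continuous_image emc) simp
 then obtain Em where Em: "\<And>x. x \<in> {0..pi} \<Longrightarrow> \<bar>em x\<bar> \<le> Em" unfolding bounded_iff by force
 have HE: "holder_bounded \<gamma> Em ((Wb * Em) * pi powr (1 - \<gamma>)) em"
 proof (rule holder_bounded_of_deriv[OF gam])
  fix x assume x: "x \<in> ?I"
  show "(em has_real_derivative - w x * em x) (at x)" unfolding em_def[abs_def] by (auto intro!: derivative_eq_intros V_deriv)
  show "\<bar>em x\<bar> \<le> Em" using Em x by simp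
  show "\<bar>- w x * em x\<bar> \<le> Wb * Em" unfolding abs_mult abs_minus by (intro mult_mono wb Em) (use x Wb_nonneg in auto)
 qed
 have HW: "holder_bounded \<gamma> Wb \<bar>Hw\<bar> w" unfolding holder_bounded_def
 proof (intro conjI ballI wb Wb_nonneg)
  fix x y assume "x \<in> ?I" "y \<in> ?I"
  then show "\<bar>w x - w y\<bar> \<le> \<bar>Hw\<bar> * \<bar>x - y\<bar> powr \<gamma>" by (intro order_trans[OF wh] mult_right_mono) auto
 qed simp
 have ueq: "u t x = em x * v t x" for t x unfolding em_def v_def by (simp add: exp_minus)
 have ux: "deriv (u t) x = em x * vx t x - w x * (em x * v t x)" for t x
 proof -
  have "deriv (u t) x = em x * vx t x - w x * u t x" unfolding vx_def em_def by (simp add: exp_minus field_simps)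
  then show ?thesis unfolding ueq .
 qed
 have vc: "continuous_on (?J \<times> ?I) (\<lambda>(t, x). v t x)"
 proof (rule continuous_on_holder_pair)
  fix s t x y assume st: "s \<in> ?J" "t \<in> ?J" "x \<in> ?I" "y \<in> ?I"
  have "\<bar>v s x - v s y\<bar> \<le> ((G + B1) * pi powr (1 - \<gamma>)) * \<bar>x - y\<bar> powr \<gamma>"
   using HV[OF st(1)] st unfolding holder_bounded_def by blast
  then show "\<bar>v t x - v s y\<bar> \<le> (3 * H + B3) * \<bar>t - s\<bar> powr ?b + ((G + B1) * pi powr (1 - \<gamma>)) * \<bar>x - y\<bar> powr \<gamma>"
   using vt[OF st(2,1,3)] by linarith
 qed (use gam in auto)
 have vxc: "continuous_on (?J \<times> ?I) (\<lambda>(t, x). vx t x)"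
 proof -
  have "continuous_on (?J \<times> ?I) (\<lambda>p. (\<lambda>(t, x). heat_flow_x v0 t x) p + (\<lambda>(t, x). F.Dx t x) p)"
   by (intro continuous_on_add continuous_on_subset[OF Q.flow_continuous[unfolded v0_eq]] continuous_on_subset[OF F.Dx_continuous(1)]) auto
  then show ?thesis by (rule continuous_on_cong[OF refl, THEN iffD1, rotated]) (auto simp: vx)
 qed
 have emc2: "continuous_on (?J \<times> ?I) (\<lambda>p. em (snd p))" and wc2: "continuous_on (?J \<times> ?I) (\<lambda>p. w (snd p))"
  by (rule continuous_on_compose2[OF emc[of UNIV]] continuous_on_compose2[OF w], auto intro!: continuous_intros)+
 show "continuous_on (?J \<times> ?I) (\<lambda>(t, x). u t x)"
  unfolding ueq using vc emc2 unfolding split_beta' by (intro continuous_on_mult)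
 show "continuous_on (?J \<times> ?I) (\<lambda>(t, x). deriv (u t) x)"
  unfolding ux using vc vxc emc2 wc2 unfolding split_beta' by (intro continuous_on_mult continuous_on_diff)
 show "\<exists>K. \<forall>t\<in>?J. \<forall>s\<in>?J. \<forall>x\<in>?I. \<forall>y\<in>?I. \<bar>u t x\<bar> \<le> K \<and> \<bar>deriv (u t) x\<bar> \<le> K \<and>
   \<bar>u t x - u s x\<bar> \<le> K * \<bar>t - s\<bar> powr ?b \<and> \<bar>deriv (u t) x - deriv (u t) y\<bar> \<le> K * \<bar>x - y\<bar> powr \<gamma>"
 proof -
  obtain A1 C1 where U: "\<And>t. t \<in> ?J \<Longrightarrow> holder_bounded \<gamma> A1 C1 (u t)"
   using holder_bounded_mult[OF HE HV] unfolding ueq[symmetric] by blast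
  obtain A2 C2 where UX: "\<And>t. t \<in> ?J \<Longrightarrow> holder_bounded \<gamma> A2 C2 (deriv (u t))"
   using that holder_bounded_diff[OF holder_bounded_mult[OF HE HVX] holder_bounded_mult[OF HW holder_bounded_mult[OF HE HV]]]
   unfolding ux by blast
  define C3 where "C3 = Em * (3 * H + B3)"
  define K where "K = max (max A1 A2) (max C2 C3)"
  have K: "A1 \<le> K" "A2 \<le> K" "C2 \<le> K" "C3 \<le> K" unfolding K_def by auto
  have "\<bar>u t x\<bar> \<le> K \<and> \<bar>deriv (u t) x\<bar> \<le> K \<and>
   \<bar>u t x - u s x\<bar> \<le> K * \<bar>t - s\<bar> powr ?b \<and> \<bar>deriv (u t) x - deriv (u t) y\<bar> \<le> K * \<bar>x - y\<bar> powr \<gamma>"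
   if st: "t \<in> ?J" "s \<in> ?J" "x \<in> ?I" "y \<in> ?I" for t s x y
  proof (intro conjI)
   show "\<bar>u t x\<bar> \<le> K" "\<bar>deriv (u t) x\<bar> \<le> K"
    using U[OF st(1)] UX[OF st(1)] st K unfolding holder_bounded_def by (blast intro: order_trans)+
   have "\<bar>deriv (u t) x - deriv (u t) y\<bar> \<le> C2 * \<bar>x - y\<bar> powr \<gamma>" using UX[OF st(1)] st unfolding holder_bounded_def by blast
   also have "\<dots> \<le> K * \<bar>x - y\<bar> powr \<gamma>" using K by (intro mult_right_mono) auto
   finally show "\<bar>deriv (u t) x - deriv (u t) y\<bar> \<le> K * \<bar>x - y\<bar> powr \<gamma>" .
   have "\<bar>u t x - u s x\<bar> = \<bar>em x\<bar> * \<bar>v t x - v s x\<bar>" unfolding ueq by (simp add: abs_mult flip: right_diff_distrib)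
   also have "\<dots> \<le> Em * ((3 * H + B3) * \<bar>t - s\<bar> powr ?b)" by (intro mult_mono Em vt) (use st HE in \<open>auto simp: holder_bounded_def\<close>)
   also have "\<dots> = C3 * \<bar>t - s\<bar> powr ?b" unfolding C3_def by simp
   also have "\<dots> \<le> K * \<bar>t - s\<bar> powr ?b" using K by (intro mult_right_mono) auto
   finally show "\<bar>u t x - u s x\<bar> \<le> K * \<bar>t - s\<bar> powr ?b" .
  qed
  then show ?thesis by blast
 qed
qed

end

section \<open>Hoelder spaces and almost every path\<close>

text \<open>Uniform continuity extends the function to the closed interval, and non-strict inequalities pass to the closure.\<close>

lemma holder_bounded_extension:
 assumes f: "holder_bounded \<gamma> A C f" and \<gamma>: "0 < \<gamma>"
 obtains g where "\<And>x. x \<in> Ipi \<Longrightarrow> g x = f x" "continuous_on {0..pi} g" "\<And>x. x \<in> {0..pi} \<Longrightarrow> \<bar>g x\<bar> \<le> A"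
  "\<And>x y. x \<in> {0..pi} \<Longrightarrow> y \<in> {0..pi} \<Longrightarrow> \<bar>g x - g y\<bar> \<le> C * \<bar>x - y\<bar> powr \<gamma>"
proof -
 let ?I = "Ipi"
 note F = f[unfolded holder_bounded_def]
 have "uniformly_continuous_on ?I f" unfolding uniformly_continuous_on_def
 proof (intro allI impI)
  fix e :: real assume e: "0 < e"
  define d where "d = (e / (C + 1)) powr (1 / \<gamma>)"
  have d: "0 < d" "d powr \<gamma> = e / (C + 1)" unfolding d_def using e F \<gamma> by (auto simp: powr_powr)
  have "dist (f y) (f x) < e" if "x \<in> ?I" "y \<in> ?I" "dist y x < d" for x y
  proof -
   have "\<bar>f y - f x\<bar> \<le> C * \<bar>y - x\<bar> powr \<gamma>" using F that by blast
   also have "\<dots> \<le> C * d powr \<gamma>" using F that \<gamma> by (intro mult_left_mono powr_mono2) (auto simp: dist_real_def)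
   also have "\<dots> < e" unfolding d(2) using e F by (simp add: field_simps)
   finally show ?thesis by (simp add: dist_real_def)
  qed
  then show "\<exists>d>0. \<forall>x\<in>?I. \<forall>x'\<in>?I. dist x' x < d \<longrightarrow> dist (f x') (f x) < e" using d(1) by blast
 qed
 moreover have cl: "closure ?I = {0..pi}" by (simp add: closure_greaterThanLessThan)
 ultimately obtain g where g: "uniformly_continuous_on {0..pi} g" "\<And>x. x \<in> ?I \<Longrightarrow> f x = g x"
  using uniformly_continuous_on_extension_on_closure[of ?I f] by metis
 have gc: "continuous_on {0..pi} g" by (rule uniformly_continuous_imp_continuous[OF g(1)])
 have "\<bar>g x\<bar> \<le> A" if "x \<in> {0..pi}" for x
  by (rule continuous_le_on_closure[where S = ?I and f = "\<lambda>x. \<bar>g x\<bar>"])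
   (use F g(2) that in \<open>auto simp: cl intro!: continuous_intros gc\<close>)
 moreover have "\<bar>g x - g y\<bar> \<le> C * \<bar>x - y\<bar> powr \<gamma>" if "x \<in> {0..pi}" "y \<in> {0..pi}" for x y
 proof -
  have "\<bar>g (fst p) - g (snd p)\<bar> - C * \<bar>fst p - snd p\<bar> powr \<gamma> \<le> 0" if "p \<in> {0..pi} \<times> {0..pi}" for p
  proof (rule continuous_le_on_closure[where S = "?I \<times> ?I" and f = "\<lambda>p. \<bar>g (fst p) - g (snd p)\<bar> - C * \<bar>fst p - snd p\<bar> powr \<gamma>"])
   have "continuous_on ({0..pi} \<times> {0..pi}) (\<lambda>p. \<bar>fst p - snd p\<bar> powr \<gamma>)"
    by (rule continuous_on_powr') (use \<gamma> in \<open>auto intro!: continuous_intros\<close>)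
   moreover have "continuous_on ({0..pi} \<times> {0..pi}) (\<lambda>p. g (fst p))" "continuous_on ({0..pi} \<times> {0..pi}) (\<lambda>p. g (snd p))"
    by (rule continuous_on_compose2[OF gc], auto intro!: continuous_intros)+
   ultimately show "continuous_on (closure (?I \<times> ?I)) (\<lambda>p. \<bar>g (fst p) - g (snd p)\<bar> - C * \<bar>fst p - snd p\<bar> powr \<gamma>)"
    unfolding closure_Times cl by (intro continuous_on_diff continuous_on_rabs continuous_on_mult_left)
   show "p \<in> closure (?I \<times> ?I)" using that unfolding closure_Times cl .
   show "\<bar>g (fst q) - g (snd q)\<bar> - C * \<bar>fst q - snd q\<bar> powr \<gamma> \<le> 0" if "q \<in> ?I \<times> ?I" for q
    using F g(2) that by (auto simp: mem_Times_iff)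
  qed
  from this[of "(x, y)"] that show ?thesis by simp
 qed
 ultimately show ?thesis using that g(2) gc by metis
qed

lemma SUP_ennreal_finite:
 assumes "(SUP x\<in>A. ennreal (f x)) < \<infinity>"
 obtains B where "0 \<le> B" "\<And>x. x \<in> A \<Longrightarrow> f x \<le> B"
proof
 show "0 \<le> enn2real (SUP x\<in>A. ennreal (f x))" by simp
 fix x assume "x \<in> A"
 then have "ennreal (f x) \<le> ennreal (enn2real (SUP x\<in>A. ennreal (f x)))" using assms SUP_upper[of x A "\<lambda>x. ennreal (f x)"] by simp
 then show "f x \<le> enn2real (SUP x\<in>A. ennreal (f x))" by (subst (asm) ennreal_le_iff) auto
qed

lemma holder_space_1D:
 assumes u: "f \<in> holder_space 1 \<gamma> Ipi"
 shows "x \<in> Ipi \<Longrightarrow> (f has_real_derivative deriv f x) (at x)"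
  "\<exists>A B C. (\<forall>x\<in>Ipi. \<bar>f x\<bar> \<le> A) \<and> holder_bounded \<gamma> B C (deriv f)"
proof -
 let ?I = "Ipi"
 have c: "Ck_on 1 ?I f" and n: "holder_norm 1 \<gamma> ?I f < \<infinity>" using u unfolding holder_space_def by auto
 show "(f has_real_derivative deriv f x) (at x)" if "x \<in> ?I"
  using c that unfolding Ck_on_def by (auto simp: DERIV_deriv_iff_field_differentiable)
 have fin: "(SUP x\<in>?I. ennreal \<bar>f x\<bar>) < \<infinity>" "(SUP x\<in>?I. ennreal \<bar>deriv f x\<bar>) < \<infinity>" "holder_seminorm \<gamma> ?I (deriv f) < \<infinity>"
  using n unfolding holder_norm_def by (auto simp: atMost_Suc)
 obtain A where A: "\<And>x. x \<in> ?I \<Longrightarrow> \<bar>f x\<bar> \<le> A" using SUP_ennreal_finite[OF fin(1)] by blast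
 obtain B where B: "0 \<le> B" "\<And>x. x \<in> ?I \<Longrightarrow> \<bar>deriv f x\<bar> \<le> B" using SUP_ennreal_finite[OF fin(2)] by blast
 have "(SUP p\<in>{(y, z). y \<in> ?I \<and> z \<in> ?I \<and> y \<noteq> z}. ennreal (\<bar>deriv f (snd p) - deriv f (fst p)\<bar> / \<bar>snd p - fst p\<bar> powr \<gamma>)) < \<infinity>"
  using fin(3) unfolding holder_seminorm_def split_beta' .
 then obtain C where C: "0 \<le> C" "\<And>y z. y \<in> ?I \<Longrightarrow> z \<in> ?I \<Longrightarrow> y \<noteq> z \<Longrightarrow> \<bar>deriv f z - deriv f y\<bar> / \<bar>z - y\<bar> powr \<gamma> \<le> C"
  by (rule SUP_ennreal_finite) force
 have "holder_bounded \<gamma> B C (deriv f)" unfolding holder_bounded_def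
 proof (intro conjI ballI B C(1))
  fix x y assume xy: "x \<in> ?I" "y \<in> ?I"
  show "\<bar>deriv f x - deriv f y\<bar> \<le> C * \<bar>x - y\<bar> powr \<gamma>"
   using C(2)[OF xy(2,1)] by (cases "x = y") (auto simp: field_simps)
 qed
 then show "\<exists>A B C. (\<forall>x\<in>?I. \<bar>f x\<bar> \<le> A) \<and> holder_bounded \<gamma> B C (deriv f)" using A by blast
qed

lemma holder_seminorm_le:
 assumes "\<And>y z. y \<in> G \<Longrightarrow> z \<in> G \<Longrightarrow> \<bar>f z - f y\<bar> \<le> K * \<bar>z - y\<bar> powr \<gamma>"
 shows "holder_seminorm \<gamma> G f \<le> ennreal K"
 unfolding holder_seminorm_def
proof (rule SUP_least, clarify)
 fix y z assume "y \<in> G" "z \<in> G" "y \<noteq> z"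
 then show "ennreal (\<bar>f z - f y\<bar> / \<bar>z - y\<bar> powr \<gamma>) \<le> ennreal K"
  using assms[of y z] by (intro ennreal_leI) (simp add: divide_le_eq)
qed

lemma holder_space_tx_01I:
 assumes d: "\<And>t x. t \<in> {0<..<T} \<Longrightarrow> x \<in> G \<Longrightarrow> (u t) field_differentiable at x"
  and c: "continuous_on ({0<..<T} \<times> G) (\<lambda>(t, x). u t x)" "continuous_on ({0<..<T} \<times> G) (\<lambda>(t, x). deriv (u t) x)"
  and b: "\<And>t s x y. t \<in> {0<..<T} \<Longrightarrow> s \<in> {0<..<T} \<Longrightarrow> x \<in> G \<Longrightarrow> y \<in> G \<Longrightarrow> \<bar>u t x\<bar> \<le> K \<and> \<bar>deriv (u t) x\<bar> \<le> K \<and>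
   \<bar>u t x - u s x\<bar> \<le> K * \<bar>t - s\<bar> powr \<beta> \<and> \<bar>deriv (u t) x - deriv (u t) y\<bar> \<le> K * \<bar>x - y\<bar> powr \<gamma>"
 shows "u \<in> holder_space_tx 0 \<beta> 1 \<gamma> T G"
proof -
 have p: "partial_tx 0 0 u = u" "partial_tx 0 (Suc 0) u = (\<lambda>t. deriv (u t))" by (auto simp: partial_tx_def fun_eq_iff)
 have "Ck_tx_on 0 1 T G u" unfolding Ck_tx_on_def using d c by (auto simp: p le_Suc_eq)
 moreover have "holder_norm_tx 0 \<beta> 1 \<gamma> T G u < \<infinity>"
 proof -
  have 1: "(SUP t\<in>{0<..<T}. SUP x\<in>G. ennreal \<bar>u t x\<bar>) \<le> ennreal K" "(SUP t\<in>{0<..<T}. SUP x\<in>G. ennreal \<bar>deriv (u t) x\<bar>) \<le> ennreal K"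
   using b by (intro SUP_least ennreal_leI; blast)+
  have 2: "(SUP x\<in>G. holder_seminorm \<beta> {0<..<T} (\<lambda>t. u t x)) \<le> ennreal K"
   "(SUP t\<in>{0<..<T}. holder_seminorm \<gamma> G (deriv (u t))) \<le> ennreal K"
   using b by (intro SUP_least holder_seminorm_le; blast)+
  show ?thesis unfolding holder_norm_tx_def
   using 1[THEN le_less_trans, OF ennreal_less_top] 2[THEN le_less_trans, OF ennreal_less_top] by (simp add: p atMost_Suc)
 qed
 ultimately show ?thesis unfolding holder_space_tx_def by simp
qed

text \<open>Only the values of the path inside the interval enter.\<close>

lemma mild_solution_cong:
 assumes w: "\<And>y. y \<in> Ipi \<Longrightarrow> w y = w' y" and m: "mild_solution w T u0 u"
 shows "mild_solution w' T u0 u"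
proof -
 have i: "set_integrable lborel ({0<..<t} \<times> Ipi) (\<lambda>(s, y). f s y * w y) = set_integrable lborel ({0<..<t} \<times> Ipi) (\<lambda>(s, y). f s y * w' y)"
  for f :: "real \<Rightarrow> real \<Rightarrow> real" and t
  by (rule set_integrable_cong) (auto simp: w)
 have l: "(LI y. f y * w y) = (LI y. f y * w' y)" for f
  by (rule set_lebesgue_integral_cong) (auto simp: w)
 show ?thesis using m unfolding mild_solution_def i l .
qed

theorem theorem3p6:
  fixes M :: "'a measure" and W :: "real \<Rightarrow> 'a \<Rightarrow> real"
  assumes "standard_brownian_motion M pi W"
  shows "AE \<omega> in M. \<forall>(T::real) (\<gamma>::real) (u\<^sub>0 :: real \<Rightarrow> real) (u :: real \<Rightarrow> real \<Rightarrow> real).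
    0 < T \<longrightarrow> 0 < \<gamma> \<longrightarrow> \<gamma> < 1/2 \<longrightarrow>
    u\<^sub>0 \<in> holder_space 1 \<gamma> {0<..<pi} \<longrightarrow> continuous_on {0..pi} u\<^sub>0 \<longrightarrow>
    mild_solution (\<lambda>x. W x \<omega>) T u\<^sub>0 u \<longrightarrow>
    u \<in> holder_space_tx 0 ((1 + \<gamma>) / 2) 1 \<gamma> T {0<..<pi}"
proof -
 interpret standard_brownian_motion M pi W by (rule assms)
 show ?thesis
  using continuous_paths AE_holder_paths[OF pi_gt_zero]
 proof eventually_elim
  case (elim \<omega>)
  show ?case
  proof (intro allI impI)
   fix T \<gamma> :: real and u0 :: "real \<Rightarrow> real" and u
   assume T: "0 < T" and \<gamma>: "0 < \<gamma>" "\<gamma> < 1 / 2" and u0h: "u0 \<in> holder_space 1 \<gamma> Ipi"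
    and u0c: "continuous_on {0..pi} u0" and ms: "mild_solution (\<lambda>x. W x \<omega>) T u0 u"
   let ?I = "Ipi"
   (* Clamping makes the path continuous and bounded on the whole line. *)
   define w where "w x = W (max 0 (min pi x)) \<omega>" for x
   have wW: "w x = W x \<omega>" if "x \<in> {0..pi}" for x using that by (simp add: w_def)
   have wc: "continuous_on UNIV w" unfolding w_def[abs_def]
    by (rule continuous_on_compose2[OF elim(1)]) (auto intro!: continuous_intros)
   have "bounded (w ` {0..pi})" by (intro compact_imp_bounded compact_continuous_image continuous_on_subset[OF wc]) auto
   then obtain Wb where Wb: "\<And>x. x \<in> {0..pi} \<Longrightarrow> \<bar>w x\<bar> \<le> Wb" unfolding bounded_iff by force
   have wb: "\<bar>w y\<bar> \<le> Wb" for y using Wb[of "max 0 (min pi y)"] by (simp add: w_def)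
   obtain Hw where Hw: "\<And>x y. x \<in> {0..pi} \<Longrightarrow> y \<in> {0..pi} \<Longrightarrow> \<bar>w x - w y\<bar> \<le> Hw * \<bar>x - y\<bar> powr \<gamma>"
    using elim(2) \<gamma> wW by metis
   have msw: "mild_solution w T u0 u" by (rule mild_solution_cong[OF _ ms]) (simp add: wW)
   interpret mild w u0 T Wb u by unfold_locales (use T wc wb u0c msw in auto)
   (* The boundary values of the datum are the limits of those of the solution. *)
   have b0: "u0 x = 0" if x: "x \<in> {0, pi}" for x
   proof (rule tendsto_unique[OF _ _ tendsto_const])
    have l: "((\<lambda>t. u t x) \<longlongrightarrow> u0 x) (at_right 0)" using msw x unfolding mild_solution_def by auto
    have "\<forall>\<^sub>F t in at_right 0. t \<in> {0<..<T}" using T by (rule eventually_at_right_real)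
    then have "\<forall>\<^sub>F t in at_right 0. u t x = 0" by eventually_elim (use msw x in \<open>auto simp: mild_solution_def\<close>)
    then show "((\<lambda>_. 0) \<longlongrightarrow> u0 x) (at_right (0::real))"
     by (rule Lim_transform_eventually[OF l])
   qed simp
   obtain A B C where A: "\<And>x. x \<in> ?I \<Longrightarrow> \<bar>u0 x\<bar> \<le> A" and B: "holder_bounded \<gamma> B C (deriv u0)"
    using holder_space_1D(2)[OF u0h] by blast
   note du = holder_space_1D(1)[OF u0h]
   obtain xE where "\<forall>x\<in>{0..pi}. exp (V x) \<le> exp (V xE)"
    using continuous_attains_sup[OF compact_Icc _ continuous_on_exp[OF V_continuous], of 0 pi] by auto
   then obtain E where E: "\<And>x. x \<in> {0..pi} \<Longrightarrow> exp (V x) \<le> E" by blast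
   have HU: "holder_bounded \<gamma> A (B * pi powr (1 - \<gamma>)) u0"
    by (rule holder_bounded_of_deriv[OF _ _ du A]) (use \<gamma> B in \<open>auto simp: holder_bounded_def\<close>)
   have HE: "holder_bounded \<gamma> E ((E * Wb) * pi powr (1 - \<gamma>)) (\<lambda>x. exp (V x))"
   proof (rule holder_bounded_of_deriv)
    fix x assume x: "x \<in> ?I"
    show "((\<lambda>x. exp (V x)) has_real_derivative exp (V x) * w x) (at x)" by (auto intro!: derivative_eq_intros V_deriv)
    show "\<bar>exp (V x)\<bar> \<le> E" using E x by simp
    show "\<bar>exp (V x) * w x\<bar> \<le> E * Wb" unfolding abs_mult using E x wb[of x] order_trans[OF exp_ge_zero E[of x]] by (intro mult_mono) auto
   qed (use \<gamma> in auto)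
   have HW: "holder_bounded \<gamma> Wb \<bar>Hw\<bar> (\<lambda>x. - w x)" unfolding holder_bounded_def
   proof (intro conjI ballI Wb_nonneg)
    fix x y assume x: "x \<in> ?I"
    show "\<bar>- w x\<bar> \<le> Wb" using wb by simp
    assume "y \<in> ?I"
    then have "\<bar>w x - w y\<bar> \<le> \<bar>Hw\<bar> * \<bar>x - y\<bar> powr \<gamma>" using x by (intro order_trans[OF Hw] mult_right_mono) auto
    then show "\<bar>- w x - - w y\<bar> \<le> \<bar>Hw\<bar> * \<bar>x - y\<bar> powr \<gamma>" by (simp add: abs_minus_commute)
   qed simp
   obtain G H where HG: "holder_bounded \<gamma> G H (\<lambda>x. exp (V x) * (deriv u0 x - - w x * u0 x))"
    using holder_bounded_mult[OF HE holder_bounded_diff[OF B holder_bounded_mult[OF HW HU]]] by blast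
   obtain g where g: "\<And>x. x \<in> ?I \<Longrightarrow> g x = exp (V x) * (deriv u0 x - - w x * u0 x)" "continuous_on {0..pi} g"
     "\<And>x. x \<in> {0..pi} \<Longrightarrow> \<bar>g x\<bar> \<le> G" "\<And>x y. x \<in> {0..pi} \<Longrightarrow> y \<in> {0..pi} \<Longrightarrow> \<bar>g x - g y\<bar> \<le> H * \<bar>x - y\<bar> powr \<gamma>"
    using holder_bounded_extension[OF HG \<gamma>(1)] by metis
   interpret mild_holder w u0 T Wb u g G H \<gamma>
   proof unfold_locales
    show "continuous_on {0..pi} (\<lambda>x. exp (prim w x) * u0 x)" using v0_continuous unfolding v0_def V_def .
    show "((\<lambda>x. exp (prim w x) * u0 x) has_real_derivative g x) (at x)" if "x \<in> ?I" for x
     unfolding g(1)[OF that] V_def[symmetric] using that by (auto intro!: derivative_eq_intros V_deriv du simp: algebra_simps)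
    show "0 \<le> H" using HG unfolding holder_bounded_def by simp
   qed (use \<gamma> b0 g in auto)
   note R = regularity[OF \<gamma>(2) Hw]
   obtain K where K: "\<And>t s x y. t \<in> {0<..<T} \<Longrightarrow> s \<in> {0<..<T} \<Longrightarrow> x \<in> ?I \<Longrightarrow> y \<in> ?I \<Longrightarrow> \<bar>u t x\<bar> \<le> K \<and> \<bar>deriv (u t) x\<bar> \<le> K \<and>
   \<bar>u t x - u s x\<bar> \<le> K * \<bar>t - s\<bar> powr ((1 + \<gamma>) / 2) \<and> \<bar>deriv (u t) x - deriv (u t) y\<bar> \<le> K * \<bar>x - y\<bar> powr \<gamma>"
    using R(3) by meson
   show "u \<in> holder_space_tx 0 ((1 + \<gamma>) / 2) 1 \<gamma> T ?I"
    by (rule holder_space_tx_01I[OF _ R(1,2) K]) (use u_deriv in \<open>auto simp: field_differentiable_def\<close>)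
  qed
 qed
qed

end
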